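(* Let $T>0$, $p\in[1,\infty)$ and $\omega_0\in L_{c}^{p}(\mathbb{R}^2)$. Let $\{\omega_0^\nu\}_{\nu}$ be a sequence (indexed by viscosities $\nu\to0^+$) of smooth compactly supported functions such that there exists $R>0$ with $\operatorname{supp}\omega_0^{\nu}\subset B_{R}(0)$ for all $\nu$ and $$\{\omega_0^\nu\}_{\nu}\text{ is bounded in }L^{p}(\mathbb{R}^2)\cap H^{-1}_{\mathrm{loc}}(\mathbb{R}^2),\qquad \omega_0^\nu\to \omega_0\ \text{ strongly in }L^{p}(\mathbb{R}^2).$$ Let $(u^\nu,\omega^\nu)$ be the solution on $(0,T)\times\mathbb{R}^2$ of the Navier-Stokes equations $$\partial_t \omega^\nu+u^\nu\cdot\nabla\omega^\nu-\nu\Delta\omega^\nu=0,\qquad u^\nu=K\ast\omega^\nu,\qquad \omega^\nu|_{t=0}=\omega_0^\nu.$$ Assume that there exists a renormalized solution $(u,\omega)$ of the two-dimensional Euler equations with initial datum $\omega_0$ such that $$u^\nu\stackrel{*}{\rightharpoonup} u\quad\text{weakly* in }L^{\infty}((0,T);L^2_{\mathrm{loc}}(\mathbb{R}^2)).$$ Then $$\omega^\nu\to \omega\quad\text{strongly in }C([0,T];L^{p}(\mathbb{R}^2)).$$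
   Context: $L^p_c(\mathbb{R}^2)$ denotes the $L^p$ functions with compact support. $T>0$ is finite and fixed. $K:\mathbb{R}^2\to\mathbb{R}^2$ is the Biot-Savart kernel $K(x)=\frac{1}{2\pi}\frac{x^{\perp}}{|x|^2}$, $x^\perp=(-x_2,x_1)$. For smooth compactly supported initial vorticity the 2D Navier-Stokes equations have a unique smooth solution; this is "the solution" $(u^\nu,\omega^\nu)$. The Euler equations are $\partial_t\omega+u\cdot\nabla\omega=0$, $u=K*\omega$, $\omega|_{t=0}=\omega_0$. Renormalized solution of the 2D Euler equations: let $\omega_0\in L_{c}^{p}(\mathbb{R}^2)$ and $\omega\in C([0,T];L^p(\mathbb{R}^2))$ with $1\leq p< \infty$. The pair $(u,\omega)$ is a renormalized solution if for any $\beta\in C^1(\mathbb{R})\cap L^\infty(\mathbb{R})$ vanishing in a neighbourhood of zero $$\int_0^T \int_{\mathbb{R}^2} \beta(\omega)(\partial_t\varphi+u\cdot\nabla\varphi)\, dx\, dt+\int_{\mathbb{R}^2} \beta(\omega_0)\varphi(0,x)\, dx=0$$ for any $\varphi\in C^\infty_c([0,T)\times\mathbb{R}^2)$, and $u(t,x)=(K*\omega(t,\cdot))(x)$ for a.e. $(t,x)\in(0,T)\times\mathbb{R}^2$. *)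

theory Defs
  imports "HOL-Analysis.Analysis"
begin

subsection \<open>Smooth functions and differential operators\<close>

text \<open>\<open>C_k n S f\<close> is meant for open \<open>S\<close>: all iterated directional derivatives of \<open>f\<close> up to
  order \<open>n\<close> exist and are continuous on \<open>S\<close>.\<close>

primrec C_k :: "nat \<Rightarrow> 'a::real_normed_vector set \<Rightarrow> ('a \<Rightarrow> 'b::real_normed_vector) \<Rightarrow> bool" where
  "C_k 0 S f \<longleftrightarrow> continuous_on S f"
| "C_k (Suc n) S f \<longleftrightarrow>
     (\<forall>x\<in>S. f differentiable (at x)) \<and> (\<forall>v. C_k n S (\<lambda>x. frechet_derivative f (at x) v))"

definition smooth_on :: "'a::real_normed_vector set \<Rightarrow> ('a \<Rightarrow> 'b::real_normed_vector) \<Rightarrow> bool" where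
  "smooth_on S f \<longleftrightarrow> (\<forall>n. C_k n S f)"

definition supp :: "('a::topological_space \<Rightarrow> 'b::zero) \<Rightarrow> 'a set" where
  "supp f = closure {x. f x \<noteq> 0}"

definition test_function :: "'a::real_normed_vector set \<Rightarrow> ('a \<Rightarrow> real) \<Rightarrow> bool" where
  "test_function \<Omega> \<phi> \<longleftrightarrow> smooth_on UNIV \<phi> \<and> compact (supp \<phi>) \<and> supp \<phi> \<subseteq> \<Omega>"

definition grad :: "('a::euclidean_space \<Rightarrow> real) \<Rightarrow> 'a \<Rightarrow> 'a" where
  "grad f x = (\<Sum>b\<in>Basis. frechet_derivative f (at x) b *\<^sub>R b)"

definition laplacian :: "('a::euclidean_space \<Rightarrow> real) \<Rightarrow> 'a \<Rightarrow> real" where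
  "laplacian f x =
     (\<Sum>b\<in>Basis. frechet_derivative (\<lambda>y. frechet_derivative f (at y) b) (at x) b)"

subsection \<open>Function spaces\<close>

text \<open>Elements of Lebesgue spaces are represented by functions. \<open>Lp_norm\<close> is only meaningful for
  functions satisfying \<open>in_Lp\<close>, since the library integral of a non-integrable function is 0.\<close>

definition in_Lp :: "real \<Rightarrow> 'a::euclidean_space set \<Rightarrow> ('a \<Rightarrow> 'b::euclidean_space) \<Rightarrow> bool" where
  "in_Lp p \<Omega> f \<longleftrightarrow> f \<in> borel_measurable (lebesgue_on \<Omega>) \<and>
     integrable (lebesgue_on \<Omega>) (\<lambda>x. norm (f x) powr p)"

definition Lp_norm :: "real \<Rightarrow> 'a::euclidean_space set \<Rightarrow> ('a \<Rightarrow> 'b::euclidean_space) \<Rightarrow> real" where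
  "Lp_norm p \<Omega> f = (\<integral>x. norm (f x) powr p \<partial>lebesgue_on \<Omega>) powr (1 / p)"

text \<open>Compact support is understood up to null sets.\<close>

definition in_Lp_c :: "real \<Rightarrow> ('a::euclidean_space \<Rightarrow> real) \<Rightarrow> bool" where
  "in_Lp_c p f \<longleftrightarrow> in_Lp p UNIV f \<and> (\<exists>A. compact A \<and> (AE x in lebesgue. x \<notin> A \<longrightarrow> f x = 0))"

text \<open>The space \<open>C([0,T]; L\<^sup>p)\<close>. Joint measurability only fixes the choice of representatives: every
  continuous curve in \<open>L\<^sup>p\<close> has a jointly measurable one. It is needed to integrate in \<open>(t,x)\<close>.\<close>

definition in_C_Lp :: "real \<Rightarrow> real \<Rightarrow> (real \<Rightarrow> 'a::euclidean_space \<Rightarrow> real) \<Rightarrow> bool" where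
  "in_C_Lp T p w \<longleftrightarrow>
     (\<lambda>(t, x). w t x) \<in> borel_measurable (lebesgue_on ({0..T} \<times> UNIV)) \<and>
     (\<forall>t\<in>{0..T}. in_Lp p UNIV (w t)) \<and>
     (\<forall>t\<in>{0..T}. ((\<lambda>s. Lp_norm p UNIV (\<lambda>x. w s x - w t x)) \<longlongrightarrow> 0) (at t within {0..T}))"

definition C_Lp_norm :: "real \<Rightarrow> real \<Rightarrow> (real \<Rightarrow> 'a::euclidean_space \<Rightarrow> real) \<Rightarrow> real" where
  "C_Lp_norm T p w = (SUP t\<in>{0..T}. Lp_norm p UNIV (w t))"

definition converges_in_C_Lp ::
  "real \<Rightarrow> real \<Rightarrow> (nat \<Rightarrow> real \<Rightarrow> 'a::euclidean_space \<Rightarrow> real) \<Rightarrow> (real \<Rightarrow> 'a \<Rightarrow> real) \<Rightarrow> bool" where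
  "converges_in_C_Lp T p w w' \<longleftrightarrow>
     (\<forall>n. in_C_Lp T p (w n)) \<and> in_C_Lp T p w' \<and>
     (\<lambda>n. C_Lp_norm T p (\<lambda>t x. w n t x - w' t x)) \<longlonglongrightarrow> 0"

text \<open>\<open>H\<^sup>-\<^sup>1(\<Omega>)\<close> is the dual of \<open>H\<^sup>1\<^sub>0(\<Omega>)\<close>, the \<open>H\<^sup>1\<close>-closure of the test functions on \<open>\<Omega>\<close>; a locally
  integrable \<open>f\<close> acts on a test function by integration.\<close>

definition H1_norm :: "('a::euclidean_space \<Rightarrow> real) \<Rightarrow> real" where
  "H1_norm \<phi> = sqrt (\<integral>x. (\<phi> x)\<^sup>2 + (norm (grad \<phi> x))\<^sup>2 \<partial>lebesgue)"

definition Hm1_norm :: "'a::euclidean_space set \<Rightarrow> ('a \<Rightarrow> real) \<Rightarrow> ennreal" where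
  "Hm1_norm \<Omega> f =
     (SUP \<phi>\<in>{\<phi>. test_function \<Omega> \<phi> \<and> H1_norm \<phi> \<le> 1}. ennreal \<bar>\<integral>x. f x * \<phi> x \<partial>lebesgue\<bar>)"

definition bounded_in_Hm1_loc :: "(nat \<Rightarrow> 'a::euclidean_space \<Rightarrow> real) \<Rightarrow> bool" where
  "bounded_in_Hm1_loc f \<longleftrightarrow>
     (\<forall>\<Omega>. open \<Omega> \<and> bounded \<Omega> \<longrightarrow> (\<exists>C. \<forall>n. Hm1_norm \<Omega> (f n) \<le> ennreal C))"

text \<open>The space \<open>L\<^sup>\<infinity>((0,T); L\<^sup>2\<^sub>l\<^sub>o\<^sub>c)\<close>, whose weak* topology is defined by duality with those elements of
  \<open>L\<^sup>1((0,T); L\<^sup>2)\<close> that vanish outside a ball independent of \<open>t\<close>.\<close>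

definition in_Linf_L2loc :: "real \<Rightarrow> (real \<Rightarrow> 'a::euclidean_space \<Rightarrow> 'a) \<Rightarrow> bool" where
  "in_Linf_L2loc T u \<longleftrightarrow>
     (\<lambda>(t, x). u t x) \<in> borel_measurable (lebesgue_on ({0<..<T} \<times> UNIV)) \<and>
     (\<forall>R. \<exists>C. AE t in lebesgue_on {0<..<T}.
        in_Lp 2 (ball 0 R) (u t) \<and> Lp_norm 2 (ball 0 R) (u t) \<le> C)"

definition in_L1_L2c :: "real \<Rightarrow> (real \<Rightarrow> 'a::euclidean_space \<Rightarrow> 'a) \<Rightarrow> bool" where
  "in_L1_L2c T g \<longleftrightarrow>
     (\<lambda>(t, x). g t x) \<in> borel_measurable (lebesgue_on ({0<..<T} \<times> UNIV)) \<and>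
     (\<exists>R. \<forall>t x. x \<notin> ball 0 R \<longrightarrow> g t x = 0) \<and>
     (AE t in lebesgue_on {0<..<T}. in_Lp 2 UNIV (g t)) \<and>
     integrable (lebesgue_on {0<..<T}) (\<lambda>t. Lp_norm 2 UNIV (g t))"

definition weakstar_Linf_L2loc ::
  "real \<Rightarrow> (nat \<Rightarrow> real \<Rightarrow> 'a::euclidean_space \<Rightarrow> 'a) \<Rightarrow> (real \<Rightarrow> 'a \<Rightarrow> 'a) \<Rightarrow> bool" where
  "weakstar_Linf_L2loc T u u' \<longleftrightarrow>
     (\<forall>n. in_Linf_L2loc T (u n)) \<and> in_Linf_L2loc T u' \<and>
     (\<forall>g. in_L1_L2c T g \<longrightarrow>
        (\<lambda>n. \<integral>(t, x). u n t x \<bullet> g t x \<partial>lebesgue_on ({0<..<T} \<times> UNIV))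
          \<longlonglongrightarrow> (\<integral>(t, x). u' t x \<bullet> g t x \<partial>lebesgue_on ({0<..<T} \<times> UNIV)))"

subsection \<open>Biot-Savart law and the two equations\<close>

definition biot_savart_kernel :: "real^2 \<Rightarrow> real^2" where
  "biot_savart_kernel x = (1 / (2 * pi)) *\<^sub>R (1 / (norm x)\<^sup>2) *\<^sub>R vector [- x $ 2, x $ 1]"

text \<open>\<open>v = (K * w)(x)\<close>, including the convergence of the convolution integral, which is not automatic
  for \<open>w \<in> L\<^sup>p\<close> with \<open>p \<ge> 2\<close>.\<close>

definition is_biot_savart :: "(real^2 \<Rightarrow> real) \<Rightarrow> real^2 \<Rightarrow> real^2 \<Rightarrow> bool" where
  "is_biot_savart w x v \<longleftrightarrow>
     has_bochner_integral lebesgue (\<lambda>y. w y *\<^sub>R biot_savart_kernel (x - y)) v"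

text \<open>The smooth solution of the Navier-Stokes equations in vorticity form with viscosity \<open>\<nu>\<close>.
  Smoothness alone does not single it out on the whole plane (as for the heat equation); the
  conditions \<open>w \<in> C([0,T]; L\<^sup>1)\<close> and \<open>w\<close> bounded, which hold for the classical solution with smooth
  compactly supported datum, select the standard uniqueness class.\<close>

definition navier_stokes_solution ::
  "real \<Rightarrow> real \<Rightarrow> (real^2 \<Rightarrow> real) \<Rightarrow> (real \<Rightarrow> real^2 \<Rightarrow> real^2) \<Rightarrow> (real \<Rightarrow> real^2 \<Rightarrow> real) \<Rightarrow> bool" where
  "navier_stokes_solution T \<nu> w0 u w \<longleftrightarrow>
     smooth_on ({0<..<T} \<times> UNIV) (\<lambda>(t, x). w t x) \<and>
     smooth_on ({0<..<T} \<times> UNIV) (\<lambda>(t, x). u t x) \<and>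
     continuous_on ({0..T} \<times> UNIV) (\<lambda>(t, x). w t x) \<and>
     in_C_Lp T 1 w \<and>
     (\<exists>M. \<forall>t\<in>{0..T}. \<forall>x. \<bar>w t x\<bar> \<le> M) \<and>
     (\<forall>t\<in>{0<..<T}. \<forall>x.
        deriv (\<lambda>s. w s x) t + u t x \<bullet> grad (w t) x - \<nu> * laplacian (w t) x = 0) \<and>
     (\<forall>t\<in>{0<..<T}. \<forall>x. is_biot_savart (w t) x (u t x)) \<and>
     (\<forall>x. w 0 x = w0 x)"

text \<open>Test functions in \<open>C\<^sub>c\<^sup>\<infinity>([0,T) \<times> \<real>\<^sup>2)\<close> need not vanish at \<open>t = 0\<close>; they are the restrictions to
  \<open>t \<ge> 0\<close> of test functions on \<open>(-\<infinity>,T) \<times> \<real>\<^sup>2\<close>. The integrability condition says that the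
  space-time integral makes sense.\<close>

definition renormalized_solution ::
  "real \<Rightarrow> real \<Rightarrow> (real^2 \<Rightarrow> real) \<Rightarrow> (real \<Rightarrow> real^2 \<Rightarrow> real^2) \<Rightarrow> (real \<Rightarrow> real^2 \<Rightarrow> real) \<Rightarrow> bool" where
  "renormalized_solution T p w0 u w \<longleftrightarrow>
     in_Lp_c p w0 \<and> in_C_Lp T p w \<and>
     (\<forall>\<beta> :: real \<Rightarrow> real. \<forall>\<phi> :: real \<times> (real^2) \<Rightarrow> real.
        \<beta> C1_differentiable_on UNIV \<and> bounded (range \<beta>) \<and>
        (\<exists>\<delta>>0. \<forall>s. \<bar>s\<bar> < \<delta> \<longrightarrow> \<beta> s = 0) \<and>
        test_function ({..<T} \<times> UNIV) \<phi> \<longrightarrow>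
          integrable (lebesgue_on ({0<..<T} \<times> UNIV))
            (\<lambda>(t, x). \<beta> (w t x) * (deriv (\<lambda>s. \<phi> (s, x)) t + u t x \<bullet> grad (\<lambda>y. \<phi> (t, y)) x)) \<and>
          (\<integral>(t, x). \<beta> (w t x) * (deriv (\<lambda>s. \<phi> (s, x)) t + u t x \<bullet> grad (\<lambda>y. \<phi> (t, y)) x)
             \<partial>lebesgue_on ({0<..<T} \<times> UNIV))
          + (\<integral>x. \<beta> (w0 x) * \<phi> (0, x) \<partial>lebesgue) = 0) \<and>
     (AE (t, x) in lebesgue_on ({0<..<T} \<times> UNIV). is_biot_savart (w t) x (u t x))"

end

theory Submission
  imports Defs "HOL-Real_Asymp.Real_Asymp"
begin

text \<open>
  Nothing is lost in the limit, and weak convergence without loss of a strictly convex energy is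
  strong. The viscous flow decreases the integral of every convex function of the vorticity that
  vanishes at 0, the Euler flow conserves the distribution function of its modulus, and both
  start from the same datum in the limit.

  On the viscous side, \<open>convex_entropy_decay\<close> bounds \<open>L\<^sup>p\<close> norms and the integrals of \<open>soft_abs k\<close>,
  a convex function that measures the mass carried by large values; so the vorticities are
  equi-integrable uniformly in time. A truncation of the vorticity satisfies the equation up to a
  dissipation error that such an entropy absorbs (\<open>entropy_inequality\<close>). Therefore the pairing of the
  vorticity with a fixed test function is Lipschitz in time up to an arbitrarily small error, with a
  constant independent of the viscosity (\<open>time_equicontinuity\<close>).

  Next, the Biot-Savart law is inverted by duality. The curl of the kernel is a positive multiple of
  the Dirac mass (\<open>kernel_grad\<close>), so pairing the velocity with a rotated gradient pairs the vorticity with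
  the test function itself (\<open>velocity_curl\<close>, \<open>euler_velocity_curl\<close>). Weak* convergence of the velocities thus
  gives convergence of time averages of these pairings, and equicontinuity turns averages into
  values: the vorticities at times \<open>t j\<close> tending to \<open>\<tau>\<close> converge weakly to the Euler vorticity at \<open>\<tau>\<close>
  (\<open>pairing_converges\<close>). By equi-integrability the weak limit is integrable (\<open>limit_L1\<close>) and bounded integrable
  functions may be used as test functions (\<open>weak_limit_bounded\<close>).

  On the inviscid side, the renormalised equation is applied to smooth approximations of the indicator
  functions of \<open>\<bar>s\<bar> > a\<close>. Since the vorticity is integrable, the corresponding flux is integrable on the plane
  (\<open>flux_bound\<close>), the contribution of infinity vanishes, and the measure of the set where
  \<open>\<bar>w t\<bar> > a\<close> does not depend on time (\<open>distribution_conserved\<close>). Hence the integrals of \<open>soft_abs 1 (w t)\<close>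
  and \<open>\<bar>w t\<bar> powr p\<close> are conserved.

  Together, the energies of the viscous vorticities at \<open>t j\<close> have an upper limit not larger than the
  energies of the weak limit. Strict convexity of \<open>soft_abs 1\<close> yields convergence almost everywhere along a
  subsequence, and the \<open>p\<close>-th powers upgrade it to \<open>L\<^sup>p\<close> (\<open>weak_to_strong\<close>). As the times may
  move, compactness of \<open>[0,T]\<close> makes the convergence uniform in time (\<open>uniform_Lp_convergence\<close>).
\<close>

section \<open>Calculus of smooth functions\<close>

abbreviation pd :: "('a::real_normed_vector \<Rightarrow> 'b::real_normed_vector) \<Rightarrow> 'a \<Rightarrow> 'a \<Rightarrow> 'b" where
  "pd f v x \<equiv> frechet_derivative f (at x) v"

lemma pd_eqI: "(f has_derivative f') (at x) \<Longrightarrow> pd f v x = f' v"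
  using frechet_derivative_at by metis

lemma differentiable_has_pd: "f differentiable (at x) \<Longrightarrow> (f has_derivative (\<lambda>v. pd f v x)) (at x)"
  by (metis eta_contract_eq frechet_derivative_works)

text \<open>Since \<open>C_k\<close> speaks about the total derivative at the points of an open set, it only sees the values
  of the function on that set. This is what allows derivatives to be computed first and rewritten
  afterwards, which is the pattern of all the closure properties below.\<close>

lemma C_k_cong:
  assumes "open S" "\<And>x. x \<in> S \<Longrightarrow> f x = g x"
  shows "C_k n S f \<longleftrightarrow> C_k n S g"
proof -
  have "C_k n S f \<Longrightarrow> (\<And>x. x \<in> S \<Longrightarrow> f x = g x) \<Longrightarrow> C_k n S g" for f g :: "'a \<Rightarrow> 'b"
  proof (induction n arbitrary: f g)
    case 0
    then show ?case by (metis C_k.simps(1) continuous_on_cong)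
  next
    case (Suc n)
    have hd: "(g has_derivative (\<lambda>v. pd f v x)) (at x)" if "x \<in> S" for x
      using has_derivative_transform_within_open[OF differentiable_has_pd assms(1) that] Suc.prems that by auto
    have 1: "pd f v x = pd g v x" if "x \<in> S" for x v
      using pd_eqI[OF hd[OF that]] by simp
    have "C_k n S (\<lambda>x. pd g v x)" for v
    proof (rule Suc.IH[of "\<lambda>x. pd f v x"])
      show "C_k n S (\<lambda>x. pd f v x)" using Suc.prems(1) by simp
    qed (rule 1)
    then show ?case using hd by (auto intro: differentiableI)
  qed
  from this[of f g] this[of g f] show ?thesis using assms(2) by auto
qed

lemma C_k_continuous: "C_k n S f \<Longrightarrow> continuous_on S f"
proof (cases n)
  case (Suc m)
  assume "C_k n S f"
  then show ?thesis unfolding Suc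
    by (auto intro!: continuous_at_imp_continuous_on differentiable_imp_continuous_within)
qed auto

lemma C_k_Suc_D: "C_k (Suc n) S f \<Longrightarrow> C_k n S f"
proof (induction n arbitrary: f)
  case 0
  then show ?case using C_k_continuous[of "Suc 0"] by auto
next
  case (Suc n)
  have "\<And>v. C_k n S (\<lambda>x. pd f v x)" using Suc by (metis C_k.simps(2))
  then show ?case using Suc.prems by auto
qed

lemma C_k_mono: "C_k n S f \<Longrightarrow> m \<le> n \<Longrightarrow> C_k m S f"
proof (induction n)
  case (Suc n)
  then show ?case using C_k_Suc_D[OF Suc.prems(1)] by (cases "m = Suc n") (auto simp del: C_k.simps)
qed auto

lemma C_k_const: "C_k n S (\<lambda>x. c)"
  by (induction n arbitrary: c) (auto simp: pd_eqI[OF has_derivative_const])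

text \<open>Closure properties are proved by induction on the order through this rule: a derivative formula
  plus one order less for the formula.\<close>

lemma C_k_SucI:
  assumes "open S" "\<And>x. x \<in> S \<Longrightarrow> (f has_derivative (f' x)) (at x)" "\<And>v. C_k n S (\<lambda>x. f' x v)"
  shows "C_k (Suc n) S f"
proof -
  have "C_k n S (\<lambda>x. pd f v x) = C_k n S (\<lambda>x. f' x v)" for v
    by (rule C_k_cong) (use assms in \<open>auto simp: pd_eqI\<close>)
  then show ?thesis using assms by (auto intro: differentiableI)
qed

lemma C_k_Suc_has: "C_k (Suc n) S f \<Longrightarrow> x \<in> S \<Longrightarrow> (f has_derivative (\<lambda>v. pd f v x)) (at x)"
  by (rule differentiable_has_pd) auto

lemma C_k_Suc_pd: "C_k (Suc n) S f \<Longrightarrow> C_k n S (\<lambda>x. pd f v x)"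
  by auto

lemma C_k_bounded_linear: "open S \<Longrightarrow> bounded_linear f \<Longrightarrow> C_k n S f"
proof (cases n)
  case 0
  assume "bounded_linear f" then show ?thesis using 0
    by (simp add: linear_continuous_on)
next
  case (Suc m)
  assume "open S" "bounded_linear f"
  then show ?thesis unfolding Suc
    by (intro C_k_SucI[of _ _ "\<lambda>x. f"]) (auto intro: bounded_linear_imp_has_derivative C_k_const)
qed

lemma C_k_add:
  assumes "open S" shows "C_k n S f \<Longrightarrow> C_k n S g \<Longrightarrow> C_k n S (\<lambda>x. f x + g x)"
proof (induction n arbitrary: f g)
  case 0 then show ?case by (auto intro: continuous_intros)
next
  case (Suc n)
  show ?case
  proof (rule C_k_SucI[OF assms])
    show "((\<lambda>x. f x + g x) has_derivative (\<lambda>v. pd f v x + pd g v x)) (at x)" if "x \<in> S" for x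
      using Suc.prems that by (intro has_derivative_add C_k_Suc_has)
    show "C_k n S (\<lambda>x. pd f v x + pd g v x)" for v
      by (rule Suc.IH[OF C_k_Suc_pd[OF Suc.prems(1)] C_k_Suc_pd[OF Suc.prems(2)]])
  qed
qed

lemma C_k_mult:
  fixes f g :: "'a::real_normed_vector \<Rightarrow> real"
  assumes "open S" shows "C_k n S f \<Longrightarrow> C_k n S g \<Longrightarrow> C_k n S (\<lambda>x. f x * g x)"
proof (induction n arbitrary: f g)
  case 0 then show ?case by (auto intro: continuous_intros)
next
  case (Suc n)
  show ?case
  proof (rule C_k_SucI[OF assms])
    show "((\<lambda>x. f x * g x) has_derivative (\<lambda>v. f x * pd g v x + pd f v x * g x)) (at x)" if "x \<in> S" for x
      using Suc.prems that by (intro has_derivative_mult C_k_Suc_has)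
    show "C_k n S (\<lambda>x. f x * pd g v x + pd f v x * g x)" for v
      by (rule C_k_add[OF assms Suc.IH[OF C_k_Suc_D[OF Suc.prems(1)] C_k_Suc_pd[OF Suc.prems(2)]]
            Suc.IH[OF C_k_Suc_pd[OF Suc.prems(1)] C_k_Suc_D[OF Suc.prems(2)]]])
  qed
qed

lemma C_k_cmult:
  fixes f :: "'a::real_normed_vector \<Rightarrow> real"
  shows "open S \<Longrightarrow> C_k n S f \<Longrightarrow> C_k n S (\<lambda>x. c * f x)"
  by (intro C_k_mult C_k_const)

lemma C_k_diff:
  fixes f :: "'a::real_normed_vector \<Rightarrow> real"
  shows "open S \<Longrightarrow> C_k n S f \<Longrightarrow> C_k n S g \<Longrightarrow> C_k n S (\<lambda>x. f x - g x)"
  using C_k_add[of S n f "\<lambda>x. (-1) * g x"] C_k_cmult[of S n g "-1"] by simp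

lemma C_k_sum:
  fixes f :: "'b \<Rightarrow> 'a::real_normed_vector \<Rightarrow> real"
  shows "open S \<Longrightarrow> (\<And>i. i \<in> I \<Longrightarrow> C_k n S (f i)) \<Longrightarrow> C_k n S (\<lambda>x. \<Sum>i\<in>I. f i x)"
  by (induction I rule: infinite_finite_induct) (auto intro: C_k_const C_k_add)

lemma C_k_inverse:
  fixes f :: "'a::real_normed_vector \<Rightarrow> real"
  assumes "open S" and "\<And>x. x \<in> S \<Longrightarrow> f x \<noteq> 0"
  shows "C_k n S f \<Longrightarrow> C_k n S (\<lambda>x. inverse (f x))"
proof (induction n)
  case 0 then show ?case using assms by (auto intro!: continuous_intros)
next
  case (Suc n)
  show ?case
  proof (rule C_k_SucI[OF assms(1)])
    show "((\<lambda>x. inverse (f x)) has_derivative (\<lambda>v. - 1 * (inverse (f x) * pd f v x * inverse (f x)))) (at x)"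
      if "x \<in> S" for x
      using Deriv.has_derivative_inverse[OF assms(2)[OF that] C_k_Suc_has[OF Suc.prems that]] by simp
    show "C_k n S (\<lambda>x. - 1 * (inverse (f x) * pd f v x * inverse (f x)))" for v
      by (rule C_k_mult[OF assms(1) C_k_const C_k_mult[OF assms(1) C_k_mult[OF assms(1)
            Suc.IH[OF C_k_Suc_D[OF Suc.prems]] C_k_Suc_pd[OF Suc.prems]] Suc.IH[OF C_k_Suc_D[OF Suc.prems]]]])
  qed
qed

lemma C_k_compose_real:
  fixes f :: "'a::real_normed_vector \<Rightarrow> real" and h :: "real \<Rightarrow> real"
  assumes "open S"
  shows "C_k n UNIV h \<Longrightarrow> C_k n S f \<Longrightarrow> C_k n S (\<lambda>x. h (f x))"
proof (induction n arbitrary: h)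
  case 0 then show ?case
    using continuous_on_compose2[of UNIV h S f] by simp
next
  case (Suc n)
  show ?case
  proof (rule C_k_SucI[OF assms(1)])
    fix x assume x: "x \<in> S"
    have h: "(h has_derivative (\<lambda>v. pd h v (f x))) (at (f x))" using Suc.prems C_k_Suc_has by blast
    have lin: "pd h v y = v * pd h 1 y" for v y
    proof -
      have "bounded_linear (\<lambda>v. pd h v y)"
        by (rule has_derivative_bounded_linear) (rule C_k_Suc_has[OF Suc.prems(1) UNIV_I])
      then show ?thesis by (metis bounded_linear.linear linear_scale mult.right_neutral real_scaleR_def)
    qed
    have "((\<lambda>x. h (f x)) has_derivative (\<lambda>v. pd h (pd f v x) (f x))) (at x)"
      using has_derivative_compose[OF C_k_Suc_has[OF Suc.prems(2) x] h] by simp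
    then show "((\<lambda>x. h (f x)) has_derivative (\<lambda>v. pd f v x * pd h 1 (f x))) (at x)"
      by (rule has_derivative_eq_rhs) (rule ext, rule lin)
  next
    show "C_k n S (\<lambda>x. pd f v x * pd h 1 (f x))" for v
      by (rule C_k_mult[OF assms C_k_Suc_pd[OF Suc.prems(2)]
            Suc.IH[OF C_k_Suc_pd[OF Suc.prems(1)] C_k_Suc_D[OF Suc.prems(2)]]])
  qed
qed

lemma C_k_compose_affine:
  fixes f :: "'a::real_normed_vector \<Rightarrow> 'b::real_normed_vector"
  assumes "bounded_linear L"
  shows "C_k n UNIV f \<Longrightarrow> C_k n UNIV (\<lambda>x. f (a + L x))"
proof (induction n arbitrary: f)
  case 0
  have "continuous_on UNIV (\<lambda>x. a + L x)"
    by (intro continuous_on_add continuous_on_const linear_continuous_on assms)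
  with 0 show ?case using continuous_on_compose2[of UNIV f UNIV "\<lambda>x. a + L x"] by simp
next
  case (Suc n)
  show ?case
  proof (rule C_k_SucI)
    fix x
    have "((\<lambda>x. a + L x) has_derivative L) (at x)"
      using has_derivative_add[OF has_derivative_const bounded_linear_imp_has_derivative[OF assms]] by simp
    from has_derivative_compose[OF this C_k_Suc_has[OF Suc.prems UNIV_I]]
    show "((\<lambda>x. f (a + L x)) has_derivative (\<lambda>v. pd f (L v) (a + L x))) (at x)" .
  next
    show "C_k n UNIV (\<lambda>x. pd f (L v) (a + L x))" for v
      using Suc.IH[OF C_k_Suc_pd[OF Suc.prems]] .
  qed auto
qed

lemma C_k_norm_sq: "C_k n UNIV (\<lambda>x::'a::euclidean_space. (norm x)\<^sup>2)"
proof -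
  have eq: "(\<lambda>x::'a. (norm x)\<^sup>2) = (\<lambda>x. \<Sum>b\<in>Basis. (x \<bullet> b) * (x \<bullet> b))"
    unfolding power2_norm_eq_inner by (rule ext, rule euclidean_inner)
  show ?thesis unfolding eq
    by (intro C_k_sum C_k_mult C_k_bounded_linear bounded_linear_inner_left) auto
qed

lemma C_k_real_SucI:
  fixes f :: "real \<Rightarrow> real"
  assumes "\<And>x. (f has_real_derivative f' x) (at x)" "C_k n UNIV f'"
  shows "C_k (Suc n) UNIV f"
proof (rule C_k_SucI[where f' = "\<lambda>x v. v * f' x"])
  show "(f has_derivative (\<lambda>v. v * f' x)) (at x)" for x
    using assms(1)[of x] unfolding has_field_derivative_def
    by (rule has_derivative_eq_rhs) (simp add: fun_eq_iff mult.commute)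
  show "C_k n UNIV (\<lambda>x. v * f' x)" for v
    by (rule C_k_cmult[OF open_UNIV assms(2)])
qed auto

section \<open>Smooth cut-off functions\<close>

text \<open>The powers \<open>inverse s ^ m\<close> are built in because the family is then closed under differentiation
  (\<open>flat_deriv\<close>), so that smoothness follows by induction on the order with \<open>m\<close> arbitrary.\<close>

definition flat :: "nat \<Rightarrow> real \<Rightarrow> real" where
  "flat m s = (if s \<le> 0 then 0 else inverse s ^ m * exp (- inverse s))"

lemma flat_tendsto: "(flat m \<longlongrightarrow> 0) (at 0)"
proof -
  have r: "(flat m \<longlongrightarrow> 0) (at_right 0)"
  proof -
    have "((\<lambda>s. inverse s ^ m / exp (inverse s)) \<longlongrightarrow> (0::real)) (at_right 0)"
      by (rule filterlim_compose[OF tendsto_power_div_exp_0 filterlim_inverse_at_top_right])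
    then show ?thesis
      by (rule Lim_transform_eventually)
         (auto simp: eventually_at_right_field flat_def exp_minus field_simps intro!: exI[of _ 1])
  qed
  have "(flat m \<longlongrightarrow> 0) (at_left 0)"
    by (rule Lim_transform_eventually[OF tendsto_const])
       (auto simp: eventually_at_left_field flat_def intro!: exI[of _ "-1"])
  with r show ?thesis by (simp add: filterlim_split_at)
qed

text \<open>At the origin the difference quotient of \<open>flat m\<close> is \<open>flat (m + 1)\<close>, which tends to 0 because the
  exponential beats every power.\<close>

lemma flat_deriv: "(flat m has_real_derivative (flat (m + 2) s - m * flat (m + 1) s)) (at s)"
proof -
  consider "s < 0" | "s > 0" | "s = 0" by linarith
  then show ?thesis
  proof cases
    case 1
    have "((\<lambda>_. 0) has_real_derivative 0) (at s)" by simp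
    then have "(flat m has_real_derivative 0) (at s)"
      by (rule has_field_derivative_transform_within[of _ _ _ _ "-s"]) (use 1 in \<open>auto simp: flat_def dist_real_def\<close>)
    then show ?thesis using 1 by (simp add: flat_def)
  next
    case 2
    have "((\<lambda>s. inverse s ^ m * exp (- inverse s)) has_real_derivative
       (flat (m + 2) s - m * flat (m + 1) s)) (at s)"
    proof (rule DERIV_cong)
      show "((\<lambda>s. inverse s ^ m * exp (- inverse s)) has_real_derivative
        (inverse s ^ m * (exp (- inverse s) * (inverse s * inverse s))
         + m * inverse s ^ (m - 1) * (- (inverse s * inverse s)) * exp (- inverse s))) (at s)"
        using 2 by (auto intro!: derivative_eq_intros simp: power2_eq_square)
      show "inverse s ^ m * (exp (- inverse s) * (inverse s * inverse s))
         + m * inverse s ^ (m - 1) * (- (inverse s * inverse s)) * exp (- inverse s) =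
         flat (m + 2) s - m * flat (m + 1) s"
        using 2 by (cases m) (simp_all add: flat_def algebra_simps)
    qed
    then show ?thesis
      by (rule has_field_derivative_transform_within[of _ _ _ _ s]) (use 2 in \<open>auto simp: flat_def dist_real_def\<close>)
  next
    case 3
    have "((\<lambda>h. flat m h / h) \<longlongrightarrow> 0) (at 0)"
      by (rule Lim_transform_eventually[OF flat_tendsto[of "m+1"]])
         (auto simp: flat_def field_simps eventually_at intro!: exI[of _ 1])
    then have "(flat m has_real_derivative 0) (at 0)" by (simp add: DERIV_def flat_def)
    then show ?thesis using 3 by (simp add: flat_def)
  qed
qed

lemma C_k_flat: "C_k n UNIV (flat m)"
proof (induction n arbitrary: m)
  case 0
  show ?case using flat_deriv by (auto intro!: DERIV_continuous_on)
next
  case (Suc n)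
  show ?case
    by (rule C_k_real_SucI[OF flat_deriv]) (rule C_k_diff[OF open_UNIV Suc.IH C_k_cmult[OF open_UNIV Suc.IH]])
qed

definition step :: "real \<Rightarrow> real" where
  "step s = flat 0 s * inverse (flat 0 s + flat 0 (1 - s))"

lemma flat_nonneg: "flat m s \<ge> 0" by (auto simp: flat_def)

lemma flat_denom_pos: "flat 0 s + flat 0 (1 - s) > 0"
proof (cases "s > 0")
  case True
  then have "flat 0 s > 0" by (simp add: flat_def)
  then show ?thesis using flat_nonneg[of 0 "1-s"] by linarith
next
  case False
  then have "flat 0 (1-s) > 0" by (simp add: flat_def)
  then show ?thesis using flat_nonneg[of 0 "s"] by linarith
qed

lemma C_k_step: "C_k n UNIV step"
proof -
  have "C_k n UNIV (\<lambda>s. flat 0 (1 + - s))"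
    by (rule C_k_compose_affine[OF bounded_linear_minus[OF bounded_linear_ident] C_k_flat])
  then have "C_k n UNIV (\<lambda>s. flat 0 (1 - s))" by simp
  then show ?thesis
    unfolding step_def[abs_def]
    by (intro C_k_mult C_k_inverse C_k_add C_k_flat) (use flat_denom_pos in \<open>auto simp: less_le\<close>)
qed

lemma step_0: "s \<le> 0 \<Longrightarrow> step s = 0" by (simp add: step_def flat_def)

lemma step_1: "s \<ge> 1 \<Longrightarrow> step s = 1" by (simp add: step_def flat_def)

lemma step_bounds: "0 \<le> step s" "step s \<le> 1"
proof -
  show "0 \<le> step s" using flat_nonneg[of 0] flat_denom_pos[of s] by (simp add: step_def)
  show "step s \<le> 1" using flat_nonneg[of 0 "1-s"] flat_denom_pos[of s] by (simp add: step_def field_simps)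
qed

text \<open>Using the square of the norm keeps the function smooth at the origin. The argument of \<open>step\<close>
  is at least 1 for \<open>norm x \<le> R\<close> and at most 0 for \<open>norm x \<ge> 2 * R\<close>.\<close>

definition cutoff :: "real \<Rightarrow> 'a::euclidean_space \<Rightarrow> real" where
  "cutoff R x = step (2 - (norm (x /\<^sub>R R))\<^sup>2)"

lemma C_k_cutoff: "C_k n UNIV (cutoff R :: 'a::euclidean_space \<Rightarrow> real)"
proof -
  have 1: "C_k n UNIV (\<lambda>x::'a. step (2 - (norm x)\<^sup>2))"
    by (rule C_k_compose_real[OF open_UNIV C_k_step C_k_diff[OF open_UNIV C_k_const C_k_norm_sq]])
  from C_k_compose_affine[OF bounded_linear_scaleR_right[of "inverse R"] this, of 0]
  show ?thesis by (simp add: cutoff_def[abs_def])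
qed

lemma cutoff_bounds: "0 \<le> cutoff R x" "cutoff R x \<le> 1"
  by (auto simp: cutoff_def step_bounds)

lemma cutoff_1: "R > 0 \<Longrightarrow> norm x \<le> R \<Longrightarrow> cutoff R x = 1"
  unfolding cutoff_def by (rule step_1) (simp add: field_simps power_mono)

lemma cutoff_0: assumes "R > 0" "norm x \<ge> 2 * R" shows "cutoff R x = 0"
proof -
  have "norm (x /\<^sub>R R) \<ge> 2" using assms by (simp add: field_simps)
  then have "(norm (x /\<^sub>R R))\<^sup>2 \<ge> 2^2" by (intro power_mono) auto
  then show ?thesis unfolding cutoff_def by (intro step_0) simp
qed

lemma supp_subset: "closed S \<Longrightarrow> (\<And>x. x \<notin> S \<Longrightarrow> f x = 0) \<Longrightarrow> supp f \<subseteq> S"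
  unfolding supp_def by (rule closure_minimal) auto

lemma real_polynomial_C_k:
  fixes f :: "'a::euclidean_space \<Rightarrow> real"
  shows "real_polynomial_function f \<Longrightarrow> C_k n UNIV f"
  by (induction rule: real_polynomial_function.induct)
     (simp_all add: C_k_bounded_linear C_k_const C_k_add C_k_mult)

section \<open>Integration by parts\<close>

definition vanishes_outside :: "real \<Rightarrow> ('a::real_normed_vector \<Rightarrow> 'b::zero) \<Rightarrow> bool" where
  "vanishes_outside R f \<longleftrightarrow> (\<forall>x. norm x > R \<longrightarrow> f x = 0)"

lemma vanishes_pd:
  assumes "vanishes_outside R f" shows "vanishes_outside R (\<lambda>x. pd f v x)"
  unfolding vanishes_outside_def
proof (intro allI impI)
  fix x :: 'a assume x: "norm x > R"
  have "((\<lambda>_. 0) has_derivative (\<lambda>_. 0)) (at x)" by simp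
  then have "(f has_derivative (\<lambda>_. 0)) (at x)"
  proof (rule has_derivative_transform_within_open)
    show "open {x. norm x > R}" by (intro open_Collect_less continuous_intros)
    show "x \<in> {x. norm x > R}" using x by simp
  qed (use assms in \<open>auto simp: vanishes_outside_def\<close>)
  then show "pd f v x = 0" by (rule pd_eqI)
qed

lemma integrable_continuous_vanishing:
  fixes f :: "'a::euclidean_space \<Rightarrow> 'b::{banach, second_countable_topology}"
  assumes "continuous_on UNIV f" "vanishes_outside R f"
  shows "integrable lborel f"
proof -
  have "integrable lborel (\<lambda>x. indicator (cball 0 R) x *\<^sub>R f x)"
    by (rule borel_integrable_compact) (auto intro: continuous_on_subset assms)
  moreover have "(\<lambda>x. indicator (cball 0 R) x *\<^sub>R f x) = f"
    using assms(2) by (auto simp: fun_eq_iff vanishes_outside_def indicator_def)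
  ultimately show ?thesis by simp
qed

lemma bounded_continuous_vanishing:
  fixes f :: "'a::euclidean_space \<Rightarrow> 'b::real_normed_vector"
  assumes "continuous_on UNIV f" "vanishes_outside R f"
  obtains B where "B > 0" "\<And>x. norm (f x) \<le> B"
proof -
  have "bounded (f ` cball 0 R)"
    by (intro compact_imp_bounded compact_continuous_image) (auto intro: continuous_on_subset assms)
  then obtain B where B: "B > 0" "\<And>x. x \<in> cball 0 R \<Longrightarrow> norm (f x) \<le> B"
    unfolding bounded_pos by auto
  have "norm (f x) \<le> B" for x
    using B assms(2) by (cases "x \<in> cball 0 R") (auto simp: vanishes_outside_def)
  with B that show ?thesis by blast
qed

lemma lborel_integral_shift:
  fixes f :: "'a::euclidean_space \<Rightarrow> 'b::{banach, second_countable_topology}"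
  assumes [measurable]: "f \<in> borel_measurable borel"
  shows "(\<integral>x. f (a + x) \<partial>lborel) = (\<integral>x. f x \<partial>lborel)"
  by (subst (2) lborel_distr_plus[of a, symmetric], subst integral_distr) auto

lemma nn_integral_shift:
  fixes f :: "'a::euclidean_space \<Rightarrow> ennreal"
  assumes [measurable]: "f \<in> borel_measurable borel"
  shows "(\<integral>\<^sup>+x. f (a + x) \<partial>lborel) = (\<integral>\<^sup>+x. f x \<partial>lborel)"
  by (subst (2) lborel_distr_plus[of a, symmetric], subst nn_integral_distr) auto

lemma C_1_has: "C_k 1 UNIV f \<Longrightarrow> (f has_derivative (\<lambda>v. pd f v x)) (at x)"
  using C_k_Suc_has[of 0 UNIV f x] by simp

lemma mvt_along_line:
  fixes f :: "'a::real_normed_vector \<Rightarrow> real"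
  assumes "C_k 1 UNIV f" "s > 0"
  obtains \<theta> where "0 < \<theta>" "\<theta> < s" "f (x + s *\<^sub>R v) - f x = s * pd f v (x + \<theta> *\<^sub>R v)"
proof -
  have d: "((\<lambda>r. f (x + r *\<^sub>R v)) has_real_derivative pd f v (x + r *\<^sub>R v)) (at r)" for r
  proof -
    have 1: "((\<lambda>r. x + r *\<^sub>R v) has_derivative (\<lambda>h. h *\<^sub>R v)) (at r)"
      by (auto intro!: derivative_eq_intros)
    have 2: "(f has_derivative (\<lambda>w. pd f w (x + r *\<^sub>R v))) (at (x + r *\<^sub>R v))"
      by (rule C_1_has[OF assms(1)])
    have "((\<lambda>r. f (x + r *\<^sub>R v)) has_derivative (\<lambda>h. pd f (h *\<^sub>R v) (x + r *\<^sub>R v))) (at r)"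
      using has_derivative_compose[OF 1 2] by simp
    moreover have "pd f (h *\<^sub>R v) (x + r *\<^sub>R v) = pd f v (x + r *\<^sub>R v) * h" for h
      using linear_scale[OF bounded_linear.linear[OF has_derivative_bounded_linear[OF 2]]] by simp
    ultimately show ?thesis by (simp add: has_field_derivative_def)
  qed
  obtain z where "0 < z" "z < s" "f (x + s *\<^sub>R v) - f (x + 0 *\<^sub>R v) = (s - 0) * pd f v (x + z *\<^sub>R v)"
    using MVT2[OF assms(2), of "\<lambda>r. f (x + r *\<^sub>R v)" "\<lambda>r. pd f v (x + r *\<^sub>R v)"] d by blast
  with that show ?thesis by simp
qed

text \<open>The integral of a difference quotient vanishes by translation invariance, and the quotients converge
  to the derivative under an integrable majorant supplied by the mean value theorem.\<close>

lemma integral_pd_zero: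
  fixes f :: "'a::euclidean_space \<Rightarrow> real"
  assumes f: "C_k 1 UNIV f" and van: "vanishes_outside R f"
  shows "integrable lborel (\<lambda>x. pd f v x)" "(\<integral>x. pd f v x \<partial>lborel) = 0"
proof -
  have cont: "continuous_on UNIV f" using f C_k_continuous by blast
  have contd: "continuous_on UNIV (\<lambda>x. pd f v x)" using f by simp
  have [measurable]: "f \<in> borel_measurable borel" "(\<lambda>x. pd f v x) \<in> borel_measurable borel"
    using cont contd by (auto intro: borel_measurable_continuous_onI)
  show int: "integrable lborel (\<lambda>x. pd f v x)"
    by (rule integrable_continuous_vanishing[OF contd vanishes_pd[OF van]])
  obtain B where B: "B > 0" "\<And>x. norm (pd f v x) \<le> B"
    using bounded_continuous_vanishing[OF contd vanishes_pd[OF van]] by blast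
  define q where "q n x = (f (x + (1 / real (Suc n)) *\<^sub>R v) - f x) * real (Suc n)" for n x
  define r where "r n = 1 / real (Suc n)" for n
  have r: "r n > 0" "r n \<le> 1" for n by (auto simp: r_def)
  have q: "\<exists>\<theta>>0. \<theta> < r n \<and> q n x = pd f v (x + \<theta> *\<^sub>R v)" for n x
  proof -
    obtain \<theta> where "0 < \<theta>" "\<theta> < r n" "f (x + r n *\<^sub>R v) - f x = r n * pd f v (x + \<theta> *\<^sub>R v)"
      using mvt_along_line[OF f r(1)] .
    then show ?thesis by (auto simp: q_def r_def intro!: exI[of _ \<theta>])
  qed
  have fi: "integrable lborel f" by (rule integrable_continuous_vanishing[OF cont van])
  have shift: "integrable lborel (\<lambda>x. f (x + a))" "(\<integral>x. f (x + a) \<partial>lborel) = (\<integral>x. f x \<partial>lborel)" for a :: 'a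
  proof -
    have "vanishes_outside (R + norm a) (\<lambda>x. f (x + a))"
      unfolding vanishes_outside_def
    proof (intro allI impI)
      fix x :: 'a assume "norm x > R + norm a"
      then have "norm (x + a) > R" using norm_triangle_ineq4[of "x+a" a] by simp
      with van show "f (x + a) = 0" by (simp add: vanishes_outside_def)
    qed
    moreover have "continuous_on UNIV (\<lambda>x. f (x + a))"
      by (rule continuous_on_compose2[OF cont]) (auto intro!: continuous_intros)
    ultimately show "integrable lborel (\<lambda>x. f (x + a))"
      using integrable_continuous_vanishing by blast
    show "(\<integral>x. f (x + a) \<partial>lborel) = (\<integral>x. f x \<partial>lborel)"
      using lborel_integral_shift[of f a] by (simp add: add.commute)
  qed
  have qi: "(\<integral>x. q n x \<partial>lborel) = 0" for n
    unfolding q_def using shift fi by simp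
  have "(\<lambda>n. \<integral>x. q n x \<partial>lborel) \<longlonglongrightarrow> (\<integral>x. pd f v x \<partial>lborel)"
  proof (rule integral_dominated_convergence)
    show "integrable lborel (\<lambda>x. B * indicator (cball 0 (R + norm v)) x)"
      by (intro integrable_mult_right integrable_real_indicator)
         (auto simp: emeasure_bounded_finite[OF bounded_cball, simplified])
    show "AE x in lborel. (\<lambda>n. q n x) \<longlonglongrightarrow> pd f v x"
    proof (rule AE_I2)
      fix x
      define t where "t n = (SOME \<theta>. \<theta> > 0 \<and> \<theta> < r n \<and> q n x = pd f v (x + \<theta> *\<^sub>R v))" for n
      have t: "t n > 0 \<and> t n < r n \<and> q n x = pd f v (x + t n *\<^sub>R v)" for n
        unfolding t_def using q[of n x] by (rule someI_ex)
      have r0: "r \<longlonglongrightarrow> 0" unfolding r_def[abs_def] using LIMSEQ_inverse_real_of_nat by (simp add: inverse_eq_divide)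
      then have "t \<longlonglongrightarrow> 0"
        using t by (intro tendsto_sandwich[OF _ _ tendsto_const r0] always_eventually allI less_imp_le) auto
      then have "(\<lambda>n. x + t n *\<^sub>R v) \<longlonglongrightarrow> x + 0 *\<^sub>R v" by (intro tendsto_intros)
      then have "(\<lambda>n. pd f v (x + t n *\<^sub>R v)) \<longlonglongrightarrow> pd f v x"
        using contd by (auto simp: continuous_on_eq_continuous_at intro: isCont_tendsto_compose)
      then show "(\<lambda>n. q n x) \<longlonglongrightarrow> pd f v x" using t by simp
    qed
    show "AE x in lborel. norm (q n x) \<le> B * indicator (cball 0 (R + norm v)) x" for n
    proof (rule AE_I2)
      fix x
      obtain \<theta> where th: "0 < \<theta>" "\<theta> < r n" "q n x = pd f v (x + \<theta> *\<^sub>R v)" using q[of n x] by blast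
      show "norm (q n x) \<le> B * indicator (cball 0 (R + norm v)) x"
      proof (cases "x \<in> cball 0 (R + norm v)")
        case True then show ?thesis using th B by simp
      next
        case False
        have "norm (\<theta> *\<^sub>R v) \<le> norm v" using th r(2)[of n] by (auto intro: mult_left_le_one_le)
        then have "norm (x + \<theta> *\<^sub>R v) > R" using False norm_triangle_ineq4[of "x + \<theta> *\<^sub>R v" "\<theta> *\<^sub>R v"] by simp
        then show ?thesis using vanishes_pd[OF van, of v] False th by (simp add: vanishes_outside_def)
      qed
    qed
  qed (auto simp: q_def)
  then show "(\<integral>x. pd f v x \<partial>lborel) = 0" using qi LIMSEQ_unique[OF tendsto_const] by (metis (lifting) LIMSEQ_const_iff qi ext)
qed

lemma pd_mult:
  fixes f g :: "'a::real_normed_vector \<Rightarrow> real"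
  assumes "C_k 1 UNIV f" "C_k 1 UNIV g"
  shows "pd (\<lambda>x. f x * g x) v x = f x * pd g v x + pd f v x * g x"
  by (rule pd_eqI, rule has_derivative_mult) (use assms C_k_Suc_has[of 0 UNIV] in auto)

lemma vanishes_mult:
  fixes f g :: "'a::real_normed_vector \<Rightarrow> real"
  shows "vanishes_outside R g \<Longrightarrow> vanishes_outside R (\<lambda>x. f x * g x)"
  by (simp add: vanishes_outside_def)

lemma integration_by_parts:
  fixes f g :: "'a::euclidean_space \<Rightarrow> real"
  assumes f: "C_k 1 UNIV f" and g: "C_k 1 UNIV g" and van: "vanishes_outside R g"
  shows "(\<integral>x. f x * pd g v x \<partial>lborel) = - (\<integral>x. pd f v x * g x \<partial>lborel)"
proof -
  have fg: "C_k 1 UNIV (\<lambda>x. f x * g x)" by (rule C_k_mult[OF open_UNIV f g])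
  have c: "continuous_on UNIV f" "continuous_on UNIV g" using f g C_k_continuous by blast+
  have i1: "integrable lborel (\<lambda>x. f x * pd g v x)"
    by (rule integrable_continuous_vanishing[OF _ vanishes_mult[OF vanishes_pd[OF van]]])
       (use c g in \<open>auto intro!: continuous_on_mult\<close>)
  have i2: "integrable lborel (\<lambda>x. pd f v x * g x)"
    by (rule integrable_continuous_vanishing[OF _ vanishes_mult[OF van]])
       (use c f in \<open>auto intro!: continuous_on_mult\<close>)
  have "0 = (\<integral>x. f x * pd g v x + pd f v x * g x \<partial>lborel)"
    using integral_pd_zero(2)[OF fg vanishes_mult[OF van], of v] by (simp add: pd_mult[OF f g])
  also have "\<dots> = (\<integral>x. f x * pd g v x \<partial>lborel) + (\<integral>x. pd f v x * g x \<partial>lborel)"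
    using i1 i2 by simp
  finally show ?thesis by simp
qed

section \<open>The Biot-Savart kernel\<close>

lemma Basis_2: "(Basis :: (real^2) set) = {axis 1 1, axis 2 1}"
  by (auto simp: Basis_vec_def UNIV_2)

lemma axis_neq: "axis 1 (1::real) \<noteq> (axis 2 1 :: real^2)"
proof -
  have "axis (1::2) (1::real) $ 1 \<noteq> axis (2::2) (1::real) $ 1" by (simp add: axis_def)
  then show ?thesis by metis
qed

lemma inner_2: "(x::real^2) \<bullet> y = x $ 1 * y $ 1 + x $ 2 * y $ 2"
  by (simp add: inner_vec_def sum_2)

lemma norm_2: "(norm (x::real^2))\<^sup>2 = (x $ 1)\<^sup>2 + (x $ 2)\<^sup>2"
  unfolding power2_norm_eq_inner by (simp add: inner_2 power2_eq_square)

lemma grad_2: "grad (f :: real^2 \<Rightarrow> real) x = vector [pd f (axis 1 1) x, pd f (axis 2 1) x]"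
  unfolding grad_def Basis_2 sum.insert[OF finite.insertI[OF finite.emptyI] , of "axis 1 1" "axis 2 1"]
  using axis_neq by (simp add: vec_eq_iff forall_2) (simp add: axis_def)

text \<open>The gradient rotated by a right angle; pairing a velocity with it tests its curl.\<close>

definition perp_grad :: "(real^2 \<Rightarrow> real) \<Rightarrow> real^2 \<Rightarrow> real^2" where
  "perp_grad f x = vector [- pd f (axis 2 1) x, pd f (axis 1 1) x]"

lemma norm_kernel: "norm (biot_savart_kernel z) = inverse (2 * pi) * inverse (norm z)"
proof -
  have "norm (vector [- z $ 2, z $ 1] :: real^2) = norm z"
    by (rule power2_eq_imp_eq) (auto simp: norm_2)
  then show ?thesis by (cases "z = 0") (auto simp: biot_savart_kernel_def field_simps power2_eq_square)
qed

lemma norm_kernel_minus: "norm (biot_savart_kernel (x - y)) = norm (biot_savart_kernel (y - x))"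
  by (simp add: norm_kernel norm_minus_commute)

lemma kernel_measurable [measurable]: "biot_savart_kernel \<in> borel_measurable borel"
proof -
  have "(\<lambda>x::real^2. vector [- x $ 2, x $ 1] :: real^2) \<in> borel_measurable borel"
    by (intro borel_measurable_continuous_onI linear_continuous_on)
       (auto intro!: linear_conv_bounded_linear[THEN iffD1] linearI simp: vec_eq_iff forall_2)
  then show ?thesis unfolding biot_savart_kernel_def[abs_def] by measurable
qed

lemma ball_borel [measurable]: "ball (a::'a::metric_space) r \<in> sets borel"
  by simp

lemma cball_borel [measurable]: "cball (a::'a::metric_space) r \<in> sets borel"
  by simp

text \<open>A dyadic decomposition: where \<open>2 ^ - (j + 1) \<le> norm z < 2 ^ - j\<close> the integrand is at most
  \<open>2 ^ (j + 1)\<close>, while the disc of radius \<open>2 ^ - j\<close> has area \<open>pi * 4 ^ - j\<close>; the resulting series is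
  geometric.\<close>

lemma nn_integral_inverse_norm_finite:
  "(\<integral>\<^sup>+z. ennreal (inverse (norm (z::real^2))) * indicator (ball 0 1) z \<partial>lborel) < \<infinity>"
proof -
  define A where "A j = (ball 0 ((1/2)^j) :: (real^2) set)" for j
  have "(\<integral>\<^sup>+z. ennreal (inverse (norm (z::real^2))) * indicator (ball 0 1) z \<partial>lborel)
     \<le> (\<integral>\<^sup>+z. (\<Sum>j. ennreal (2 ^ (Suc j)) * indicator (A j) z) \<partial>lborel)"
  proof (rule nn_integral_mono)
    fix z :: "real^2"
    show "ennreal (inverse (norm z)) * indicator (ball 0 1) z \<le> (\<Sum>j. ennreal (2 ^ (Suc j)) * indicator (A j) z)"
    proof (cases "z \<in> ball 0 1 \<and> z \<noteq> 0")
      case False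
      then show ?thesis by (auto simp: indicator_def)
    next
      case True
      define n where "n = (LEAST n. (1/2)^n \<le> norm z)"
      have ex: "\<exists>n. (1/2)^n \<le> norm z"
        using True real_arch_pow_inv[of "norm z" "1/2"] less_imp_le by auto
      have n: "(1/2)^n \<le> norm z" unfolding n_def using ex by (rule LeastI_ex)
      have "n \<noteq> 0" using n True by (metis mem_ball_0 not_le power_0)
      then obtain j where j: "n = Suc j" by (cases n) auto
      have "\<not> (1/2)^j \<le> norm z" using not_less_Least[of j "\<lambda>n. (1/2)^n \<le> norm z"] j unfolding n_def by simp
      then have zA: "z \<in> A j" by (simp add: A_def)
      have "inverse (norm z) \<le> inverse ((1/2)^Suc j)"
        using n j by (intro le_imp_inverse_le) auto
      also have "\<dots> = 2 ^ Suc j" by (simp add: power_one_over inverse_eq_divide field_simps)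
      finally have "ennreal (inverse (norm z)) * indicator (ball 0 1) z \<le> ennreal (2 ^ Suc j) * indicator (A j) z"
        using zA True by (simp add: ennreal_leI)
      also have "\<dots> = sum (\<lambda>j. ennreal (2 ^ (Suc j)) * indicator (A j) z) {j}"
        by (simp only: sum.insert[OF finite.emptyI empty_iff[THEN iffD1, THEN notI]] sum.insert finite.emptyI empty_iff not_False_eq_True sum.empty add_0_right)
      also have "\<dots> \<le> (\<Sum>j. ennreal (2 ^ (Suc j)) * indicator (A j) z)"
        by (rule sum_le_suminf) auto
      finally show ?thesis .
    qed
  qed
  also have "\<dots> = (\<Sum>j. \<integral>\<^sup>+z. ennreal (2 ^ (Suc j)) * indicator (A j) z \<partial>lborel)"
    unfolding A_def by (intro nn_integral_suminf) measurable
  also have "\<dots> = (\<Sum>j. ennreal (2 * pi * (1/2)^j))"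
  proof (rule suminf_cong)
    fix j
    have "(\<integral>\<^sup>+z. ennreal (2 ^ (Suc j)) * indicator (A j) z \<partial>lborel) = ennreal (2 ^ (Suc j)) * emeasure lborel (A j)"
      by (rule nn_integral_cmult_indicator) (simp add: A_def)
    also have "\<dots> = ennreal (2 ^ Suc j * (pi * ((1/2)^j)^2))"
      unfolding A_def by (subst emeasure_ball) (auto simp: unit_ball_vol_2 ennreal_mult)
    also have "2 ^ Suc j * (pi * ((1/2)^j)^2) = 2 * pi * (1/2)^j"
      by (simp add: power2_eq_square power_one_over field_simps)
    finally show "(\<integral>\<^sup>+z. ennreal (2 ^ (Suc j)) * indicator (A j) z \<partial>lborel) = ennreal (2 * pi * (1/2)^j)" .
  qed
  also have "\<dots> = ennreal (\<Sum>j. 2 * pi * (1/2)^j)"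
    by (rule suminf_ennreal2) (auto intro!: summable_mult summable_geometric)
  also have "\<dots> < \<infinity>" by simp
  finally show ?thesis .
qed

lemma integrable_inverse_norm:
  fixes f :: "real^2 \<Rightarrow> real"
  assumes [measurable]: "f \<in> borel_measurable borel" and B: "\<And>x. \<bar>f x\<bar> \<le> B" and van: "vanishes_outside R f"
  shows "integrable lborel (\<lambda>x. inverse (norm x) * f x)"
proof -
  have B0: "B \<ge> 0" using B[of 0] by linarith
  have [measurable]: "ball 0 1 \<in> sets (borel :: (real^2) measure)" by simp
  have i1: "integrable lborel (\<lambda>z. inverse (norm (z::real^2)) * indicator (ball 0 1) z)"
    using nn_integral_inverse_norm_finite
    by (intro integrableI_nonneg) (auto simp: ennreal_mult'' ennreal_indicator)
  have i2: "integrable lborel (\<lambda>z. indicator (cball 0 R) z :: real)"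
    by (intro integrable_real_indicator) (auto simp: emeasure_bounded_finite[OF bounded_cball, simplified])
  show ?thesis
  proof (rule Bochner_Integration.integrable_bound)
    show "integrable lborel (\<lambda>z. B * (inverse (norm (z::real^2)) * indicator (ball 0 1) z) + B * indicator (cball 0 R) z)"
      by (intro Bochner_Integration.integrable_add integrable_mult_right i1 i2)
    show "AE x in lborel. norm (inverse (norm x) * f x) \<le>
      norm (B * (inverse (norm x) * indicator (ball 0 1) x) + B * indicator (cball 0 R) x)"
    proof (rule AE_I2)
      fix x :: "real^2"
      have "inverse (norm x) * \<bar>f x\<bar> \<le> B * (inverse (norm x) * indicator (ball 0 1) x) + B * indicator (cball 0 R) x"
      proof (cases "x \<in> ball 0 1")
        case True
        have "inverse (norm x) * \<bar>f x\<bar> \<le> inverse (norm x) * B" using B by (intro mult_left_mono) auto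
        then show ?thesis using True B0 by (auto simp: algebra_simps indicator_def)
      next
        case False
        then have "inverse (norm x) \<le> 1" by (auto intro: inverse_le_1_iff[THEN iffD2])
        then have "inverse (norm x) * \<bar>f x\<bar> \<le> 1 * \<bar>f x\<bar>" by (intro mult_right_mono) auto
        also have "\<dots> \<le> B * indicator (cball 0 R) x"
          using B[of x] van by (cases "x \<in> cball 0 R") (auto simp: vanishes_outside_def)
        finally show ?thesis using False by simp
      qed
      then show "norm (inverse (norm x) * f x) \<le>
        norm (B * (inverse (norm x) * indicator (ball 0 1) x) + B * indicator (cball 0 R) x)"
        by (simp add: abs_mult)
    qed
  qed measurable
qed

text \<open>The smooth field \<open>z / (\<bar>z\<bar>\<^sup>2 + \<epsilon>\<^sup>2)\<close>. For \<open>\<epsilon> = 0\<close> it is, up to rotation and the factor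
  \<open>2 * pi\<close>, the Biot-Savart kernel; for \<open>\<epsilon> > 0\<close> one may integrate by parts.\<close>

definition reg_field :: "real \<Rightarrow> 2 \<Rightarrow> real^2 \<Rightarrow> real" where
  "reg_field \<epsilon> i z = z $ i * inverse ((norm z)\<^sup>2 + \<epsilon>\<^sup>2)"

lemma C_k_component: "C_k n UNIV (\<lambda>z::real^2. z $ i)"
  by (rule C_k_bounded_linear[OF open_UNIV bounded_linear_vec_nth])

lemma C_k_reg_denom:
  assumes "\<epsilon> > 0"
  shows "C_k n UNIV (\<lambda>z::real^2. (norm z)\<^sup>2 + \<epsilon>\<^sup>2)" "C_k n UNIV (\<lambda>z::real^2. inverse ((norm z)\<^sup>2 + \<epsilon>\<^sup>2))"
    "(norm (z::real^2))\<^sup>2 + \<epsilon>\<^sup>2 > 0"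
proof -
  show pos: "(norm (z::real^2))\<^sup>2 + \<epsilon>\<^sup>2 > 0" for z using assms by (simp add: add_nonneg_pos)
  show 1: "C_k n UNIV (\<lambda>z::real^2. (norm z)\<^sup>2 + \<epsilon>\<^sup>2)" by (rule C_k_add[OF open_UNIV C_k_norm_sq C_k_const])
  show "C_k n UNIV (\<lambda>z::real^2. inverse ((norm z)\<^sup>2 + \<epsilon>\<^sup>2))"
    by (rule C_k_inverse[OF open_UNIV _ 1]) (metis pos less_irrefl)
qed

lemma C_k_reg_field: "\<epsilon> > 0 \<Longrightarrow> C_k n UNIV (reg_field \<epsilon> i)"
  unfolding reg_field_def[abs_def] by (rule C_k_mult[OF open_UNIV C_k_component C_k_reg_denom(2)])

lemma pd_reg_field:
  assumes "\<epsilon> > 0"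
  shows "pd (reg_field \<epsilon> i) (axis j 1) z =
    (if i = j then inverse ((norm z)\<^sup>2 + \<epsilon>\<^sup>2) else 0) - 2 * z $ i * z $ j * (inverse ((norm z)\<^sup>2 + \<epsilon>\<^sup>2))\<^sup>2"
proof -
  have d1: "((\<lambda>z::real^2. (norm z)\<^sup>2 + \<epsilon>\<^sup>2) has_derivative (\<lambda>v. 2 * (z \<bullet> v))) (at z)"
    unfolding power2_norm_eq_inner
    by (auto intro!: derivative_eq_intros simp: inner_commute)
  have d2: "((\<lambda>z::real^2. inverse ((norm z)\<^sup>2 + \<epsilon>\<^sup>2)) has_derivative
     (\<lambda>v. - (inverse ((norm z)\<^sup>2 + \<epsilon>\<^sup>2) * (2 * (z \<bullet> v)) * inverse ((norm z)\<^sup>2 + \<epsilon>\<^sup>2)))) (at z)"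
    by (rule Deriv.has_derivative_inverse[OF _ d1]) (metis C_k_reg_denom(3)[OF assms] less_irrefl)
  have "(reg_field \<epsilon> i has_derivative (\<lambda>v. z $ i * - (inverse ((norm z)\<^sup>2 + \<epsilon>\<^sup>2) * (2 * (z \<bullet> v)) * inverse ((norm z)\<^sup>2 + \<epsilon>\<^sup>2))
     + v $ i * inverse ((norm z)\<^sup>2 + \<epsilon>\<^sup>2))) (at z)"
    unfolding reg_field_def[abs_def]
    by (rule has_derivative_mult[OF bounded_linear_imp_has_derivative[OF bounded_linear_vec_nth] d2])
  from pd_eqI[OF this, of "axis j 1"]
  have *: "pd (reg_field \<epsilon> i) (axis j 1) z = z $ i * - (inverse ((norm z)\<^sup>2 + \<epsilon>\<^sup>2) * (2 * (z \<bullet> axis j 1)) * inverse ((norm z)\<^sup>2 + \<epsilon>\<^sup>2))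
     + axis j 1 $ i * inverse ((norm z)\<^sup>2 + \<epsilon>\<^sup>2)" .
  have inn: "z \<bullet> axis j 1 = z $ j" by (simp add: inner_axis)
  have ax: "axis j (1::real) $ i = (if i = j then 1 else 0)" by (simp add: axis_def)
  show ?thesis unfolding * inn ax by (simp add: power2_eq_square)
qed

lemma abs_component_le: "\<bar>(z::real^2) $ i\<bar> \<le> norm z"
  using Finite_Cartesian_Product.norm_nth_le[of z i] by simp

lemma abs_reg_field_le: "\<bar>reg_field \<epsilon> i z\<bar> \<le> inverse (norm z)"
proof (cases "z = 0")
  case False
  then have p: "norm z > 0" by simp
  have "\<bar>reg_field \<epsilon> i z\<bar> = \<bar>z $ i\<bar> * inverse ((norm z)\<^sup>2 + \<epsilon>\<^sup>2)"
    by (simp add: reg_field_def abs_mult)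
  also have "\<dots> \<le> norm z * inverse ((norm z)\<^sup>2)"
    using p by (intro mult_mono abs_component_le le_imp_inverse_le) auto
  also have "\<dots> = inverse (norm z)" using p by (simp add: power2_eq_square)
  finally show ?thesis .
qed (simp add: reg_field_def)

lemma reg_field_tendsto:
  assumes "\<epsilon> \<longlonglongrightarrow> 0"
  shows "(\<lambda>n. reg_field (\<epsilon> n) i z) \<longlonglongrightarrow> reg_field 0 i z"
proof (cases "z = 0")
  case False
  then have "(norm z)\<^sup>2 + 0\<^sup>2 \<noteq> 0" by simp
  then show ?thesis unfolding reg_field_def by (intro tendsto_intros assms)
qed (simp add: reg_field_def)

lemma reg_field_measurable [measurable]: "reg_field \<epsilon> i \<in> borel_measurable borel"
proof -
  have [measurable]: "(\<lambda>z::real^2. z $ i) \<in> borel_measurable borel"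
    by (intro borel_measurable_continuous_onI continuous_intros)
  show ?thesis unfolding reg_field_def[abs_def] by measurable
qed

lemma reg_integral_tendsto:
  fixes f :: "real^2 \<Rightarrow> real"
  assumes f: "continuous_on UNIV f" "vanishes_outside R f" and "\<epsilon> \<longlonglongrightarrow> 0"
  shows "(\<lambda>n. \<integral>z. reg_field (\<epsilon> n) i z * f z \<partial>lborel) \<longlonglongrightarrow> (\<integral>z. reg_field 0 i z * f z \<partial>lborel)"
    and "integrable lborel (\<lambda>z. reg_field \<epsilon>' i z * f z)"
proof -
  obtain B where B: "\<And>x. norm (f x) \<le> B" using bounded_continuous_vanishing[OF f] by blast
  have [measurable]: "f \<in> borel_measurable borel" using f(1) by (rule borel_measurable_continuous_onI)
  have dom: "norm (reg_field \<epsilon> i z * f z) \<le> norm (inverse (norm z) * f z)" for z \<epsilon>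
    by (simp add: abs_mult mult_right_mono abs_reg_field_le)
  have dint: "integrable lborel (\<lambda>z. inverse (norm z) * f z)"
    by (rule integrable_inverse_norm[OF _ _ f(2)]) (use B in auto)
  show "integrable lborel (\<lambda>z. reg_field \<epsilon>' i z * f z)"
    by (rule Bochner_Integration.integrable_bound[OF dint]) (use dom in auto)
  show "(\<lambda>n. \<integral>z. reg_field (\<epsilon> n) i z * f z \<partial>lborel) \<longlonglongrightarrow> (\<integral>z. reg_field 0 i z * f z \<partial>lborel)"
  proof (rule integral_dominated_convergence)
    show "integrable lborel (\<lambda>z. norm (inverse (norm z) * f z))" using dint by (rule integrable_norm)
    show "AE z in lborel. (\<lambda>n. reg_field (\<epsilon> n) i z * f z) \<longlonglongrightarrow> reg_field 0 i z * f z"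
      by (intro AE_I2 tendsto_intros reg_field_tendsto assms)
    show "AE z in lborel. norm (reg_field (\<epsilon> n) i z * f z) \<le> norm (inverse (norm z) * f z)" for n
      using dom by (intro AE_I2)
  qed auto
qed

text \<open>Minus the distributional derivative of the singular field, tested with \<open>\<psi>\<close>. Up to
  constants, the antisymmetric part of this matrix is the divergence of the Biot-Savart kernel and its trace is the curl.\<close>

definition moment :: "2 \<Rightarrow> 2 \<Rightarrow> (real^2 \<Rightarrow> real) \<Rightarrow> real" where
  "moment i j \<psi> = (\<integral>z. reg_field 0 i z * pd \<psi> (axis j 1) z \<partial>lborel)"

lemma moment_limit:
  assumes \<psi>: "C_k 1 UNIV \<psi>" "vanishes_outside R \<psi>"
  shows "(\<lambda>n. - (\<integral>z. pd (reg_field (1 / Suc n) i) (axis j 1) z * \<psi> z \<partial>lborel)) \<longlonglongrightarrow> moment i j \<psi>"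
proof -
  have c: "continuous_on UNIV (\<lambda>x. pd \<psi> (axis j 1) x)" using \<psi> by simp
  have "(\<lambda>n. 1 / real (Suc n)) \<longlonglongrightarrow> 0" by real_asymp
  from reg_integral_tendsto(1)[OF c vanishes_pd[OF \<psi>(2)] this, of i]
  show ?thesis unfolding moment_def
    by (subst (asm) integration_by_parts[OF C_k_reg_field \<psi>]) auto
qed

text \<open>The regularised field is a gradient, so its Jacobian is symmetric; the symmetry survives in the limit.\<close>

lemma moment_swap:
  assumes \<psi>: "C_k 1 UNIV \<psi>" "vanishes_outside R \<psi>"
  shows "moment 1 2 \<psi> = moment 2 1 \<psi>"
proof (rule LIMSEQ_unique[OF moment_limit[OF \<psi>]])
  show "(\<lambda>n. - (\<integral>z. pd (reg_field (1 / Suc n) 1) (axis 2 1) z * \<psi> z \<partial>lborel)) \<longlonglongrightarrow> moment 2 1 \<psi>"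
    using moment_limit[OF \<psi>, of 2 1] by (simp add: pd_reg_field mult_ac)
qed

text \<open>The divergence of the regularised field is \<open>2 * \<epsilon>\<^sup>2 / (\<bar>z\<bar>\<^sup>2 + \<epsilon>\<^sup>2)\<^sup>2\<close>, an approximate multiple of the
  Dirac mass. If \<open>\<psi>\<close> vanishes at the origin, then \<open>\<bar>\<psi> z\<bar>\<close> is bounded by a multiple of \<open>norm z\<close>, the
  product is dominated by a multiple of \<open>inverse (norm z)\<close>, and dominated convergence gives 0.\<close>

lemma moment_trace_zero:
  assumes \<psi>: "C_k 1 UNIV \<psi>" "vanishes_outside R \<psi>" and z0: "\<psi> 0 = 0"
  shows "moment 1 1 \<psi> + moment 2 2 \<psi> = 0"
proof -
  let ?e = "\<lambda>n. 1 / real (Suc n)"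
  define q where "q n z = (norm (z::real^2))\<^sup>2 + (?e n)\<^sup>2" for n z
  have qpos: "q n z > 0" for n z unfolding q_def by (rule C_k_reg_denom(3)) simp
  define r where "r n z = 2 * (?e n)\<^sup>2 * (inverse (q n z))\<^sup>2 * \<psi> z" for n z
  have sum_eq: "pd (reg_field (?e n) 1) (axis 1 1) z * \<psi> z + pd (reg_field (?e n) 2) (axis 2 1) z * \<psi> z = r n z" for n z
  proof -
    have "pd (reg_field (?e n) 1) (axis 1 1) z + pd (reg_field (?e n) 2) (axis 2 1) z
      = 2 * inverse (q n z) - 2 * (norm z)\<^sup>2 * (inverse (q n z))\<^sup>2"
      by (simp add: pd_reg_field q_def norm_2 algebra_simps power2_eq_square[of "z $ _"])
    also have "\<dots> = 2 * (q n z) * (inverse (q n z))\<^sup>2 - 2 * (norm z)\<^sup>2 * (inverse (q n z))\<^sup>2"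
      using qpos[of n z] by (simp add: power2_eq_square)
    also have "\<dots> = 2 * (?e n)\<^sup>2 * (inverse (q n z))\<^sup>2" by (simp add: q_def algebra_simps)
    finally show ?thesis unfolding r_def by (metis distrib_right)
  qed
  have c\<psi>: "continuous_on UNIV \<psi>" using \<psi> C_k_continuous by blast
  have [measurable]: "\<psi> \<in> borel_measurable borel" using c\<psi> by (rule borel_measurable_continuous_onI)
  have int: "integrable lborel (\<lambda>z. pd (reg_field (?e n) i) (axis i 1) z * \<psi> z)" for i n
  proof (rule integrable_continuous_vanishing[OF _ vanishes_mult[OF \<psi>(2)]])
    have "C_k 1 UNIV (reg_field (?e n) i)" by (rule C_k_reg_field) simp
    then show "continuous_on UNIV (\<lambda>z. pd (reg_field (?e n) i) (axis i 1) z * \<psi> z)"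
      by (auto intro!: continuous_on_mult c\<psi>)
  qed
  have lim1: "(\<lambda>n. - (\<integral>z. r n z \<partial>lborel)) \<longlonglongrightarrow> moment 1 1 \<psi> + moment 2 2 \<psi>"
  proof -
    have "- (\<integral>z. pd (reg_field (?e n) 1) (axis 1 1) z * \<psi> z \<partial>lborel) +
      - (\<integral>z. pd (reg_field (?e n) 2) (axis 2 1) z * \<psi> z \<partial>lborel) = - (\<integral>z. r n z \<partial>lborel)" for n
      unfolding sum_eq[symmetric] Bochner_Integration.integral_add[OF int int] by simp
    then show ?thesis
      using tendsto_add[OF moment_limit[OF \<psi>, of 1 1] moment_limit[OF \<psi>, of 2 2]] by simp
  qed
  have cpd: "continuous_on UNIV (\<lambda>x. pd \<psi> v x)" for v using \<psi> by simp
  obtain B1 where B1: "\<And>x. norm (pd \<psi> (axis 1 1) x) \<le> B1"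
    using bounded_continuous_vanishing[OF cpd vanishes_pd[OF \<psi>(2)]] by blast
  obtain B2 where B2: "\<And>x. norm (pd \<psi> (axis 2 1) x) \<le> B2"
    using bounded_continuous_vanishing[OF cpd vanishes_pd[OF \<psi>(2)]] by blast
  have lip: "\<bar>\<psi> z\<bar> \<le> (B1 + B2) * norm z" for z
  proof -
    obtain \<theta> where "\<psi> (0 + 1 *\<^sub>R z) - \<psi> 0 = 1 * pd \<psi> z (0 + \<theta> *\<^sub>R z)"
      using mvt_along_line[OF \<psi>(1), of 1 0 z] by (metis zero_less_one)
    then have "\<psi> z = pd \<psi> z (\<theta> *\<^sub>R z)" using z0 by simp
    also have "\<dots> = pd \<psi> (z $ 1 *\<^sub>R axis 1 1 + z $ 2 *\<^sub>R axis 2 1) (\<theta> *\<^sub>R z)"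
      by (rule arg_cong[of _ _ "\<lambda>v. pd \<psi> v (\<theta> *\<^sub>R z)"]) (simp add: vec_eq_iff forall_2 axis_def)
    also have "\<dots> = z $ 1 * pd \<psi> (axis 1 1) (\<theta> *\<^sub>R z) + z $ 2 * pd \<psi> (axis 2 1) (\<theta> *\<^sub>R z)"
      using has_derivative_bounded_linear[OF C_1_has[OF \<psi>(1), of "\<theta> *\<^sub>R z"]]
      by (simp add: linear_add linear_scale bounded_linear.linear)
    also have "\<bar>\<dots>\<bar> \<le> norm z * B1 + norm z * B2"
      using B1[of "\<theta> *\<^sub>R z"] B2[of "\<theta> *\<^sub>R z"]
      by (intro order.trans[OF abs_triangle_ineq] add_mono) (auto simp: abs_mult intro!: mult_mono abs_component_le)
    finally show ?thesis by (simp add: algebra_simps)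
  qed
  have B0: "B1 + B2 \<ge> 0" using B1[of 0] B2[of 0] norm_ge_zero by (meson add_nonneg_nonneg order_trans)
  have rbound: "norm (r n z) \<le> norm (inverse (norm z) * (2 * (B1 + B2) * indicator (cball 0 R) z))" for n z
  proof (cases "z = 0 \<or> z \<notin> cball 0 R")
    case True then show ?thesis using z0 \<psi>(2) by (auto simp: r_def vanishes_outside_def)
  next
    case False
    have e1: "(?e n)\<^sup>2 * inverse (q n z) \<le> 1" using qpos[of n z] by (simp add: q_def field_simps)
    have e2: "inverse (q n z) * norm z \<le> inverse (norm z)"
    proof -
      have "inverse (q n z) * norm z \<le> inverse ((norm z)\<^sup>2) * norm z"
        using False by (intro mult_right_mono le_imp_inverse_le) (auto simp: q_def)
      also have "\<dots> = inverse (norm z)" using False by (simp add: power2_eq_square)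
      finally show ?thesis .
    qed
    have "norm (r n z) = 2 * ((?e n)\<^sup>2 * inverse (q n z)) * (inverse (q n z) * \<bar>\<psi> z\<bar>)"
      using qpos[of n z] by (simp add: r_def abs_mult power2_eq_square)
    also have "\<dots> \<le> 2 * 1 * (inverse (q n z) * ((B1 + B2) * norm z))"
      using e1 lip[of z] qpos[of n z] by (intro mult_mono) auto
    also have "\<dots> = 2 * (B1 + B2) * (inverse (q n z) * norm z)" by simp
    also have "\<dots> \<le> 2 * (B1 + B2) * inverse (norm z)" using e2 B0 by (intro mult_left_mono) auto
    finally show ?thesis using False B0 by (simp add: mult_ac)
  qed
  have "(\<lambda>n. \<integral>z. r n z \<partial>lborel) \<longlonglongrightarrow> (\<integral>z. 0 \<partial>(lborel :: (real^2) measure))"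
  proof (rule integral_dominated_convergence)
    show "integrable lborel (\<lambda>z::real^2. norm (inverse (norm z) * (2 * (B1 + B2) * indicator (cball 0 R) z)))"
      by (intro integrable_norm integrable_inverse_norm[where B = "2 * (B1 + B2)" and R = R])
         (use B0 in \<open>auto simp: vanishes_outside_def indicator_def\<close>)
    show "AE z in lborel. (\<lambda>n. r n z) \<longlonglongrightarrow> 0"
    proof (rule AE_I2)
      fix z
      show "(\<lambda>n. r n z) \<longlonglongrightarrow> 0"
      proof (cases "z = 0")
        case False
        have e0: "?e \<longlonglongrightarrow> 0" by real_asymp
        have "(\<lambda>n. 2 * (?e n)\<^sup>2 * (inverse ((norm z)\<^sup>2 + (?e n)\<^sup>2))\<^sup>2 * \<psi> z) \<longlonglongrightarrow>
          2 * 0\<^sup>2 * (inverse ((norm z)\<^sup>2 + 0\<^sup>2))\<^sup>2 * \<psi> z"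
          by (intro tendsto_intros e0) (use False in auto)
        then show ?thesis by (simp add: r_def[abs_def] q_def)
      qed (simp add: r_def z0)
    qed
    show "AE z in lborel. norm (r n z) \<le> norm (inverse (norm z) * (2 * (B1 + B2) * indicator (cball 0 R) z))" for n
      using rbound by (intro AE_I2)
  qed (auto simp: r_def q_def)
  then have "(\<lambda>n. - (\<integral>z. r n z \<partial>lborel)) \<longlonglongrightarrow> 0" using tendsto_minus by fastforce
  then show ?thesis using LIMSEQ_unique lim1 by blast
qed

text \<open>By \<open>moment_trace_zero\<close> the trace depends linearly on \<open>\<psi> 0\<close> alone, so a single bump function
  determines the factor, and for a radially decreasing bump its sign is visible from the integrand.\<close>

lemma moment_trace_const:
  obtains \<kappa> where "\<kappa> > 0"
    "\<And>\<psi> R. C_k 1 UNIV \<psi> \<Longrightarrow> vanishes_outside R \<psi> \<Longrightarrow> moment 1 1 \<psi> + moment 2 2 \<psi> = - \<kappa> * \<psi> 0"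
proof -
  \<comment> \<open>A bump function on the unit disc whose radial derivative is a negative multiple of \<open>flat 2\<close>.\<close>
  define b where "b z = flat 0 (1 - (norm (z::real^2))\<^sup>2)" for z
  have Cb: "C_k 1 UNIV b"
    unfolding b_def[abs_def]
    by (rule C_k_compose_real[OF open_UNIV C_k_flat C_k_diff[OF open_UNIV C_k_const C_k_norm_sq]])
  have vb: "vanishes_outside 1 b"
    using one_less_power[of "norm x" 2 for x :: "real^2"] by (fastforce simp: vanishes_outside_def b_def flat_def)
  have pdb: "pd b v z = - 2 * (z \<bullet> v) * flat 2 (1 - (norm z)\<^sup>2)" for v z
  proof -
    have "((\<lambda>z::real^2. 1 - (norm z)\<^sup>2) has_derivative (\<lambda>v. - (2 * (z \<bullet> v)))) (at z)"
      unfolding power2_norm_eq_inner by (auto intro!: derivative_eq_intros simp: inner_commute)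
    moreover have "(flat 0 has_derivative (\<lambda>h. flat 2 s * h)) (at s)" for s
      using flat_deriv[of 0 s] by (simp add: has_field_derivative_def numeral_2_eq_2)
    ultimately have "(b has_derivative (\<lambda>v. flat 2 (1 - (norm z)\<^sup>2) * - (2 * (z \<bullet> v)))) (at z)"
      unfolding b_def[abs_def] by (rule has_derivative_compose)
    from pd_eqI[OF this] show ?thesis by simp
  qed
  have cpd: "continuous_on UNIV (\<lambda>x. pd b v x)" for v using Cb by simp
  have zero: "(\<lambda>n. 0::real) \<longlonglongrightarrow> 0" by simp
  have int: "integrable lborel (\<lambda>z. reg_field 0 i z * pd b (axis i 1) z)" for i
    by (rule reg_integral_tendsto(2)[OF cpd vanishes_pd[OF vb] zero])
  have f2c: "continuous_on UNIV (\<lambda>z::real^2. flat 2 (1 - (norm z)\<^sup>2))"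
    using C_k_compose_real[OF open_UNIV C_k_flat[of 0 2] C_k_diff[OF open_UNIV C_k_const C_k_norm_sq], of 1] by simp
  have f2v: "vanishes_outside 1 (\<lambda>z::real^2. flat 2 (1 - (norm z)\<^sup>2))"
    using one_less_power[of "norm x" 2 for x :: "real^2"] by (fastforce simp: vanishes_outside_def flat_def)
  have f2i: "integrable lborel (\<lambda>z::real^2. flat 2 (1 - (norm z)\<^sup>2))"
    by (rule integrable_continuous_vanishing[OF f2c f2v])
  have "moment 1 1 b + moment 2 2 b = (\<integral>z. reg_field 0 1 z * pd b (axis 1 1) z + reg_field 0 2 z * pd b (axis 2 1) z \<partial>lborel)"
    unfolding moment_def by (rule Bochner_Integration.integral_add[OF int int, symmetric])
  also have "\<dots> = (\<integral>z. - 2 * flat 2 (1 - (norm (z::real^2))\<^sup>2) \<partial>lborel)"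
  proof (rule integral_cong_AE)
    have "AE z in lborel. z \<noteq> (0::real^2)" by (rule AE_lborel_singleton)
    then show "AE z in lborel. reg_field 0 1 z * pd b (axis 1 1) z + reg_field 0 2 z * pd b (axis 2 1) z
      = - 2 * flat 2 (1 - (norm (z::real^2))\<^sup>2)"
    proof (eventually_elim)
      fix z :: "real^2" assume z: "z \<noteq> 0"
      define F where "F = flat 2 (1 - (norm z)\<^sup>2)"
      have "reg_field 0 1 z * pd b (axis 1 1) z + reg_field 0 2 z * pd b (axis 2 1) z
        = - 2 * F * (((z $ 1)\<^sup>2 + (z $ 2)\<^sup>2) * inverse ((norm z)\<^sup>2))"
        unfolding pdb F_def[symmetric] reg_field_def by (simp add: inner_axis power2_eq_square algebra_simps)
      also have "\<dots> = - 2 * F" using z by (simp add: norm_2[symmetric])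
      finally show "reg_field 0 1 z * pd b (axis 1 1) z + reg_field 0 2 z * pd b (axis 2 1) z
        = - 2 * flat 2 (1 - (norm z)\<^sup>2)" by (simp add: F_def)
    qed
    show "(\<lambda>z. reg_field 0 1 z * pd b (axis 1 1) z + reg_field 0 2 z * pd b (axis 2 1) z) \<in> borel_measurable lborel"
      using int by auto
    show "(\<lambda>z::real^2. - 2 * flat 2 (1 - (norm z)\<^sup>2)) \<in> borel_measurable lborel" using f2i by auto
  qed
  also have "\<dots> = - 2 * (\<integral>z. flat 2 (1 - (norm (z::real^2))\<^sup>2) \<partial>lborel)" by simp
  finally have tr: "moment 1 1 b + moment 2 2 b = - 2 * (\<integral>z. flat 2 (1 - (norm (z::real^2))\<^sup>2) \<partial>lborel)" .
  have "0 < exp (-2) * measure lborel (ball (0::real^2) (1/2))" by (simp add: content_ball_pos)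
  also have "\<dots> = (\<integral>z. exp (-2) * indicator (ball (0::real^2) (1/2)) z \<partial>lborel)" by simp
  also have "\<dots> \<le> (\<integral>z. flat 2 (1 - (norm (z::real^2))\<^sup>2) \<partial>lborel)"
  proof (rule integral_mono[OF _ f2i])
    show "integrable lborel (\<lambda>z. exp (-2) * indicator (ball (0::real^2) (1/2)) z :: real)"
      by (intro integrable_mult_right integrable_real_indicator)
         (auto simp: emeasure_bounded_finite[OF bounded_ball, simplified])
    show "exp (-2) * indicator (ball 0 (1/2)) z \<le> flat 2 (1 - (norm z)\<^sup>2)" for z :: "real^2"
    proof (cases "z \<in> ball 0 (1/2)")
      case True
      define s where "s = 1 - (norm z)\<^sup>2"
      have "(norm z)\<^sup>2 \<le> (1/2)^2" using True by (intro power_mono) auto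
      then have s: "1/2 \<le> s" "s \<le> 1" by (auto simp: s_def power2_eq_square)
      then have "inverse s \<le> 2" "1 \<le> inverse s" by (auto simp: field_simps)
      then have "1 * exp (-2) \<le> inverse s ^ 2 * exp (- inverse s)"
        by (intro mult_mono one_le_power) auto
      then show ?thesis using True s by (simp add: flat_def s_def)
    next
      case False then show ?thesis by (simp add: flat_nonneg)
    qed
  qed
  finally have pos: "(\<integral>z. flat 2 (1 - (norm (z::real^2))\<^sup>2) \<partial>lborel) > 0" .
  have b0: "b 0 > 0" by (simp add: b_def flat_def)
  define \<kappa> where "\<kappa> = - (moment 1 1 b + moment 2 2 b) / b 0"
  show ?thesis
  proof (rule that[of \<kappa>])
    show "\<kappa> > 0" using pos b0 by (simp add: \<kappa>_def tr)
    fix \<psi> :: "real^2 \<Rightarrow> real" and R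
    assume \<psi>: "C_k 1 UNIV \<psi>" "vanishes_outside R \<psi>"
    \<comment> \<open>The combination that vanishes at the origin.\<close>
    define \<phi> where "\<phi> z = \<psi> z - (\<psi> 0 / b 0) * b z" for z
    have cb: "C_k 1 UNIV (\<lambda>z. (\<psi> 0 / b 0) * b z)" by (rule C_k_cmult[OF open_UNIV Cb])
    have C\<phi>: "C_k 1 UNIV \<phi>" unfolding \<phi>_def[abs_def] by (rule C_k_diff[OF open_UNIV \<psi>(1) cb])
    have v\<phi>: "vanishes_outside (max R 1) \<phi>" using \<psi>(2) vb by (auto simp: \<phi>_def vanishes_outside_def)
    have pd\<phi>: "pd \<phi> v z = pd \<psi> v z - (\<psi> 0 / b 0) * pd b v z" for v z
      unfolding \<phi>_def[abs_def]
      by (rule pd_eqI, intro has_derivative_diff has_derivative_mult_right C_1_has \<psi> Cb)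
    have c\<psi>: "continuous_on UNIV (\<lambda>x. pd \<psi> v x)" for v using \<psi> by simp
    have lin: "moment i i \<phi> = moment i i \<psi> - (\<psi> 0 / b 0) * moment i i b" for i
    proof -
      have "moment i i \<phi> = (\<integral>z. reg_field 0 i z * pd \<psi> (axis i 1) z - (\<psi> 0 / b 0) * (reg_field 0 i z * pd b (axis i 1) z) \<partial>lborel)"
        unfolding moment_def pd\<phi> by (simp add: algebra_simps)
      also have "\<dots> = moment i i \<psi> - (\<psi> 0 / b 0) * moment i i b"
        unfolding moment_def
        using reg_integral_tendsto(2)[OF c\<psi> vanishes_pd[OF \<psi>(2)] zero] int[of i] by simp
      finally show ?thesis .
    qed
    have "moment 1 1 \<phi> + moment 2 2 \<phi> = 0"
      by (rule moment_trace_zero[OF C\<phi> v\<phi>]) (use b0 in \<open>simp add: \<phi>_def\<close>)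
    then have "moment 1 1 \<psi> + moment 2 2 \<psi> = (\<psi> 0 / b 0) * (moment 1 1 b + moment 2 2 b)"
      unfolding lin by (simp add: algebra_simps)
    then show "moment 1 1 \<psi> + moment 2 2 \<psi> = - \<kappa> * \<psi> 0"
      unfolding \<kappa>_def by (simp add: divide_inverse algebra_simps)
  qed
qed

text \<open>The constant \<open>c\<close> for which the curl of the Biot-Savart kernel is \<open>c\<close> times the Dirac mass; by positivity
  one may divide by it when the Biot-Savart law is inverted.\<close>

definition kernel_const :: real where
  "kernel_const = (SOME c. c > 0 \<and> (\<forall>\<psi> R. C_k 1 UNIV \<psi> \<longrightarrow> vanishes_outside R \<psi> \<longrightarrow>
     moment 1 1 \<psi> + moment 2 2 \<psi> = - (2 * pi * c) * \<psi> 0))"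

lemma kernel_const:
  "kernel_const > 0"
  "C_k 1 UNIV \<psi> \<Longrightarrow> vanishes_outside R \<psi> \<Longrightarrow> moment 1 1 \<psi> + moment 2 2 \<psi> = - (2 * pi * kernel_const) * \<psi> 0"
proof -
  obtain \<kappa> where "\<kappa> > 0"
    "\<And>\<psi> R. C_k 1 UNIV \<psi> \<Longrightarrow> vanishes_outside R \<psi> \<Longrightarrow> moment 1 1 \<psi> + moment 2 2 \<psi> = - \<kappa> * \<psi> 0"
    by (rule moment_trace_const) auto
  then have "\<exists>c. c > 0 \<and> (\<forall>\<psi> R. C_k 1 UNIV \<psi> \<longrightarrow> vanishes_outside R \<psi> \<longrightarrow>
     moment 1 1 \<psi> + moment 2 2 \<psi> = - (2 * pi * c) * \<psi> 0)"
    by (intro exI[of _ "\<kappa> / (2 * pi)"]) auto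
  from someI_ex[OF this] show "kernel_const > 0"
    "C_k 1 UNIV \<psi> \<Longrightarrow> vanishes_outside R \<psi> \<Longrightarrow> moment 1 1 \<psi> + moment 2 2 \<psi> = - (2 * pi * kernel_const) * \<psi> 0"
    unfolding kernel_const_def[symmetric] by blast+
qed

lemma kernel_reg: "biot_savart_kernel z = (1 / (2 * pi)) *\<^sub>R vector [- reg_field 0 2 z, reg_field 0 1 z]"
  by (simp add: biot_savart_kernel_def reg_field_def vec_eq_iff forall_2 field_simps)

text \<open>The divergence and the curl of the kernel in the sense of distributions: zero, and a positive multiple
  of the Dirac mass at the origin.\<close>

lemma kernel_grad_origin:
  assumes \<psi>: "C_k 1 UNIV \<psi>" "vanishes_outside R \<psi>"
  shows "(\<integral>z. biot_savart_kernel z \<bullet> grad \<psi> z \<partial>lborel) = 0"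
    and "(\<integral>z. biot_savart_kernel z \<bullet> perp_grad \<psi> z \<partial>lborel) = - kernel_const * \<psi> 0"
proof -
  have c\<psi>: "continuous_on UNIV (\<lambda>x. pd \<psi> v x)" for v using \<psi> by simp
  have zero: "(\<lambda>n. 0::real) \<longlonglongrightarrow> 0" by simp
  have int: "integrable lborel (\<lambda>z. reg_field 0 i z * pd \<psi> v z)" for i v
    by (rule reg_integral_tendsto(2)[OF c\<psi> vanishes_pd[OF \<psi>(2)] zero])
  have "(\<integral>z. biot_savart_kernel z \<bullet> grad \<psi> z \<partial>lborel) =
    (\<integral>z. (1 / (2 * pi)) * (reg_field 0 1 z * pd \<psi> (axis 2 1) z - reg_field 0 2 z * pd \<psi> (axis 1 1) z) \<partial>lborel)"
    by (simp add: kernel_reg grad_2 inner_2 algebra_simps)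
  also have "\<dots> = (1 / (2 * pi)) * (moment 1 2 \<psi> - moment 2 1 \<psi>)"
    unfolding moment_def integral_mult_right_zero Bochner_Integration.integral_diff[OF int int] ..
  also have "\<dots> = 0" using moment_swap[OF \<psi>] by simp
  finally show "(\<integral>z. biot_savart_kernel z \<bullet> grad \<psi> z \<partial>lborel) = 0" .
  have "(\<integral>z. biot_savart_kernel z \<bullet> perp_grad \<psi> z \<partial>lborel) =
    (\<integral>z. (1 / (2 * pi)) * (reg_field 0 1 z * pd \<psi> (axis 1 1) z + reg_field 0 2 z * pd \<psi> (axis 2 1) z) \<partial>lborel)"
    by (simp add: kernel_reg perp_grad_def inner_2 algebra_simps)
  also have "\<dots> = (1 / (2 * pi)) * (moment 1 1 \<psi> + moment 2 2 \<psi>)"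
    unfolding moment_def integral_mult_right_zero Bochner_Integration.integral_add[OF int int] ..
  also have "\<dots> = - kernel_const * \<psi> 0" using kernel_const(2)[OF \<psi>] by simp
  finally show "(\<integral>z. biot_savart_kernel z \<bullet> perp_grad \<psi> z \<partial>lborel) = - kernel_const * \<psi> 0" .
qed

lemma grad_measurable:
  assumes "C_k 1 UNIV \<psi>"
  shows "grad \<psi> \<in> borel_measurable borel" "perp_grad \<psi> \<in> borel_measurable borel"
    "continuous_on UNIV (grad \<psi>)" "continuous_on UNIV (perp_grad \<psi>)"
proof -
  have c\<psi>: "continuous_on UNIV (\<lambda>x. pd \<psi> v x)" for v using assms by simp
  show 1: "continuous_on UNIV (grad \<psi>)"
    unfolding grad_def[abs_def] by (intro continuous_intros c\<psi>)
  have "perp_grad \<psi> = (\<lambda>x. - pd \<psi> (axis 2 1) x *\<^sub>R axis 1 1 + pd \<psi> (axis 1 1) x *\<^sub>R axis 2 1)"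
    by (auto simp: perp_grad_def vec_eq_iff forall_2 fun_eq_iff axis_def)
  then show 2: "continuous_on UNIV (perp_grad \<psi>)" by (simp only:) (intro continuous_intros c\<psi>)
  show "grad \<psi> \<in> borel_measurable borel" "perp_grad \<psi> \<in> borel_measurable borel"
    using 1 2 borel_measurable_continuous_onI by blast+
qed

lemma vanishes_grad:
  assumes "vanishes_outside R \<psi>"
  shows "vanishes_outside R (grad \<psi>)" "vanishes_outside R (perp_grad \<psi>)"
  using vanishes_pd[OF assms] by (auto simp: vanishes_outside_def grad_2 perp_grad_def vec_eq_iff forall_2)

lemma kernel_grad:
  assumes \<psi>: "C_k 1 UNIV \<psi>" "vanishes_outside R \<psi>"
  shows "(\<integral>x. biot_savart_kernel (x - y) \<bullet> grad \<psi> x \<partial>lborel) = 0"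
    and "(\<integral>x. biot_savart_kernel (x - y) \<bullet> perp_grad \<psi> x \<partial>lborel) = - kernel_const * \<psi> y"
proof -
  define \<phi> where "\<phi> z = \<psi> (y + z)" for z
  have C\<phi>: "C_k 1 UNIV \<phi>" unfolding \<phi>_def[abs_def]
    by (rule C_k_compose_affine[OF bounded_linear_ident \<psi>(1)])
  have v\<phi>: "vanishes_outside (R + norm y) \<phi>"
    unfolding vanishes_outside_def
  proof (intro allI impI)
    fix x :: "real^2" assume "norm x > R + norm y"
    then have "norm (y + x) > R" using norm_triangle_ineq4[of "y+x" y] by simp
    with \<psi>(2) show "\<phi> x = 0" by (simp add: vanishes_outside_def \<phi>_def)
  qed
  have pd\<phi>: "pd \<phi> v z = pd \<psi> v (y + z)" for v z
  proof (rule pd_eqI)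
    have "((\<lambda>z. y + z) has_derivative (\<lambda>v. v)) (at z)"
      using has_derivative_add[OF has_derivative_const has_derivative_ident] by simp
    from has_derivative_compose[OF this C_1_has[OF \<psi>(1)]]
    show "(\<phi> has_derivative (\<lambda>v. pd \<psi> v (y + z))) (at z)" unfolding \<phi>_def[abs_def] .
  qed
  have g: "grad \<phi> z = grad \<psi> (y + z)" "perp_grad \<phi> z = perp_grad \<psi> (y + z)" for z
    by (simp_all add: grad_2 perp_grad_def pd\<phi>)
  note [measurable] = grad_measurable(1,2)[OF \<psi>(1)]
  have "(\<integral>x. biot_savart_kernel (x - y) \<bullet> grad \<psi> x \<partial>lborel) = (\<integral>z. biot_savart_kernel ((y + z) - y) \<bullet> grad \<psi> (y + z) \<partial>lborel)"
    by (rule lborel_integral_shift[symmetric]) measurable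
  then show "(\<integral>x. biot_savart_kernel (x - y) \<bullet> grad \<psi> x \<partial>lborel) = 0"
    using kernel_grad_origin(1)[OF C\<phi> v\<phi>] by (simp add: g)
  have "(\<integral>x. biot_savart_kernel (x - y) \<bullet> perp_grad \<psi> x \<partial>lborel) = (\<integral>z. biot_savart_kernel ((y + z) - y) \<bullet> perp_grad \<psi> (y + z) \<partial>lborel)"
    by (rule lborel_integral_shift[symmetric]) measurable
  then show "(\<integral>x. biot_savart_kernel (x - y) \<bullet> perp_grad \<psi> x \<partial>lborel) = - kernel_const * \<psi> y"
    using kernel_grad_origin(2)[OF C\<phi> v\<phi>] by (simp add: g \<phi>_def)
qed

section \<open>Duality for the Biot-Savart law\<close>

text \<open>The radius 1 is a convenience: outside the unit disc the kernel is bounded by 1.\<close>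

definition kernel_mass :: real where
  "kernel_mass = (\<integral>z. norm (biot_savart_kernel z) * indicator (ball 0 1) z \<partial>lborel)"

lemma kernel_mass_nonneg: "kernel_mass \<ge> 0"
  unfolding kernel_mass_def by (rule integral_nonneg_AE) simp

lemma kernel_mass:
  "(\<integral>\<^sup>+z. ennreal (norm (biot_savart_kernel z) * indicator (ball 0 1) z) \<partial>lborel) = ennreal kernel_mass"
proof -
  have "integrable lborel (\<lambda>z::real^2. inverse (norm z) * (inverse (2 * pi) * indicator (ball 0 1) z))"
    by (rule integrable_inverse_norm[where B = "inverse (2 * pi)" and R = 1])
       (auto simp: vanishes_outside_def indicator_def)
  then have "integrable lborel (\<lambda>z. norm (biot_savart_kernel z) * indicator (ball 0 1) z)"
    by (simp add: norm_kernel mult_ac)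
  then show ?thesis unfolding kernel_mass_def by (rule nn_integral_eq_integral) simp
qed

lemma norm_kernel_split: "norm (biot_savart_kernel z) \<le> norm (biot_savart_kernel z) * indicator (ball 0 1) z + 1"
proof (cases "z \<in> ball 0 1")
  case False
  then have "inverse (norm z) \<le> 1" by (auto intro: inverse_le_1_iff[THEN iffD2])
  moreover have "inverse (2 * pi) \<le> 1" using pi_ge_two by (intro inverse_le_1_iff[THEN iffD2]) auto
  ultimately have "inverse (2 * pi) * inverse (norm z) \<le> 1 * 1" by (intro mult_mono) auto
  then show ?thesis using False by (simp add: norm_kernel)
qed simp

text \<open>Near the diagonal the kernel is integrable and \<open>G\<close> is bounded; away from it the kernel is bounded by 1
  and \<open>G\<close> is integrable. All velocity estimates rest on this splitting.\<close>

lemma kernel_convolution_bound: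
  fixes G :: "real^2 \<Rightarrow> ennreal"
  assumes [measurable]: "G \<in> borel_measurable borel" and m: "AE x in lborel. G x \<le> ennreal m"
  shows "(\<integral>\<^sup>+x. ennreal (norm (biot_savart_kernel (x - y))) * G x \<partial>lborel)
    \<le> ennreal m * ennreal kernel_mass + (\<integral>\<^sup>+x. G x \<partial>lborel)"
proof -
  let ?k = "\<lambda>z. ennreal (norm (biot_savart_kernel z) * indicator (ball 0 1) z)"
  have "(\<integral>\<^sup>+x. ennreal (norm (biot_savart_kernel (x - y))) * G x \<partial>lborel)
     \<le> (\<integral>\<^sup>+x. ennreal m * ?k (x - y) + G x \<partial>lborel)"
  proof (rule nn_integral_mono_AE, use m in eventually_elim)
    fix x assume "G x \<le> ennreal m"
    have "ennreal (norm (biot_savart_kernel (x - y))) \<le> ?k (x - y) + 1"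
      using norm_kernel_split[of "x - y"] by (metis ennreal_1 ennreal_leI ennreal_plus mult_nonneg_nonneg norm_ge_zero indicator_pos_le zero_le_one)
    then have "ennreal (norm (biot_savart_kernel (x - y))) * G x \<le> (?k (x - y) + 1) * G x"
      by (rule mult_right_mono) simp
    also have "\<dots> = ?k (x - y) * G x + G x" by (simp add: distrib_right)
    also have "\<dots> \<le> ennreal m * ?k (x - y) + G x"
      using \<open>G x \<le> ennreal m\<close> by (intro add_right_mono) (metis mult.commute mult_left_mono zero_le)
    finally show "ennreal (norm (biot_savart_kernel (x - y))) * G x \<le> ennreal m * ?k (x - y) + G x" .
  qed
  also have "\<dots> = ennreal m * (\<integral>\<^sup>+x. ?k (x - y) \<partial>lborel) + (\<integral>\<^sup>+x. G x \<partial>lborel)"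
    by (subst nn_integral_add) (auto simp: nn_integral_cmult)
  also have "(\<integral>\<^sup>+x. ?k (x - y) \<partial>lborel) = ennreal kernel_mass"
    using nn_integral_shift[of ?k "- y"] by (simp add: kernel_mass)
  finally show ?thesis .
qed

lemma borel_representative:
  fixes f :: "'a::euclidean_space \<Rightarrow> real"
  assumes "f \<in> borel_measurable lebesgue"
  obtains g where "g \<in> borel_measurable borel" "AE x in lborel. f x = g x"
  using completion_ex_borel_measurable_real[OF assms] by auto

text \<open>Vorticities are only Lebesgue measurable. Product measures are built from Borel sets, so Fubini
  arguments are carried out for a Borel representative.\<close>

lemma is_biot_savart_cong_AE:
  assumes "AE y in lborel. w y = w' y" "w \<in> borel_measurable lebesgue" "w' \<in> borel_measurable borel" "is_biot_savart w x v"
  shows "has_bochner_integral lborel (\<lambda>y. w' y *\<^sub>R biot_savart_kernel (x - y)) v"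
proof -
  note [measurable] = assms(3)
  have m: "(\<lambda>y. w' y *\<^sub>R biot_savart_kernel (x - y)) \<in> borel_measurable lborel" by measurable
  have "has_bochner_integral lebesgue (\<lambda>y. w' y *\<^sub>R biot_savart_kernel (x - y)) v
     \<longleftrightarrow> has_bochner_integral lebesgue (\<lambda>y. w y *\<^sub>R biot_savart_kernel (x - y)) v"
  proof (rule has_bochner_integral_cong_AE)
    show "(\<lambda>y. w' y *\<^sub>R biot_savart_kernel (x - y)) \<in> borel_measurable lebesgue"
      by (intro measurable_completion) measurable
    have [measurable]: "(\<lambda>y. biot_savart_kernel (x - y)) \<in> borel_measurable lebesgue"
      by (intro measurable_completion) measurable
    show "(\<lambda>y. w y *\<^sub>R biot_savart_kernel (x - y)) \<in> borel_measurable lebesgue"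
      using assms(2) by measurable
    show "AE y in lebesgue. w' y *\<^sub>R biot_savart_kernel (x - y) = w y *\<^sub>R biot_savart_kernel (x - y)"
      by (rule AE_completion) (use assms(1) in eventually_elim, simp)
  qed
  with assms(4) have "has_bochner_integral lebesgue (\<lambda>y. w' y *\<^sub>R biot_savart_kernel (x - y)) v"
    by (simp add: is_biot_savart_def)
  then show ?thesis using m by (simp add: has_bochner_integral_iff integrable_completion integral_completion)
qed

lemma biot_savart_norm_bound:
  fixes G :: "real^2 \<Rightarrow> ennreal"
  assumes w: "w \<in> borel_measurable lebesgue" and u: "AE x in lborel. is_biot_savart w x (u x)"
    and [measurable]: "G \<in> borel_measurable borel"
  shows "(\<integral>\<^sup>+x. ennreal (norm (u x)) * G x \<partial>lborel)
    \<le> (\<integral>\<^sup>+y. ennreal \<bar>w y\<bar> * (\<integral>\<^sup>+x. ennreal (norm (biot_savart_kernel (x - y))) * G x \<partial>lborel) \<partial>lborel)"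
proof -
  obtain w' where [measurable]: "w' \<in> borel_measurable borel" and w': "AE x in lborel. w x = w' x"
    using borel_representative[OF w] .
  have "(\<integral>\<^sup>+x. ennreal (norm (u x)) * G x \<partial>lborel)
    \<le> (\<integral>\<^sup>+x. (\<integral>\<^sup>+y. ennreal \<bar>w' y\<bar> * ennreal (norm (biot_savart_kernel (x - y))) * G x \<partial>lborel) \<partial>lborel)"
  proof (rule nn_integral_mono_AE, use u in eventually_elim)
    fix x assume "is_biot_savart w x (u x)"
    then have h: "has_bochner_integral lborel (\<lambda>y. w' y *\<^sub>R biot_savart_kernel (x - y)) (u x)"
      by (intro is_biot_savart_cong_AE[OF w' w]) auto
    have "ennreal (norm (u x)) \<le> (\<integral>\<^sup>+y. norm (w' y *\<^sub>R biot_savart_kernel (x - y)) \<partial>lborel)"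
      using h has_bochner_integral_norm_bound by blast
    also have "\<dots> = (\<integral>\<^sup>+y. ennreal \<bar>w' y\<bar> * ennreal (norm (biot_savart_kernel (x - y))) \<partial>lborel)"
      by (simp add: ennreal_mult)
    finally have "ennreal (norm (u x)) * G x \<le> (\<integral>\<^sup>+y. ennreal \<bar>w' y\<bar> * ennreal (norm (biot_savart_kernel (x - y))) \<partial>lborel) * G x"
      by (rule mult_right_mono) simp
    also have "\<dots> = (\<integral>\<^sup>+y. ennreal \<bar>w' y\<bar> * ennreal (norm (biot_savart_kernel (x - y))) * G x \<partial>lborel)"
      by (rule nn_integral_multc[symmetric]) measurable
    finally show "ennreal (norm (u x)) * G x \<le> (\<integral>\<^sup>+y. ennreal \<bar>w' y\<bar> * ennreal (norm (biot_savart_kernel (x - y))) * G x \<partial>lborel)" .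
  qed
  also have "\<dots> = (\<integral>\<^sup>+y. (\<integral>\<^sup>+x. ennreal \<bar>w' y\<bar> * ennreal (norm (biot_savart_kernel (x - y))) * G x \<partial>lborel) \<partial>lborel)"
    by (rule lborel_pair.Fubini') measurable
  also have "\<dots> = (\<integral>\<^sup>+y. ennreal \<bar>w' y\<bar> * (\<integral>\<^sup>+x. ennreal (norm (biot_savart_kernel (x - y))) * G x \<partial>lborel) \<partial>lborel)"
    by (simp add: nn_integral_cmult mult.assoc)
  also have "\<dots> = (\<integral>\<^sup>+y. ennreal \<bar>w y\<bar> * (\<integral>\<^sup>+x. ennreal (norm (biot_savart_kernel (x - y))) * G x \<partial>lborel) \<partial>lborel)"
    by (rule nn_integral_cong_AE, use w' in eventually_elim) simp
  finally show ?thesis .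
qed

text \<open>Fubini's theorem moves the convolution from the vorticity to the test field. With \<open>kernel_grad\<close> this
  turns statements about \<open>u\<close> into statements about \<open>w\<close>.\<close>

lemma biot_savart_pairing:
  fixes g :: "real^2 \<Rightarrow> real^2"
  assumes w: "w \<in> borel_measurable lebesgue" and u: "AE x in lborel. is_biot_savart w x (u x)"
    and [measurable]: "g \<in> borel_measurable borel"
    and fin: "(\<integral>\<^sup>+y. ennreal \<bar>w y\<bar> * (\<integral>\<^sup>+x. ennreal (norm (biot_savart_kernel (x - y))) * ennreal (norm (g x)) \<partial>lborel) \<partial>lborel) < \<infinity>"
  shows "(\<integral>x. u x \<bullet> g x \<partial>lebesgue) = (\<integral>y. w y * (\<integral>x. biot_savart_kernel (x - y) \<bullet> g x \<partial>lborel) \<partial>lebesgue)"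
    and "integrable lebesgue (\<lambda>x. u x \<bullet> g x)"
proof -
  obtain w' where [measurable]: "w' \<in> borel_measurable borel" and w': "AE x in lborel. w x = w' x"
    using borel_representative[OF w] .
  define f where "f = (\<lambda>(x, y). w' y * (biot_savart_kernel (x - y) \<bullet> g x))"
  have [measurable]: "f \<in> borel_measurable (lborel \<Otimes>\<^sub>M lborel)" unfolding f_def by measurable
  have intf: "integrable (lborel \<Otimes>\<^sub>M lborel) f"
  proof (rule integrableI_bounded)
    have "(\<integral>\<^sup>+z. ennreal (norm (f z)) \<partial>(lborel \<Otimes>\<^sub>M lborel)) = (\<integral>\<^sup>+y. \<integral>\<^sup>+x. ennreal (norm (f (x, y))) \<partial>lborel \<partial>lborel)"
      by (rule lborel_pair.nn_integral_snd[symmetric]) measurable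
    also have "\<dots> \<le> (\<integral>\<^sup>+y. \<integral>\<^sup>+x. ennreal \<bar>w' y\<bar> * (ennreal (norm (biot_savart_kernel (x - y))) * ennreal (norm (g x))) \<partial>lborel \<partial>lborel)"
      by (intro nn_integral_mono)
         (auto simp: f_def abs_mult ennreal_mult[symmetric] intro!: ennreal_leI mult_left_mono Cauchy_Schwarz_ineq2)
    also have "\<dots> = (\<integral>\<^sup>+y. ennreal \<bar>w' y\<bar> * (\<integral>\<^sup>+x. ennreal (norm (biot_savart_kernel (x - y))) * ennreal (norm (g x)) \<partial>lborel) \<partial>lborel)"
      by (simp add: nn_integral_cmult)
    also have "\<dots> = (\<integral>\<^sup>+y. ennreal \<bar>w y\<bar> * (\<integral>\<^sup>+x. ennreal (norm (biot_savart_kernel (x - y))) * ennreal (norm (g x)) \<partial>lborel) \<partial>lborel)"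
      by (rule nn_integral_cong_AE, use w' in eventually_elim) simp
    also note fin
    finally show "(\<integral>\<^sup>+z. ennreal (norm (f z)) \<partial>(lborel \<Otimes>\<^sub>M lborel)) < \<infinity>" .
  qed measurable
  have ug: "AE x in lborel. u x \<bullet> g x = (\<integral>y. f (x, y) \<partial>lborel)"
    using u
  proof eventually_elim
    fix x assume "is_biot_savart w x (u x)"
    then have h: "has_bochner_integral lborel (\<lambda>y. w' y *\<^sub>R biot_savart_kernel (x - y)) (u x)"
      by (intro is_biot_savart_cong_AE[OF w' w]) auto
    have "has_bochner_integral lborel (\<lambda>y. (w' y *\<^sub>R biot_savart_kernel (x - y)) \<bullet> g x) (u x \<bullet> g x)"
      by (rule has_bochner_integral_inner_left) (use h in auto)
    then show "u x \<bullet> g x = (\<integral>y. f (x, y) \<partial>lborel)"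
      by (simp add: f_def has_bochner_integral_iff)
  qed
  have int1: "integrable lborel (\<lambda>x. \<integral>y. f (x, y) \<partial>lborel)"
    by (rule lborel_pair.integrable_fst'[OF intf])
  have intl: "integrable lebesgue (\<lambda>x. \<integral>y. f (x, y) \<partial>lborel)"
    using int1 by (simp add: integrable_completion)
  have ug': "AE x in lebesgue. (\<integral>y. f (x, y) \<partial>lborel) = u x \<bullet> g x"
    by (rule AE_completion) (use ug in eventually_elim, simp)
  have mug: "(\<lambda>x. u x \<bullet> g x) \<in> borel_measurable lebesgue"
    by (rule borel_measurable_AE[OF borel_measurable_integrable[OF intl] ug'])
  show "integrable lebesgue (\<lambda>x. u x \<bullet> g x)"
    by (rule integrable_cong_AE_imp[OF intl mug]) (use ug' in eventually_elim, simp)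
  have "(\<integral>x. u x \<bullet> g x \<partial>lebesgue) = (\<integral>x. \<integral>y. f (x, y) \<partial>lborel \<partial>lebesgue)"
    by (rule integral_cong_AE[OF mug borel_measurable_integrable[OF intl]]) (use ug' in eventually_elim, simp)
  also have "\<dots> = (\<integral>x. \<integral>y. f (x, y) \<partial>lborel \<partial>lborel)"
    using int1 by (simp add: integral_completion)
  also have "\<dots> = (\<integral>y. \<integral>x. f (x, y) \<partial>lborel \<partial>lborel)"
    using lborel_pair.Fubini_integral[of "\<lambda>x y. f (x, y)"] intf by (simp add: case_prod_unfold)
  also have "\<dots> = (\<integral>y. w' y * (\<integral>x. biot_savart_kernel (x - y) \<bullet> g x \<partial>lborel) \<partial>lborel)"
    by (simp add: f_def)
  also have "\<dots> = (\<integral>y. w' y * (\<integral>x. biot_savart_kernel (x - y) \<bullet> g x \<partial>lborel) \<partial>lebesgue)"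
    by (rule integral_completion[symmetric]) measurable
  also have "\<dots> = (\<integral>y. w y * (\<integral>x. biot_savart_kernel (x - y) \<bullet> g x \<partial>lborel) \<partial>lebesgue)"
  proof (rule integral_cong_AE)
    have m[measurable]: "(\<lambda>y. \<integral>x. biot_savart_kernel (x - y) \<bullet> g x \<partial>lborel) \<in> borel_measurable lborel" by measurable
    have m': "(\<lambda>y. \<integral>x. biot_savart_kernel (x - y) \<bullet> g x \<partial>lborel) \<in> borel_measurable lebesgue"
      by (intro measurable_completion) measurable
    show "(\<lambda>y. w' y * (\<integral>x. biot_savart_kernel (x - y) \<bullet> g x \<partial>lborel)) \<in> borel_measurable lebesgue"
      by (intro measurable_completion) measurable
    show "(\<lambda>y. w y * (\<integral>x. biot_savart_kernel (x - y) \<bullet> g x \<partial>lborel)) \<in> borel_measurable lebesgue"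
      using w m' by (rule borel_measurable_times)
    show "AE y in lebesgue. w' y * (\<integral>x. biot_savart_kernel (x - y) \<bullet> g x \<partial>lborel) = w y * (\<integral>x. biot_savart_kernel (x - y) \<bullet> g x \<partial>lborel)"
      by (rule AE_completion) (use w' in eventually_elim, simp)
  qed
  finally show "(\<integral>x. u x \<bullet> g x \<partial>lebesgue) = (\<integral>y. w y * (\<integral>x. biot_savart_kernel (x - y) \<bullet> g x \<partial>lborel) \<partial>lebesgue)" .
qed

section \<open>The entropy balance of the Navier-Stokes equations\<close>

lemma pd_slice:
  fixes f :: "real \<times> 'a::real_normed_vector \<Rightarrow> 'b::real_normed_vector"
  assumes "C_k (Suc n) (I \<times> UNIV) f" "t \<in> I"
  shows "((\<lambda>x. f (t, x)) has_derivative (\<lambda>v. pd f (0, v) (t, x))) (at x)"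
    "pd (\<lambda>x. f (t, x)) v x = pd f (0, v) (t, x)"
proof -
  have f: "(f has_derivative (\<lambda>v. pd f v (t, x))) (at (t, x))"
    by (rule C_k_Suc_has[OF assms(1)]) (use assms in auto)
  have "((\<lambda>x. (t, x)) has_derivative (\<lambda>v. (0, v))) (at x)"
    by (auto intro!: derivative_eq_intros)
  from has_derivative_compose[OF this f]
  show d: "((\<lambda>x. f (t, x)) has_derivative (\<lambda>v. pd f (0, v) (t, x))) (at x)" .
  show "pd (\<lambda>x. f (t, x)) v x = pd f (0, v) (t, x)" by (rule pd_eqI[OF d])
qed

lemma C_k_slice:
  fixes f :: "real \<times> 'a::real_normed_vector \<Rightarrow> 'b::real_normed_vector"
  assumes "t \<in> I"
  shows "C_k n (I \<times> UNIV) f \<Longrightarrow> C_k n UNIV (\<lambda>x. f (t, x))"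
proof (induction n arbitrary: f)
  case 0
  then have "continuous_on (I \<times> UNIV) f" by simp
  then have "continuous_on UNIV (\<lambda>x. f (t, x))"
    by (rule continuous_on_compose2) (use assms in \<open>auto intro!: continuous_intros\<close>)
  then show ?case by simp
next
  case (Suc n)
  show ?case
    by (rule C_k_SucI[OF open_UNIV pd_slice(1)[OF Suc.prems assms] Suc.IH[OF C_k_Suc_pd[OF Suc.prems]]])
qed

lemma deriv_slice:
  fixes f :: "real \<times> 'a::real_normed_vector \<Rightarrow> real"
  assumes "C_k (Suc n) (I \<times> UNIV) f" "t \<in> I"
  shows "((\<lambda>s. f (s, x)) has_real_derivative pd f (1, 0) (t, x)) (at t)"
proof -
  have f: "(f has_derivative (\<lambda>v. pd f v (t, x))) (at (t, x))"
    by (rule C_k_Suc_has[OF assms(1)]) (use assms in auto)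
  have "((\<lambda>s. (s, x)) has_derivative (\<lambda>h. (h, 0))) (at t)"
    by (auto intro!: derivative_eq_intros)
  from has_derivative_compose[OF this f]
  have d: "((\<lambda>s. f (s, x)) has_derivative (\<lambda>h. pd f (h, 0) (t, x))) (at t)" .
  have lin: "pd f (h, 0) (t, x) = pd f (1, 0) (t, x) * h" for h
    using linear_scale[OF bounded_linear.linear[OF has_derivative_bounded_linear[OF f]], of h "(1, 0)"]
    by (simp add: mult.commute)
  show ?thesis unfolding has_field_derivative_def
    by (rule has_derivative_eq_rhs[OF d]) (rule ext, rule lin)
qed

lemma inner_grad:
  fixes f :: "'a::euclidean_space \<Rightarrow> real"
  assumes "f differentiable (at x)"
  shows "v \<bullet> grad f x = pd f v x"
proof -
  have lin: "linear (\<lambda>v. pd f v x)"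
    using differentiable_has_pd[OF assms] has_derivative_bounded_linear bounded_linear.linear by blast
  have "pd f v x = pd f (\<Sum>b\<in>Basis. (v \<bullet> b) *\<^sub>R b) x" by (simp add: euclidean_representation)
  also have "\<dots> = (\<Sum>b\<in>Basis. (v \<bullet> b) * pd f b x)"
    using lin by (simp add: linear_sum linear_scale)
  also have "\<dots> = v \<bullet> grad f x" by (simp add: grad_def inner_sum_right mult.commute)
  finally show ?thesis ..
qed

lemma norm_grad_sq: "(norm (grad f x))\<^sup>2 = (\<Sum>b\<in>Basis. (pd f b x)\<^sup>2)"
proof -
  have "grad f x \<bullet> b = pd f b x" if "b \<in> Basis" for b
    unfolding grad_def using that by (simp add: inner_sum_left_Basis)
  then show ?thesis
    unfolding power2_norm_eq_inner euclidean_inner[of "grad f x" "grad f x"] by (simp add: power2_eq_square)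
qed

lemma integral_cbox_vanishing:
  fixes g :: "'a::euclidean_space \<Rightarrow> real"
  assumes "continuous_on UNIV g" "vanishes_outside R g" "cball 0 R \<subseteq> cbox a b"
  shows "(\<integral>x. g x \<partial>lborel) = integral (cbox a b) g"
proof -
  have "(\<integral>x. g x \<partial>lborel) = integral UNIV g"
    by (rule integral_lborel[symmetric]) (rule integrable_continuous_vanishing[OF assms(1,2)])
  also have "\<dots> = integral UNIV (\<lambda>x. if x \<in> cbox a b then g x else 0)"
    using assms(2,3) by (intro arg_cong[of _ _ "integral UNIV"]) (force simp: vanishes_outside_def fun_eq_iff)
  also have "\<dots> = integral (cbox a b) g" by (rule integral_restrict_UNIV)
  finally show ?thesis .
qed

lemma cball_in_cbox: obtains a b :: "'a::euclidean_space" where "cball 0 R \<subseteq> cbox a b"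
  using bounded_subset_cbox_symmetric[OF bounded_cball[of 0 R]] by metis

lemma L1_integral:
  fixes f :: "'a::euclidean_space \<Rightarrow> real"
  assumes "in_Lp 1 UNIV f"
  shows "integrable lebesgue f" "Lp_norm 1 UNIV f = (\<integral>x. \<bar>f x\<bar> \<partial>lebesgue)"
proof -
  have "integrable lebesgue (\<lambda>x. \<bar>f x\<bar>)" "f \<in> borel_measurable lebesgue"
    using assms by (auto simp: in_Lp_def lebesgue_on_UNIV_eq)
  then show "integrable lebesgue f" by (simp add: integrable_abs_iff)
  have "(\<integral>x. \<bar>f x\<bar> \<partial>lebesgue) \<ge> 0" by simp
  then show "Lp_norm 1 UNIV f = (\<integral>x. \<bar>f x\<bar> \<partial>lebesgue)" by (simp add: Lp_norm_def lebesgue_on_UNIV_eq)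
qed

lemma C_k_2_real:
  fixes F :: "real \<Rightarrow> real"
  assumes "\<And>s. (F has_real_derivative F1 s) (at s)" "\<And>s. (F1 has_real_derivative F2 s) (at s)" "continuous_on UNIV F2"
  shows "C_k 2 UNIV F" "C_k 1 UNIV F1"
proof -
  have "C_k (Suc 0) UNIV F1" by (rule C_k_real_SucI[OF assms(2)]) (use assms(3) in simp)
  then show 1: "C_k 1 UNIV F1" by simp
  have "C_k (Suc 1) UNIV F" by (rule C_k_real_SucI[OF assms(1) 1])
  then show "C_k 2 UNIV F" by (simp add: numeral_2_eq_2)
qed

lemma pd_compose_real:
  assumes "(F has_real_derivative F1 (f x)) (at (f x))" "(f has_derivative (\<lambda>v. pd f v x)) (at x)"
  shows "((\<lambda>x. F (f x)) has_derivative (\<lambda>v. F1 (f x) * pd f v x)) (at x)"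
  using has_derivative_compose[OF assms(2) assms(1)[unfolded has_field_derivative_def]] .

locale navier_stokes =
  fixes T \<nu> :: real and w0 :: "real^2 \<Rightarrow> real" and u :: "real \<Rightarrow> real^2 \<Rightarrow> real^2"
    and w :: "real \<Rightarrow> real^2 \<Rightarrow> real"
  assumes T_pos: "T > 0" and nu_pos: "\<nu> > 0" and sol: "navier_stokes_solution T \<nu> w0 u w"
begin

lemma w_smooth: "C_k n ({0<..<T} \<times> UNIV) (\<lambda>(t, x). w t x)"
  using sol by (auto simp: navier_stokes_solution_def smooth_on_def)

lemma w_C_k: "t \<in> {0<..<T} \<Longrightarrow> C_k n UNIV (w t)"
  using C_k_slice[OF _ w_smooth] by simp

lemma u_continuous: "t \<in> {0<..<T} \<Longrightarrow> continuous_on UNIV (u t)"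
proof -
  have "smooth_on ({0<..<T} \<times> UNIV) (\<lambda>(t, x). u t x)"
    using sol by (simp add: navier_stokes_solution_def)
  then have "C_k 0 ({0<..<T} \<times> UNIV) (\<lambda>(t, x). u t x)" unfolding smooth_on_def by blast
  from C_k_slice[OF _ this] show "t \<in> {0<..<T} \<Longrightarrow> continuous_on UNIV (u t)" by simp
qed

lemma w_continuous: "continuous_on ({0..T} \<times> UNIV) (\<lambda>(t, x). w t x)"
  using sol by (simp add: navier_stokes_solution_def)

lemma w_continuous_slice: "t \<in> {0..T} \<Longrightarrow> continuous_on UNIV (w t)"
  using C_k_slice[of t "{0..T}" 0 "\<lambda>(t, x). w t x"] w_continuous by simp

lemma w_initial: "w 0 = w0"
  using sol by (auto simp: navier_stokes_solution_def)

lemma w_borel: "t \<in> {0..T} \<Longrightarrow> w t \<in> borel_measurable borel"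
  using w_continuous_slice borel_measurable_continuous_onI by blast

lemma w_in_L1: "t \<in> {0..T} \<Longrightarrow> in_Lp 1 UNIV (w t)"
  using sol by (simp add: navier_stokes_solution_def in_C_Lp_def)

lemma w_integrable: "t \<in> {0..T} \<Longrightarrow> integrable lebesgue (w t)"
  using w_in_L1 L1_integral by blast

lemma w_integrable': "t \<in> {0..T} \<Longrightarrow> integrable lborel (w t)"
  using w_integrable w_borel by (simp add: integrable_completion)

lemma w_continuous_L1:
  assumes "t \<in> {0..T}"
  shows "((\<lambda>s. \<integral>x. \<bar>w s x - w t x\<bar> \<partial>lborel) \<longlongrightarrow> 0) (at t within {0..T})"
proof -
  have "((\<lambda>s. Lp_norm 1 UNIV (\<lambda>x. w s x - w t x)) \<longlongrightarrow> 0) (at t within {0..T})"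
    using sol assms by (simp add: navier_stokes_solution_def in_C_Lp_def)
  then show ?thesis
  proof (rule Lim_transform_eventually)
    show "\<forall>\<^sub>F s in at t within {0..T}. Lp_norm 1 UNIV (\<lambda>x. w s x - w t x) = (\<integral>x. \<bar>w s x - w t x\<bar> \<partial>lborel)"
      unfolding eventually_at_filter
    proof (intro always_eventually allI impI)
      fix s assume s: "s \<in> {0..T}"
      note [measurable] = w_borel[OF s] w_borel[OF assms]
      have "(\<lambda>x. w s x - w t x) \<in> borel_measurable borel" by measurable
      moreover have "integrable lborel (\<lambda>x. w s x - w t x)"
        using w_integrable' s assms by simp
      ultimately have "in_Lp 1 UNIV (\<lambda>x. w s x - w t x)"
        by (simp add: in_Lp_def lebesgue_on_UNIV_eq integrable_completion measurable_completion)
      then show "Lp_norm 1 UNIV (\<lambda>x. w s x - w t x) = (\<integral>x. \<bar>w s x - w t x\<bar> \<partial>lborel)"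
        by (simp add: L1_integral integral_completion)
    qed
  qed
qed

lemma L1_norm_bounded: obtains N where "N \<ge> 0" "\<And>t. t \<in> {0..T} \<Longrightarrow> (\<integral>x. \<bar>w t x\<bar> \<partial>lborel) \<le> N"
proof -
  have "continuous_on {0..T} (\<lambda>t. \<integral>x. \<bar>w t x\<bar> \<partial>lborel)"
    unfolding continuous_on_def
  proof
    fix t assume t: "t \<in> {0..T}"
    have "((\<lambda>s. (\<integral>x. \<bar>w s x\<bar> \<partial>lborel) - (\<integral>x. \<bar>w t x\<bar> \<partial>lborel)) \<longlongrightarrow> 0) (at t within {0..T})"
    proof (rule Lim_null_comparison[OF _ w_continuous_L1[OF t]])
      show "\<forall>\<^sub>F s in at t within {0..T}. norm ((\<integral>x. \<bar>w s x\<bar> \<partial>lborel) - (\<integral>x. \<bar>w t x\<bar> \<partial>lborel)) \<le> (\<integral>x. \<bar>w s x - w t x\<bar> \<partial>lborel)"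
        unfolding eventually_at_filter
      proof (intro always_eventually allI impI)
        fix s assume s: "s \<in> {0..T}"
        have "norm ((\<integral>x. \<bar>w s x\<bar> \<partial>lborel) - (\<integral>x. \<bar>w t x\<bar> \<partial>lborel)) = norm (\<integral>x. \<bar>w s x\<bar> - \<bar>w t x\<bar> \<partial>lborel)"
          using w_integrable'[OF s] w_integrable'[OF t] by simp
        also have "\<dots> \<le> (\<integral>x. norm (\<bar>w s x\<bar> - \<bar>w t x\<bar>) \<partial>lborel)" by (rule integral_norm_bound)
        also have "\<dots> \<le> (\<integral>x. \<bar>w s x - w t x\<bar> \<partial>lborel)"
          using w_integrable'[OF s] w_integrable'[OF t] by (intro integral_mono) auto
        finally show "norm ((\<integral>x. \<bar>w s x\<bar> \<partial>lborel) - (\<integral>x. \<bar>w t x\<bar> \<partial>lborel)) \<le> (\<integral>x. \<bar>w s x - w t x\<bar> \<partial>lborel)" .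
      qed
    qed
    then show "((\<lambda>t. \<integral>x. \<bar>w t x\<bar> \<partial>lborel) \<longlongrightarrow> (\<integral>x. \<bar>w t x\<bar> \<partial>lborel)) (at t within {0..T})"
      by (rule LIM_zero_cancel)
  qed
  then have "bounded ((\<lambda>t. \<integral>x. \<bar>w t x\<bar> \<partial>lborel) ` {0..T})"
    by (intro compact_imp_bounded compact_continuous_image) auto
  then obtain N where "N > 0" "\<And>t. t \<in> {0..T} \<Longrightarrow> norm (\<integral>x. \<bar>w t x\<bar> \<partial>lborel) \<le> N"
    unfolding bounded_pos by auto
  then show ?thesis using that[of N] by fastforce
qed

lemma w_bounded: obtains M where "M > 0" "\<And>t x. t \<in> {0..T} \<Longrightarrow> \<bar>w t x\<bar> \<le> M"
proof -
  obtain M where M: "\<forall>t\<in>{0..T}. \<forall>x. \<bar>w t x\<bar> \<le> M"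
    using sol by (auto simp: navier_stokes_solution_def)
  have "0 < max M 1" by simp
  moreover have "\<bar>w t x\<bar> \<le> max M 1" if "t \<in> {0..T}" for t x using M that by (meson max.coboundedI1)
  ultimately show ?thesis using that by blast
qed

lemma biot_savart: "t \<in> {0<..<T} \<Longrightarrow> is_biot_savart (w t) x (u t x)"
  using sol by (auto simp: navier_stokes_solution_def)

text \<open>The vorticity is bounded and integrable, which is what the splitting of the kernel needs.\<close>

lemma u_bounded: obtains U where "U \<ge> 0" "\<And>t x. t \<in> {0<..<T} \<Longrightarrow> norm (u t x) \<le> U"
proof -
  obtain M where M: "M > 0" "\<And>t x. t \<in> {0..T} \<Longrightarrow> \<bar>w t x\<bar> \<le> M" using w_bounded by blast
  obtain N where N: "N \<ge> 0" "\<And>t. t \<in> {0..T} \<Longrightarrow> (\<integral>x. \<bar>w t x\<bar> \<partial>lborel) \<le> N" using L1_norm_bounded by blast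
  have "norm (u t x) \<le> M * kernel_mass + N" if t: "t \<in> {0<..<T}" for t x
  proof -
    have t': "t \<in> {0..T}" using t by auto
    note [measurable] = w_borel[OF t']
    have "has_bochner_integral lborel (\<lambda>y. w t y *\<^sub>R biot_savart_kernel (x - y)) (u t x)"
      by (rule is_biot_savart_cong_AE[OF _ _ _ biot_savart[OF t]]) (auto intro: measurable_completion)
    then have "ennreal (norm (u t x)) \<le> (\<integral>\<^sup>+y. norm (w t y *\<^sub>R biot_savart_kernel (x - y)) \<partial>lborel)"
      using has_bochner_integral_norm_bound by blast
    also have "\<dots> = (\<integral>\<^sup>+y. ennreal (norm (biot_savart_kernel (y - x))) * ennreal \<bar>w t y\<bar> \<partial>lborel)"
      by (simp add: ennreal_mult'' norm_kernel_minus[of x] mult.commute)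
    also have "\<dots> \<le> ennreal M * ennreal kernel_mass + (\<integral>\<^sup>+y. ennreal \<bar>w t y\<bar> \<partial>lborel)"
      by (rule kernel_convolution_bound) (use M t' in \<open>auto intro!: ennreal_leI\<close>)
    also have "(\<integral>\<^sup>+y. ennreal \<bar>w t y\<bar> \<partial>lborel) = ennreal (\<integral>x. \<bar>w t x\<bar> \<partial>lborel)"
      by (rule nn_integral_eq_integral) (use w_integrable'[OF t'] in auto)
    also have "\<dots> \<le> ennreal N" using N t' by (intro ennreal_leI) auto
    finally show ?thesis using M N kernel_mass_nonneg
      by (simp add: ennreal_mult[symmetric] ennreal_plus[symmetric] del: ennreal_plus)
  qed
  moreover have "M * kernel_mass + N \<ge> 0" using M N kernel_mass_nonneg by simp
  ultimately show ?thesis using that by blast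
qed

lemma kernel_pairing_finite:
  fixes g :: "real^2 \<Rightarrow> real^2"
  assumes t: "t \<in> {0..T}" and g: "continuous_on UNIV g" "vanishes_outside R g"
  shows "(\<integral>\<^sup>+y. ennreal \<bar>w t y\<bar> * (\<integral>\<^sup>+x. ennreal (norm (biot_savart_kernel (x - y))) * ennreal (norm (g x)) \<partial>lborel) \<partial>lborel) < \<infinity>"
proof -
  have [measurable]: "g \<in> borel_measurable borel" using g(1) by (rule borel_measurable_continuous_onI)
  obtain B where B: "\<And>x. norm (g x) \<le> B" using bounded_continuous_vanishing[OF g] by blast
  note [measurable] = w_borel[OF t]
  define C where "C = ennreal B * ennreal kernel_mass + (\<integral>\<^sup>+x. ennreal (norm (g x)) \<partial>lborel)"
  have "integrable lborel g" by (rule integrable_continuous_vanishing[OF g])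
  then have "(\<integral>\<^sup>+x. ennreal (norm (g x)) \<partial>lborel) < \<infinity>" by (simp add: integrable_iff_bounded)
  then have C: "C < \<infinity>" unfolding C_def by (simp add: ennreal_mult_less_top less_top)
  have "(\<integral>\<^sup>+y. ennreal \<bar>w t y\<bar> * (\<integral>\<^sup>+x. ennreal (norm (biot_savart_kernel (x - y))) * ennreal (norm (g x)) \<partial>lborel) \<partial>lborel)
    \<le> (\<integral>\<^sup>+y. ennreal \<bar>w t y\<bar> * C \<partial>lborel)"
    unfolding C_def by (intro nn_integral_mono mult_left_mono kernel_convolution_bound) (use B in \<open>auto intro!: ennreal_leI\<close>)
  also have "\<dots> = (\<integral>\<^sup>+y. ennreal \<bar>w t y\<bar> \<partial>lborel) * C" by (rule nn_integral_multc) measurable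
  also have "\<dots> < \<infinity>"
    using w_integrable'[OF t] C by (simp add: integrable_iff_bounded ennreal_mult_less_top less_top)
  finally show ?thesis .
qed

lemma velocity_divergence_free:
  assumes t: "t \<in> {0<..<T}" and \<psi>: "C_k 1 UNIV \<psi>" "vanishes_outside R \<psi>"
  shows "(\<integral>x. u t x \<bullet> grad \<psi> x \<partial>lborel) = 0"
proof -
  have t': "t \<in> {0..T}" using t by auto
  note g = grad_measurable[OF \<psi>(1)]
  have "(\<integral>x. u t x \<bullet> grad \<psi> x \<partial>lborel) = (\<integral>x. u t x \<bullet> grad \<psi> x \<partial>lebesgue)"
    by (rule integral_completion[symmetric])
       (use g u_continuous[OF t] in \<open>auto intro!: borel_measurable_continuous_onI continuous_intros\<close>)
  also have "\<dots> = (\<integral>y. w t y * (\<integral>x. biot_savart_kernel (x - y) \<bullet> grad \<psi> x \<partial>lborel) \<partial>lebesgue)"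
    by (rule biot_savart_pairing(1)[OF _ _ g(1) kernel_pairing_finite[OF t' g(3) vanishes_grad(1)[OF \<psi>(2)]]])
       (use w_borel[OF t'] biot_savart[OF t] in \<open>auto intro: measurable_completion\<close>)
  also have "\<dots> = 0" by (simp add: kernel_grad(1)[OF \<psi>])
  finally show ?thesis .
qed

lemma velocity_curl:
  assumes t: "t \<in> {0<..<T}" and \<psi>: "C_k 1 UNIV \<psi>" "vanishes_outside R \<psi>"
  shows "(\<integral>x. u t x \<bullet> perp_grad \<psi> x \<partial>lebesgue) = - kernel_const * (\<integral>x. w t x * \<psi> x \<partial>lebesgue)"
proof -
  have t': "t \<in> {0..T}" using t by auto
  note g = grad_measurable[OF \<psi>(1)]
  have "(\<integral>x. u t x \<bullet> perp_grad \<psi> x \<partial>lebesgue) = (\<integral>y. w t y * (\<integral>x. biot_savart_kernel (x - y) \<bullet> perp_grad \<psi> x \<partial>lborel) \<partial>lebesgue)"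
    by (rule biot_savart_pairing(1)[OF _ _ g(2) kernel_pairing_finite[OF t' g(4) vanishes_grad(2)[OF \<psi>(2)]]])
       (use w_borel[OF t'] biot_savart[OF t] in \<open>auto intro: measurable_completion\<close>)
  also have "\<dots> = (\<integral>y. - kernel_const * (w t y * \<psi> y) \<partial>lebesgue)" by (simp add: kernel_grad(2)[OF \<psi>] mult_ac)
  also have "\<dots> = - kernel_const * (\<integral>x. w t x * \<psi> x \<partial>lebesgue)" by simp
  finally show ?thesis .
qed

text \<open>The equation is multiplied by \<open>F' (w) * \<zeta>\<close> and integrated by parts. The transport term produces
  \<open>u \<bullet> grad \<zeta>\<close> because \<open>u\<close> is divergence free in the weak sense, the viscous term produces the
  dissipation \<open>F'' (w) * \<bar>grad w\<bar>\<^sup>2\<close>.\<close>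

lemma local_entropy_balance:
  assumes F: "\<And>s. (F has_real_derivative F1 s) (at s)" "\<And>s. (F1 has_real_derivative F2 s) (at s)" "continuous_on UNIV F2"
    and \<zeta>: "C_k 2 UNIV \<zeta>" "vanishes_outside R \<zeta>" and t: "t \<in> {0<..<T}"
  shows "((\<lambda>s. \<integral>x. F (w s x) * \<zeta> x \<partial>lborel) has_real_derivative
     ((\<integral>x. F (w t x) * (u t x \<bullet> grad \<zeta> x + \<nu> * laplacian \<zeta> x) \<partial>lborel)
      - \<nu> * (\<integral>x. F2 (w t x) * (norm (grad (w t) x))\<^sup>2 * \<zeta> x \<partial>lborel))) (at t)"
proof -
  define W where "W = (\<lambda>(t, x). w t x)"
  define E where "E = {0<..<T} \<times> (UNIV :: (real^2) set)"
  have oE: "open E" unfolding E_def by (intro open_Times) auto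
  have CW: "C_k n E W" for n using w_smooth by (simp add: W_def E_def)
  have CF: "C_k 2 UNIV F" "C_k 1 UNIV F1" using C_k_2_real[OF F] by auto
  have cF: "continuous_on UNIV F" "continuous_on UNIV F1" using CF C_k_continuous by blast+
  have \<zeta>1: "C_k 1 UNIV \<zeta>" using C_k_mono[OF \<zeta>(1), of 1] by simp
  have c\<zeta>: "continuous_on UNIV \<zeta>" using \<zeta> C_k_continuous by blast
  obtain a b :: "real^2" where ab: "cball 0 R \<subseteq> cbox a b" using cball_in_cbox by blast
  have cwt: "continuous_on UNIV (w s)" if "s \<in> {0<..<T}" for s using w_C_k[OF that, of 0] by simp
  have cFw: "continuous_on UNIV (\<lambda>x. F (w s x) * \<zeta> x)" if "s \<in> {0<..<T}" for s
    by (rule continuous_on_mult[OF continuous_on_compose2[OF cF(1) cwt[OF that] subset_UNIV] c\<zeta>])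
  \<comment> \<open>The time derivative, by differentiation under the integral sign.\<close>
  have dt: "((\<lambda>s. \<integral>x. F (w s x) * \<zeta> x \<partial>lborel) has_real_derivative
     (\<integral>x. F1 (w t x) * pd W (1, 0) (t, x) * \<zeta> x \<partial>lborel)) (at t)"
  proof -
    have cdt: "continuous_on E (\<lambda>z. F1 (W z) * pd W (1, 0) z * \<zeta> (snd z))"
      by (rule continuous_on_mult[OF continuous_on_mult[OF
            continuous_on_compose2[OF cF(2) C_k_continuous[OF CW] subset_UNIV] C_k_continuous[OF C_k_Suc_pd[OF CW]]]
            continuous_on_compose2[OF c\<zeta> continuous_on_snd[OF continuous_on_id] subset_UNIV]])
    have 1: "((\<lambda>s. integral (cbox a b) (\<lambda>x. F (w s x) * \<zeta> x)) has_real_derivative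
       integral (cbox a b) (\<lambda>x. F1 (w t x) * pd W (1, 0) (t, x) * \<zeta> x)) (at t within {0<..<T})"
    proof (rule leibniz_rule_field_derivative)
      fix s x assume s: "s \<in> {0<..<T}"
      have "((\<lambda>s. w s x) has_real_derivative pd W (1, 0) (s, x)) (at s)"
        using deriv_slice[of 0 "{0<..<T}" W s x] CW[of 1] s by (simp add: W_def E_def)
      then have "((\<lambda>s. F (w s x) * \<zeta> x) has_real_derivative F1 (w s x) * pd W (1, 0) (s, x) * \<zeta> x) (at s)"
        by (intro DERIV_cmult_right DERIV_chain2[OF F(1)])
      then show "((\<lambda>s. F (w s x) * \<zeta> x) has_real_derivative F1 (w s x) * pd W (1, 0) (s, x) * \<zeta> x) (at s within {0<..<T})"
        by (rule has_field_derivative_at_within)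
    next
      fix s assume s: "s \<in> {0<..<T}"
      show "(\<lambda>x. F (w s x) * \<zeta> x) integrable_on cbox a b"
        by (rule integrable_continuous, rule continuous_on_subset[OF cFw[OF s]]) simp
    next
      show "continuous_on ({0<..<T} \<times> cbox a b) (\<lambda>(s, x). F1 (w s x) * pd W (1, 0) (s, x) * \<zeta> x)"
        using continuous_on_subset[OF cdt, of "{0<..<T} \<times> cbox a b"] by (auto simp: E_def W_def case_prod_unfold)
    qed (use t in auto)
    have 2: "(\<integral>x. F1 (w t x) * pd W (1, 0) (t, x) * \<zeta> x \<partial>lborel) = integral (cbox a b) (\<lambda>x. F1 (w t x) * pd W (1, 0) (t, x) * \<zeta> x)"
    proof (rule integral_cbox_vanishing[OF _ _ ab])
      show "continuous_on UNIV (\<lambda>x. F1 (w t x) * pd W (1, 0) (t, x) * \<zeta> x)"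
      proof -
        have "continuous_on UNIV (\<lambda>x::real^2. (t, x))" by (intro continuous_intros)
        moreover have "range (\<lambda>x. (t, x)) \<subseteq> E" using t by (auto simp: E_def)
        ultimately show ?thesis
          using continuous_on_compose2[OF cdt, of UNIV "\<lambda>x. (t, x)"] by (simp add: W_def)
      qed
      show "vanishes_outside R (\<lambda>x. F1 (w t x) * pd W (1, 0) (t, x) * \<zeta> x)"
        using \<zeta>(2) by (rule vanishes_mult)
    qed
    have 3: "(\<integral>x. F (w s x) * \<zeta> x \<partial>lborel) = integral (cbox a b) (\<lambda>x. F (w s x) * \<zeta> x)" if s: "s \<in> {0<..<T}" for s
      by (rule integral_cbox_vanishing[OF cFw[OF s] vanishes_mult[OF \<zeta>(2)] ab])
    show ?thesis unfolding 2
    proof (rule has_field_derivative_transform_within_open[OF _ _ t])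
      show "((\<lambda>s. integral (cbox a b) (\<lambda>x. F (w s x) * \<zeta> x)) has_real_derivative
       integral (cbox a b) (\<lambda>x. F1 (w t x) * pd W (1, 0) (t, x) * \<zeta> x)) (at t)"
        using 1 at_within_open[OF t] by simp
    qed (use 3 in auto)
  qed
  \<comment> \<open>The equation and integration by parts in space.\<close>
  define f where "f = w t"
  have Cf: "C_k n UNIV f" for n unfolding f_def by (rule w_C_k[OF t])
  have hf: "(f has_derivative (\<lambda>v. pd f v x)) (at x)" for x by (rule C_1_has[OF Cf])
  have hFf: "((\<lambda>x. F (f x)) has_derivative (\<lambda>v. F1 (f x) * pd f v x)) (at x)"
    and hF1f: "((\<lambda>x. F1 (f x)) has_derivative (\<lambda>v. F2 (f x) * pd f v x)) (at x)" for x
    by (rule pd_compose_real[of F F1 f x, OF F(1) hf], rule pd_compose_real[of F1 F2 f x, OF F(2) hf])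
  have Cpf: "C_k n UNIV (\<lambda>x. pd f v x)" for n v by (rule C_k_Suc_pd[OF Cf])
  have Cp\<zeta>: "C_k 1 UNIV (\<lambda>x. pd \<zeta> v x)" for v using \<zeta>(1) by (simp add: numeral_2_eq_2)
  have CFf: "C_k 2 UNIV (\<lambda>x. F (f x))" by (rule C_k_compose_real[OF open_UNIV CF(1) Cf])
  have CFf1: "C_k 1 UNIV (\<lambda>x. F (f x))" using C_k_mono[OF CFf, of 1] by simp
  have CF1f: "C_k 1 UNIV (\<lambda>x. F1 (f x))" by (rule C_k_compose_real[OF open_UNIV CF(2) Cf])
  define \<psi> where "\<psi> x = F (f x) * \<zeta> x" for x
  have C\<psi>: "C_k 1 UNIV \<psi>" unfolding \<psi>_def[abs_def] by (rule C_k_mult[OF open_UNIV CFf1 \<zeta>1])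
  have v\<psi>: "vanishes_outside R \<psi>" unfolding \<psi>_def[abs_def] by (rule vanishes_mult[OF \<zeta>(2)])
  have pd\<psi>: "pd \<psi> v x = F (f x) * pd \<zeta> v x + F1 (f x) * pd f v x * \<zeta> x" for v x
    unfolding \<psi>_def[abs_def]
    by (rule pd_eqI, rule has_derivative_mult[OF hFf C_1_has[OF \<zeta>1]])
  \<comment> \<open>The second Green identity: the divergence of \<open>G\<close> collects the viscous terms.\<close>
  define G where "G b x = F1 (f x) * (\<zeta> x * pd f b x) - F (f x) * pd \<zeta> b x" for b x
  have CG: "C_k 1 UNIV (G b)" for b
    unfolding G_def[abs_def]
    by (rule C_k_diff[OF open_UNIV C_k_mult[OF open_UNIV CF1f C_k_mult[OF open_UNIV \<zeta>1 Cpf]]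
          C_k_mult[OF open_UNIV CFf1 Cp\<zeta>]])
  have vG: "vanishes_outside R (G b)" for b
    using \<zeta>(2) vanishes_pd[OF \<zeta>(2), of b] by (auto simp: vanishes_outside_def G_def)
  have pdG: "pd (G b) b x = F2 (f x) * (pd f b x)\<^sup>2 * \<zeta> x + F1 (f x) * \<zeta> x * pd (\<lambda>y. pd f b y) b x
     - F (f x) * pd (\<lambda>y. pd \<zeta> b y) b x" for b x
  proof -
    have "(G b has_derivative (\<lambda>v. (F1 (f x) * (\<zeta> x * pd (\<lambda>y. pd f b y) v x + pd \<zeta> v x * pd f b x)
       + F2 (f x) * pd f v x * (\<zeta> x * pd f b x))
       - (F (f x) * pd (\<lambda>y. pd \<zeta> b y) v x + F1 (f x) * pd f v x * pd \<zeta> b x))) (at x)"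
      unfolding G_def[abs_def]
      by (rule has_derivative_diff[OF has_derivative_mult[OF hF1f
            has_derivative_mult[OF C_1_has[OF \<zeta>1] C_1_has[OF Cpf]]]
          has_derivative_mult[OF hFf C_1_has[OF Cp\<zeta>]]])
    from pd_eqI[OF this, of b] show ?thesis by (simp add: algebra_simps power2_eq_square)
  qed
  have pde: "pd W (1, 0) (t, x) = - (u t x \<bullet> grad f x) + \<nu> * laplacian f x" for x
  proof -
    have "((\<lambda>s. w s x) has_real_derivative pd W (1, 0) (t, x)) (at t)"
      using deriv_slice[of 0 "{0<..<T}" W t x] CW[of 1] t by (simp add: W_def E_def)
    then have "deriv (\<lambda>s. w s x) t = pd W (1, 0) (t, x)" by (rule DERIV_imp_deriv)
    moreover have "deriv (\<lambda>s. w s x) t + u t x \<bullet> grad (w t) x - \<nu> * laplacian (w t) x = 0"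
      using sol t by (auto simp: navier_stokes_solution_def)
    ultimately show ?thesis by (simp add: f_def)
  qed
  have ig: "u t x \<bullet> grad f x = pd f (u t x) x" "u t x \<bullet> grad \<psi> x = pd \<psi> (u t x) x" "u t x \<bullet> grad \<zeta> x = pd \<zeta> (u t x) x" for x
    by (rule inner_grad, rule differentiableI, rule C_1_has, fact Cf C\<psi> \<zeta>1)+
  have pointwise: "F1 (w t x) * pd W (1, 0) (t, x) * \<zeta> x =
     (F (w t x) * (u t x \<bullet> grad \<zeta> x + \<nu> * laplacian \<zeta> x) - \<nu> * (F2 (w t x) * (norm (grad (w t) x))\<^sup>2 * \<zeta> x))
     - u t x \<bullet> grad \<psi> x + \<nu> * (\<Sum>b\<in>Basis. pd (G b) b x)" for x
    unfolding pde f_def[symmetric] ig pd\<psi> norm_grad_sq laplacian_def pdG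
    by (simp add: sum.distrib sum_subtractf sum_distrib_left sum_distrib_right algebra_simps)
  have cu: "continuous_on UNIV (u t)" by (rule u_continuous[OF t])
  have cff: "continuous_on UNIV f" using Cf C_k_continuous by blast
  have cl\<zeta>: "continuous_on UNIV (laplacian \<zeta>)"
    unfolding laplacian_def[abs_def] using Cp\<zeta> by (intro continuous_on_sum) auto
  have vl\<zeta>: "vanishes_outside R (laplacian \<zeta>)"
    using vanishes_pd[OF vanishes_pd[OF \<zeta>(2)]] by (auto simp: vanishes_outside_def laplacian_def)
  have i1: "integrable lborel (\<lambda>x. F (w t x) * (u t x \<bullet> grad \<zeta> x + \<nu> * laplacian \<zeta> x))"
    by (rule integrable_continuous_vanishing[where R = R])
       (use vl\<zeta> vanishes_grad(1)[OF \<zeta>(2)] in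
        \<open>auto simp: vanishes_outside_def f_def[symmetric] intro!: continuous_on_mult continuous_on_add continuous_on_inner
          continuous_on_const continuous_on_compose2[OF cF(1) cff] cl\<zeta> grad_measurable(3)[OF \<zeta>1] cu\<close>)
  have i2: "integrable lborel (\<lambda>x. F2 (w t x) * (norm (grad (w t) x))\<^sup>2 * \<zeta> x)"
    by (rule integrable_continuous_vanishing[OF _ vanishes_mult[OF \<zeta>(2)]])
       (auto simp: f_def[symmetric] intro!: continuous_on_mult continuous_on_power continuous_on_norm
          continuous_on_compose2[OF F(3) cff] c\<zeta> grad_measurable(3)[OF Cf])
  have i3: "integrable lborel (\<lambda>x. u t x \<bullet> grad \<psi> x)"
    by (rule integrable_continuous_vanishing[where R = R])
       (use vanishes_grad(1)[OF v\<psi>] grad_measurable(3)[OF C\<psi>] cu in \<open>auto simp: vanishes_outside_def intro!: continuous_on_inner\<close>)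
  have i4: "integrable lborel (\<lambda>x. \<Sum>b\<in>Basis. pd (G b) b x)"
    by (intro Bochner_Integration.integrable_sum integral_pd_zero(1)[OF CG vG])
  have z4: "(\<integral>x. (\<Sum>b\<in>Basis. pd (G b) b x) \<partial>lborel) = 0"
    by (subst Bochner_Integration.integral_sum) (auto simp: integral_pd_zero[OF CG vG])
  have "(\<integral>x. F1 (w t x) * pd W (1, 0) (t, x) * \<zeta> x \<partial>lborel) =
     (\<integral>x. F (w t x) * (u t x \<bullet> grad \<zeta> x + \<nu> * laplacian \<zeta> x) \<partial>lborel)
      - \<nu> * (\<integral>x. F2 (w t x) * (norm (grad (w t) x))\<^sup>2 * \<zeta> x \<partial>lborel)"
    unfolding pointwise using i1 i2 i3 i4 z4 velocity_divergence_free[OF t C\<psi> v\<psi>] by simp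
  with dt show ?thesis by simp
qed

end

lemma cutoff_scale: "cutoff R = (\<lambda>x. cutoff 1 (x /\<^sub>R R))"
  by (auto simp: cutoff_def)

lemma pd_scale:
  fixes f :: "'a::real_normed_vector \<Rightarrow> real"
  assumes "C_k 1 UNIV f"
  shows "pd (\<lambda>x. f (x /\<^sub>R R)) v x = inverse R * pd f v (x /\<^sub>R R)"
proof -
  have "((\<lambda>x. x /\<^sub>R R) has_derivative (\<lambda>v. v /\<^sub>R R)) (at x)" by (auto intro!: derivative_eq_intros)
  from has_derivative_compose[OF this C_1_has[OF assms]]
  have "pd (\<lambda>x. f (x /\<^sub>R R)) v x = pd f (v /\<^sub>R R) (x /\<^sub>R R)" by (rule pd_eqI)
  also have "\<dots> = inverse R * pd f v (x /\<^sub>R R)"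
    using linear_scale[OF bounded_linear.linear[OF has_derivative_bounded_linear[OF C_1_has[OF assms]]]] by simp
  finally show ?thesis .
qed

lemma vanishes_cutoff: "R > 0 \<Longrightarrow> vanishes_outside (2 * R) (cutoff R)"
  by (auto simp: vanishes_outside_def cutoff_0)

lemma pd_cmult:
  fixes f :: "'a::real_normed_vector \<Rightarrow> real"
  assumes "C_k 1 UNIV f"
  shows "pd (\<lambda>x. c * f x) v x = c * pd f v x"
  by (rule pd_eqI, rule has_derivative_mult_right, rule C_1_has[OF assms])

lemma norm_grad_le: "norm (grad f x) \<le> (\<Sum>b\<in>Basis. \<bar>pd f b x\<bar>)"
  unfolding grad_def by (rule order_trans[OF norm_sum]) simp

text \<open>By scaling, a derivative of the cut-off of radius \<open>R\<close> gains a factor \<open>1 / R\<close>; hence truncation at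
  infinity costs nothing in the limit.\<close>

lemma cutoff_derivative_bounds:
  obtains c where "c > 0"
    "\<And>R x. R \<ge> 1 \<Longrightarrow> norm (grad (cutoff R) (x :: 'a::euclidean_space)) \<le> c / R"
    "\<And>R x. R \<ge> 1 \<Longrightarrow> \<bar>laplacian (cutoff R) (x :: 'a)\<bar> \<le> c / R"
proof -
  let ?c = "cutoff 1 :: 'a \<Rightarrow> real"
  have C: "C_k n UNIV ?c" for n by (rule C_k_cutoff)
  have v: "vanishes_outside 2 ?c" using vanishes_cutoff[of 1] by simp
  have C1: "C_k n UNIV (\<lambda>x. pd ?c b x)" for b n by (rule C_k_Suc_pd[OF C])
  have c1: "continuous_on UNIV (\<lambda>x. pd ?c b x)" for b using C1 C_k_continuous by blast
  have c2: "continuous_on UNIV (\<lambda>x. pd (\<lambda>y. pd ?c b y) b x)" for b using C_k_continuous[OF C_k_Suc_pd[OF C1]] by blast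
  have "\<exists>B. \<forall>x. \<bar>pd ?c b x\<bar> \<le> B" for b
    using bounded_continuous_vanishing[OF c1[of b] vanishes_pd[OF v]] by (metis real_norm_def)
  then obtain B1 where B1: "\<And>b x. \<bar>pd ?c b x\<bar> \<le> B1 b" by metis
  have "\<exists>B. \<forall>x. \<bar>pd (\<lambda>y. pd ?c b y) b x\<bar> \<le> B" for b
    using bounded_continuous_vanishing[OF c2[of b] vanishes_pd[OF vanishes_pd[OF v]]] by (metis real_norm_def)
  then obtain B2 where B2: "\<And>b x. \<bar>pd (\<lambda>y. pd ?c b y) b x\<bar> \<le> B2 b" by metis
  have n1: "B1 b \<ge> 0" "B2 b \<ge> 0" for b
    by (rule order_trans[OF abs_ge_zero B1], rule order_trans[OF abs_ge_zero B2])
  define c where "c = (\<Sum>b\<in>(Basis::'a set). B1 b) + (\<Sum>b\<in>(Basis::'a set). B2 b) + 1"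
  have cs: "(\<Sum>b\<in>(Basis::'a set). B1 b) \<le> c" "(\<Sum>b\<in>(Basis::'a set). B2 b) \<le> c" "c > 0"
    using sum_nonneg[of Basis B1] sum_nonneg[of Basis B2] n1 by (auto simp: c_def)
  have p1: "pd (cutoff R) b x = inverse R * pd ?c b (x /\<^sub>R R)" for R b x
    unfolding cutoff_scale[of R] by (rule pd_scale[OF C])
  have p2: "pd (\<lambda>y. pd (cutoff R) b y) b x = inverse R * (inverse R * pd (\<lambda>y. pd ?c b y) b (x /\<^sub>R R))" for R b x
  proof -
    have "C_k 1 UNIV (\<lambda>x. pd ?c b (x /\<^sub>R R))"
      using C_k_compose_affine[OF bounded_linear_scaleR_right[of "inverse R"] C1, where a = 0] by simp
    moreover have "(\<lambda>y. pd (cutoff R) b y) = (\<lambda>y. inverse R * pd ?c b (y /\<^sub>R R))"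
      by (rule ext, rule p1)
    ultimately show ?thesis by (simp only: pd_cmult pd_scale[OF C1])
  qed
  show ?thesis
  proof (rule that[OF cs(3)])
    fix R :: real and x :: 'a assume R: "R \<ge> 1"
    have "norm (grad (cutoff R) x) \<le> (\<Sum>b\<in>Basis. \<bar>pd (cutoff R) b x\<bar>)" by (rule norm_grad_le)
    also have "\<dots> = inverse R * (\<Sum>b\<in>Basis. \<bar>pd ?c b (x /\<^sub>R R)\<bar>)"
      using R unfolding p1[of R] by (simp add: abs_mult sum_distrib_left)
    also have "\<dots> \<le> inverse R * (\<Sum>b\<in>(Basis::'a set). B1 b)"
      using R B1 by (intro mult_left_mono sum_mono) auto
    also have "\<dots> \<le> inverse R * c" using R cs by (intro mult_left_mono) auto
    finally show "norm (grad (cutoff R) x) \<le> c / R" by (simp add: divide_inverse mult.commute)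
    have "\<bar>laplacian (cutoff R) x\<bar> \<le> (\<Sum>b\<in>Basis. \<bar>pd (\<lambda>y. pd (cutoff R) b y) b x\<bar>)"
      unfolding laplacian_def by (rule sum_abs)
    also have "\<dots> = inverse R * (inverse R * (\<Sum>b\<in>Basis. \<bar>pd (\<lambda>y. pd ?c b y) b (x /\<^sub>R R)\<bar>))"
      using R unfolding p2[of R] by (simp add: abs_mult sum_distrib_left)
    also have "\<dots> \<le> inverse R * (1 * (\<Sum>b\<in>(Basis::'a set). B2 b))"
      using R B2 n1 by (intro mult_left_mono mult_mono sum_mono sum_nonneg) (auto simp: field_simps)
    also have "\<dots> \<le> inverse R * c" using R cs by (intro mult_left_mono) auto
    finally show "\<bar>laplacian (cutoff R) x\<bar> \<le> c / R" by (simp add: divide_inverse mult.commute)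
  qed
qed

lemma locally_lipschitz_at_zero:
  fixes F :: "real \<Rightarrow> real"
  assumes F: "\<And>s. (F has_real_derivative F1 s) (at s)" "continuous_on UNIV F1" "F 0 = 0" and "M > 0"
  obtains L where "L > 0" "\<And>s. \<bar>s\<bar> \<le> M \<Longrightarrow> \<bar>F s\<bar> \<le> L * \<bar>s\<bar>"
proof -
  have "bounded (F1 ` {-M..M})"
    by (intro compact_imp_bounded compact_continuous_image continuous_on_subset[OF F(2)]) auto
  then obtain L where L: "L > 0" "\<And>s. s \<in> {-M..M} \<Longrightarrow> \<bar>F1 s\<bar> \<le> L" unfolding bounded_pos by auto
  have "\<bar>F s\<bar> \<le> L * \<bar>s\<bar>" if "\<bar>s\<bar> \<le> M" for s
  proof -
    have "norm (F s - F 0) \<le> L * norm (s - 0)"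
    proof (rule field_differentiable_bound[of "{-M..M}" F F1])
      show "(F has_field_derivative F1 z) (at z within {-M..M})" for z
        using F(1) by (rule has_field_derivative_at_within)
    qed (use L that \<open>M > 0\<close> in auto)
    then show ?thesis using F(3) by simp
  qed
  with L that show ?thesis by blast
qed

context navier_stokes begin

lemma entropy_integrable:
  assumes F: "\<And>s. (F has_real_derivative F1 s) (at s)" "continuous_on UNIV F1" "F 0 = 0" and t: "t \<in> {0..T}"
  shows "integrable lborel (\<lambda>x. F (w t x))"
proof -
  obtain M where M: "M > 0" "\<And>t x. t \<in> {0..T} \<Longrightarrow> \<bar>w t x\<bar> \<le> M" using w_bounded by blast
  obtain L where L: "L > 0" "\<And>s. \<bar>s\<bar> \<le> M \<Longrightarrow> \<bar>F s\<bar> \<le> L * \<bar>s\<bar>"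
    using locally_lipschitz_at_zero[OF F M(1)] by blast
  have cF: "continuous_on UNIV F" using F(1) by (auto intro: DERIV_continuous_on)
  have [measurable]: "(\<lambda>x. F (w t x)) \<in> borel_measurable borel"
    by (rule borel_measurable_continuous_onI[OF continuous_on_compose2[OF cF w_continuous_slice[OF t] subset_UNIV]])
  show ?thesis
  proof (rule Bochner_Integration.integrable_bound)
    show "integrable lborel (\<lambda>x. L * w t x)" using w_integrable'[OF t] by simp
  qed (use L M t in \<open>auto simp: abs_mult\<close>)
qed

text \<open>Two balances are added: the localised one for an arbitrary nonlinearity \<open>\<beta>\<close>, and the global one for
  a convex \<open>F\<close> whose dissipation dominates that of \<open>\<beta>\<close>. The dissipation terms are
  only compared with each other, so the viscosity enters the bound through \<open>B\<close> alone. Taking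
  \<open>\<beta> = 0\<close> gives the decay of convex entropies, taking \<open>\<beta>\<close> to be a truncation gives equicontinuity in time.\<close>

lemma entropy_inequality:
  assumes F: "\<And>s. (F has_real_derivative F1 s) (at s)" "\<And>s. (F1 has_real_derivative F2 s) (at s)" "continuous_on UNIV F2" "F 0 = 0"
    and \<beta>: "\<And>s. (\<beta> has_real_derivative \<beta>1 s) (at s)" "\<And>s. (\<beta>1 has_real_derivative \<beta>2 s) (at s)" "continuous_on UNIV \<beta>2"
    and \<zeta>: "C_k 2 UNIV \<zeta>" "vanishes_outside R \<zeta>"
    and dom: "\<And>s x. \<bar>\<beta>2 s * \<zeta> x\<bar> \<le> F2 s"
    and B: "\<And>\<tau>. \<tau> \<in> {0<..<T} \<Longrightarrow> (\<integral>x. \<beta> (w \<tau> x) * (u \<tau> x \<bullet> grad \<zeta> x + \<nu> * laplacian \<zeta> x) \<partial>lborel) \<le> B"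
    and st: "0 \<le> s" "s \<le> t" "t \<le> T"
  shows "(\<integral>x. \<beta> (w t x) * \<zeta> x \<partial>lborel) - (\<integral>x. \<beta> (w s x) * \<zeta> x \<partial>lborel)
    \<le> (\<integral>x. F (w s x) \<partial>lborel) - (\<integral>x. F (w t x) \<partial>lborel) + B * (t - s)"
proof -
  have F2_nonneg: "F2 s \<ge> 0" for s using dom[of s 0] by linarith
  obtain M where M: "M > 0" "\<And>t x. t \<in> {0..T} \<Longrightarrow> \<bar>w t x\<bar> \<le> M" using w_bounded by blast
  obtain N where N: "N \<ge> 0" "\<And>t. t \<in> {0..T} \<Longrightarrow> (\<integral>x. \<bar>w t x\<bar> \<partial>lborel) \<le> N" using L1_norm_bounded by blast
  obtain U where U: "U \<ge> 0" "\<And>t x. t \<in> {0<..<T} \<Longrightarrow> norm (u t x) \<le> U" using u_bounded by blast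
  have cF: "continuous_on UNIV F" "continuous_on UNIV F1" "continuous_on UNIV \<beta>"
    using F \<beta> by (auto intro: DERIV_continuous_on)
  obtain L where L: "L > 0" "\<And>s. \<bar>s\<bar> \<le> M \<Longrightarrow> \<bar>F s\<bar> \<le> L * \<bar>s\<bar>"
    using locally_lipschitz_at_zero[OF F(1) cF(2) F(4) M(1)] by blast
  obtain c where c: "c > 0" "\<And>R x. R \<ge> 1 \<Longrightarrow> norm (grad (cutoff R) (x :: real^2)) \<le> c / R"
    "\<And>R x. R \<ge> 1 \<Longrightarrow> \<bar>laplacian (cutoff R) (x :: real^2)\<bar> \<le> c / R"
    using cutoff_derivative_bounds[where 'a = "real^2"] by metis
  have c\<zeta>: "continuous_on UNIV \<zeta>" using \<zeta> C_k_continuous by blast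
  have int_cont: "continuous_on {0..T} (\<lambda>\<tau>. \<integral>x. G (w \<tau> x) * \<eta> x \<partial>lborel)"
    if G: "continuous_on UNIV G" and \<eta>: "continuous_on UNIV \<eta>" "vanishes_outside r \<eta>"
      for G :: "real \<Rightarrow> real" and \<eta> :: "real^2 \<Rightarrow> real" and r
  proof -
    obtain a b :: "real^2" where ab: "cball 0 r \<subseteq> cbox a b" using cball_in_cbox by blast
    have 1: "continuous_on ({0..T} \<times> UNIV) (\<lambda>z. G (case z of (\<tau>, x) \<Rightarrow> w \<tau> x) * \<eta> (snd z))"
    proof (rule continuous_on_mult)
      show "continuous_on ({0..T} \<times> UNIV) (\<lambda>z. G (case z of (\<tau>, x) \<Rightarrow> w \<tau> x))"
        by (rule continuous_on_compose2[OF G w_continuous subset_UNIV])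
      show "continuous_on ({0..T} \<times> UNIV) (\<lambda>z::real \<times> (real^2). \<eta> (snd z))"
        by (rule continuous_on_compose2[OF \<eta>(1) _ subset_UNIV]) (intro continuous_intros)
    qed
    have "continuous_on ({0..T} \<times> cbox a b) (\<lambda>(\<tau>, x). G (w \<tau> x) * \<eta> x)"
      using continuous_on_subset[OF 1, of "{0..T} \<times> cbox a b"] by (auto simp: case_prod_unfold)
    then have ci: "continuous_on {0..T} (\<lambda>\<tau>. integral (cbox a b) (\<lambda>x. G (w \<tau> x) * \<eta> x))"
      by (rule integral_continuous_on_param)
    have eq: "(\<integral>x. G (w \<tau> x) * \<eta> x \<partial>lborel) = integral (cbox a b) (\<lambda>x. G (w \<tau> x) * \<eta> x)" if "\<tau> \<in> {0..T}" for \<tau>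
      by (rule integral_cbox_vanishing[OF _ vanishes_mult[OF \<eta>(2)] ab])
         (rule continuous_on_mult[OF continuous_on_compose2[OF G w_continuous_slice[OF that] subset_UNIV] \<eta>(1)])
    show ?thesis by (rule continuous_on_eq[OF ci eq[symmetric]])
  qed
  \<comment> \<open>The error of the spatial cut-off of radius \<open>\<rho>\<close> in the balance for \<open>F\<close> is \<open>K / \<rho>\<close>; here the maximum of the vorticity may enter, since \<open>\<rho>\<close> tends to infinity for a fixed solution.\<close>
  define K where "K = L * N * (U + \<nu>) * c"
  define e where "e \<tau> = (\<integral>x. \<beta> (w \<tau> x) * \<zeta> x \<partial>lborel)" for \<tau>
  have step: "(\<integral>x. F (w t x) * cutoff \<rho> x \<partial>lborel) + e t - ((\<integral>x. F (w s x) * cutoff \<rho> x \<partial>lborel) + e s) \<le> (K / \<rho> + B) * (t - s)"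
    if \<rho>: "\<rho> \<ge> 1" "\<rho> \<ge> R" for \<rho>
  proof -
    define \<theta> :: "real^2 \<Rightarrow> real" where "\<theta> = cutoff \<rho>"
    have \<theta>: "C_k n UNIV \<theta>" "vanishes_outside (2 * \<rho>) \<theta>" for n
      unfolding \<theta>_def by (rule C_k_cutoff, rule vanishes_cutoff) (use \<rho> in linarith)
    have \<theta>c: "continuous_on UNIV \<theta>" using \<theta>(1) C_k_continuous by blast
    define g where "g \<tau> = (\<integral>x. F (w \<tau> x) * \<theta> x \<partial>lborel) + e \<tau> - (K / \<rho> + B) * \<tau>" for \<tau>
    have "g t \<le> g s"
    proof (rule DERIV_nonpos_imp_decreasing_open[OF st(2)])
      show "continuous_on {s..t} g"
        unfolding g_def e_def
        by (rule continuous_on_subset[of "{0..T}"])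
           (use st in \<open>auto intro!: continuous_on_add continuous_on_diff continuous_on_mult continuous_on_const continuous_on_id
             int_cont[OF cF(1) \<theta>c \<theta>(2)] int_cont[OF cF(3) c\<zeta> \<zeta>(2)]\<close>)
      fix \<tau> assume "s < \<tau>" "\<tau> < t"
      then have \<tau>: "\<tau> \<in> {0<..<T}" "\<tau> \<in> {0..T}" using st by auto
      define A1 where "A1 = (\<integral>x. F (w \<tau> x) * (u \<tau> x \<bullet> grad \<theta> x + \<nu> * laplacian \<theta> x) \<partial>lborel)"
      define A2 where "A2 = (\<integral>x. F2 (w \<tau> x) * (norm (grad (w \<tau>) x))\<^sup>2 * \<theta> x \<partial>lborel)"
      define A3 where "A3 = (\<integral>x. \<beta> (w \<tau> x) * (u \<tau> x \<bullet> grad \<zeta> x + \<nu> * laplacian \<zeta> x) \<partial>lborel)"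
      define A4 where "A4 = (\<integral>x. \<beta>2 (w \<tau> x) * (norm (grad (w \<tau>) x))\<^sup>2 * \<zeta> x \<partial>lborel)"
      have d: "(g has_real_derivative (A1 - \<nu> * A2) + (A3 - \<nu> * A4) - (K / \<rho> + B)) (at \<tau>)"
        unfolding g_def[abs_def] e_def A1_def A2_def A3_def A4_def
        by (intro DERIV_diff DERIV_add local_entropy_balance[OF F(1-3) \<theta> \<tau>(1)]
              local_entropy_balance[OF \<beta> \<zeta> \<tau>(1)] DERIV_cmult_Id)
      have A1: "A1 \<le> K / \<rho>"
      proof -
        have "A1 \<le> (\<integral>x. (L * (U + \<nu>) * c / \<rho>) * \<bar>w \<tau> x\<bar> \<partial>lborel)"
          unfolding A1_def
        proof (rule integral_mono')
          show "integrable lborel (\<lambda>x. (L * (U + \<nu>) * c / \<rho>) * \<bar>w \<tau> x\<bar>)" using w_integrable'[OF \<tau>(2)] by simp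
          fix x
          have "\<bar>u \<tau> x \<bullet> grad \<theta> x + \<nu> * laplacian \<theta> x\<bar> \<le> \<bar>u \<tau> x \<bullet> grad \<theta> x\<bar> + \<bar>\<nu> * laplacian \<theta> x\<bar>"
            by (rule abs_triangle_ineq)
          also have "\<dots> \<le> norm (u \<tau> x) * norm (grad \<theta> x) + \<nu> * \<bar>laplacian \<theta> x\<bar>"
            using nu_pos by (intro add_mono Cauchy_Schwarz_ineq2) (simp add: abs_mult)
          also have "\<dots> \<le> U * (c / \<rho>) + \<nu> * (c / \<rho>)"
            using U \<tau> c \<rho> nu_pos unfolding \<theta>_def by (intro add_mono mult_mono) auto
          finally have 1: "\<bar>u \<tau> x \<bullet> grad \<theta> x + \<nu> * laplacian \<theta> x\<bar> \<le> (U + \<nu>) * (c / \<rho>)" by (simp only: distrib_right)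
          have "F (w \<tau> x) * (u \<tau> x \<bullet> grad \<theta> x + \<nu> * laplacian \<theta> x) \<le> \<bar>F (w \<tau> x)\<bar> * \<bar>u \<tau> x \<bullet> grad \<theta> x + \<nu> * laplacian \<theta> x\<bar>"
            by (metis abs_ge_self abs_mult)
          also have "\<dots> \<le> (L * \<bar>w \<tau> x\<bar>) * ((U + \<nu>) * (c / \<rho>))"
            using 1 L M \<tau> by (intro mult_mono) auto
          finally show "F (w \<tau> x) * (u \<tau> x \<bullet> grad \<theta> x + \<nu> * laplacian \<theta> x) \<le> (L * (U + \<nu>) * c / \<rho>) * \<bar>w \<tau> x\<bar>"
            by (simp add: mult_ac)
          show "0 \<le> (L * (U + \<nu>) * c / \<rho>) * \<bar>w \<tau> x\<bar>" using L U c nu_pos \<rho> by simp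
        qed
        also have "\<dots> = (L * (U + \<nu>) * c / \<rho>) * (\<integral>x. \<bar>w \<tau> x\<bar> \<partial>lborel)" by simp
        also have "\<dots> \<le> (L * (U + \<nu>) * c / \<rho>) * N"
          using N \<tau> L U c nu_pos \<rho> by (intro mult_left_mono) auto
        finally show ?thesis by (simp add: K_def mult_ac)
      qed
      have gc: "continuous_on UNIV (\<lambda>x. (norm (grad (w \<tau>) x))\<^sup>2)"
        by (intro continuous_on_power continuous_on_norm grad_measurable(3)[OF w_C_k[OF \<tau>(1)]])
      have i2: "integrable lborel (\<lambda>x. F2 (w \<tau> x) * (norm (grad (w \<tau>) x))\<^sup>2 * \<theta> x)"
        by (rule integrable_continuous_vanishing[OF _ vanishes_mult[OF \<theta>(2)]])
           (intro continuous_on_mult gc \<theta>c continuous_on_compose2[OF F(3) w_continuous_slice[OF \<tau>(2)] subset_UNIV])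
      have i4: "integrable lborel (\<lambda>x. \<beta>2 (w \<tau> x) * (norm (grad (w \<tau>) x))\<^sup>2 * \<zeta> x)"
        by (rule integrable_continuous_vanishing[OF _ vanishes_mult[OF \<zeta>(2)]])
           (intro continuous_on_mult gc c\<zeta> continuous_on_compose2[OF \<beta>(3) w_continuous_slice[OF \<tau>(2)] subset_UNIV])
      \<comment> \<open>The dissipation terms add up to something nonnegative pointwise: where \<open>\<zeta>\<close> lives the cut-off equals 1.\<close>
      have "0 \<le> (\<integral>x. F2 (w \<tau> x) * (norm (grad (w \<tau>) x))\<^sup>2 * \<theta> x + \<beta>2 (w \<tau> x) * (norm (grad (w \<tau>) x))\<^sup>2 * \<zeta> x \<partial>lborel)"
      proof (rule integral_nonneg_AE, rule AE_I2)
        fix x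
        have "0 \<le> F2 (w \<tau> x) * \<theta> x + \<beta>2 (w \<tau> x) * \<zeta> x"
        proof (cases "norm x \<le> R")
          case True
          then have "\<theta> x = 1" unfolding \<theta>_def using \<rho> by (intro cutoff_1) auto
          then show ?thesis using dom[of "w \<tau> x" x] by simp
        next
          case False
          then have "\<zeta> x = 0" using \<zeta>(2) by (simp add: vanishes_outside_def)
          then show ?thesis using F2_nonneg cutoff_bounds(1)[of \<rho> x] by (simp add: \<theta>_def)
        qed
        then have "0 \<le> (F2 (w \<tau> x) * \<theta> x + \<beta>2 (w \<tau> x) * \<zeta> x) * (norm (grad (w \<tau>) x))\<^sup>2" by simp
        then show "0 \<le> F2 (w \<tau> x) * (norm (grad (w \<tau>) x))\<^sup>2 * \<theta> x + \<beta>2 (w \<tau> x) * (norm (grad (w \<tau>) x))\<^sup>2 * \<zeta> x"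
          by (simp add: algebra_simps)
      qed
      then have "A2 + A4 \<ge> 0" unfolding A2_def A4_def using i2 i4 by simp
      then have "\<nu> * (A2 + A4) \<ge> 0" using nu_pos by simp
      moreover have "A3 \<le> B" unfolding A3_def by (rule B[OF \<tau>(1)])
      ultimately have "(A1 - \<nu> * A2) + (A3 - \<nu> * A4) - (K / \<rho> + B) \<le> 0"
        using A1 by (simp add: algebra_simps)
      with d show "\<exists>y. (g has_real_derivative y) (at \<tau>) \<and> y \<le> 0" by blast
    qed
    then show ?thesis unfolding g_def \<theta>_def right_diff_distrib by linarith
  qed
  define \<rho> where "\<rho> n = max R 1 + real n" for n
  have lim: "(\<lambda>n. \<integral>x. F (w \<tau> x) * cutoff (\<rho> n) x \<partial>lborel) \<longlonglongrightarrow> (\<integral>x. F (w \<tau> x) \<partial>lborel)" if \<tau>: "\<tau> \<in> {0..T}" for \<tau>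
  proof (rule integral_dominated_convergence)
    have [measurable]: "(\<lambda>x. F (w \<tau> x)) \<in> borel_measurable borel"
      by (rule borel_measurable_continuous_onI[OF continuous_on_compose2[OF cF(1) w_continuous_slice[OF \<tau>] subset_UNIV]])
    have [measurable]: "cutoff (\<rho> n) \<in> borel_measurable (borel :: (real^2) measure)" for n
      using C_k_continuous[OF C_k_cutoff] by (rule borel_measurable_continuous_onI)
    show "(\<lambda>x. F (w \<tau> x)) \<in> borel_measurable lborel" "(\<lambda>x. F (w \<tau> x) * cutoff (\<rho> n) x) \<in> borel_measurable lborel" for n
      by measurable
    show "integrable lborel (\<lambda>x. \<bar>F (w \<tau> x)\<bar>)"
      by (rule integrable_abs[OF entropy_integrable[OF F(1) cF(2) F(4) \<tau>]])
    show "AE x in lborel. (\<lambda>n. F (w \<tau> x) * cutoff (\<rho> n) x) \<longlonglongrightarrow> F (w \<tau> x)"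
    proof (rule AE_I2)
      fix x :: "real^2"
      obtain n0 where n0: "norm x \<le> real n0" using real_arch_simple by blast
      have "\<forall>\<^sub>F n in sequentially. F (w \<tau> x) = F (w \<tau> x) * cutoff (\<rho> n) x"
        using eventually_ge_at_top[of n0]
      proof eventually_elim
        fix n assume "n \<ge> n0"
        then have "cutoff (\<rho> n) x = 1" using n0 by (intro cutoff_1) (auto simp: \<rho>_def)
        then show "F (w \<tau> x) = F (w \<tau> x) * cutoff (\<rho> n) x" by simp
      qed
      then show "(\<lambda>n. F (w \<tau> x) * cutoff (\<rho> n) x) \<longlonglongrightarrow> F (w \<tau> x)"
        by (rule Lim_transform_eventually[OF tendsto_const])
    qed
    show "AE x in lborel. norm (F (w \<tau> x) * cutoff (\<rho> n) x) \<le> \<bar>F (w \<tau> x)\<bar>" for n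
      by (intro AE_I2) (simp add: abs_mult mult_left_le cutoff_bounds)
  qed
  have "(\<lambda>n. K / \<rho> n) \<longlonglongrightarrow> 0" unfolding \<rho>_def by real_asymp
  then have R: "(\<lambda>n. (K / \<rho> n + B) * (t - s)) \<longlonglongrightarrow> (0 + B) * (t - s)" by (intro tendsto_intros)
  have Lh: "(\<lambda>n. (\<integral>x. F (w t x) * cutoff (\<rho> n) x \<partial>lborel) + e t - ((\<integral>x. F (w s x) * cutoff (\<rho> n) x \<partial>lborel) + e s))
    \<longlonglongrightarrow> (\<integral>x. F (w t x) \<partial>lborel) + e t - ((\<integral>x. F (w s x) \<partial>lborel) + e s)"
    using st by (intro tendsto_intros lim) auto
  have "(\<integral>x. F (w t x) \<partial>lborel) + e t - ((\<integral>x. F (w s x) \<partial>lborel) + e s) \<le> (0 + B) * (t - s)"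
    by (rule LIMSEQ_le[OF Lh R]) (use step in \<open>auto simp: \<rho>_def\<close>)
  then show ?thesis by (simp add: e_def)
qed

end

section \<open>Truncations and regularised powers\<close>

text \<open>A smooth convex substitute for \<open>max 0 (\<bar>s\<bar> - k)\<close>: it is at most \<open>\<bar>s\<bar>\<close>, vanishes at 0, and decreases to
  0 as \<open>k\<close> grows, so that its integral measures how much mass a function carries on large values. For
  \<open>k = 1\<close> it also serves as the strictly convex energy that detects strong convergence.\<close>

definition soft_abs :: "real \<Rightarrow> real \<Rightarrow> real" where
  "soft_abs k s = sqrt (k\<^sup>2 + s\<^sup>2) - k"

text \<open>A smooth truncation at height \<open>k\<close>. It is matched to \<open>soft_abs\<close>: the truncation error is at most
  \<open>soft_abs k s\<close> (\<open>trunc_error\<close>), and its second derivative is at most three times that of \<open>soft_abs k\<close>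
  (\<open>trunc_deriv2_le\<close>).\<close>

definition trunc :: "real \<Rightarrow> real \<Rightarrow> real" where
  "trunc k s = k * s / sqrt (k\<^sup>2 + s\<^sup>2)"

lemma soft_abs_nonneg: "k > 0 \<Longrightarrow> soft_abs k s \<ge> 0"
  by (simp add: soft_abs_def real_le_rsqrt)

lemma soft_abs_le: "k > 0 \<Longrightarrow> soft_abs k s \<le> \<bar>s\<bar>"
  using sqrt_sum_squares_le_sum_abs[of k s] by (simp add: soft_abs_def)

lemma soft_abs_zero [simp]: "k > 0 \<Longrightarrow> soft_abs k 0 = 0"
  by (simp add: soft_abs_def)

lemma sqrt_pos: "k > 0 \<Longrightarrow> sqrt (k\<^sup>2 + s\<^sup>2) > 0"
  by (simp add: add_pos_nonneg)

lemma soft_abs_deriv: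
  assumes "k > 0"
  shows "(soft_abs k has_real_derivative s / sqrt (k\<^sup>2 + s\<^sup>2)) (at s)"
proof -
  have "k\<^sup>2 + s\<^sup>2 > 0" using assms by (simp add: add_pos_nonneg)
  then show ?thesis
    unfolding soft_abs_def[abs_def] using assms by (auto intro!: derivative_eq_intros simp: field_simps)
qed

lemma soft_abs_deriv2:
  assumes "k > 0"
  shows "((\<lambda>s. s / sqrt (k\<^sup>2 + s\<^sup>2)) has_real_derivative k\<^sup>2 / sqrt (k\<^sup>2 + s\<^sup>2) ^ 3) (at s)"
proof -
  define q where "q = sqrt (k\<^sup>2 + s\<^sup>2)"
  have q: "q > 0" "q\<^sup>2 = k\<^sup>2 + s\<^sup>2" using sqrt_pos[OF assms] by (auto simp: q_def)
  have d: "((\<lambda>s. sqrt (k\<^sup>2 + s\<^sup>2)) has_real_derivative s / q) (at s)"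
    using q assms unfolding q_def by (auto intro!: derivative_eq_intros simp: field_simps)
  have "((\<lambda>s. s / sqrt (k\<^sup>2 + s\<^sup>2)) has_real_derivative (1 * q - s * (s / q)) / (q * q)) (at s)"
    unfolding q_def by (rule DERIV_divide[OF DERIV_ident d[unfolded q_def]]) (use assms in simp)
  moreover have "(1 * q - s * (s / q)) / (q * q) = k\<^sup>2 / q ^ 3"
  proof -
    have "1 * q - s * (s / q) = (q\<^sup>2 - s\<^sup>2) / q" using q(1) by (simp add: field_simps power2_eq_square)
    also have "\<dots> = k\<^sup>2 / q" using q(2) by simp
    finally show ?thesis by (simp add: power3_eq_cube)
  qed
  ultimately show ?thesis by (simp add: q_def)
qed

lemma trunc_deriv2:
  assumes "k > 0"
  shows "((\<lambda>s. k ^ 3 / sqrt (k\<^sup>2 + s\<^sup>2) ^ 3) has_real_derivative - 3 * k ^ 3 * s / sqrt (k\<^sup>2 + s\<^sup>2) ^ 5) (at s)"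
proof -
  define q where "q = sqrt (k\<^sup>2 + s\<^sup>2)"
  have q: "q > 0" "q\<^sup>2 = k\<^sup>2 + s\<^sup>2" using sqrt_pos[OF assms] by (auto simp: q_def)
  have d: "((\<lambda>s. sqrt (k\<^sup>2 + s\<^sup>2)) has_real_derivative s / q) (at s)"
    using q assms unfolding q_def by (auto intro!: derivative_eq_intros simp: field_simps)
  have d3: "((\<lambda>s. sqrt (k\<^sup>2 + s\<^sup>2) ^ 3) has_real_derivative 3 * q ^ 2 * (s / q)) (at s)"
    using DERIV_power[OF d, of 3] by (simp add: q_def mult_ac)
  have "((\<lambda>s. k ^ 3 / sqrt (k\<^sup>2 + s\<^sup>2) ^ 3) has_real_derivative
     (0 * q ^ 3 - k ^ 3 * (3 * q ^ 2 * (s / q))) / (q ^ 3 * q ^ 3)) (at s)"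
    unfolding q_def
    by (rule DERIV_divide[OF DERIV_const d3[unfolded q_def]]) (use assms in simp)
  moreover have "(0 * q ^ 3 - k ^ 3 * (3 * q ^ 2 * (s / q))) / (q ^ 3 * q ^ 3) = - 3 * k ^ 3 * s / q ^ 5"
    using q(1) by (simp add: field_simps power2_eq_square eval_nat_numeral)
  ultimately show ?thesis by (simp add: q_def)
qed

lemma trunc_deriv:
  assumes "k > 0"
  shows "(trunc k has_real_derivative k ^ 3 / sqrt (k\<^sup>2 + s\<^sup>2) ^ 3) (at s)"
  using DERIV_cmult[OF soft_abs_deriv2[OF assms], of k s]
  unfolding trunc_def[abs_def] by (simp add: power2_eq_square power3_eq_cube mult_ac)

lemma trunc_deriv2_le:
  assumes "k > 0"
  shows "\<bar>- 3 * k ^ 3 * s / sqrt (k\<^sup>2 + s\<^sup>2) ^ 5\<bar> \<le> 3 * (k\<^sup>2 / sqrt (k\<^sup>2 + s\<^sup>2) ^ 3)"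
proof -
  define q where "q = sqrt (k\<^sup>2 + s\<^sup>2)"
  have q: "q > 0" "q\<^sup>2 = k\<^sup>2 + s\<^sup>2" using sqrt_pos[OF assms] by (auto simp: q_def)
  have "2 * (k * \<bar>s\<bar>) \<le> k\<^sup>2 + s\<^sup>2" using sum_squares_bound[of k "\<bar>s\<bar>"] by simp
  moreover have "0 \<le> k * \<bar>s\<bar>" using assms by simp
  ultimately have "k * \<bar>s\<bar> \<le> q\<^sup>2" unfolding q(2) by linarith
  then have r: "k * \<bar>s\<bar> / q\<^sup>2 \<le> 1" using q(1) by simp
  have "\<bar>- 3 * k ^ 3 * s / q ^ 5\<bar> = 3 * (k\<^sup>2 / q ^ 3) * (k * \<bar>s\<bar> / q\<^sup>2)"
    using q(1) assms by (simp add: abs_mult eval_nat_numeral)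
  also have "\<dots> \<le> 3 * (k\<^sup>2 / q ^ 3) * 1" using r q(1) by (intro mult_left_mono) auto
  finally show ?thesis by (simp add: q_def)
qed

lemma trunc_bounded: assumes "k > 0" shows "\<bar>trunc k s\<bar> \<le> k"
proof -
  have "\<bar>s\<bar> \<le> sqrt (k\<^sup>2 + s\<^sup>2)" by (rule real_le_rsqrt) simp
  then show ?thesis using sqrt_pos[OF assms, of s] assms
    by (simp add: trunc_def abs_mult divide_le_eq)
qed

lemma trunc_error: assumes "k > 0" shows "\<bar>s - trunc k s\<bar> \<le> soft_abs k s"
proof -
  define q where "q = sqrt (k\<^sup>2 + s\<^sup>2)"
  have q: "q > 0" using sqrt_pos[OF assms] by (auto simp: q_def)
  have s: "\<bar>s\<bar> \<le> q" unfolding q_def by (rule real_le_rsqrt) simp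
  have kq: "k \<le> q" unfolding q_def by (rule real_le_rsqrt) simp
  have "s - trunc k s = s * (q - k) / q" using q by (simp add: trunc_def q_def[symmetric] field_simps)
  then have "\<bar>s - trunc k s\<bar> = (\<bar>s\<bar> / q) * (q - k)" using q kq by (simp add: abs_mult)
  also have "\<dots> \<le> 1 * (q - k)" using s q kq by (intro mult_right_mono) auto
  finally show ?thesis by (simp add: soft_abs_def q_def)
qed

lemma abs_le_soft_abs: assumes "k > 0" shows "\<bar>s\<bar> \<le> k + soft_abs k s"
  using trunc_bounded[OF assms, of s] trunc_error[OF assms, of s] by linarith

lemma soft_abs_lipschitz: assumes "k > 0" shows "\<bar>soft_abs k a - soft_abs k b\<bar> \<le> \<bar>a - b\<bar>"
proof -
  have "norm (soft_abs k a - soft_abs k b) \<le> 1 * norm (a - b)"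
  proof (rule field_differentiable_bound[of UNIV "soft_abs k" "\<lambda>s. s / sqrt (k\<^sup>2 + s\<^sup>2)"])
    show "(soft_abs k has_field_derivative s / sqrt (k\<^sup>2 + s\<^sup>2)) (at s within UNIV)" for s
      using soft_abs_deriv[OF assms] by simp
    show "norm (s / sqrt (k\<^sup>2 + s\<^sup>2)) \<le> 1" for s
    proof -
      have "\<bar>s\<bar> \<le> sqrt (k\<^sup>2 + s\<^sup>2)" by (rule real_le_rsqrt) simp
      then show ?thesis using sqrt_pos[OF assms, of s] by (simp add: divide_le_eq)
    qed
  qed auto
  then show ?thesis by simp
qed

lemma soft_abs_measurable [measurable]: "soft_abs k \<in> borel_measurable borel"
  unfolding soft_abs_def[abs_def] by measurable

lemma trunc_measurable [measurable]: "trunc k \<in> borel_measurable borel"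
  unfolding trunc_def[abs_def] by measurable

text \<open>The function \<open>\<bar>s\<bar> powr p\<close> is not twice differentiable at 0 for \<open>p < 2\<close>; this convex regularisation is,
  and it vanishes at 0.\<close>

definition reg_power :: "real \<Rightarrow> real \<Rightarrow> real \<Rightarrow> real" where
  "reg_power p \<epsilon> s = (s\<^sup>2 + \<epsilon>\<^sup>2) powr (p / 2) - (\<epsilon>\<^sup>2) powr (p / 2)"

lemma reg_power_deriv:
  assumes "\<epsilon> > 0"
  shows "(reg_power p \<epsilon> has_real_derivative p * (s * (s\<^sup>2 + \<epsilon>\<^sup>2) powr (p / 2 - 1))) (at s)"
    and "((\<lambda>s. p * (s * (s\<^sup>2 + \<epsilon>\<^sup>2) powr (p / 2 - 1))) has_real_derivative
      p * ((s\<^sup>2 + \<epsilon>\<^sup>2) powr (p / 2 - 2) * ((p - 1) * s\<^sup>2 + \<epsilon>\<^sup>2))) (at s)"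
proof -
  have pos: "s\<^sup>2 + \<epsilon>\<^sup>2 > 0" using assms by (simp add: add_nonneg_pos)
  show "(reg_power p \<epsilon> has_real_derivative p * (s * (s\<^sup>2 + \<epsilon>\<^sup>2) powr (p / 2 - 1))) (at s)"
  proof -
    have "((\<lambda>s. s\<^sup>2 + \<epsilon>\<^sup>2) has_real_derivative 2 * s) (at s)" by (auto intro!: derivative_eq_intros)
    from DERIV_diff[OF DERIV_fun_powr[OF this pos, of "p / 2"] DERIV_const]
    show ?thesis unfolding reg_power_def[abs_def] by (rule DERIV_cong) simp
  qed
  have split: "(s\<^sup>2 + \<epsilon>\<^sup>2) powr (p / 2 - 1) = (s\<^sup>2 + \<epsilon>\<^sup>2) powr (p / 2 - 2) * (s\<^sup>2 + \<epsilon>\<^sup>2)"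
  proof -
    have "p / 2 - 1 = (p / 2 - 2) + 1" by simp
    then show ?thesis using pos by (metis powr_add powr_one less_imp_le)
  qed
  have d: "((\<lambda>s. (s\<^sup>2 + \<epsilon>\<^sup>2) powr (p / 2 - 1)) has_real_derivative
     (p / 2 - 1) * (s\<^sup>2 + \<epsilon>\<^sup>2) powr (p / 2 - 2) * (2 * s)) (at s)"
  proof -
    have "((\<lambda>s. s\<^sup>2 + \<epsilon>\<^sup>2) has_real_derivative 2 * s) (at s)" by (auto intro!: derivative_eq_intros)
    from DERIV_fun_powr[OF this pos, of "p / 2 - 1"] show ?thesis by simp
  qed
  have "((\<lambda>s. p * (s * (s\<^sup>2 + \<epsilon>\<^sup>2) powr (p / 2 - 1))) has_real_derivative
     p * (1 * (s\<^sup>2 + \<epsilon>\<^sup>2) powr (p / 2 - 1) + (p / 2 - 1) * (s\<^sup>2 + \<epsilon>\<^sup>2) powr (p / 2 - 2) * (2 * s) * s)) (at s)"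
    by (rule DERIV_cmult, rule DERIV_mult[OF DERIV_ident d])
  moreover have "p * (1 * (s\<^sup>2 + \<epsilon>\<^sup>2) powr (p / 2 - 1) + (p / 2 - 1) * (s\<^sup>2 + \<epsilon>\<^sup>2) powr (p / 2 - 2) * (2 * s) * s)
     = p * ((s\<^sup>2 + \<epsilon>\<^sup>2) powr (p / 2 - 2) * ((p - 1) * s\<^sup>2 + \<epsilon>\<^sup>2))"
    unfolding split by (simp add: algebra_simps power2_eq_square)
  ultimately show "((\<lambda>s. p * (s * (s\<^sup>2 + \<epsilon>\<^sup>2) powr (p / 2 - 1))) has_real_derivative
      p * ((s\<^sup>2 + \<epsilon>\<^sup>2) powr (p / 2 - 2) * ((p - 1) * s\<^sup>2 + \<epsilon>\<^sup>2))) (at s)" by (rule DERIV_cong)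
qed

lemma reg_power_nonneg: "p \<ge> 1 \<Longrightarrow> reg_power p \<epsilon> s \<ge> 0"
  unfolding reg_power_def by (simp add: powr_mono2)

lemma reg_power_tendsto:
  assumes "p \<ge> 1" "\<epsilon> \<longlonglongrightarrow> 0"
  shows "(\<lambda>n. reg_power p (\<epsilon> n) s) \<longlonglongrightarrow> \<bar>s\<bar> powr p"
proof -
  have c: "continuous_on {0..} (\<lambda>x::real. x powr (p / 2))"
    using assms(1) by (intro continuous_on_powr') (auto intro!: continuous_intros)
  have e2: "(\<lambda>n. (\<epsilon> n)\<^sup>2) \<longlonglongrightarrow> 0" using tendsto_power[OF assms(2), of 2] by simp
  have 1: "(\<lambda>n. (s\<^sup>2 + (\<epsilon> n)\<^sup>2) powr (p / 2)) \<longlonglongrightarrow> (s\<^sup>2 + 0) powr (p / 2)"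
    by (rule continuous_on_tendsto_compose[OF c tendsto_add[OF tendsto_const e2]]) auto
  have 2: "(\<lambda>n. ((\<epsilon> n)\<^sup>2) powr (p / 2)) \<longlonglongrightarrow> 0 powr (p / 2)"
    by (rule continuous_on_tendsto_compose[OF c e2]) auto
  have "(s\<^sup>2 + 0) powr (p / 2) - 0 powr (p / 2) = \<bar>s\<bar> powr p"
  proof -
    have s2: "\<bar>s\<bar> powr 2 = s\<^sup>2" by (simp add: powr_numeral)
    have "(s\<^sup>2) powr (p / 2) = (\<bar>s\<bar> powr 2) powr (p / 2)" by (simp only: s2)
    also have "\<dots> = \<bar>s\<bar> powr p" unfolding powr_powr by simp
    finally show ?thesis by simp
  qed
  with tendsto_diff[OF 1 2] show ?thesis by (simp add: reg_power_def)
qed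

lemma powr_le_linear:
  assumes "p \<ge> 1" "\<bar>s\<bar> \<le> M"
  shows "\<bar>s::real\<bar> powr p \<le> M powr (p - 1) * \<bar>s\<bar>"
proof (cases "s = 0")
  case False
  have "\<bar>s\<bar> powr p = \<bar>s\<bar> powr ((p - 1) + 1)" by simp
  also have "\<dots> = \<bar>s\<bar> powr (p - 1) * \<bar>s\<bar>" unfolding powr_add by simp
  also have "\<dots> \<le> M powr (p - 1) * \<bar>s\<bar>"
    using assms False by (auto intro!: mult_right_mono powr_mono2)
  finally show ?thesis .
qed simp

context navier_stokes begin

lemma convex_entropy_decay:
  assumes F: "\<And>s. (F has_real_derivative F1 s) (at s)" "\<And>s. (F1 has_real_derivative F2 s) (at s)" "continuous_on UNIV F2" "F 0 = 0"
    and convex: "\<And>s. F2 s \<ge> 0" and t: "t \<in> {0..T}"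
  shows "(\<integral>x. F (w t x) \<partial>lborel) \<le> (\<integral>x. F (w0 x) \<partial>lborel)"
proof -
  have "(\<integral>x. 0 * 0 \<partial>(lborel :: (real^2) measure)) - (\<integral>x. 0 * 0 \<partial>(lborel :: (real^2) measure))
    \<le> (\<integral>x. F (w 0 x) \<partial>lborel) - (\<integral>x. F (w t x) \<partial>lborel) + 0 * (t - 0)"
    by (rule entropy_inequality[OF F, where \<beta> = "\<lambda>_. 0" and \<zeta> = "\<lambda>_. 0" and ?\<beta>1.0 = "\<lambda>_. 0" and ?\<beta>2.0 = "\<lambda>_. 0" and R = 0])
       (use convex t in \<open>auto simp: C_k_const vanishes_outside_def\<close>)
  then show ?thesis by (simp add: w_initial)
qed

lemma soft_abs_integrable: "k > 0 \<Longrightarrow> t \<in> {0..T} \<Longrightarrow> integrable lborel (\<lambda>x. soft_abs k (w t x))"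
proof (rule entropy_integrable[OF soft_abs_deriv])
  assume "k > 0"
  then show "continuous_on UNIV (\<lambda>s. s / sqrt (k\<^sup>2 + s\<^sup>2))"
    by (intro DERIV_continuous_on[OF has_field_derivative_at_within[OF soft_abs_deriv2]])
qed auto

lemma soft_abs_decay:
  assumes "k > 0" and t: "t \<in> {0..T}"
  shows "(\<integral>x. soft_abs k (w t x) \<partial>lborel) \<le> (\<integral>x. soft_abs k (w0 x) \<partial>lborel)"
proof (rule convex_entropy_decay[OF soft_abs_deriv[OF assms(1)] soft_abs_deriv2[OF assms(1)] _ _ _ t])
  show "continuous_on UNIV (\<lambda>s. k\<^sup>2 / sqrt (k\<^sup>2 + s\<^sup>2) ^ 3)"
    using sqrt_pos[OF assms(1)] by (intro continuous_intros) (auto simp: less_le)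
qed (use assms in auto)

lemma w_powr_integrable:
  assumes p: "p \<ge> 1" and t: "t \<in> {0..T}"
  shows "integrable lborel (\<lambda>x. \<bar>w t x\<bar> powr p)"
proof -
  obtain M where M: "M > 0" "\<And>t x. t \<in> {0..T} \<Longrightarrow> \<bar>w t x\<bar> \<le> M" using w_bounded by blast
  note [measurable] = w_borel[OF t]
  show ?thesis
  proof (rule Bochner_Integration.integrable_bound)
    show "integrable lborel (\<lambda>x. M powr (p - 1) * \<bar>w t x\<bar>)" using w_integrable'[OF t] by simp
  qed (use powr_le_linear[OF p] M t in auto)
qed

text \<open>The regularised powers decay; on the right they converge by dominated convergence, the initial datum
  being bounded with bounded support, and on the left Fatou's lemma suffices.\<close>

lemma Lp_decay:
  assumes p: "p \<ge> 1" and t: "t \<in> {0..T}" and w0: "vanishes_outside R w0"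
  shows "(\<integral>x. \<bar>w t x\<bar> powr p \<partial>lborel) \<le> (\<integral>x. \<bar>w0 x\<bar> powr p \<partial>lborel)"
proof -
  define e where "e n = 1 / real (Suc n)" for n
  have e: "e n > 0" "e n \<le> 1" for n by (auto simp: e_def)
  have e0: "e \<longlonglongrightarrow> 0" unfolding e_def by real_asymp
  have T0: "0 \<in> {0..T}" using T_pos by simp
  obtain M where M: "M > 0" "\<And>t x. t \<in> {0..T} \<Longrightarrow> \<bar>w t x\<bar> \<le> M" using w_bounded by blast
  note [measurable] = w_borel[OF t] w_borel[OF T0, unfolded w_initial]
  have [measurable]: "reg_power p (e n) \<in> borel_measurable borel" for n
    unfolding reg_power_def[abs_def] by measurable
  have F1c: "continuous_on UNIV (\<lambda>s. p * (s * (s\<^sup>2 + (e n)\<^sup>2) powr (p / 2 - 1)))" for n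
    by (intro DERIV_continuous_on[OF has_field_derivative_at_within[OF reg_power_deriv(2)[OF e(1)]]])
  have F0: "reg_power p (e n) 0 = 0" for n by (simp add: reg_power_def)
  have int: "integrable lborel (\<lambda>x. reg_power p (e n) (w t x))" if "t \<in> {0..T}" for n t
    by (rule entropy_integrable[OF reg_power_deriv(1)[OF e(1)] F1c F0 that])
  have dec: "(\<integral>x. reg_power p (e n) (w t x) \<partial>lborel) \<le> (\<integral>x. reg_power p (e n) (w0 x) \<partial>lborel)" for n
  proof (rule convex_entropy_decay[OF reg_power_deriv[OF e(1)] _ F0 _ t])
    have nz: "s\<^sup>2 + (e n)\<^sup>2 \<noteq> 0" for s using e(1)[of n] by (metis add_nonneg_pos less_irrefl zero_le_power2 zero_less_power)
    show "continuous_on UNIV (\<lambda>s. p * ((s\<^sup>2 + (e n)\<^sup>2) powr (p / 2 - 2) * ((p - 1) * s\<^sup>2 + (e n)\<^sup>2)))"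
      by (intro continuous_intros) (use nz in auto)
    show "0 \<le> p * ((s\<^sup>2 + (e n)\<^sup>2) powr (p / 2 - 2) * ((p - 1) * s\<^sup>2 + (e n)\<^sup>2))" for s
      using p by (intro mult_nonneg_nonneg add_nonneg_nonneg) auto
  qed
  have lim0: "(\<lambda>n. \<integral>x. reg_power p (e n) (w0 x) \<partial>lborel) \<longlonglongrightarrow> (\<integral>x. \<bar>w0 x\<bar> powr p \<partial>lborel)"
  proof (rule integral_dominated_convergence)
    show "integrable lborel (\<lambda>x. (M\<^sup>2 + 1) powr (p / 2) * indicator (cball (0::real^2) R) x)"
      by (intro integrable_mult_right integrable_real_indicator)
         (auto simp: emeasure_bounded_finite[OF bounded_cball, simplified])
    show "AE x in lborel. norm (reg_power p (e n) (w0 x)) \<le> (M\<^sup>2 + 1) powr (p / 2) * indicator (cball 0 R) x" for n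
    proof (rule AE_I2)
      fix x
      show "norm (reg_power p (e n) (w0 x)) \<le> (M\<^sup>2 + 1) powr (p / 2) * indicator (cball 0 R) x"
      proof (cases "x \<in> cball 0 R")
        case True
        have "\<bar>w0 x\<bar> \<le> M" using M(2)[OF T0, of x] by (simp add: w_initial)
        then have "\<bar>w0 x\<bar>\<^sup>2 \<le> M\<^sup>2" by (intro power_mono) auto
        moreover have "(e n)\<^sup>2 \<le> 1" using e[of n] by (simp add: power_le_one)
        ultimately have "((w0 x)\<^sup>2 + (e n)\<^sup>2) powr (p / 2) \<le> (M\<^sup>2 + 1) powr (p / 2)"
          using p by (intro powr_mono2) auto
        then have "reg_power p (e n) (w0 x) \<le> (M\<^sup>2 + 1) powr (p / 2)"
          unfolding reg_power_def using powr_ge_zero[of "(e n)\<^sup>2" "p / 2"] by linarith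
        then show ?thesis using True reg_power_nonneg[OF p] by simp
      next
        case False
        then show ?thesis using w0 by (simp add: vanishes_outside_def F0)
      qed
    qed
    show "AE x in lborel. (\<lambda>n. reg_power p (e n) (w0 x)) \<longlonglongrightarrow> \<bar>w0 x\<bar> powr p"
      by (intro AE_I2 reg_power_tendsto p e0)
  qed auto
  have "(\<integral>\<^sup>+x. ennreal (\<bar>w t x\<bar> powr p) \<partial>lborel) = (\<integral>\<^sup>+x. liminf (\<lambda>n. ennreal (reg_power p (e n) (w t x))) \<partial>lborel)"
    by (intro nn_integral_cong lim_imp_Liminf[symmetric] tendsto_ennrealI reg_power_tendsto p e0) simp
  also have "\<dots> \<le> liminf (\<lambda>n. \<integral>\<^sup>+x. ennreal (reg_power p (e n) (w t x)) \<partial>lborel)"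
    by (rule nn_integral_liminf) measurable
  also have "\<dots> \<le> liminf (\<lambda>n. ennreal (\<integral>x. reg_power p (e n) (w0 x) \<partial>lborel))"
  proof (intro Liminf_mono always_eventually allI)
    fix n
    have "(\<integral>\<^sup>+x. ennreal (reg_power p (e n) (w t x)) \<partial>lborel) = ennreal (\<integral>x. reg_power p (e n) (w t x) \<partial>lborel)"
      by (rule nn_integral_eq_integral[OF int[OF t]]) (simp add: reg_power_nonneg p)
    also have "\<dots> \<le> ennreal (\<integral>x. reg_power p (e n) (w0 x) \<partial>lborel)" by (rule ennreal_leI[OF dec])
    finally show "(\<integral>\<^sup>+x. ennreal (reg_power p (e n) (w t x)) \<partial>lborel) \<le> ennreal (\<integral>x. reg_power p (e n) (w0 x) \<partial>lborel)" .
  qed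
  also have "\<dots> = ennreal (\<integral>x. \<bar>w0 x\<bar> powr p \<partial>lborel)"
    by (intro lim_imp_Liminf tendsto_ennrealI lim0) simp
  finally have "ennreal (\<integral>x. \<bar>w t x\<bar> powr p \<partial>lborel) \<le> ennreal (\<integral>x. \<bar>w0 x\<bar> powr p \<partial>lborel)"
    by (subst (asm) nn_integral_eq_integral[OF w_powr_integrable[OF p t]]) auto
  then show ?thesis by (subst (asm) ennreal_le_iff) auto
qed

text \<open>A bound by the \<open>L\<^sup>1\<close> norm of the vorticity alone, in contrast with \<open>u_bounded\<close>: the maximum of the
  vorticity is not controlled uniformly along the sequence of solutions.\<close>

lemma velocity_L1_local:
  assumes t: "t \<in> {0<..<T}"
  shows "integrable lborel (\<lambda>x. norm (u t x) * indicator (cball 0 R) x)"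
    "(\<integral>x. norm (u t x) * indicator (cball 0 R) x \<partial>lborel)
      \<le> (\<integral>x. \<bar>w t x\<bar> \<partial>lborel) * (kernel_mass + measure lborel (cball (0::real^2) R))"
proof -
  have t': "t \<in> {0..T}" using t by auto
  note [measurable] = w_borel[OF t'] borel_measurable_continuous_onI[OF u_continuous[OF t]]
  obtain U where U: "U \<ge> 0" "\<And>t x. t \<in> {0<..<T} \<Longrightarrow> norm (u t x) \<le> U" using u_bounded by blast
  have fin: "emeasure lborel (cball (0::real^2) R) = ennreal (measure lborel (cball (0::real^2) R))"
    by (rule emeasure_eq_ennreal_measure) (use emeasure_bounded_finite[OF bounded_cball] in \<open>simp add: less_top[symmetric]\<close>)
  show int: "integrable lborel (\<lambda>x. norm (u t x) * indicator (cball 0 R) x)"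
  proof (rule Bochner_Integration.integrable_bound)
    show "integrable lborel (\<lambda>x. U * indicator (cball (0::real^2) R) x)"
      by (intro integrable_mult_right integrable_real_indicator) (simp_all add: fin)
  qed (use U t in \<open>auto split: split_indicator\<close>)
  have "ennreal (\<integral>x. norm (u t x) * indicator (cball 0 R) x \<partial>lborel) = (\<integral>\<^sup>+x. ennreal (norm (u t x) * indicator (cball 0 R) x) \<partial>lborel)"
    by (rule nn_integral_eq_integral[OF int, symmetric]) simp
  also have "\<dots> = (\<integral>\<^sup>+x. ennreal (norm (u t x)) * indicator (cball 0 R) x \<partial>lborel)"
    by (intro nn_integral_cong) (simp split: split_indicator)
  also have "\<dots> \<le> (\<integral>\<^sup>+y. ennreal \<bar>w t y\<bar> * (\<integral>\<^sup>+x. ennreal (norm (biot_savart_kernel (x - y))) * indicator (cball 0 R) x \<partial>lborel) \<partial>lborel)"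
    by (rule biot_savart_norm_bound) (use biot_savart[OF t] in \<open>auto intro: measurable_completion\<close>)
  also have "\<dots> \<le> (\<integral>\<^sup>+y. ennreal \<bar>w t y\<bar> * ennreal (kernel_mass + measure lborel (cball (0::real^2) R)) \<partial>lborel)"
  proof (intro nn_integral_mono mult_left_mono)
    fix y
    have "(\<integral>\<^sup>+x. ennreal (norm (biot_savart_kernel (x - y))) * indicator (cball 0 R) x \<partial>lborel)
      \<le> ennreal 1 * ennreal kernel_mass + (\<integral>\<^sup>+x. indicator (cball (0::real^2) R) x \<partial>lborel)"
      by (rule kernel_convolution_bound) (auto split: split_indicator)
    also have "\<dots> = ennreal (kernel_mass + measure lborel (cball (0::real^2) R))"
      using kernel_mass_nonneg by (simp add: fin)
    finally show "(\<integral>\<^sup>+x. ennreal (norm (biot_savart_kernel (x - y))) * indicator (cball 0 R) x \<partial>lborel)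
      \<le> ennreal (kernel_mass + measure lborel (cball (0::real^2) R))" .
  qed simp
  also have "\<dots> = (\<integral>\<^sup>+y. ennreal \<bar>w t y\<bar> \<partial>lborel) * ennreal (kernel_mass + measure lborel (cball (0::real^2) R))"
    by (rule nn_integral_multc) measurable
  also have "(\<integral>\<^sup>+y. ennreal \<bar>w t y\<bar> \<partial>lborel) = ennreal (\<integral>x. \<bar>w t x\<bar> \<partial>lborel)"
    by (rule nn_integral_eq_integral) (use w_integrable'[OF t'] in auto)
  finally have "ennreal (\<integral>x. norm (u t x) * indicator (cball 0 R) x \<partial>lborel)
    \<le> ennreal ((\<integral>x. \<bar>w t x\<bar> \<partial>lborel) * (kernel_mass + measure lborel (cball (0::real^2) R)))"
    using kernel_mass_nonneg by (simp add: ennreal_mult)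
  then show "(\<integral>x. norm (u t x) * indicator (cball 0 R) x \<partial>lborel)
      \<le> (\<integral>x. \<bar>w t x\<bar> \<partial>lborel) * (kernel_mass + measure lborel (cball (0::real^2) R))"
    using kernel_mass_nonneg by (subst (asm) ennreal_le_iff) auto
qed

text \<open>The truncated vorticity satisfies the equation up to a dissipation error that the convex entropy
  \<open>3 * m * soft_abs k\<close> absorbs; this accounts for \<open>3 * m\<close> of the constant, and replacing the vorticity by
  its truncation at the two times costs \<open>m\<close> each. The flux of the truncated vorticity is bounded by \<open>k\<close>
  times the local \<open>L\<^sup>1\<close> norm of the velocity. So the first term is small for large \<open>k\<close>, uniformly in time,
  and the second is Lipschitz in time for fixed \<open>k\<close>. The vorticity itself has no such bound when it is
  merely integrable, since the product of \<open>u\<close> and \<open>w\<close> need not be locally integrable.\<close>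

lemma time_equicontinuity:
  assumes k: "k > 0" and w0: "vanishes_outside R0 w0"
    and \<zeta>: "C_k 2 UNIV \<zeta>" "vanishes_outside R \<zeta>" and m: "\<And>x. \<bar>\<zeta> x\<bar> \<le> m"
    and G: "\<And>x. norm (grad \<zeta> x) \<le> G" and \<Lambda>: "\<And>x. \<bar>laplacian \<zeta> x\<bar> \<le> \<Lambda>"
    and st: "0 \<le> s" "s \<le> t" "t \<le> T"
  defines "V \<equiv> measure lborel (cball (0::real^2) R)"
  shows "\<bar>(\<integral>x. w t x * \<zeta> x \<partial>lborel) - (\<integral>x. w s x * \<zeta> x \<partial>lborel)\<bar>
    \<le> 5 * m * (\<integral>x. soft_abs k (w0 x) \<partial>lborel)
      + k * (G * ((\<integral>x. \<bar>w0 x\<bar> \<partial>lborel) * (kernel_mass + V)) + \<nu> * \<Lambda> * V) * (t - s)"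
proof -
  define S where "S = (\<integral>x. soft_abs k (w0 x) \<partial>lborel)"
  define B where "B = k * (G * ((\<integral>x. \<bar>w0 x\<bar> \<partial>lborel) * (kernel_mass + V)) + \<nu> * \<Lambda> * V)"
  have m0: "m \<ge> 0" "G \<ge> 0" "\<Lambda> \<ge> 0" using order_trans[OF abs_ge_zero m] order_trans[OF norm_ge_zero G] order_trans[OF abs_ge_zero \<Lambda>] by auto
  have \<zeta>1: "C_k 1 UNIV \<zeta>" using C_k_mono[OF \<zeta>(1), of 1] by simp
  have c\<zeta>: "continuous_on UNIV \<zeta>" using \<zeta> C_k_continuous by blast
  have [measurable]: "\<zeta> \<in> borel_measurable borel" using c\<zeta> by (rule borel_measurable_continuous_onI)
  have vl: "vanishes_outside R (laplacian \<zeta>)"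
    using vanishes_pd[OF vanishes_pd[OF \<zeta>(2)]] by (auto simp: vanishes_outside_def laplacian_def)
  have flux: "\<bar>\<integral>x. trunc k (w \<tau> x) * (u \<tau> x \<bullet> grad \<zeta> x + \<nu> * laplacian \<zeta> x) \<partial>lborel\<bar> \<le> B" if \<tau>: "\<tau> \<in> {0<..<T}" for \<tau>
  proof -
    have \<tau>': "\<tau> \<in> {0..T}" using \<tau> by auto
    let ?i = "indicator (cball (0::real^2) R) :: _ \<Rightarrow> real"
    have bi: "integrable lborel ?i"
      by (intro integrable_real_indicator) (auto simp: emeasure_bounded_finite[OF bounded_cball, simplified])
    have "norm (\<integral>x. trunc k (w \<tau> x) * (u \<tau> x \<bullet> grad \<zeta> x + \<nu> * laplacian \<zeta> x) \<partial>lborel)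
      \<le> (\<integral>x. k * (G * (norm (u \<tau> x) * ?i x) + \<nu> * \<Lambda> * ?i x) \<partial>lborel)"
    proof (rule order_trans[OF integral_norm_bound integral_mono'])
      show "integrable lborel (\<lambda>x. k * (G * (norm (u \<tau> x) * ?i x) + \<nu> * \<Lambda> * ?i x))"
        using velocity_L1_local(1)[OF \<tau>] bi by (intro integrable_mult_right Bochner_Integration.integrable_add)
      fix x
      have "\<bar>u \<tau> x \<bullet> grad \<zeta> x + \<nu> * laplacian \<zeta> x\<bar> \<le> G * (norm (u \<tau> x) * ?i x) + \<nu> * \<Lambda> * ?i x"
      proof (cases "x \<in> cball 0 R")
        case True
        have "\<bar>u \<tau> x \<bullet> grad \<zeta> x\<bar> \<le> norm (u \<tau> x) * G"
          using Cauchy_Schwarz_ineq2[of "u \<tau> x" "grad \<zeta> x"] mult_left_mono[OF G[of x], of "norm (u \<tau> x)"] by simp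
        moreover have "\<bar>\<nu> * laplacian \<zeta> x\<bar> \<le> \<nu> * \<Lambda>" using \<Lambda>[of x] nu_pos by (simp add: abs_mult)
        ultimately show ?thesis using True by (simp add: mult.commute)
      next
        case False
        then show ?thesis using vl vanishes_grad(1)[OF \<zeta>(2)] by (simp add: vanishes_outside_def)
      qed
      then show "norm (trunc k (w \<tau> x) * (u \<tau> x \<bullet> grad \<zeta> x + \<nu> * laplacian \<zeta> x))
        \<le> k * (G * (norm (u \<tau> x) * ?i x) + \<nu> * \<Lambda> * ?i x)"
        using trunc_bounded[OF k, of "w \<tau> x"] k by (simp add: abs_mult mult_mono)
      show "0 \<le> k * (G * (norm (u \<tau> x) * ?i x) + \<nu> * \<Lambda> * ?i x)" using k m0 nu_pos by simp
    qed
    also have "\<dots> = k * (G * (\<integral>x. norm (u \<tau> x) * ?i x \<partial>lborel) + \<nu> * \<Lambda> * V)"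
      using velocity_L1_local(1)[OF \<tau>] bi by (simp add: V_def)
    also have "\<dots> \<le> B"
    proof -
      have "(\<integral>x. \<bar>w \<tau> x\<bar> \<partial>lborel) \<le> (\<integral>x. \<bar>w0 x\<bar> \<partial>lborel)" using Lp_decay[OF _ \<tau>' w0, of 1] by simp
      then have "(\<integral>x. norm (u \<tau> x) * ?i x \<partial>lborel) \<le> (\<integral>x. \<bar>w0 x\<bar> \<partial>lborel) * (kernel_mass + V)"
        using velocity_L1_local(2)[OF \<tau>, of R] kernel_mass_nonneg unfolding V_def
        by (elim order_trans) (intro mult_right_mono, auto)
      then show ?thesis unfolding B_def using k m0 nu_pos by (intro mult_left_mono add_mono) auto
    qed
    finally show ?thesis by simp
  qed
  have ds: "((\<lambda>s. 3 * m * soft_abs k s) has_real_derivative 3 * m * (s / sqrt (k\<^sup>2 + s\<^sup>2))) (at s)"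
    "((\<lambda>s. 3 * m * (s / sqrt (k\<^sup>2 + s\<^sup>2))) has_real_derivative 3 * m * (k\<^sup>2 / sqrt (k\<^sup>2 + s\<^sup>2) ^ 3)) (at s)" for s
    by (intro DERIV_cmult soft_abs_deriv soft_abs_deriv2 k)+
  have cs: "continuous_on UNIV (\<lambda>s. 3 * m * (k\<^sup>2 / sqrt (k\<^sup>2 + s\<^sup>2) ^ 3))"
    using sqrt_pos[OF k] by (intro continuous_intros) (auto simp: less_le)
  have s0: "3 * m * soft_abs k 0 = 0" using k by simp
  have ct: "continuous_on UNIV (\<lambda>s. c * (- 3 * k ^ 3 * s / sqrt (k\<^sup>2 + s\<^sup>2) ^ 5))" for c
    using sqrt_pos[OF k] by (intro continuous_intros) (auto simp: less_le)
  have S_int: "0 \<le> (\<integral>x. soft_abs k (w \<tau> x) \<partial>lborel)" "(\<integral>x. soft_abs k (w \<tau> x) \<partial>lborel) \<le> S" if "\<tau> \<in> {0..T}" for \<tau>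
    using soft_abs_decay[OF k that] soft_abs_nonneg[OF k] by (auto simp: S_def)
  have sT: "s \<in> {0..T}" "t \<in> {0..T}" using st by auto
  \<comment> \<open>The sign \<open>c\<close> gives both halves of the absolute value.\<close>
  have tr: "c * ((\<integral>x. trunc k (w t x) * \<zeta> x \<partial>lborel) - (\<integral>x. trunc k (w s x) * \<zeta> x \<partial>lborel)) \<le> 3 * m * S + B * (t - s)"
    if c: "\<bar>c\<bar> = 1" for c
  proof -
    have "(\<integral>x. (c * trunc k (w t x)) * \<zeta> x \<partial>lborel) - (\<integral>x. (c * trunc k (w s x)) * \<zeta> x \<partial>lborel)
      \<le> (\<integral>x. 3 * m * soft_abs k (w s x) \<partial>lborel) - (\<integral>x. 3 * m * soft_abs k (w t x) \<partial>lborel) + B * (t - s)"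
    proof (rule entropy_inequality[OF ds cs s0 DERIV_cmult[OF trunc_deriv[OF k]] DERIV_cmult[OF trunc_deriv2[OF k]] ct \<zeta> _ _ st])
      fix s x
      have "\<bar>- 3 * k ^ 3 * s / sqrt (k\<^sup>2 + s\<^sup>2) ^ 5\<bar> * \<bar>\<zeta> x\<bar> \<le> 3 * (k\<^sup>2 / sqrt (k\<^sup>2 + s\<^sup>2) ^ 3) * m"
        using sqrt_pos[OF k, of s] by (intro mult_mono trunc_deriv2_le k m) auto
      then show "\<bar>c * (- 3 * k ^ 3 * s / sqrt (k\<^sup>2 + s\<^sup>2) ^ 5) * \<zeta> x\<bar> \<le> 3 * m * (k\<^sup>2 / sqrt (k\<^sup>2 + s\<^sup>2) ^ 3)"
        unfolding abs_mult c by (simp add: mult_ac)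
    next
      fix \<tau> assume "\<tau> \<in> {0<..<T}"
      then have "\<bar>c * (\<integral>x. trunc k (w \<tau> x) * (u \<tau> x \<bullet> grad \<zeta> x + \<nu> * laplacian \<zeta> x) \<partial>lborel)\<bar> \<le> B"
        using flux c by (simp add: abs_mult)
      then show "(\<integral>x. (c * trunc k (w \<tau> x)) * (u \<tau> x \<bullet> grad \<zeta> x + \<nu> * laplacian \<zeta> x) \<partial>lborel) \<le> B"
        by (simp add: mult.assoc)
    qed
    also have "\<dots> \<le> 3 * m * S + B * (t - s)"
    proof -
      have "3 * m * (\<integral>x. soft_abs k (w s x) \<partial>lborel) \<le> 3 * m * S"
        using S_int[OF sT(1)] m0 by (intro mult_left_mono) auto
      moreover have "0 \<le> 3 * m * (\<integral>x. soft_abs k (w t x) \<partial>lborel)"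
        using S_int[OF sT(2)] m0 by (intro mult_nonneg_nonneg) auto
      ultimately show ?thesis unfolding integral_mult_right_zero by linarith
    qed
    finally show ?thesis by (simp add: mult.assoc right_diff_distrib)
  qed
  have err: "\<bar>(\<integral>x. w \<tau> x * \<zeta> x \<partial>lborel) - (\<integral>x. trunc k (w \<tau> x) * \<zeta> x \<partial>lborel)\<bar> \<le> m * S" if \<tau>: "\<tau> \<in> {0..T}" for \<tau>
  proof -
    note [measurable] = w_borel[OF \<tau>]
    have i1: "integrable lborel (\<lambda>x. w \<tau> x * \<zeta> x)"
      by (rule integrable_continuous_vanishing[OF _ vanishes_mult[OF \<zeta>(2)]])
         (intro continuous_on_mult c\<zeta> w_continuous_slice[OF \<tau>])
    have ctr: "continuous_on UNIV (trunc k)"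
      by (intro DERIV_continuous_on[OF has_field_derivative_at_within[OF trunc_deriv[OF k]]])
    have i2: "integrable lborel (\<lambda>x. trunc k (w \<tau> x) * \<zeta> x)"
      by (rule integrable_continuous_vanishing[OF _ vanishes_mult[OF \<zeta>(2)]])
         (intro continuous_on_mult c\<zeta> continuous_on_compose2[OF ctr w_continuous_slice[OF \<tau>] subset_UNIV])
    have "norm (\<integral>x. w \<tau> x * \<zeta> x - trunc k (w \<tau> x) * \<zeta> x \<partial>lborel) \<le> (\<integral>x. m * soft_abs k (w \<tau> x) \<partial>lborel)"
    proof (rule order_trans[OF integral_norm_bound integral_mono'])
      show "integrable lborel (\<lambda>x. m * soft_abs k (w \<tau> x))" using soft_abs_integrable[OF k \<tau>] by simp
      fix x
      have "norm (w \<tau> x * \<zeta> x - trunc k (w \<tau> x) * \<zeta> x) = \<bar>w \<tau> x - trunc k (w \<tau> x)\<bar> * \<bar>\<zeta> x\<bar>"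
        by (simp add: left_diff_distrib[symmetric] abs_mult)
      also have "\<dots> \<le> soft_abs k (w \<tau> x) * m"
        by (intro mult_mono trunc_error k m soft_abs_nonneg) auto
      finally show "norm (w \<tau> x * \<zeta> x - trunc k (w \<tau> x) * \<zeta> x) \<le> m * soft_abs k (w \<tau> x)" by (simp add: mult.commute)
      show "0 \<le> m * soft_abs k (w \<tau> x)" using m0 soft_abs_nonneg[OF k] by simp
    qed
    also have "\<dots> \<le> m * S" using S_int[OF \<tau>] m0 by (simp add: mult_left_mono)
    finally show ?thesis using i1 i2 by simp
  qed
  show ?thesis
    using tr[of 1] tr[of "-1"] err[OF sT(1)] err[OF sT(2)]
    unfolding S_def[symmetric] B_def[symmetric] by (simp add: algebra_simps abs_le_iff) linarith
qed

text \<open>A bounded curve that is continuous in \<open>L\<^sup>1\<close> is continuous in \<open>L\<^sup>p\<close> by interpolation.\<close>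

lemma solution_in_C_Lp:
  assumes p: "p \<ge> 1"
  shows "in_C_Lp T p w"
  unfolding in_C_Lp_def
proof (intro conjI ballI)
  have "{0..T} \<times> (UNIV :: (real^2) set) \<in> sets lebesgue"
    by (intro sets_completionI_sets) (auto intro!: borel_closed closed_Times)
  then show "(\<lambda>(t, x). w t x) \<in> borel_measurable (lebesgue_on ({0..T} \<times> UNIV))"
    using w_continuous by (intro continuous_imp_measurable_on_sets_lebesgue) auto
  obtain M where M: "M > 0" "\<And>t x. t \<in> {0..T} \<Longrightarrow> \<bar>w t x\<bar> \<le> M" using w_bounded by blast
  have inp: "integrable lebesgue (\<lambda>x. \<bar>w s x\<bar> powr p)" "w s \<in> borel_measurable lebesgue" if "s \<in> {0..T}" for s
    using w_powr_integrable[OF p that] w_borel[OF that]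
    by (auto simp: integrable_completion intro: measurable_completion)
  fix t assume t: "t \<in> {0..T}"
  show "in_Lp p UNIV (w t)" using inp[OF t] by (simp add: in_Lp_def lebesgue_on_UNIV_eq)
  define d where "d s = (\<integral>x. \<bar>w s x - w t x\<bar> \<partial>lborel)" for s
  have d0: "(d \<longlongrightarrow> 0) (at t within {0..T})" unfolding d_def by (rule w_continuous_L1[OF t])
  have 1: "((\<lambda>s. ((2 * M) powr (p - 1) * d s) powr (1 / p)) \<longlongrightarrow> 0) (at t within {0..T})"
  proof (rule tendsto_zero_powrI)
    show "((\<lambda>s. (2 * M) powr (p - 1) * d s) \<longlongrightarrow> 0) (at t within {0..T})"
      using tendsto_mult_right_zero[OF d0] by simp
    show "\<forall>\<^sub>F s in at t within {0..T}. 0 \<le> (2 * M) powr (p - 1) * d s"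
      by (simp add: d_def)
    show "((\<lambda>_. 1 / p) \<longlongrightarrow> 1 / p) (at t within {0..T})" by simp
    show "0 < 1 / p" using p by simp
  qed
  show "((\<lambda>s. Lp_norm p UNIV (\<lambda>x. w s x - w t x)) \<longlongrightarrow> 0) (at t within {0..T})"
  proof (rule Lim_null_comparison[OF _ 1])
    show "\<forall>\<^sub>F s in at t within {0..T}. norm (Lp_norm p UNIV (\<lambda>x. w s x - w t x)) \<le> ((2 * M) powr (p - 1) * d s) powr (1 / p)"
      unfolding eventually_at_filter
    proof (intro always_eventually allI impI)
      fix s assume s: "s \<in> {0..T}"
      note [measurable] = w_borel[OF s] w_borel[OF t]
      have "(\<integral>x. \<bar>w s x - w t x\<bar> powr p \<partial>lebesgue) = (\<integral>x. \<bar>w s x - w t x\<bar> powr p \<partial>lborel)"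
        by (rule integral_completion) measurable
      also have "\<dots> \<le> (\<integral>x. (2 * M) powr (p - 1) * \<bar>w s x - w t x\<bar> \<partial>lborel)"
      proof (rule integral_mono')
        show "integrable lborel (\<lambda>x. (2 * M) powr (p - 1) * \<bar>w s x - w t x\<bar>)"
          using w_integrable'[OF s] w_integrable'[OF t] by simp
        fix x
        have "\<bar>w s x - w t x\<bar> \<le> 2 * M" using M(2)[OF s, of x] M(2)[OF t, of x] by linarith
        then show "\<bar>w s x - w t x\<bar> powr p \<le> (2 * M) powr (p - 1) * \<bar>w s x - w t x\<bar>"
          by (rule powr_le_linear[OF p])
      qed simp
      also have "\<dots> = (2 * M) powr (p - 1) * d s" by (simp add: d_def)
      finally have "(\<integral>x. \<bar>w s x - w t x\<bar> powr p \<partial>lebesgue) powr (1 / p) \<le> ((2 * M) powr (p - 1) * d s) powr (1 / p)"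
        using p by (intro powr_mono2) auto
      then show "norm (Lp_norm p UNIV (\<lambda>x. w s x - w t x)) \<le> ((2 * M) powr (p - 1) * d s) powr (1 / p)"
        by (simp add: Lp_norm_def lebesgue_on_UNIV_eq)
    qed
  qed
qed

end

section \<open>Fubini's theorem for Lebesgue measure on a time strip\<close>

lemma strip_sets: "{0<..<T::real} \<times> (UNIV :: (real^2) set) \<in> sets lebesgue"
  by (intro sets_completionI_sets) (simp add: borel_open open_Times)

lemma AE_lebesgue_pair:
  fixes P :: "real \<Rightarrow> real^2 \<Rightarrow> bool"
  assumes "AE z in lebesgue. P (fst z) (snd z)"
  shows "AE t in lebesgue. AE x in lebesgue. P t x"
proof -
  have "AE z in lborel \<Otimes>\<^sub>M lborel. P (fst z) (snd z)"
    using assms unfolding AE_completion_iff lborel_prod .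
  from lborel_pair.AE_pair[OF this] show ?thesis by (simp add: AE_completion_iff)
qed

lemma borel_representative_pair:
  fixes f :: "real \<times> (real^2) \<Rightarrow> real"
  assumes "f \<in> borel_measurable lebesgue"
  obtains g where "g \<in> borel_measurable (lborel \<Otimes>\<^sub>M lborel)" "AE z in lborel \<Otimes>\<^sub>M lborel. f z = g z"
proof -
  obtain g where "g \<in> borel_measurable lborel" "AE z in lborel. f z = g z"
    using completion_ex_borel_measurable_real[OF assms] by auto
  then show ?thesis unfolding lborel_prod[symmetric] by (rule that)
qed

text \<open>Lebesgue measure on the product is the completion of the product of Borel measures, so Fubini's theorem is applied
  to a Borel representative and transported back slice by slice.\<close>

lemma Fubini_lebesgue_pair:
  fixes f :: "real \<times> (real^2) \<Rightarrow> real"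
  assumes "integrable lebesgue f"
  shows "AE t in lebesgue. integrable lebesgue (\<lambda>x. f (t, x))"
    "integrable lebesgue (\<lambda>t. \<integral>x. f (t, x) \<partial>lebesgue)"
    "(\<integral>z. f z \<partial>lebesgue) = (\<integral>t. \<integral>x. f (t, x) \<partial>lebesgue \<partial>lebesgue)"
proof -
  obtain g where g[measurable]: "g \<in> borel_measurable (lborel \<Otimes>\<^sub>M lborel)"
    and fg: "AE z in lborel \<Otimes>\<^sub>M lborel. f z = g z"
    using borel_representative_pair[OF borel_measurable_integrable[OF assms]] by blast
  have gl: "g \<in> borel_measurable lborel" using g by (simp add: lborel_prod)
  have fgl: "AE z in lebesgue. f z = g z"
    using fg unfolding AE_completion_iff lborel_prod .
  have "integrable lebesgue g"
    by (rule integrable_cong_AE_imp[OF assms]) (use gl fgl in \<open>auto intro: measurable_completion elim!: AE_mp\<close>)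
  then have gint: "integrable (lborel \<Otimes>\<^sub>M lborel) g"
    using gl by (simp add: integrable_completion lborel_prod)
  have s: "AE t in lborel. AE x in lborel. f (t, x) = g (t, x)"
    using lborel_pair.AE_pair[OF fg] .
  have gi: "AE t in lborel. integrable lborel (\<lambda>x. g (t, x))"
    by (rule lborel_pair.AE_integrable_fst'[OF gint])
  have slice: "AE t in lborel. integrable lebesgue (\<lambda>x. f (t, x)) \<and> (\<integral>x. f (t, x) \<partial>lebesgue) = (\<integral>x. g (t, x) \<partial>lborel)"
    using s gi
  proof eventually_elim
    fix t assume a: "AE x in lborel. f (t, x) = g (t, x)" and i: "integrable lborel (\<lambda>x. g (t, x))"
    have m: "(\<lambda>x. g (t, x)) \<in> borel_measurable lborel" by measurable
    have il: "integrable lebesgue (\<lambda>x. g (t, x))" using i m by (simp add: integrable_completion)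
    have a': "AE x in lebesgue. g (t, x) = f (t, x)" using a by (auto simp: AE_completion_iff elim!: AE_mp)
    have mf: "(\<lambda>x. f (t, x)) \<in> borel_measurable lebesgue"
      by (rule borel_measurable_AE[OF borel_measurable_integrable[OF il] a'])
    have "integrable lebesgue (\<lambda>x. f (t, x))"
      by (rule integrable_cong_AE_imp[OF il mf]) (use a' in \<open>auto elim!: AE_mp\<close>)
    moreover have "(\<integral>x. f (t, x) \<partial>lebesgue) = (\<integral>x. g (t, x) \<partial>lebesgue)"
      by (rule integral_cong_AE[OF mf borel_measurable_integrable[OF il]]) (use a' in \<open>auto elim!: AE_mp\<close>)
    ultimately show "integrable lebesgue (\<lambda>x. f (t, x)) \<and> (\<integral>x. f (t, x) \<partial>lebesgue) = (\<integral>x. g (t, x) \<partial>lborel)"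
      using m by (simp add: integral_completion)
  qed
  show "AE t in lebesgue. integrable lebesgue (\<lambda>x. f (t, x))"
    by (rule AE_completion) (use slice in eventually_elim, simp)
  have gi2: "integrable lborel (\<lambda>t. \<integral>x. g (t, x) \<partial>lborel)" by (rule lborel_pair.integrable_fst'[OF gint])
  have gi2l: "integrable lebesgue (\<lambda>t. \<integral>x. g (t, x) \<partial>lborel)" using gi2 by (simp add: integrable_completion)
  have sl: "AE t in lebesgue. (\<integral>x. g (t, x) \<partial>lborel) = (\<integral>x. f (t, x) \<partial>lebesgue)"
    by (rule AE_completion) (use slice in eventually_elim, simp)
  have m: "(\<lambda>t. \<integral>x. f (t, x) \<partial>lebesgue) \<in> borel_measurable lebesgue"
    by (rule borel_measurable_AE[OF borel_measurable_integrable[OF gi2l] sl])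
  show "integrable lebesgue (\<lambda>t. \<integral>x. f (t, x) \<partial>lebesgue)"
    by (rule integrable_cong_AE_imp[OF gi2l m]) (use sl in \<open>auto elim!: AE_mp\<close>)
  have "(\<integral>z. f z \<partial>lebesgue) = (\<integral>z. g z \<partial>lebesgue)"
    by (rule integral_cong_AE) (use assms gl fgl in \<open>auto intro: measurable_completion\<close>)
  also have "\<dots> = (\<integral>z. g z \<partial>(lborel \<Otimes>\<^sub>M lborel))" using gl by (simp add: integral_completion lborel_prod)
  also have "\<dots> = (\<integral>t. \<integral>x. g (t, x) \<partial>lborel \<partial>lborel)"
    by (rule lborel_pair.integral_fst'[OF gint, symmetric])
  also have "\<dots> = (\<integral>t. \<integral>x. g (t, x) \<partial>lborel \<partial>lebesgue)" using gi2 by (simp add: integral_completion)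
  also have "\<dots> = (\<integral>t. \<integral>x. f (t, x) \<partial>lebesgue \<partial>lebesgue)"
    by (rule integral_cong_AE[OF borel_measurable_integrable[OF gi2l] m sl])
  finally show "(\<integral>z. f z \<partial>lebesgue) = (\<integral>t. \<integral>x. f (t, x) \<partial>lebesgue \<partial>lebesgue)" .
qed

lemma AE_strip:
  fixes P :: "real \<Rightarrow> real^2 \<Rightarrow> bool"
  assumes "AE z in lebesgue_on ({0<..<T} \<times> UNIV). P (fst z) (snd z)"
  shows "AE t in lebesgue_on {0<..<T}. AE x in lebesgue. P t x"
proof -
  have "AE z in lebesgue. z \<in> {0<..<T} \<times> UNIV \<longrightarrow> P (fst z) (snd z)"
    using assms strip_sets by (subst (asm) AE_restrict_space_iff) auto
  then have "AE z in lebesgue. fst z \<in> {0<..<T} \<longrightarrow> P (fst z) (snd z)"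
    by (rule AE_mp) (auto simp: mem_Times_iff)
  from AE_lebesgue_pair[of "\<lambda>t x. t \<in> {0<..<T} \<longrightarrow> P t x", OF this]
  show ?thesis by (subst AE_restrict_space_iff) (auto elim!: AE_mp)
qed

lemma Fubini_strip:
  fixes f :: "real \<Rightarrow> real^2 \<Rightarrow> real"
  assumes "integrable (lebesgue_on ({0<..<T} \<times> UNIV)) (\<lambda>(t, x). f t x)"
  shows "AE t in lebesgue_on {0<..<T}. integrable lebesgue (f t)"
    "integrable (lebesgue_on {0<..<T}) (\<lambda>t. \<integral>x. f t x \<partial>lebesgue)"
    "(\<integral>(t, x). f t x \<partial>lebesgue_on ({0<..<T} \<times> UNIV)) = (\<integral>t. \<integral>x. f t x \<partial>lebesgue \<partial>lebesgue_on {0<..<T})"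
proof -
  define F :: "real \<times> (real^2) \<Rightarrow> real" where "F z = indicator {0<..<T} (fst z) * f (fst z) (snd z)" for z
  have eq: "(\<lambda>z. indicator ({0<..<T} \<times> UNIV) z *\<^sub>R (case z of (t, x) \<Rightarrow> f t x)) = F"
    by (auto simp: F_def fun_eq_iff indicator_def)
  have F: "integrable lebesgue F"
    using assms strip_sets[of T] unfolding eq[symmetric] by (subst (asm) integrable_restrict_space) auto
  note Fub = Fubini_lebesgue_pair[OF F]
  have inner: "(\<integral>x. F (t, x) \<partial>lebesgue) = indicator {0<..<T} t *\<^sub>R (\<integral>x. f t x \<partial>lebesgue)" for t
    by (simp add: F_def)
  have "AE t in lebesgue. t \<in> {0<..<T} \<longrightarrow> integrable lebesgue (f t)"
    by (rule AE_mp[OF Fub(1)]) (auto simp: F_def)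
  then show "AE t in lebesgue_on {0<..<T}. integrable lebesgue (f t)"
    by (subst AE_restrict_space_iff) auto
  show "integrable (lebesgue_on {0<..<T}) (\<lambda>t. \<integral>x. f t x \<partial>lebesgue)"
    using Fub(2) by (subst integrable_restrict_space) (auto simp: inner)
  have "(\<integral>(t, x). f t x \<partial>lebesgue_on ({0<..<T} \<times> UNIV)) = (\<integral>z. F z \<partial>lebesgue)"
    using strip_sets[of T] unfolding eq[symmetric] by (subst integral_restrict_space) auto
  also have "\<dots> = (\<integral>t. indicator {0<..<T} t *\<^sub>R (\<integral>x. f t x \<partial>lebesgue) \<partial>lebesgue)"
    unfolding Fub(3) inner ..
  also have "\<dots> = (\<integral>t. \<integral>x. f t x \<partial>lebesgue \<partial>lebesgue_on {0<..<T})"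
    by (subst integral_restrict_space) auto
  finally show "(\<integral>(t, x). f t x \<partial>lebesgue_on ({0<..<T} \<times> UNIV)) = (\<integral>t. \<integral>x. f t x \<partial>lebesgue \<partial>lebesgue_on {0<..<T})" .
qed

lemma integrable_stripI:
  fixes f :: "real \<Rightarrow> real^2 \<Rightarrow> real"
  assumes m: "(\<lambda>(t, x). f t x) \<in> borel_measurable (lebesgue_on ({0<..<T} \<times> UNIV))"
    and b: "AE t in lebesgue_on {0<..<T}. integrable lebesgue (f t) \<and> (\<integral>x. \<bar>f t x\<bar> \<partial>lebesgue) \<le> C"
  shows "integrable (lebesgue_on ({0<..<T} \<times> UNIV)) (\<lambda>(t, x). f t x)"
proof -
  define F :: "real \<times> (real^2) \<Rightarrow> real" where "F z = indicator {0<..<T} (fst z) * f (fst z) (snd z)" for z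
  have eq: "(\<lambda>z. indicator ({0<..<T} \<times> UNIV) z *\<^sub>R (case z of (t, x) \<Rightarrow> f t x)) = F"
    by (auto simp: F_def fun_eq_iff indicator_def)
  have mF: "F \<in> borel_measurable lebesgue"
    using m strip_sets[of T] unfolding eq[symmetric] by (subst (asm) borel_measurable_restrict_space_iff) auto
  obtain g where g[measurable]: "g \<in> borel_measurable (lborel \<Otimes>\<^sub>M lborel)"
    and fg: "AE z in lborel \<Otimes>\<^sub>M lborel. F z = g z"
    using borel_representative_pair[OF mF] by blast
  have b': "AE t in lborel. t \<in> {0<..<T} \<longrightarrow> integrable lebesgue (f t) \<and> (\<integral>x. \<bar>f t x\<bar> \<partial>lebesgue) \<le> C"
    using b by (subst (asm) AE_restrict_space_iff) (auto simp: AE_completion_iff)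
  have "(\<integral>\<^sup>+z. ennreal (norm (F z)) \<partial>lebesgue) = (\<integral>\<^sup>+z. ennreal (norm (F z)) \<partial>(lborel \<Otimes>\<^sub>M lborel))"
    by (simp add: nn_integral_completion lborel_prod)
  also have "\<dots> = (\<integral>\<^sup>+z. ennreal (norm (g z)) \<partial>(lborel \<Otimes>\<^sub>M lborel))"
    by (rule nn_integral_cong_AE) (use fg in eventually_elim, simp)
  also have "\<dots> = (\<integral>\<^sup>+t. \<integral>\<^sup>+x. ennreal (norm (g (t, x))) \<partial>lborel \<partial>lborel)"
    by (rule lborel.nn_integral_fst[symmetric]) measurable
  also have "\<dots> \<le> (\<integral>\<^sup>+t. ennreal C * indicator {0<..<T} t \<partial>lborel)"
  proof (rule nn_integral_mono_AE)
    have s: "AE t in lborel. AE x in lborel. F (t, x) = g (t, x)"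
      using lborel_pair.AE_pair[OF fg] .
    show "AE t in lborel. (\<integral>\<^sup>+x. ennreal (norm (g (t, x))) \<partial>lborel) \<le> ennreal C * indicator {0<..<T} t"
      using s b'
    proof eventually_elim
      fix t assume a: "AE x in lborel. F (t, x) = g (t, x)"
        and b: "t \<in> {0<..<T} \<longrightarrow> integrable lebesgue (f t) \<and> (\<integral>x. \<bar>f t x\<bar> \<partial>lebesgue) \<le> C"
      have "(\<integral>\<^sup>+x. ennreal (norm (g (t, x))) \<partial>lborel) = (\<integral>\<^sup>+x. ennreal (norm (F (t, x))) \<partial>lborel)"
        by (rule nn_integral_cong_AE) (use a in eventually_elim, simp)
      also have "\<dots> \<le> ennreal C * indicator {0<..<T} t"
      proof (cases "t \<in> {0<..<T}")
        case True
        then have i: "integrable lebesgue (\<lambda>x. \<bar>f t x\<bar>)" and c: "(\<integral>x. \<bar>f t x\<bar> \<partial>lebesgue) \<le> C" using b by auto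
        have "(\<integral>\<^sup>+x. ennreal (norm (F (t, x))) \<partial>lborel) = (\<integral>\<^sup>+x. ennreal \<bar>f t x\<bar> \<partial>lebesgue)"
          using True by (simp add: F_def nn_integral_completion)
        also have "\<dots> = ennreal (\<integral>x. \<bar>f t x\<bar> \<partial>lebesgue)" by (rule nn_integral_eq_integral[OF i]) simp
        also have "\<dots> \<le> ennreal C" by (rule ennreal_leI[OF c])
        finally show ?thesis using True by simp
      qed (simp add: F_def)
      finally show "(\<integral>\<^sup>+x. ennreal (norm (g (t, x))) \<partial>lborel) \<le> ennreal C * indicator {0<..<T} t" .
    qed
  qed
  also have "\<dots> = ennreal C * emeasure lborel {0<..<T}" by (rule nn_integral_cmult_indicator) simp
  also have "\<dots> < \<infinity>" by (cases "0 \<le> T") (auto simp: ennreal_mult_less_top)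
  finally have "integrable lebesgue F" using mF by (simp add: integrable_iff_bounded)
  then show ?thesis
    using strip_sets[of T] unfolding eq[symmetric] by (subst integrable_restrict_space) auto
qed

section \<open>Passing the Biot-Savart law to the limit\<close>

text \<open>On the bounded support of \<open>G\<close> the norm of \<open>u\<close> is at most \<open>1 + \<bar>u\<bar>\<^sup>2\<close>, whose integral is bounded
  uniformly in time.\<close>

lemma Linf_L2loc_pairing_integrable:
  fixes u :: "real \<Rightarrow> real^2 \<Rightarrow> real^2" and G :: "real^2 \<Rightarrow> real^2"
  assumes u: "in_Linf_L2loc T u" and G: "continuous_on UNIV G" "vanishes_outside R G" and J: "J \<in> sets borel"
  shows "integrable (lebesgue_on ({0<..<T} \<times> UNIV)) (\<lambda>(t, x). u t x \<bullet> (indicator J t *\<^sub>R G x))"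
proof -
  obtain B where B: "B > 0" "\<And>x. norm (G x) \<le> B" using bounded_continuous_vanishing[OF G] by blast
  have [measurable]: "G \<in> borel_measurable borel" using G(1) by (rule borel_measurable_continuous_onI)
  define r where "r = \<bar>R\<bar> + 1"
  have Gr: "G x = 0" if "x \<notin> ball 0 r" for x using G(2) that by (auto simp: vanishes_outside_def r_def)
  obtain C where C: "AE t in lebesgue_on {0<..<T}. in_Lp 2 (ball 0 r) (u t) \<and> Lp_norm 2 (ball 0 r) (u t) \<le> C"
    using u unfolding in_Linf_L2loc_def by blast
  define V where "V = measure lborel (ball (0::real^2) r)"
  have mg: "(\<lambda>(t, x). indicator J t *\<^sub>R G x) \<in> borel_measurable (borel :: (real \<times> (real^2)) measure)"
    using J unfolding borel_prod[symmetric] by measurable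
  have "(\<lambda>z. (case z of (t, x) \<Rightarrow> u t x) \<bullet> (case z of (t, x) \<Rightarrow> indicator J t *\<^sub>R G x)) \<in> borel_measurable (lebesgue_on ({0<..<T} \<times> UNIV))"
  proof (rule borel_measurable_inner)
    show "(\<lambda>(t, x). u t x) \<in> borel_measurable (lebesgue_on ({0<..<T} \<times> UNIV))"
      using u by (simp add: in_Linf_L2loc_def)
    show "(\<lambda>(t, x). indicator J t *\<^sub>R G x) \<in> borel_measurable (lebesgue_on ({0<..<T} \<times> UNIV))"
      by (rule measurable_restrict_space1) (use mg in \<open>auto intro: measurable_completion\<close>)
  qed
  then have m: "(\<lambda>(t, x). u t x \<bullet> (indicator J t *\<^sub>R G x)) \<in> borel_measurable (lebesgue_on ({0<..<T} \<times> UNIV))"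
    by (simp add: case_prod_unfold)
  show ?thesis
  proof (rule integrable_stripI[OF m])
    show "AE t in lebesgue_on {0<..<T}. integrable lebesgue (\<lambda>x. u t x \<bullet> (indicator J t *\<^sub>R G x)) \<and>
       (\<integral>x. \<bar>u t x \<bullet> (indicator J t *\<^sub>R G x)\<bar> \<partial>lebesgue) \<le> B * (V + C\<^sup>2)"
      using C
    proof eventually_elim
      fix t assume t: "in_Lp 2 (ball 0 r) (u t) \<and> Lp_norm 2 (ball 0 r) (u t) \<le> C"
      define h where "h x = B * (indicator (ball 0 r) x * (1 + (norm (u t x))\<^sup>2))" for x
      have ball: "ball (0::real^2) r \<inter> space lebesgue \<in> sets lebesgue" by simp
      have mu: "u t \<in> borel_measurable (lebesgue_on (ball 0 r))" and i2: "integrable (lebesgue_on (ball 0 r)) (\<lambda>x. (norm (u t x))\<^sup>2)"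
        using t by (auto simp: in_Lp_def powr_numeral)
      have mi: "(\<lambda>x. indicator (ball 0 r) x *\<^sub>R u t x) \<in> borel_measurable lebesgue"
        using mu ball by (subst (asm) borel_measurable_restrict_space_iff) auto
      have bi: "integrable lebesgue (\<lambda>x. indicator (ball (0::real^2) r) x :: real)"
        by (intro integrable_real_indicator) (auto simp: emeasure_bounded_finite[OF bounded_ball, simplified])
      have i2': "integrable lebesgue (\<lambda>x. indicator (ball 0 r) x * (norm (u t x))\<^sup>2)"
        using i2 ball by (subst (asm) integrable_restrict_space) auto
      have hi: "integrable lebesgue h"
        unfolding h_def distrib_left mult_1_right by (intro integrable_mult_right Bochner_Integration.integrable_add bi i2')
      have ptw: "\<bar>u t x \<bullet> (indicator J t *\<^sub>R G x)\<bar> \<le> h x" for x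
      proof (cases "x \<in> ball 0 r")
        case True
        have "\<bar>u t x \<bullet> (indicator J t *\<^sub>R G x)\<bar> \<le> norm (u t x) * norm (indicator J t *\<^sub>R G x)"
          by (rule Cauchy_Schwarz_ineq2)
        also have "\<dots> \<le> norm (u t x) * B" using B by (intro mult_left_mono) (auto simp: indicator_def)
        also have "\<dots> \<le> (1 + (norm (u t x))\<^sup>2) * B"
        proof (intro mult_right_mono)
          show "norm (u t x) \<le> 1 + (norm (u t x))\<^sup>2"
          proof -
            have "2 * norm (u t x) \<le> (norm (u t x))\<^sup>2 + 1"
              using sum_squares_bound[of "norm (u t x)" 1] by simp
            then show ?thesis using norm_ge_zero[of "u t x"] by linarith
          qed
        qed (use B in simp)
        finally show ?thesis using True by (simp add: h_def mult.commute)
      next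
        case False then show ?thesis by (simp add: Gr h_def)
      qed
      have ptw': "norm (u t x \<bullet> (indicator J t *\<^sub>R G x)) \<le> norm (h x)" for x
        unfolding real_norm_def using ptw[of x] by linarith
      have eq: "(\<lambda>x. u t x \<bullet> (indicator J t *\<^sub>R G x)) = (\<lambda>x. (indicator (ball 0 r) x *\<^sub>R u t x) \<bullet> (indicator J t *\<^sub>R G x))"
        by (auto simp: fun_eq_iff Gr indicator_def)
      have mm: "(\<lambda>x. u t x \<bullet> (indicator J t *\<^sub>R G x)) \<in> borel_measurable lebesgue"
        unfolding eq by (intro borel_measurable_inner mi) (auto intro: measurable_completion)
      have int: "integrable lebesgue (\<lambda>x. u t x \<bullet> (indicator J t *\<^sub>R G x))"
        by (rule Bochner_Integration.integrable_bound[OF hi mm], rule AE_I2, rule ptw')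
      have "(\<integral>x. \<bar>u t x \<bullet> (indicator J t *\<^sub>R G x)\<bar> \<partial>lebesgue) \<le> (\<integral>x. h x \<partial>lebesgue)"
        using int hi ptw by (intro integral_mono) auto
      also have "\<dots> = B * (V + (\<integral>x. indicator (ball 0 r) x * (norm (u t x))\<^sup>2 \<partial>lebesgue))"
        unfolding h_def distrib_left mult_1_right using bi i2' by (simp add: V_def)
      also have "\<dots> \<le> B * (V + C\<^sup>2)"
      proof -
        have "(\<integral>x. indicator (ball 0 r) x * (norm (u t x))\<^sup>2 \<partial>lebesgue) = (\<integral>x. (norm (u t x))\<^sup>2 \<partial>lebesgue_on (ball 0 r))"
          using ball by (subst integral_restrict_space) auto
        also have "\<dots> = (Lp_norm 2 (ball 0 r) (u t))\<^sup>2"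
          by (simp add: Lp_norm_def powr_numeral powr_half_sqrt)
        also have "\<dots> \<le> C\<^sup>2" using t by (intro power_mono) (auto simp: Lp_norm_def)
        finally show ?thesis using B by (intro mult_left_mono add_left_mono) auto
      qed
      finally show "integrable lebesgue (\<lambda>x. u t x \<bullet> (indicator J t *\<^sub>R G x)) \<and>
       (\<integral>x. \<bar>u t x \<bullet> (indicator J t *\<^sub>R G x)\<bar> \<partial>lebesgue) \<le> B * (V + C\<^sup>2)" using int by simp
    qed
  qed
qed

lemma Lp_locally_integrable:
  fixes f :: "'a::euclidean_space \<Rightarrow> real"
  assumes f: "in_Lp p UNIV f" and p: "p \<ge> 1"
  shows "integrable lebesgue (\<lambda>x. indicator (cball 0 R) x * f x)"
proof -
  have m: "f \<in> borel_measurable lebesgue" and i: "integrable lebesgue (\<lambda>x. \<bar>f x\<bar> powr p)"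
    using f by (auto simp: in_Lp_def lebesgue_on_UNIV_eq)
  have bi: "integrable lebesgue (\<lambda>x. indicator (cball (0::'a) R) x :: real)"
    by (intro integrable_real_indicator) (auto simp: emeasure_bounded_finite[OF bounded_cball, simplified])
  show ?thesis
  proof (rule Bochner_Integration.integrable_bound[OF Bochner_Integration.integrable_add[OF bi i]])
    show "(\<lambda>x. indicator (cball 0 R) x * f x) \<in> borel_measurable lebesgue"
      using bi m by (intro borel_measurable_times) auto
    show "AE x in lebesgue. norm (indicator (cball 0 R) x * f x) \<le> norm (indicator (cball 0 R) x + \<bar>f x\<bar> powr p)"
    proof (rule AE_I2)
      fix x
      have "\<bar>f x\<bar> \<le> 1 + \<bar>f x\<bar> powr p"
      proof (cases "\<bar>f x\<bar> \<le> 1")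
        case False
        then have "\<bar>f x\<bar> powr 1 \<le> \<bar>f x\<bar> powr p" using p by (intro powr_mono) auto
        then show ?thesis using False by simp
      qed (simp add: add_increasing2)
      then show "norm (indicator (cball 0 R) x * f x) \<le> norm (indicator (cball 0 R) x + \<bar>f x\<bar> powr p)"
        by (auto simp: indicator_def)
    qed
  qed
qed

text \<open>For \<open>w\<close> in \<open>L\<^sup>p\<close> the convolution converges only by assumption. Absolute convergence at a single
  point \<open>x0\<close> is enough: for \<open>y\<close> far from both \<open>x0\<close> and the support of \<open>g\<close>, the kernel at \<open>x - y\<close> is at most
  twice the kernel at \<open>x0 - y\<close>, and on the remaining ball \<open>w\<close> is integrable.\<close>

lemma biot_savart_pairing_finite:
  fixes g :: "real^2 \<Rightarrow> real^2"
  assumes w: "in_Lp p UNIV w" and p: "p \<ge> 1" and x0: "is_biot_savart w x0 v"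
    and g: "continuous_on UNIV g" "vanishes_outside R g"
  shows "(\<integral>\<^sup>+y. ennreal \<bar>w y\<bar> * (\<integral>\<^sup>+x. ennreal (norm (biot_savart_kernel (x - y))) * ennreal (norm (g x)) \<partial>lborel) \<partial>lborel) < \<infinity>"
proof -
  have [measurable]: "g \<in> borel_measurable borel" using g(1) by (rule borel_measurable_continuous_onI)
  obtain B where B: "\<And>x. norm (g x) \<le> B" using bounded_continuous_vanishing[OF g] by blast
  have m: "w \<in> borel_measurable lebesgue" using w by (auto simp: in_Lp_def lebesgue_on_UNIV_eq)
  define I where "I y = (\<integral>\<^sup>+x. ennreal (norm (biot_savart_kernel (x - y))) * ennreal (norm (g x)) \<partial>lborel)" for y
  define D where "D = (\<integral>\<^sup>+x. ennreal (norm (g x)) \<partial>lborel)"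
  define C where "C = ennreal B * ennreal kernel_mass + D"
  have "integrable lborel g" by (rule integrable_continuous_vanishing[OF g])
  then have D: "D < \<infinity>" by (simp add: integrable_iff_bounded D_def)
  then have C: "C < \<infinity>" unfolding C_def by (simp add: ennreal_mult_less_top less_top)
  have near: "I y \<le> C" for y
    unfolding I_def C_def D_def by (rule kernel_convolution_bound) (use B in \<open>auto intro!: ennreal_leI\<close>)
  define r where "r = \<bar>R\<bar>"
  \<comment> \<open>Outside this radius \<open>\<bar>x0 - y\<bar> \<le> 2 * \<bar>x - y\<bar>\<close> for all \<open>x\<close> in the support of \<open>g\<close>.\<close>
  define R1 where "R1 = 2 * r + norm x0 + 1"
  have far: "I y \<le> ennreal (2 * norm (biot_savart_kernel (x0 - y))) * D" if y: "norm y > R1" for y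
  proof -
    have "I y \<le> (\<integral>\<^sup>+x. ennreal (2 * norm (biot_savart_kernel (x0 - y))) * ennreal (norm (g x)) \<partial>lborel)"
      unfolding I_def
    proof (rule nn_integral_mono)
      fix x
      show "ennreal (norm (biot_savart_kernel (x - y))) * ennreal (norm (g x)) \<le> ennreal (2 * norm (biot_savart_kernel (x0 - y))) * ennreal (norm (g x))"
      proof (cases "norm x \<le> r")
        case True
        have 1: "norm (x - y) \<ge> norm y - r" using norm_triangle_ineq3[of x y] True by (simp add: norm_minus_commute)
        have 2: "norm (x0 - y) \<le> norm x0 + norm y" by (rule norm_triangle_ineq4)
        have "x0 \<noteq> y" using y by (auto simp: R1_def r_def)
        then have 3: "norm (x0 - y) > 0" by simp
        have "norm (x0 - y) \<le> 2 * norm (x - y)" using 1 2 y by (simp add: R1_def)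
        moreover have "norm (x - y) > 0" using 3 \<open>norm (x0 - y) \<le> 2 * norm (x - y)\<close> by linarith
        ultimately have "inverse (norm (x - y)) \<le> 2 * inverse (norm (x0 - y))"
          using 3 zero_less_mult_pos[of 2 "norm (x - y)"] by (simp add: field_simps)
        then have "inverse (2 * pi) * inverse (norm (x - y)) \<le> inverse (2 * pi) * (2 * inverse (norm (x0 - y)))"
          by (intro mult_left_mono) auto
        then have "norm (biot_savart_kernel (x - y)) \<le> 2 * norm (biot_savart_kernel (x0 - y))"
          unfolding norm_kernel by linarith
        then show ?thesis by (intro mult_right_mono ennreal_leI) auto
      next
        case False
        then have "g x = 0" using g(2) by (simp add: vanishes_outside_def r_def)
        then show ?thesis by simp
      qed
    qed
    also have "\<dots> = ennreal (2 * norm (biot_savart_kernel (x0 - y))) * D"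
      unfolding D_def by (rule nn_integral_cmult) measurable
    finally show ?thesis .
  qed
  have i1: "(\<integral>\<^sup>+y. ennreal \<bar>indicator (cball 0 R1) y * w y\<bar> \<partial>lebesgue) < \<infinity>"
    using Lp_locally_integrable[OF w p, of R1] by (simp add: integrable_iff_bounded)
  have i2: "(\<integral>\<^sup>+y. ennreal (norm (w y *\<^sub>R biot_savart_kernel (x0 - y))) \<partial>lebesgue) < \<infinity>"
    using x0 by (simp add: is_biot_savart_def has_bochner_integral_iff integrable_iff_bounded)
  have mk: "(\<lambda>y. biot_savart_kernel (x0 - y)) \<in> borel_measurable lebesgue"
    by (intro measurable_completion) measurable
  have mi: "(\<lambda>y. indicator (cball 0 R1) y * w y) \<in> borel_measurable lebesgue"
    using Lp_locally_integrable[OF w p, of R1] by auto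
  have "(\<integral>\<^sup>+y. ennreal \<bar>w y\<bar> * I y \<partial>lborel) = (\<integral>\<^sup>+y. ennreal \<bar>w y\<bar> * I y \<partial>lebesgue)"
    by (simp add: nn_integral_completion)
  also have "\<dots> \<le> (\<integral>\<^sup>+y. C * ennreal \<bar>indicator (cball 0 R1) y * w y\<bar> + (2 * D) * ennreal (norm (w y *\<^sub>R biot_savart_kernel (x0 - y))) \<partial>lebesgue)"
  proof (rule nn_integral_mono)
    fix y
    show "ennreal \<bar>w y\<bar> * I y \<le> C * ennreal \<bar>indicator (cball 0 R1) y * w y\<bar> + (2 * D) * ennreal (norm (w y *\<^sub>R biot_savart_kernel (x0 - y)))"
    proof (cases "y \<in> cball 0 R1")
      case True
      have "ennreal \<bar>w y\<bar> * I y \<le> ennreal \<bar>w y\<bar> * C" by (intro mult_left_mono near) simp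
      then show ?thesis using True by (simp add: mult.commute add_increasing2)
    next
      case False
      then have "ennreal \<bar>w y\<bar> * I y \<le> ennreal \<bar>w y\<bar> * (ennreal (2 * norm (biot_savart_kernel (x0 - y))) * D)"
        by (intro mult_left_mono far) auto
      also have "\<dots> = (2 * D) * ennreal (norm (w y *\<^sub>R biot_savart_kernel (x0 - y)))"
        by (simp add: ennreal_mult' ennreal_mult'' mult_ac)
      finally show ?thesis by (simp add: add_increasing)
    qed
  qed
  also have "\<dots> = C * (\<integral>\<^sup>+y. ennreal \<bar>indicator (cball 0 R1) y * w y\<bar> \<partial>lebesgue) + (2 * D) * (\<integral>\<^sup>+y. ennreal (norm (w y *\<^sub>R biot_savart_kernel (x0 - y))) \<partial>lebesgue)"
    using m mk mi by (subst nn_integral_add) (auto intro!: borel_measurable_times borel_measurable_scaleR borel_measurable_norm measurable_compose[OF _ measurable_ennreal] simp: nn_integral_cmult)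
  also have "\<dots> < \<infinity>"
    using C D i1 i2 by (auto simp: ennreal_mult_eq_top_iff less_top[symmetric])
  finally show ?thesis by (simp add: I_def)
qed

lemma euler_velocity_curl:
  assumes w: "in_Lp p UNIV w" and p: "p \<ge> 1" and bs: "AE x in lebesgue. is_biot_savart w x (u x)"
    and \<psi>: "C_k 1 UNIV \<psi>" "vanishes_outside R \<psi>"
  shows "(\<integral>x. u x \<bullet> perp_grad \<psi> x \<partial>lebesgue) = - kernel_const * (\<integral>x. w x * \<psi> x \<partial>lebesgue)"
proof -
  have bs': "AE x in lborel. is_biot_savart w x (u x)" using bs by (simp add: AE_completion_iff)
  have "\<exists>x. is_biot_savart w x (u x)"
  proof (rule ccontr)
    assume "\<not> ?thesis"
    then have "AE x in (lborel :: (real^2) measure). False" using bs' by auto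
    then have "emeasure lborel (UNIV :: (real^2) set) = 0" by (simp add: AE_iff_measurable[OF _ refl])
    then show False by simp
  qed
  then obtain x0 where x0: "is_biot_savart w x0 (u x0)" ..
  have m: "w \<in> borel_measurable lebesgue" using w by (auto simp: in_Lp_def lebesgue_on_UNIV_eq)
  note g = grad_measurable[OF \<psi>(1)]
  have "(\<integral>x. u x \<bullet> perp_grad \<psi> x \<partial>lebesgue) = (\<integral>y. w y * (\<integral>x. biot_savart_kernel (x - y) \<bullet> perp_grad \<psi> x \<partial>lborel) \<partial>lebesgue)"
    by (rule biot_savart_pairing(1)[OF m bs' g(2) biot_savart_pairing_finite[OF w p x0 g(4) vanishes_grad(2)[OF \<psi>(2)]]])
  also have "\<dots> = (\<integral>y. - kernel_const * (w y * \<psi> y) \<partial>lebesgue)" by (simp add: kernel_grad(2)[OF \<psi>] mult_ac)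
  also have "\<dots> = - kernel_const * (\<integral>x. w x * \<psi> x \<partial>lebesgue)" by simp
  finally show ?thesis .
qed

section \<open>Weak convergence of equi-integrable sequences\<close>

text \<open>The tail condition only asks for \<open>eventually\<close> because it is inherited from the initial data through
  their convergence.\<close>

definition equiintegrable :: "(nat \<Rightarrow> 'a::euclidean_space \<Rightarrow> real) \<Rightarrow> bool" where
  "equiintegrable f \<longleftrightarrow> (\<forall>j. integrable lebesgue (f j)) \<and>
     (\<forall>\<eta>>0. \<exists>k>0. \<forall>\<^sub>F j in sequentially. (\<integral>x. soft_abs k (f j x) \<partial>lebesgue) \<le> \<eta>)"

lemma soft_abs_integrable_comp:
  assumes "k > 0" "integrable M f"
  shows "integrable M (\<lambda>x. soft_abs k (f x))"
proof (rule Bochner_Integration.integrable_bound[OF assms(2)])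
  show "(\<lambda>x. soft_abs k (f x)) \<in> borel_measurable M" using assms(2) by measurable
  show "AE x in M. norm (soft_abs k (f x)) \<le> norm (f x)"
    using soft_abs_le[OF assms(1)] soft_abs_nonneg[OF assms(1)] by (auto intro!: AE_I2)
qed

lemma integrable_mult_bounded:
  fixes f g :: "'a \<Rightarrow> real"
  assumes "integrable M f" "g \<in> borel_measurable M" "\<And>x. \<bar>g x\<bar> \<le> B"
  shows "integrable M (\<lambda>x. f x * g x)"
proof (rule Bochner_Integration.integrable_bound)
  show "integrable M (\<lambda>x. B * \<bar>f x\<bar>)" using assms(1) by simp
  show "(\<lambda>x. f x * g x) \<in> borel_measurable M" using assms by measurable
  have "B \<ge> 0" using order_trans[OF abs_ge_zero assms(3)] .
  then show "AE x in M. norm (f x * g x) \<le> norm (B * \<bar>f x\<bar>)"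
    using mult_left_mono[OF assms(3) abs_ge_zero] by (intro AE_I2) (simp add: abs_mult mult.commute)
qed

text \<open>Split \<open>f j = trunc k (f j) + (f j - trunc k (f j))\<close>. Against the bounded part, \<open>L\<^sup>1\<close> convergence of
  the test functions suffices; the remainder is uniformly small in \<open>L\<^sup>1\<close> and meets only bounded test functions.\<close>

lemma weak_limit_closure:
  fixes f :: "nat \<Rightarrow> 'a::euclidean_space \<Rightarrow> real"
  assumes f: "equiintegrable f"
    and g: "g \<in> borel_measurable lebesgue" "\<And>x. \<bar>g x\<bar> \<le> B" and fg: "integrable lebesgue (\<lambda>x. f0 x * g x)"
    and \<phi>: "\<And>i. \<phi> i \<in> borel_measurable lebesgue" "\<And>i x. \<bar>\<phi> i x\<bar> \<le> B" "\<And>i. integrable lebesgue (\<lambda>x. f0 x * \<phi> i x)"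
    and d: "\<And>i. integrable lebesgue (\<lambda>x. \<phi> i x - g x)"
    and L1: "(\<lambda>i. \<integral>x. \<bar>\<phi> i x - g x\<bar> \<partial>lebesgue) \<longlonglongrightarrow> 0"
    and L2: "(\<lambda>i. \<integral>x. f0 x * \<phi> i x \<partial>lebesgue) \<longlonglongrightarrow> (\<integral>x. f0 x * g x \<partial>lebesgue)"
    and conv: "\<And>i. (\<lambda>j. \<integral>x. f j x * \<phi> i x \<partial>lebesgue) \<longlonglongrightarrow> (\<integral>x. f0 x * \<phi> i x \<partial>lebesgue)"
  shows "(\<lambda>j. \<integral>x. f j x * g x \<partial>lebesgue) \<longlonglongrightarrow> (\<integral>x. f0 x * g x \<partial>lebesgue)"
proof (rule LIMSEQ_I)
  fix r :: real assume r: "r > 0"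
  have B0: "B \<ge> 0" using order_trans[OF abs_ge_zero g(2)] .
  \<comment> \<open>Two remainders of size \<open>B * \<eta>\<close> and three further errors of size \<open>\<eta>\<close> have to stay below \<open>r\<close>.\<close>
  define \<eta> where "\<eta> = r / (2 * B + 4)"
  have \<eta>: "\<eta> > 0" using r B0 by (simp add: \<eta>_def)
  obtain k where k: "k > 0" and ev: "\<forall>\<^sub>F j in sequentially. (\<integral>x. soft_abs k (f j x) \<partial>lebesgue) \<le> \<eta>"
    using f \<eta> unfolding equiintegrable_def by blast
  have fi: "integrable lebesgue (f j)" for j using f by (simp add: equiintegrable_def)
  have "\<forall>\<^sub>F i in sequentially. (\<integral>x. \<bar>\<phi> i x - g x\<bar> \<partial>lebesgue) < \<eta> / k"
    using order_tendstoD(2)[OF L1] \<eta> k by simp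
  moreover have "\<forall>\<^sub>F i in sequentially. \<bar>(\<integral>x. f0 x * \<phi> i x \<partial>lebesgue) - (\<integral>x. f0 x * g x \<partial>lebesgue)\<bar> < \<eta>"
    using tendstoD[OF L2 \<eta>] by (simp add: dist_real_def)
  ultimately obtain i where i: "(\<integral>x. \<bar>\<phi> i x - g x\<bar> \<partial>lebesgue) < \<eta> / k"
    "\<bar>(\<integral>x. f0 x * \<phi> i x \<partial>lebesgue) - (\<integral>x. f0 x * g x \<partial>lebesgue)\<bar> < \<eta>"
    by (metis (mono_tags, lifting) eventually_conj eventually_sequentially le_refl)
  have "\<forall>\<^sub>F j in sequentially. \<bar>(\<integral>x. f j x * \<phi> i x \<partial>lebesgue) - (\<integral>x. f0 x * \<phi> i x \<partial>lebesgue)\<bar> < \<eta>"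
    using tendstoD[OF conv[of i] \<eta>] by (simp add: dist_real_def)
  with ev have "\<forall>\<^sub>F j in sequentially. norm ((\<integral>x. f j x * g x \<partial>lebesgue) - (\<integral>x. f0 x * g x \<partial>lebesgue)) < r"
  proof eventually_elim
    fix j assume j: "(\<integral>x. soft_abs k (f j x) \<partial>lebesgue) \<le> \<eta>"
      "\<bar>(\<integral>x. f j x * \<phi> i x \<partial>lebesgue) - (\<integral>x. f0 x * \<phi> i x \<partial>lebesgue)\<bar> < \<eta>"
    have i1: "integrable lebesgue (\<lambda>x. f j x * \<phi> i x)" "integrable lebesgue (\<lambda>x. f j x * g x)"
      by (rule integrable_mult_bounded[OF fi \<phi>(1,2)], rule integrable_mult_bounded[OF fi g])
    have si: "integrable lebesgue (\<lambda>x. soft_abs k (f j x))" by (rule soft_abs_integrable_comp[OF k fi])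
    have di: "integrable lebesgue (\<lambda>x. \<bar>\<phi> i x - g x\<bar>)" using d by simp
    have "norm (\<integral>x. f j x * \<phi> i x - f j x * g x \<partial>lebesgue) \<le> (\<integral>x. k * \<bar>\<phi> i x - g x\<bar> + 2 * B * soft_abs k (f j x) \<partial>lebesgue)"
    proof (rule order_trans[OF integral_norm_bound integral_mono'])
      show "integrable lebesgue (\<lambda>x. k * \<bar>\<phi> i x - g x\<bar> + 2 * B * soft_abs k (f j x))" using si di by simp
      fix x
      have "norm (f j x * \<phi> i x - f j x * g x) = \<bar>f j x\<bar> * \<bar>\<phi> i x - g x\<bar>"
        by (simp add: right_diff_distrib[symmetric] abs_mult)
      also have "\<dots> \<le> (k + soft_abs k (f j x)) * \<bar>\<phi> i x - g x\<bar>"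
        by (intro mult_right_mono abs_le_soft_abs k) auto
      also have "\<dots> = k * \<bar>\<phi> i x - g x\<bar> + soft_abs k (f j x) * \<bar>\<phi> i x - g x\<bar>" by (rule distrib_right)
      also have "\<dots> \<le> k * \<bar>\<phi> i x - g x\<bar> + soft_abs k (f j x) * (2 * B)"
        using g(2)[of x] \<phi>(2)[of i x] soft_abs_nonneg[OF k, of "f j x"] by (intro add_left_mono mult_left_mono) auto
      finally show "norm (f j x * \<phi> i x - f j x * g x) \<le> k * \<bar>\<phi> i x - g x\<bar> + 2 * B * soft_abs k (f j x)"
        by (simp add: mult.commute)
      show "0 \<le> k * \<bar>\<phi> i x - g x\<bar> + 2 * B * soft_abs k (f j x)"
        using k B0 soft_abs_nonneg[OF k] by simp
    qed
    also have "\<dots> = k * (\<integral>x. \<bar>\<phi> i x - g x\<bar> \<partial>lebesgue) + 2 * B * (\<integral>x. soft_abs k (f j x) \<partial>lebesgue)"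
      using si di by simp
    also have "\<dots> \<le> k * (\<eta> / k) + 2 * B * \<eta>"
      using i(1) j(1) k B0 by (intro add_mono mult_left_mono) auto
    also have "\<dots> = (2 * B + 1) * \<eta>" using k by (simp add: algebra_simps)
    finally have "\<bar>(\<integral>x. f j x * \<phi> i x \<partial>lebesgue) - (\<integral>x. f j x * g x \<partial>lebesgue)\<bar> \<le> (2 * B + 1) * \<eta>"
      using i1 by simp
    then have "\<bar>(\<integral>x. f j x * g x \<partial>lebesgue) - (\<integral>x. f0 x * g x \<partial>lebesgue)\<bar> < (2 * B + 1) * \<eta> + \<eta> + \<eta>"
      using i(2) j(2) by linarith
    also have "\<dots> < (2 * B + 4) * \<eta>" using \<eta> by (simp add: algebra_simps)
    also have "\<dots> = r" using B0 by (simp add: \<eta>_def)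
    finally show "norm ((\<integral>x. f j x * g x \<partial>lebesgue) - (\<integral>x. f0 x * g x \<partial>lebesgue)) < r" by simp
  qed
  then show "\<exists>no. \<forall>n\<ge>no. norm ((\<integral>x. f n x * g x \<partial>lebesgue) - (\<integral>x. f0 x * g x \<partial>lebesgue)) < r"
    by (simp add: eventually_sequentially)
qed

text \<open>A Lebesgue measurable function is almost everywhere a limit of continuous functions. These are truncated to values
  in \<open>[-1,1]\<close>, approximated uniformly on a ball by polynomials, and multiplied with a cut-off.\<close>

lemma test_function_approximation:
  fixes g :: "'a::euclidean_space \<Rightarrow> real"
  assumes g: "g \<in> borel_measurable lebesgue" "\<And>x. \<bar>g x\<bar> \<le> 1" "vanishes_outside R g" and R: "R > 0"
  obtains \<phi> where "\<And>i n. C_k n UNIV (\<phi> i)" "\<And>i. vanishes_outside (2 * R) (\<phi> i)" "\<And>i x. \<bar>\<phi> i x\<bar> \<le> 2"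
    "AE x in lebesgue. (\<lambda>i. \<phi> i x) \<longlonglongrightarrow> g x"
proof -
  have "g measurable_on UNIV" by (rule lebesgue_measurable_imp_measurable_on) (use g(1) in auto)
  then obtain N h where N: "negligible N" and h: "\<And>n. continuous_on UNIV (h n)" "\<And>x. x \<notin> N \<Longrightarrow> (\<lambda>n. h n x) \<longlonglongrightarrow> g x"
    unfolding measurable_on_def by auto
  define c where "c n x = max (-1) (min 1 (h n x))" for n x
  have cc: "continuous_on UNIV (c n)" for n unfolding c_def by (intro continuous_intros h)
  have cb: "\<bar>c n x\<bar> \<le> 1" for n x by (auto simp: c_def)
  have cl: "(\<lambda>n. c n x) \<longlonglongrightarrow> g x" if "x \<notin> N" for x
  proof -
    have "(\<lambda>n. max (-1) (min 1 (h n x))) \<longlonglongrightarrow> max (-1) (min 1 (g x))"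
      by (intro tendsto_max tendsto_min tendsto_const h(2) that)
    moreover have "max (-1) (min 1 (g x)) = g x" using g(2)[of x] by auto
    ultimately show ?thesis by (simp add: c_def)
  qed
  have "\<exists>q. real_polynomial_function q \<and> (\<forall>x\<in>cball 0 (2 * R). \<bar>c n x - q x\<bar> < inverse (real (Suc n)))" for n
  proof -
    obtain q where "real_polynomial_function q" "\<And>x. x \<in> cball 0 (2 * R) \<Longrightarrow> \<bar>c n x - q x\<bar> < inverse (real (Suc n))"
      by (rule Stone_Weierstrass_real_polynomial_function[of "cball 0 (2 * R)" "c n" "inverse (real (Suc n))"])
         (auto intro: continuous_on_subset[OF cc])
    then show ?thesis by blast
  qed
  then obtain q where q: "\<And>n. real_polynomial_function (q n)"
    "\<And>n x. x \<in> cball 0 (2 * R) \<Longrightarrow> \<bar>c n x - q n x\<bar> < inverse (real (Suc n))" by metis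
  define \<phi> where "\<phi> n x = q n x * cutoff R x" for n x
  show ?thesis
  proof (rule that[of \<phi>])
    show "C_k m UNIV (\<phi> n)" for m n
      unfolding \<phi>_def[abs_def] by (rule C_k_mult[OF open_UNIV real_polynomial_C_k[OF q(1)] C_k_cutoff])
    show "vanishes_outside (2 * R) (\<phi> n)" for n
      unfolding \<phi>_def[abs_def] by (rule vanishes_mult[OF vanishes_cutoff[OF R]])
    show "\<bar>\<phi> n x\<bar> \<le> 2" for n x
    proof (cases "x \<in> cball 0 (2 * R)")
      case True
      have "inverse (real (Suc n)) \<le> 1" by (simp add: field_simps)
      then have "\<bar>q n x\<bar> \<le> 2" using q(2)[OF True, of n] cb[of n x] by linarith
      then have "\<bar>q n x\<bar> * \<bar>cutoff R x\<bar> \<le> 2 * 1" using cutoff_bounds[of R x] by (intro mult_mono) auto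
      then show ?thesis by (simp add: \<phi>_def abs_mult)
    next
      case False then show ?thesis using cutoff_0[OF R, of x] by (simp add: \<phi>_def)
    qed
    show "AE x in lebesgue. (\<lambda>i. \<phi> i x) \<longlonglongrightarrow> g x"
    proof (rule AE_I')
      show "N \<in> null_sets lebesgue" using N by (simp add: negligible_iff_null_sets)
      show "{x \<in> space lebesgue. \<not> (\<lambda>i. \<phi> i x) \<longlonglongrightarrow> g x} \<subseteq> N"
      proof (rule subsetI, rule ccontr)
        fix x assume x: "x \<in> {x \<in> space lebesgue. \<not> (\<lambda>i. \<phi> i x) \<longlonglongrightarrow> g x}" and "x \<notin> N"
        have "(\<lambda>i. \<phi> i x) \<longlonglongrightarrow> g x"
        proof (cases "x \<in> cball 0 (2 * R)")
          case True
          have "(\<lambda>n. c n x - q n x) \<longlonglongrightarrow> 0"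
            by (rule Lim_null_comparison[OF _ LIMSEQ_inverse_real_of_nat])
               (use q(2)[OF True] in \<open>auto intro!: always_eventually less_imp_le\<close>)
          from tendsto_diff[OF cl[OF \<open>x \<notin> N\<close>] this] have "(\<lambda>n. q n x) \<longlonglongrightarrow> g x" by simp
          then have "(\<lambda>n. q n x * cutoff R x) \<longlonglongrightarrow> g x * cutoff R x" by (intro tendsto_intros)
          moreover have "g x * cutoff R x = g x"
            using g(3) cutoff_1[OF R, of x] by (cases "norm x \<le> R") (auto simp: vanishes_outside_def)
          ultimately show ?thesis by (simp add: \<phi>_def)
        next
          case False
          then have "g x = 0" using g(3) R by (simp add: vanishes_outside_def)
          then show ?thesis using cutoff_0[OF R, of x] False by (simp add: \<phi>_def)
        qed
        with x show False by simp
      qed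
    qed
  qed
qed

lemma indicator_cball_integrable: "integrable lebesgue (\<lambda>x. indicator (cball (0::'a::euclidean_space) R) x :: real)"
  by (intro integrable_real_indicator) (auto simp: emeasure_bounded_finite[OF bounded_cball, simplified])

definition locally_integrable :: "('a::euclidean_space \<Rightarrow> real) \<Rightarrow> bool" where
  "locally_integrable f \<longleftrightarrow> (\<forall>R. integrable lebesgue (\<lambda>x. indicator (cball 0 R) x * f x))"

text \<open>Convergence in the sense of distributions, against smooth functions of bounded support.\<close>

definition weakly_convergent :: "(nat \<Rightarrow> 'a::euclidean_space \<Rightarrow> real) \<Rightarrow> ('a \<Rightarrow> real) \<Rightarrow> bool" where
  "weakly_convergent f f0 \<longleftrightarrow> (\<forall>\<zeta> R. (\<forall>n. C_k n UNIV \<zeta>) \<longrightarrow> vanishes_outside R \<zeta> \<longrightarrow>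
     (\<lambda>j. \<integral>x. f j x * \<zeta> x \<partial>lebesgue) \<longlonglongrightarrow> (\<integral>x. f0 x * \<zeta> x \<partial>lebesgue))"

lemma locally_integrable_mult:
  fixes g :: "'a::euclidean_space \<Rightarrow> real"
  assumes "locally_integrable f" "g \<in> borel_measurable lebesgue" "\<And>x. \<bar>g x\<bar> \<le> B" "vanishes_outside R g"
  shows "integrable lebesgue (\<lambda>x. f x * g x)"
proof -
  have "integrable lebesgue (\<lambda>x. (indicator (cball 0 R) x * f x) * g x)"
    by (rule integrable_mult_bounded[OF _ assms(2,3)]) (use assms(1) in \<open>simp add: locally_integrable_def\<close>)
  moreover have "(\<lambda>x. (indicator (cball 0 R) x * f x) * g x) = (\<lambda>x. f x * g x)"
    using assms(4) by (auto simp: fun_eq_iff vanishes_outside_def indicator_def)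
  ultimately show ?thesis by simp
qed

lemma weak_limit_compact_support:
  fixes f :: "nat \<Rightarrow> 'a::euclidean_space \<Rightarrow> real"
  assumes f: "equiintegrable f" and f0: "locally_integrable f0" and conv: "weakly_convergent f f0"
    and g: "g \<in> borel_measurable lebesgue" "\<And>x. \<bar>g x\<bar> \<le> 1" "vanishes_outside R g"
  shows "(\<lambda>j. \<integral>x. f j x * g x \<partial>lebesgue) \<longlonglongrightarrow> (\<integral>x. f0 x * g x \<partial>lebesgue)"
proof -
  define r where "r = \<bar>R\<bar> + 1"
  have r: "r > 0" by (simp add: r_def)
  have gr: "vanishes_outside r g" using g(3) by (auto simp: vanishes_outside_def r_def)
  obtain \<phi> where \<phi>: "\<And>i n. C_k n UNIV (\<phi> i)" "\<And>i. vanishes_outside (2 * r) (\<phi> i)" "\<And>i x. \<bar>\<phi> i x\<bar> \<le> 2"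
    and lim: "AE x in lebesgue. (\<lambda>i. \<phi> i x) \<longlonglongrightarrow> g x"
    using test_function_approximation[OF g(1,2) gr r] by blast
  have m\<phi>: "\<phi> i \<in> borel_measurable lebesgue" for i
    using C_k_continuous[OF \<phi>(1)] by (intro measurable_completion) (auto intro: borel_measurable_continuous_onI)
  have g2: "\<bar>g x\<bar> \<le> 2" for x using g(2)[of x] by simp
  have gr2: "vanishes_outside (2 * r) g" using gr r by (auto simp: vanishes_outside_def)
  let ?i = "indicator (cball (0::'a) (2 * r)) :: _ \<Rightarrow> real"
  have bound: "\<bar>\<phi> i x - g x\<bar> \<le> 4 * ?i x" for i x
    using \<phi>(3)[of i x] g2[of x] \<phi>(2)[of i] gr2 by (cases "x \<in> cball 0 (2 * r)") (auto simp: vanishes_outside_def)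
  have d: "integrable lebesgue (\<lambda>x. \<phi> i x - g x)" for i
  proof (rule Bochner_Integration.integrable_bound)
    show "integrable lebesgue (\<lambda>x. 4 * ?i x)" by (intro integrable_mult_right indicator_cball_integrable)
    show "(\<lambda>x. \<phi> i x - g x) \<in> borel_measurable lebesgue" using m\<phi> g(1) by measurable
  qed (use bound in auto)
  have L1: "(\<lambda>i. \<integral>x. \<bar>\<phi> i x - g x\<bar> \<partial>lebesgue) \<longlonglongrightarrow> (\<integral>x. 0 \<partial>(lebesgue :: 'a measure))"
  proof (rule integral_dominated_convergence)
    show "integrable lebesgue (\<lambda>x. 4 * ?i x)" by (intro integrable_mult_right indicator_cball_integrable)
    show "AE x in lebesgue. (\<lambda>i. \<bar>\<phi> i x - g x\<bar>) \<longlonglongrightarrow> 0"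
      using lim by eventually_elim (metis LIM_zero tendsto_rabs_zero)
    show "AE x in lebesgue. norm \<bar>\<phi> i x - g x\<bar> \<le> 4 * ?i x" for i using bound by (intro AE_I2) simp
  qed (use d in auto)
  have L2: "(\<lambda>i. \<integral>x. f0 x * \<phi> i x \<partial>lebesgue) \<longlonglongrightarrow> (\<integral>x. f0 x * g x \<partial>lebesgue)"
  proof (rule integral_dominated_convergence)
    show "integrable lebesgue (\<lambda>x. 2 * \<bar>?i x * f0 x\<bar>)" using f0 by (simp add: locally_integrable_def)
    show "AE x in lebesgue. (\<lambda>i. f0 x * \<phi> i x) \<longlonglongrightarrow> f0 x * g x"
      using lim by eventually_elim (rule tendsto_mult_left)
    show "AE x in lebesgue. norm (f0 x * \<phi> i x) \<le> 2 * \<bar>?i x * f0 x\<bar>" for i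
    proof (rule AE_I2)
      fix x
      show "norm (f0 x * \<phi> i x) \<le> 2 * \<bar>?i x * f0 x\<bar>"
        using mult_left_mono[OF \<phi>(3)[of i x], of "\<bar>f0 x\<bar>"] \<phi>(2)[of i]
        by (cases "x \<in> cball 0 (2 * r)") (auto simp: vanishes_outside_def abs_mult mult.commute)
    qed
    show "(\<lambda>x. f0 x * g x) \<in> borel_measurable lebesgue" "(\<lambda>x. f0 x * \<phi> i x) \<in> borel_measurable lebesgue" for i
      using locally_integrable_mult[OF f0 g(1) g2 gr2] locally_integrable_mult[OF f0 m\<phi> \<phi>(3,2)] by auto
  qed
  show ?thesis
  proof (rule weak_limit_closure[OF f g(1) g2 _ m\<phi> \<phi>(3) _ d _ L2])
    show "integrable lebesgue (\<lambda>x. f0 x * g x)" "integrable lebesgue (\<lambda>x. f0 x * \<phi> i x)" for i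
      using locally_integrable_mult[OF f0 g(1) g2 gr2] locally_integrable_mult[OF f0 m\<phi> \<phi>(3,2)] by auto
    show "(\<lambda>i. \<integral>x. \<bar>\<phi> i x - g x\<bar> \<partial>lebesgue) \<longlonglongrightarrow> 0" using L1 by simp
    show "(\<lambda>j. \<integral>x. f j x * \<phi> i x \<partial>lebesgue) \<longlonglongrightarrow> (\<integral>x. f0 x * \<phi> i x \<partial>lebesgue)" for i
      using conv \<phi>(1,2) unfolding weakly_convergent_def by blast
  qed
qed

text \<open>Testing with the sign of the limit on balls, followed by Fatou's lemma as the balls exhaust the space.\<close>

lemma weak_limit_integrable:
  fixes f :: "nat \<Rightarrow> 'a::euclidean_space \<Rightarrow> real"
  assumes f: "equiintegrable f" and f0: "locally_integrable f0" "f0 \<in> borel_measurable lebesgue" and conv: "weakly_convergent f f0"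
    and N: "\<And>j. (\<integral>x. \<bar>f j x\<bar> \<partial>lebesgue) \<le> N"
  shows "integrable lebesgue f0" "(\<integral>x. \<bar>f0 x\<bar> \<partial>lebesgue) \<le> N"
proof -
  have fi: "integrable lebesgue (f j)" for j using f by (simp add: equiintegrable_def)
  have ball: "(\<integral>x. indicator (cball 0 (real n)) x * \<bar>f0 x\<bar> \<partial>lebesgue) \<le> N" for n
  proof -
    define g where "g x = indicator (cball 0 (real n)) x * sgn (f0 x)" for x
    have mi: "(\<lambda>x. indicator (cball (0::'a) (real n)) x :: real) \<in> borel_measurable lebesgue"
      using indicator_cball_integrable by (rule borel_measurable_integrable)
    have gm: "g \<in> borel_measurable lebesgue"
      unfolding g_def[abs_def] using mi f0(2) by measurable
    have gb: "\<bar>g x\<bar> \<le> 1" for x by (simp add: g_def indicator_def sgn_if)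
    have gv: "vanishes_outside (real n) g" by (simp add: vanishes_outside_def g_def)
    have "(\<lambda>j. \<integral>x. f j x * g x \<partial>lebesgue) \<longlonglongrightarrow> (\<integral>x. f0 x * g x \<partial>lebesgue)"
      by (rule weak_limit_compact_support[OF f f0(1) conv gm gb gv])
    moreover have "(\<integral>x. f j x * g x \<partial>lebesgue) \<le> N" for j
    proof -
      have "(\<integral>x. f j x * g x \<partial>lebesgue) \<le> (\<integral>x. \<bar>f j x\<bar> \<partial>lebesgue)"
      proof (rule integral_mono)
        show "integrable lebesgue (\<lambda>x. f j x * g x)" by (rule integrable_mult_bounded[OF fi gm gb])
        show "f j x * g x \<le> \<bar>f j x\<bar>" for x
          using mult_left_mono[OF gb[of x], of "\<bar>f j x\<bar>"] by (simp add: abs_mult[symmetric])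
      qed (use fi in simp)
      then show ?thesis using N[of j] by linarith
    qed
    ultimately have "(\<integral>x. f0 x * g x \<partial>lebesgue) \<le> N" by (intro LIMSEQ_le_const2) auto
    moreover have "(\<lambda>x. f0 x * g x) = (\<lambda>x. indicator (cball 0 (real n)) x * \<bar>f0 x\<bar>)"
      by (auto simp: g_def fun_eq_iff abs_sgn)
    ultimately show ?thesis by simp
  qed
  have int: "integrable lebesgue (\<lambda>x. indicator (cball 0 (real n)) x * \<bar>f0 x\<bar>)" for n
    using integrable_abs[of lebesgue "\<lambda>x. indicator (cball 0 (real n)) x * f0 x"] f0(1)
    by (simp add: locally_integrable_def abs_mult)
  have N0: "N \<ge> 0" using N[of 0] by (rule order_trans[rotated]) simp
  have "(\<integral>\<^sup>+x. ennreal \<bar>f0 x\<bar> \<partial>lebesgue) = (\<integral>\<^sup>+x. liminf (\<lambda>n. ennreal (indicator (cball 0 (real n)) x * \<bar>f0 x\<bar>)) \<partial>lebesgue)"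
  proof (intro nn_integral_cong lim_imp_Liminf[symmetric] tendsto_ennrealI)
    fix x :: 'a
    obtain n0 where n0: "norm x \<le> real n0" using real_arch_simple by blast
    have "\<forall>\<^sub>F n in sequentially. \<bar>f0 x\<bar> = indicator (cball 0 (real n)) x * \<bar>f0 x\<bar>"
      using eventually_ge_at_top[of n0] by eventually_elim (use n0 in auto)
    then show "(\<lambda>n. indicator (cball 0 (real n)) x * \<bar>f0 x\<bar>) \<longlonglongrightarrow> \<bar>f0 x\<bar>"
      by (rule Lim_transform_eventually[OF tendsto_const])
  qed simp
  also have "\<dots> \<le> liminf (\<lambda>n. \<integral>\<^sup>+x. ennreal (indicator (cball 0 (real n)) x * \<bar>f0 x\<bar>) \<partial>lebesgue)"
    by (rule nn_integral_liminf) (use int in \<open>auto intro: borel_measurable_integrable\<close>)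
  also have "\<dots> \<le> liminf (\<lambda>n. ennreal N)"
  proof (intro Liminf_mono always_eventually allI)
    fix n
    have "(\<integral>\<^sup>+x. ennreal (indicator (cball 0 (real n)) x * \<bar>f0 x\<bar>) \<partial>lebesgue) = ennreal (\<integral>x. indicator (cball 0 (real n)) x * \<bar>f0 x\<bar> \<partial>lebesgue)"
      by (rule nn_integral_eq_integral[OF int]) simp
    also have "\<dots> \<le> ennreal N" by (rule ennreal_leI[OF ball])
    finally show "(\<integral>\<^sup>+x. ennreal (indicator (cball 0 (real n)) x * \<bar>f0 x\<bar>) \<partial>lebesgue) \<le> ennreal N" .
  qed
  also have "\<dots> = ennreal N" by (rule Liminf_const) simp
  finally have le: "(\<integral>\<^sup>+x. ennreal \<bar>f0 x\<bar> \<partial>lebesgue) \<le> ennreal N" .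
  show i: "integrable lebesgue f0"
    unfolding integrable_iff_bounded using f0(2) order_le_less_trans[OF le] by simp
  show "(\<integral>x. \<bar>f0 x\<bar> \<partial>lebesgue) \<le> N"
    using le N0 by (subst (asm) nn_integral_eq_integral) (use i in auto)
qed

lemma weak_limit_bounded:
  fixes f :: "nat \<Rightarrow> 'a::euclidean_space \<Rightarrow> real"
  assumes f: "equiintegrable f" and f0: "integrable lebesgue f0" and conv: "weakly_convergent f f0"
    and g: "integrable lebesgue g" "\<And>x. \<bar>g x\<bar> \<le> 1"
  shows "(\<lambda>j. \<integral>x. f j x * g x \<partial>lebesgue) \<longlonglongrightarrow> (\<integral>x. f0 x * g x \<partial>lebesgue)"
proof -
  define \<phi> where "\<phi> n x = indicator (cball 0 (real n)) x * g x" for n x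
  have mi: "(\<lambda>x. indicator (cball (0::'a) (real n)) x :: real) \<in> borel_measurable lebesgue" for n
    using indicator_cball_integrable by (rule borel_measurable_integrable)
  have gm: "g \<in> borel_measurable lebesgue" using g(1) by (rule borel_measurable_integrable)
  have m\<phi>: "\<phi> n \<in> borel_measurable lebesgue" for n unfolding \<phi>_def[abs_def] using mi gm by measurable
  have b\<phi>: "\<bar>\<phi> n x\<bar> \<le> 1" for n x using g(2)[of x] by (simp add: \<phi>_def indicator_def)
  have \<phi>g: "\<bar>\<phi> n x\<bar> \<le> \<bar>g x\<bar>" for n x by (simp add: \<phi>_def indicator_def)
  have lim: "(\<lambda>n. \<phi> n x) \<longlonglongrightarrow> g x" for x
  proof -
    obtain n0 where n0: "norm x \<le> real n0" using real_arch_simple by blast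
    have "\<forall>\<^sub>F n in sequentially. g x = \<phi> n x"
      using eventually_ge_at_top[of n0] by eventually_elim (use n0 in \<open>auto simp: \<phi>_def\<close>)
    then show ?thesis by (rule Lim_transform_eventually[OF tendsto_const])
  qed
  have loc: "locally_integrable f0"
    unfolding locally_integrable_def
  proof
    fix R
    have "integrable lebesgue (\<lambda>x. f0 x * indicator (cball 0 R) x)"
      by (rule integrable_mult_bounded[of _ _ _ 1, OF f0 borel_measurable_integrable[OF indicator_cball_integrable]]) (simp add: indicator_def)
    then show "integrable lebesgue (\<lambda>x. indicator (cball 0 R) x * f0 x)" by (simp add: mult.commute)
  qed
  have \<phi>i: "integrable lebesgue (\<phi> n)" for n
    by (rule Bochner_Integration.integrable_bound[OF g(1) m\<phi>]) (use \<phi>g in auto)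
  have L1: "(\<lambda>i. \<integral>x. \<bar>\<phi> i x - g x\<bar> \<partial>lebesgue) \<longlonglongrightarrow> (\<integral>x. 0 \<partial>(lebesgue :: 'a measure))"
  proof (rule integral_dominated_convergence)
    show "integrable lebesgue (\<lambda>x. 2 * \<bar>g x\<bar>)" using g(1) by simp
    show "AE x in lebesgue. (\<lambda>i. \<bar>\<phi> i x - g x\<bar>) \<longlonglongrightarrow> 0"
      by (intro AE_I2 tendsto_rabs_zero LIM_zero lim)
    show "AE x in lebesgue. norm \<bar>\<phi> i x - g x\<bar> \<le> 2 * \<bar>g x\<bar>" for i
    proof (rule AE_I2)
      fix x
      show "norm \<bar>\<phi> i x - g x\<bar> \<le> 2 * \<bar>g x\<bar>" using \<phi>g[of i x] unfolding real_norm_def by linarith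
    qed
  qed (use m\<phi> gm in auto)
  have L2: "(\<lambda>i. \<integral>x. f0 x * \<phi> i x \<partial>lebesgue) \<longlonglongrightarrow> (\<integral>x. f0 x * g x \<partial>lebesgue)"
  proof (rule integral_dominated_convergence)
    show "integrable lebesgue (\<lambda>x. \<bar>f0 x\<bar>)" using f0 by simp
    show "AE x in lebesgue. (\<lambda>i. f0 x * \<phi> i x) \<longlonglongrightarrow> f0 x * g x" by (intro AE_I2 tendsto_mult_left lim)
    show "AE x in lebesgue. norm (f0 x * \<phi> i x) \<le> \<bar>f0 x\<bar>" for i
      using b\<phi> by (intro AE_I2) (simp add: abs_mult mult_left_le)
  qed (use m\<phi> gm f0 in auto)
  show ?thesis
  proof (rule weak_limit_closure[OF f gm g(2) _ m\<phi> b\<phi> _ _ _ L2])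
    show "integrable lebesgue (\<lambda>x. f0 x * g x)" "integrable lebesgue (\<lambda>x. f0 x * \<phi> i x)" for i
      by (rule integrable_mult_bounded[OF f0 gm g(2)], rule integrable_mult_bounded[OF f0 m\<phi> b\<phi>])
    show "integrable lebesgue (\<lambda>x. \<phi> i x - g x)" for i using \<phi>i g(1) by simp
    show "(\<lambda>i. \<integral>x. \<bar>\<phi> i x - g x\<bar> \<partial>lebesgue) \<longlonglongrightarrow> 0" using L1 by simp
    show "(\<lambda>j. \<integral>x. f j x * \<phi> i x \<partial>lebesgue) \<longlonglongrightarrow> (\<integral>x. f0 x * \<phi> i x \<partial>lebesgue)" for i
      by (rule weak_limit_compact_support[OF f loc conv m\<phi>[of i] b\<phi>, where R = "real i"]) (simp add: vanishes_outside_def \<phi>_def)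
  qed
qed

section \<open>From weak to strong convergence\<close>

text \<open>The gap between the strictly convex function \<open>soft_abs 1\<close> and its tangent at \<open>a\<close>.\<close>

definition bregman :: "real \<Rightarrow> real \<Rightarrow> real" where
  "bregman s a = soft_abs 1 s - soft_abs 1 a - a / sqrt (1 + a\<^sup>2) * (s - a)"

text \<open>With \<open>S = sqrt (1 + s\<^sup>2)\<close> and \<open>A = sqrt (1 + a\<^sup>2)\<close> the gap is \<open>(S * A - (1 + a * s)) / A\<close>, and
  \<open>(S * A)\<^sup>2 - (1 + a * s)\<^sup>2 = (s - a)\<^sup>2\<close>. The second bound is the quantitative strict convexity.\<close>

lemma bregman_bounds:
  shows "bregman s a \<ge> 0" "(s - a)\<^sup>2 \<le> 2 * bregman s a * (1 + a\<^sup>2) * sqrt (1 + s\<^sup>2)"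
proof -
  define S A where "S = sqrt (1 + s\<^sup>2)" and "A = sqrt (1 + a\<^sup>2)"
  have SA: "S > 0" "A > 0" "S\<^sup>2 = 1 + s\<^sup>2" "A\<^sup>2 = 1 + a\<^sup>2"
    by (auto simp: S_def A_def add_pos_nonneg)
  have b: "bregman s a * A = S * A - (1 + a * s)"
  proof -
    have "bregman s a = S - A - a / A * (s - a)"
      by (simp add: bregman_def soft_abs_def S_def A_def)
    then have "bregman s a * A = S * A - A\<^sup>2 - a * (s - a)"
      using SA(2) by (simp add: field_simps power2_eq_square)
    also have "\<dots> = S * A - (1 + a * s)" unfolding SA(4) by (simp add: algebra_simps power2_eq_square)
    finally show ?thesis .
  qed
  have sq: "(S * A)\<^sup>2 - (1 + a * s)\<^sup>2 = (s - a)\<^sup>2"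
    unfolding power_mult_distrib SA(3,4) by (simp add: algebra_simps power2_eq_square)
  have le: "\<bar>1 + a * s\<bar> \<le> S * A"
  proof (rule power2_le_imp_le)
    show "\<bar>1 + a * s\<bar>\<^sup>2 \<le> (S * A)\<^sup>2" using sq zero_le_power2[of "s - a"] unfolding power2_abs by linarith
  qed (use SA in simp)
  have "bregman s a * A \<ge> 0" using b le by linarith
  then show nn: "bregman s a \<ge> 0" using SA(2) by (simp add: zero_le_mult_iff)
  have "(s - a)\<^sup>2 = (bregman s a * A) * (S * A + (1 + a * s))"
    unfolding b sq[symmetric] by (simp add: algebra_simps power2_eq_square)
  also have "\<dots> \<le> (bregman s a * A) * (2 * (S * A))"
  proof (rule mult_left_mono)
    show "S * A + (1 + a * s) \<le> 2 * (S * A)" using le by linarith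
  qed (use nn SA in simp)
  also have "\<dots> = 2 * bregman s a * A\<^sup>2 * S" by (simp add: power2_eq_square)
  finally show "(s - a)\<^sup>2 \<le> 2 * bregman s a * (1 + a\<^sup>2) * sqrt (1 + s\<^sup>2)"
    unfolding SA(4) by (simp add: S_def)
qed

lemma bregman_tendsto:
  fixes s :: "nat \<Rightarrow> real"
  assumes "(\<lambda>j. bregman (s j) a) \<longlonglongrightarrow> 0"
  shows "s \<longlonglongrightarrow> a"
proof -
  define c where "c j = 2 * bregman (s j) a * (1 + a\<^sup>2)" for j
  have c0: "c \<longlonglongrightarrow> 0"
    unfolding c_def[abs_def] using tendsto_mult_left_zero[OF tendsto_mult_right_zero[OF assms, of 2], of "1 + a\<^sup>2"] by simp
  have cn: "c j \<ge> 0" for j unfolding c_def using bregman_bounds(1) by (intro mult_nonneg_nonneg) auto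
  define X where "X = 1 + \<bar>a\<bar>"
  have bound: "\<bar>s j - a\<bar> \<le> c j + sqrt (c j * X)" for j
  proof (rule ccontr)
    define d where "d = \<bar>s j - a\<bar>"
    assume "\<not> ?thesis"
    then have gt: "d > c j + sqrt (c j * X)" by (simp add: d_def)
    have sX: "sqrt (c j * X) \<ge> 0" "(sqrt (c j * X))\<^sup>2 = c j * X" using cn[of j] by (auto simp: X_def)
    have "sqrt (1 + (s j)\<^sup>2) \<le> 1 + \<bar>s j\<bar>" using soft_abs_le[of 1 "s j"] by (simp add: soft_abs_def)
    also have "\<dots> \<le> X + d" by (simp add: X_def d_def)
    finally have "d\<^sup>2 \<le> c j * (X + d)"
      using bregman_bounds(2)[of "s j" a] mult_left_mono[OF _ cn[of j], of "sqrt (1 + (s j)\<^sup>2)" "X + d"]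
      by (simp add: c_def d_def)
    then have "d * (d - c j) \<le> c j * X" by (simp add: algebra_simps power2_eq_square)
    moreover have "sqrt (c j * X) * sqrt (c j * X) < d * (d - c j)"
      using gt sX cn[of j] by (intro mult_strict_mono') auto
    ultimately show False using sX(2) by (simp add: power2_eq_square)
  qed
  have "(\<lambda>j. c j + sqrt (c j * X)) \<longlonglongrightarrow> 0 + sqrt (0 * X)" by (intro tendsto_intros c0)
  then have up: "(\<lambda>j. c j + sqrt (c j * X)) \<longlonglongrightarrow> 0" by simp
  have "(\<lambda>j. s j - a) \<longlonglongrightarrow> 0"
    by (rule Lim_null_comparison[OF always_eventually up]) (simp add: bound)
  then show ?thesis by (rule LIM_zero_cancel)
qed

lemma powr_diff_le:
  assumes "p \<ge> 1"
  shows "\<bar>a - b :: real\<bar> powr p \<le> 2 powr p * (\<bar>a\<bar> powr p + \<bar>b\<bar> powr p)"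
proof -
  have "\<bar>a - b\<bar> powr p \<le> (2 * max \<bar>a\<bar> \<bar>b\<bar>) powr p" using assms by (intro powr_mono2) auto
  also have "\<dots> = 2 powr p * (max \<bar>a\<bar> \<bar>b\<bar>) powr p" by (simp add: powr_mult)
  also have "\<dots> \<le> 2 powr p * (\<bar>a\<bar> powr p + \<bar>b\<bar> powr p)"
    by (intro mult_left_mono) (auto simp: max_def)
  finally show ?thesis .
qed

text \<open>Scheffe's lemma gives \<open>L\<^sup>1\<close> convergence of the powers. The \<open>p\<close>-th power of the difference exceeds a
  multiple of the difference of the powers by at most a multiple of \<open>\<bar>f0\<bar> powr p\<close>, so that dominated convergence
  handles the excess.\<close>

lemma scheffe_powr:
  fixes f :: "nat \<Rightarrow> 'a \<Rightarrow> real"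
  assumes p: "p \<ge> 1" and m: "\<And>j. f j \<in> borel_measurable M" "f0 \<in> borel_measurable M"
    and i: "\<And>j. integrable M (\<lambda>x. \<bar>f j x\<bar> powr p)" "integrable M (\<lambda>x. \<bar>f0 x\<bar> powr p)"
    and lim: "AE x in M. (\<lambda>j. f j x) \<longlonglongrightarrow> f0 x"
    and le: "\<And>j. (\<integral>x. \<bar>f j x\<bar> powr p \<partial>M) \<le> B j" "B \<longlonglongrightarrow> (\<integral>x. \<bar>f0 x\<bar> powr p \<partial>M)"
  shows "(\<lambda>j. \<integral>x. \<bar>f j x - f0 x\<bar> powr p \<partial>M) \<longlonglongrightarrow> 0"
proof -
  note [measurable] = m
  have pc: "((\<lambda>j. \<bar>s j\<bar> powr p) \<longlonglongrightarrow> \<bar>a\<bar> powr p)" if "s \<longlonglongrightarrow> a" for s :: "nat \<Rightarrow> real" and a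
    using that p by (intro tendsto_powr' tendsto_rabs tendsto_const) auto
  have limp: "AE x in M. (\<lambda>j. \<bar>f j x\<bar> powr p) \<longlonglongrightarrow> \<bar>f0 x\<bar> powr p"
    using lim by eventually_elim (rule pc)
  have "(\<lambda>n. \<integral>\<^sup>+x. norm (\<bar>f n x\<bar> powr p - \<bar>f0 x\<bar> powr p) \<partial>M) \<longlonglongrightarrow> 0"
  proof (rule Scheffe_lemma1[OF i limp])
    have eq: "(\<integral>\<^sup>+x. ennreal (\<bar>g x\<bar> powr p) \<partial>M) = ennreal (\<integral>x. \<bar>g x\<bar> powr p \<partial>M)"
      if "integrable M (\<lambda>x. \<bar>g x\<bar> powr p)" for g :: "'a \<Rightarrow> real"
      using nn_integral_eq_integral[OF that] by simp
    have "limsup (\<lambda>n. \<integral>\<^sup>+x. ennreal (norm (\<bar>f n x\<bar> powr p)) \<partial>M) \<le> limsup (\<lambda>n. ennreal (B n))"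
      by (intro Limsup_mono always_eventually allI) (simp add: eq[OF i(1)] le ennreal_leI)
    also have "\<dots> = ennreal (\<integral>x. \<bar>f0 x\<bar> powr p \<partial>M)"
      by (intro lim_imp_Limsup tendsto_ennrealI le) simp
    finally show "limsup (\<lambda>n. \<integral>\<^sup>+x. ennreal (norm (\<bar>f n x\<bar> powr p)) \<partial>M) \<le> (\<integral>\<^sup>+x. ennreal (norm (\<bar>f0 x\<bar> powr p)) \<partial>M)"
      by (simp add: eq[OF i(2)])
  qed
  moreover have id: "integrable M (\<lambda>x. \<bar>\<bar>f n x\<bar> powr p - \<bar>f0 x\<bar> powr p\<bar>)" for n using i by simp
  ultimately have "(\<lambda>n. ennreal (\<integral>x. \<bar>\<bar>f n x\<bar> powr p - \<bar>f0 x\<bar> powr p\<bar> \<partial>M)) \<longlonglongrightarrow> ennreal 0"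
    using nn_integral_eq_integral[OF id] by simp
  then have sch: "(\<lambda>n. \<integral>x. \<bar>\<bar>f n x\<bar> powr p - \<bar>f0 x\<bar> powr p\<bar> \<partial>M) \<longlonglongrightarrow> 0"
    by (subst (asm) tendsto_ennreal_iff) auto
  define e where "e n x = \<bar>\<bar>f n x\<bar> powr p - \<bar>f0 x\<bar> powr p\<bar>" for n x
  define h where "h n x = max 0 (\<bar>f n x - f0 x\<bar> powr p - 2 powr p * e n x)" for n x
  have [measurable]: "e n \<in> borel_measurable M" "h n \<in> borel_measurable M" for n
    unfolding e_def[abs_def] h_def[abs_def] by measurable
  have hb: "0 \<le> h n x" "h n x \<le> 2 * 2 powr p * \<bar>f0 x\<bar> powr p" for n x
  proof -
    have "\<bar>f n x - f0 x\<bar> powr p \<le> 2 powr p * (\<bar>f n x\<bar> powr p + \<bar>f0 x\<bar> powr p)" by (rule powr_diff_le[OF p])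
    also have "\<dots> \<le> 2 powr p * (e n x + 2 * \<bar>f0 x\<bar> powr p)" by (intro mult_left_mono) (auto simp: e_def)
    finally show "h n x \<le> 2 * 2 powr p * \<bar>f0 x\<bar> powr p" by (simp add: h_def algebra_simps)
  qed (simp add: h_def)
  have hlim: "(\<lambda>n. \<integral>x. h n x \<partial>M) \<longlonglongrightarrow> (\<integral>x. 0 \<partial>M)"
  proof (rule integral_dominated_convergence)
    show "integrable M (\<lambda>x. 2 * 2 powr p * \<bar>f0 x\<bar> powr p)" using i(2) by simp
    show "AE x in M. norm (h n x) \<le> 2 * 2 powr p * \<bar>f0 x\<bar> powr p" for n using hb by simp
    show "AE x in M. (\<lambda>n. h n x) \<longlonglongrightarrow> 0"
      using lim limp
    proof eventually_elim
      fix x assume a: "(\<lambda>j. f j x) \<longlonglongrightarrow> f0 x" and b: "(\<lambda>j. \<bar>f j x\<bar> powr p) \<longlonglongrightarrow> \<bar>f0 x\<bar> powr p"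
      have "(\<lambda>j. \<bar>f j x - f0 x\<bar> powr p) \<longlonglongrightarrow> \<bar>f0 x - f0 x\<bar> powr p" by (intro pc tendsto_diff a tendsto_const)
      moreover have "(\<lambda>j. e j x) \<longlonglongrightarrow> 0" unfolding e_def using b by (intro tendsto_rabs_zero LIM_zero)
      ultimately have "(\<lambda>n. h n x) \<longlonglongrightarrow> max 0 (\<bar>f0 x - f0 x\<bar> powr p - 2 powr p * 0)"
        unfolding h_def by (intro tendsto_max tendsto_diff tendsto_const tendsto_mult)
      then show "(\<lambda>n. h n x) \<longlonglongrightarrow> 0" using p by simp
    qed
  qed auto
  have hi: "integrable M (h n)" for n
    by (rule Bochner_Integration.integrable_bound[of M "\<lambda>x. 2 * 2 powr p * \<bar>f0 x\<bar> powr p"]) (use i(2) hb in \<open>auto simp: abs_mult\<close>)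
  have upper: "(\<lambda>n. (\<integral>x. h n x \<partial>M) + 2 powr p * (\<integral>x. e n x \<partial>M)) \<longlonglongrightarrow> 0"
    using tendsto_add[OF hlim tendsto_mult_right_zero[OF sch, of "2 powr p"]] by (simp add: e_def)
  show ?thesis
  proof (rule Lim_null_comparison[OF _ upper], rule always_eventually, rule allI)
    fix n
    have ei: "integrable M (e n)" using id[of n] by (simp add: e_def[abs_def])
    have "(\<integral>x. \<bar>f n x - f0 x\<bar> powr p \<partial>M) \<le> (\<integral>x. h n x + 2 powr p * e n x \<partial>M)"
    proof (rule integral_mono')
      show "integrable M (\<lambda>x. h n x + 2 powr p * e n x)" using hi ei by simp
      show "\<bar>f n x - f0 x\<bar> powr p \<le> h n x + 2 powr p * e n x" for x by (simp add: h_def)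
      show "0 \<le> h n x + 2 powr p * e n x" for x by (simp add: h_def e_def)
    qed
    also have "\<dots> = (\<integral>x. h n x \<partial>M) + 2 powr p * (\<integral>x. e n x \<partial>M)" using hi ei by simp
    finally show "norm (\<integral>x. \<bar>f n x - f0 x\<bar> powr p \<partial>M) \<le> (\<integral>x. h n x \<partial>M) + 2 powr p * (\<integral>x. e n x \<partial>M)" by simp
  qed
qed

text \<open>Weak convergence without loss of a strictly convex energy is strong. The Bregman gap integrates to the
  difference of energies minus a term linear in \<open>f j - f0\<close>, and its coefficient \<open>f0 / sqrt (1 + f0\<^sup>2)\<close> is a bounded
  integrable function, hence admissible for the weak convergence. So the gap tends to 0 in
  \<open>L\<^sup>1\<close>, almost everywhere along a subsequence, and \<open>scheffe_powr\<close> concludes. Using \<open>soft_abs 1\<close>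
  instead of \<open>\<bar>s\<bar> powr p\<close> covers \<open>p = 1\<close>, where the power is not strictly convex.\<close>

lemma weak_to_strong:
  fixes f :: "nat \<Rightarrow> 'a::euclidean_space \<Rightarrow> real"
  assumes f: "equiintegrable f" and f0: "integrable lebesgue f0" and conv: "weakly_convergent f f0" and p: "p \<ge> 1"
    and E: "\<And>j. (\<integral>x. soft_abs 1 (f j x) \<partial>lebesgue) \<le> A j" "A \<longlonglongrightarrow> (\<integral>x. soft_abs 1 (f0 x) \<partial>lebesgue)"
    and i: "\<And>j. integrable lebesgue (\<lambda>x. \<bar>f j x\<bar> powr p)" "integrable lebesgue (\<lambda>x. \<bar>f0 x\<bar> powr p)"
    and P: "\<And>j. (\<integral>x. \<bar>f j x\<bar> powr p \<partial>lebesgue) \<le> B j" "B \<longlonglongrightarrow> (\<integral>x. \<bar>f0 x\<bar> powr p \<partial>lebesgue)"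
  obtains r where "strict_mono (r :: nat \<Rightarrow> nat)" "(\<lambda>j. \<integral>x. \<bar>f (r j) x - f0 x\<bar> powr p \<partial>lebesgue) \<longlonglongrightarrow> 0"
proof -
  have fi: "integrable lebesgue (f j)" for j using f by (simp add: equiintegrable_def)
  \<comment> \<open>The derivative of \<open>soft_abs 1\<close> at the limit function.\<close>
  define g where "g x = f0 x / sqrt (1 + (f0 x)\<^sup>2)" for x
  have sq: "sqrt (1 + s\<^sup>2) \<ge> 1" "\<bar>s\<bar> \<le> sqrt (1 + s\<^sup>2)" for s :: real by (auto intro: real_le_rsqrt)
  have sp: "sqrt (1 + s\<^sup>2) > 0" for s :: real using sq(1)[of s] by linarith
  have gb: "\<bar>g x\<bar> \<le> 1" "\<bar>g x\<bar> \<le> \<bar>f0 x\<bar>" for x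
  proof -
    have "\<bar>g x\<bar> = \<bar>f0 x\<bar> / sqrt (1 + (f0 x)\<^sup>2)" using sp[of "f0 x"] by (simp add: g_def abs_divide)
    moreover have "\<bar>f0 x\<bar> \<le> \<bar>f0 x\<bar> * sqrt (1 + (f0 x)\<^sup>2)" using mult_left_mono[OF sq(1)[of "f0 x"], of "\<bar>f0 x\<bar>"] by simp
    ultimately show "\<bar>g x\<bar> \<le> 1" "\<bar>g x\<bar> \<le> \<bar>f0 x\<bar>" using sq(2)[of "f0 x"] sp[of "f0 x"] by (auto simp: divide_le_eq)
  qed
  have f0m: "f0 \<in> borel_measurable lebesgue" using f0 by (rule borel_measurable_integrable)
  have gm: "g \<in> borel_measurable lebesgue" unfolding g_def[abs_def] using f0m by measurable
  have gi: "integrable lebesgue g" by (rule Bochner_Integration.integrable_bound[OF f0 gm]) (use gb in auto)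
  have wl: "(\<lambda>j. \<integral>x. f j x * g x \<partial>lebesgue) \<longlonglongrightarrow> (\<integral>x. f0 x * g x \<partial>lebesgue)"
    by (rule weak_limit_bounded[OF f f0 conv gi gb(1)])
  have isf: "integrable lebesgue (\<lambda>x. soft_abs 1 (f j x))" "integrable lebesgue (\<lambda>x. soft_abs 1 (f0 x))" for j
    by (rule soft_abs_integrable_comp[OF zero_less_one fi], rule soft_abs_integrable_comp[OF zero_less_one f0])
  have im: "integrable lebesgue (\<lambda>x. f j x * g x)" "integrable lebesgue (\<lambda>x. f0 x * g x)" for j
    by (rule integrable_mult_bounded[OF fi gm gb(1)], rule integrable_mult_bounded[OF f0 gm gb(1)])
  have beq: "bregman (f j x) (f0 x) = soft_abs 1 (f j x) - soft_abs 1 (f0 x) - (f j x * g x - f0 x * g x)" for j x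
  proof -
    have "f0 x / sqrt (1 + (f0 x)\<^sup>2) * (f j x - f0 x) = f j x * g x - f0 x * g x"
      by (simp only: mult.commute[of _ "f j x - f0 x"] left_diff_distrib g_def)
    then show ?thesis by (simp add: bregman_def)
  qed
  have bi: "integrable lebesgue (\<lambda>x. bregman (f j x) (f0 x))" for j
    unfolding beq using isf im by simp
  have up: "(\<lambda>j. A j - (\<integral>x. soft_abs 1 (f0 x) \<partial>lebesgue) - ((\<integral>x. f j x * g x \<partial>lebesgue) - (\<integral>x. f0 x * g x \<partial>lebesgue))) \<longlonglongrightarrow> 0"
    using tendsto_diff[OF LIM_zero[OF E(2)] LIM_zero[OF wl]] by simp
  have "(\<lambda>j. \<integral>x. norm (bregman (f j x) (f0 x)) \<partial>lebesgue) \<longlonglongrightarrow> 0"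
  proof (rule Lim_null_comparison[OF _ up], rule always_eventually, rule allI)
    fix j
    have "(\<integral>x. norm (bregman (f j x) (f0 x)) \<partial>lebesgue) = (\<integral>x. bregman (f j x) (f0 x) \<partial>lebesgue)"
      using bregman_bounds(1) by simp
    also have "\<dots> = (\<integral>x. soft_abs 1 (f j x) \<partial>lebesgue) - (\<integral>x. soft_abs 1 (f0 x) \<partial>lebesgue) - ((\<integral>x. f j x * g x \<partial>lebesgue) - (\<integral>x. f0 x * g x \<partial>lebesgue))"
      unfolding beq using isf im by simp
    also have "\<dots> \<le> A j - (\<integral>x. soft_abs 1 (f0 x) \<partial>lebesgue) - ((\<integral>x. f j x * g x \<partial>lebesgue) - (\<integral>x. f0 x * g x \<partial>lebesgue))"
      using E(1)[of j] by simp
    finally show "norm (\<integral>x. norm (bregman (f j x) (f0 x)) \<partial>lebesgue) \<le> A j - (\<integral>x. soft_abs 1 (f0 x) \<partial>lebesgue) - ((\<integral>x. f j x * g x \<partial>lebesgue) - (\<integral>x. f0 x * g x \<partial>lebesgue))"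
      using bregman_bounds(1) by simp
  qed
  from tendsto_L1_AE_subseq[OF bi this]
  obtain r :: "nat \<Rightarrow> nat" where r: "strict_mono r" "AE x in lebesgue. (\<lambda>n. bregman (f (r n) x) (f0 x)) \<longlonglongrightarrow> 0" by blast
  have lim: "AE x in lebesgue. (\<lambda>n. f (r n) x) \<longlonglongrightarrow> f0 x"
    using r(2) by eventually_elim (rule bregman_tendsto)
  have Br: "(\<lambda>j. B (r j)) \<longlonglongrightarrow> (\<integral>x. \<bar>f0 x\<bar> powr p \<partial>lebesgue)"
    using LIMSEQ_subseq_LIMSEQ[OF P(2) r(1)] by (simp add: o_def)
  show ?thesis
    by (rule that[OF r(1)], rule scheffe_powr[OF p borel_measurable_integrable[OF fi] f0m i lim P(1) Br])
qed

section \<open>Equimeasurable functions\<close>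

lemma layer_cake:
  fixes f :: "'a::euclidean_space \<Rightarrow> real"
  assumes "f \<in> borel_measurable lebesgue" "\<And>x. f x \<ge> 0"
  shows "(\<integral>\<^sup>+x. ennreal (f x) \<partial>lebesgue) = (\<integral>\<^sup>+\<tau>. indicator {0<..} \<tau> * emeasure lebesgue {x. \<tau> < f x} \<partial>lborel)"
proof -
  obtain g where g[measurable]: "g \<in> borel_measurable borel" and fg: "AE x in lborel. f x = g x"
    using borel_representative[OF assms(1)] .
  have "(\<integral>\<^sup>+x. ennreal (f x) \<partial>lebesgue) = (\<integral>\<^sup>+x. ennreal (f x) \<partial>lborel)" by (rule nn_integral_completion)
  also have "\<dots> = (\<integral>\<^sup>+x. ennreal (g x) \<partial>lborel)" by (rule nn_integral_cong_AE) (use fg in eventually_elim, simp)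
  also have "\<dots> = (\<integral>\<^sup>+x. (\<integral>\<^sup>+\<tau>. indicator {0<..} \<tau> * (if \<tau> < g x then 1 else 0) \<partial>lborel) \<partial>lborel)"
  proof (rule nn_integral_cong)
    fix x
    have "(\<integral>\<^sup>+\<tau>. indicator {0<..} \<tau> * (if \<tau> < g x then 1 else 0) \<partial>lborel) = (\<integral>\<^sup>+\<tau>. indicator {0<..<g x} \<tau> \<partial>lborel)"
      by (intro nn_integral_cong) (auto simp: indicator_def)
    also have "\<dots> = ennreal (g x)" by (cases "g x \<ge> 0") (auto simp: ennreal_neg)
    finally show "ennreal (g x) = (\<integral>\<^sup>+\<tau>. indicator {0<..} \<tau> * (if \<tau> < g x then 1 else 0) \<partial>lborel)" by simp
  qed
  also have "\<dots> = (\<integral>\<^sup>+\<tau>. (\<integral>\<^sup>+x. indicator {0<..} \<tau> * (if \<tau> < g x then 1 else 0) \<partial>lborel) \<partial>lborel)"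
    by (rule lborel_pair.Fubini') measurable
  also have "\<dots> = (\<integral>\<^sup>+\<tau>. indicator {0<..} \<tau> * emeasure lebesgue {x. \<tau> < f x} \<partial>lborel)"
  proof (rule nn_integral_cong)
    fix \<tau> :: real
    have [measurable]: "{x. \<tau> < g x} \<in> sets borel" by measurable
    have "{x \<in> space lebesgue. \<tau> < f x} \<in> sets lebesgue" using assms(1) by measurable
    then have mf: "{x. \<tau> < f x} \<in> sets lebesgue" by simp
    have "(\<integral>\<^sup>+x. indicator {0<..} \<tau> * (if \<tau> < g x then 1 else 0) \<partial>lborel) = (\<integral>\<^sup>+x. indicator {0<..} \<tau> * indicator {x. \<tau> < g x} x \<partial>lborel)"
      by (intro nn_integral_cong) (auto simp: indicator_def)
    also have "\<dots> = indicator {0<..} \<tau> * emeasure lborel {x. \<tau> < g x}" by (rule nn_integral_cmult_indicator) simp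
    also have "emeasure lborel {x. \<tau> < g x} = emeasure lebesgue {x. \<tau> < g x}" by simp
    also have "\<dots> = emeasure lebesgue {x. \<tau> < f x}"
      by (rule emeasure_eq_AE) (use fg mf in \<open>auto simp: AE_completion_iff elim!: AE_mp\<close>)
    finally show "(\<integral>\<^sup>+x. indicator {0<..} \<tau> * (if \<tau> < g x then 1 else 0) \<partial>lborel) = indicator {0<..} \<tau> * emeasure lebesgue {x. \<tau> < f x}" .
  qed
  finally show ?thesis .
qed

text \<open>By the layer cake formula the integral of \<open>G\<close> only involves its superlevel sets at positive heights, and
  these are superlevel sets of the absolute value.\<close>

lemma equimeasurable_integral:
  fixes f g :: "'a::euclidean_space \<Rightarrow> real"
  assumes m: "f \<in> borel_measurable lebesgue" "g \<in> borel_measurable lebesgue"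
    and eq: "\<And>a. a > 0 \<Longrightarrow> emeasure lebesgue {x. a < \<bar>f x\<bar>} = emeasure lebesgue {x. a < \<bar>g x\<bar>}"
    and G[measurable]: "(G :: real \<Rightarrow> real) \<in> borel_measurable borel" and Gn: "\<And>s. G s \<ge> 0"
    and level: "\<And>\<tau>. \<tau> > 0 \<Longrightarrow> \<exists>a>0. \<forall>s. \<tau> < G s \<longleftrightarrow> a < \<bar>s\<bar>"
  shows "(\<integral>x. G (f x) \<partial>lebesgue) = (\<integral>x. G (g x) \<partial>lebesgue)"
proof -
  have mG: "(\<lambda>x. G (f x)) \<in> borel_measurable lebesgue" "(\<lambda>x. G (g x)) \<in> borel_measurable lebesgue" using m by measurable
  have "(\<integral>\<^sup>+x. ennreal (G (f x)) \<partial>lebesgue) = (\<integral>\<^sup>+x. ennreal (G (g x)) \<partial>lebesgue)"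
    unfolding layer_cake[OF mG(1) Gn] layer_cake[OF mG(2) Gn]
  proof (rule nn_integral_cong)
    fix \<tau> :: real
    show "indicator {0<..} \<tau> * emeasure lebesgue {x. \<tau> < G (f x)} = indicator {0<..} \<tau> * emeasure lebesgue {x. \<tau> < G (g x)}"
    proof (cases "\<tau> > 0")
      case True
      from level[OF True] obtain a where "a > 0" "\<forall>s. \<tau> < G s \<longleftrightarrow> a < \<bar>s\<bar>" by blast
      then show ?thesis using eq[of a] by simp
    qed simp
  qed
  then show ?thesis using mG Gn by (simp add: integral_eq_nn_integral)
qed

lemma soft_abs_level: "\<tau> > 0 \<Longrightarrow> \<exists>a>0. \<forall>s. \<tau> < soft_abs 1 s \<longleftrightarrow> a < \<bar>s\<bar>"
proof (intro exI conjI allI)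
  assume t: "\<tau> > 0"
  have pos: "(\<tau> + 1)\<^sup>2 - 1 > 0" using t by (simp add: power2_eq_square algebra_simps add_pos_pos)
  show "sqrt ((\<tau> + 1)\<^sup>2 - 1) > 0" using pos by simp
  fix s :: real
  have "\<tau> < soft_abs 1 s \<longleftrightarrow> \<tau> + 1 < sqrt (1 + s\<^sup>2)" by (auto simp: soft_abs_def)
  also have "\<dots> \<longleftrightarrow> sqrt ((\<tau> + 1)\<^sup>2) < sqrt (1 + s\<^sup>2)" using t by simp
  also have "\<dots> \<longleftrightarrow> sqrt ((\<tau> + 1)\<^sup>2 - 1) < sqrt (s\<^sup>2)" unfolding real_sqrt_less_iff by auto
  finally show "\<tau> < soft_abs 1 s \<longleftrightarrow> sqrt ((\<tau> + 1)\<^sup>2 - 1) < \<bar>s\<bar>" by simp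
qed

lemma powr_level:
  assumes "p \<ge> 1" "\<tau> > 0" shows "\<exists>a>0. \<forall>s. \<tau> < \<bar>s::real\<bar> powr p \<longleftrightarrow> a < \<bar>s\<bar>"
proof (intro exI conjI allI)
  show "\<tau> powr (1 / p) > 0" using assms by simp
  fix s :: real
  have t: "(\<tau> powr (1 / p)) powr p = \<tau>" using assms by (simp add: powr_powr)
  show "\<tau> < \<bar>s\<bar> powr p \<longleftrightarrow> \<tau> powr (1 / p) < \<bar>s\<bar>"
  proof
    assume "\<tau> powr (1 / p) < \<bar>s\<bar>"
    then have "(\<tau> powr (1 / p)) powr p < \<bar>s\<bar> powr p" using assms by (intro powr_less_mono2) auto
    then show "\<tau> < \<bar>s\<bar> powr p" by (simp only: t)
  next
    assume a: "\<tau> < \<bar>s\<bar> powr p"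
    show "\<tau> powr (1 / p) < \<bar>s\<bar>"
    proof (rule ccontr)
      assume "\<not> ?thesis"
      then have "\<bar>s\<bar> powr p \<le> (\<tau> powr (1 / p)) powr p" using assms by (intro powr_mono2) auto
      then show False using a by (simp only: t)
    qed
  qed
qed

section \<open>Local \<open>L\<^sup>1\<close> and global \<open>L\<^sup>p\<close> consequences of convergence in \<open>L\<^sup>p\<close>\<close>

text \<open>Young's inequality in the form \<open>\<bar>h\<bar> \<le> \<eta> + \<eta> powr (1 - p) * \<bar>h\<bar> powr p\<close>, which includes \<open>p = 1\<close>.\<close>

lemma L1_ball_le_Lp:
  fixes h :: "'a::euclidean_space \<Rightarrow> real"
  assumes h: "in_Lp p UNIV h" and p: "p \<ge> 1" and \<eta>: "\<eta> > 0"
  shows "(\<integral>x. indicator (cball 0 R) x * \<bar>h x\<bar> \<partial>lebesgue)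
    \<le> \<eta> * measure lebesgue (cball (0::'a) R) + \<eta> powr (1 - p) * (\<integral>x. \<bar>h x\<bar> powr p \<partial>lebesgue)"
proof -
  have i: "integrable lebesgue (\<lambda>x. \<bar>h x\<bar> powr p)" using h by (auto simp: in_Lp_def lebesgue_on_UNIV_eq)
  have bi: "integrable lebesgue (\<lambda>x. \<eta> * indicator (cball (0::'a) R) x)"
    by (intro integrable_mult_right indicator_cball_integrable)
  have "(\<integral>x. indicator (cball 0 R) x * \<bar>h x\<bar> \<partial>lebesgue) \<le> (\<integral>x. \<eta> * indicator (cball 0 R) x + \<eta> powr (1 - p) * \<bar>h x\<bar> powr p \<partial>lebesgue)"
  proof (rule integral_mono')
    show "integrable lebesgue (\<lambda>x. \<eta> * indicator (cball 0 R) x + \<eta> powr (1 - p) * \<bar>h x\<bar> powr p)" using bi i by simp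
    fix x
    have "\<bar>h x\<bar> \<le> \<eta> + \<eta> powr (1 - p) * \<bar>h x\<bar> powr p"
    proof (cases "\<bar>h x\<bar> \<le> \<eta>")
      case False
      then have "1 \<le> (\<bar>h x\<bar> / \<eta>) powr (p - 1)" using \<eta> p by (intro ge_one_powr_ge_zero) auto
      then have "\<bar>h x\<bar> * 1 \<le> \<bar>h x\<bar> * (\<bar>h x\<bar> / \<eta>) powr (p - 1)" by (intro mult_left_mono) auto
      also have "\<dots> = \<eta> powr (1 - p) * \<bar>h x\<bar> powr p"
        using False \<eta> by (simp add: powr_divide powr_diff field_simps)
      finally show ?thesis using \<eta> by simp
    qed (simp add: add_increasing2)
    then show "indicator (cball 0 R) x * \<bar>h x\<bar> \<le> \<eta> * indicator (cball 0 R) x + \<eta> powr (1 - p) * \<bar>h x\<bar> powr p"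
      by (auto simp: indicator_def)
    show "0 \<le> \<eta> * indicator (cball 0 R) x + \<eta> powr (1 - p) * \<bar>h x\<bar> powr p" using \<eta> by simp
  qed
  also have "\<dots> = \<eta> * measure lebesgue (cball (0::'a) R) + \<eta> powr (1 - p) * (\<integral>x. \<bar>h x\<bar> powr p \<partial>lebesgue)"
    using bi i by simp
  finally show ?thesis .
qed

lemma Lp_norm_tendsto_imp:
  fixes h :: "'b \<Rightarrow> 'a::euclidean_space \<Rightarrow> real"
  assumes "p \<ge> 1" "((\<lambda>s. Lp_norm p UNIV (h s)) \<longlongrightarrow> 0) F"
  shows "((\<lambda>s. \<integral>x. \<bar>h s x\<bar> powr p \<partial>lebesgue) \<longlongrightarrow> 0) F"
proof -
  have "((\<lambda>s. Lp_norm p UNIV (h s) powr p) \<longlongrightarrow> 0) F"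
    by (rule tendsto_zero_powrI[OF assms(2) tendsto_const]) (use assms(1) in \<open>auto simp: Lp_norm_def\<close>)
  moreover have "Lp_norm p UNIV (h s) powr p = (\<integral>x. \<bar>h s x\<bar> powr p \<partial>lebesgue)" for s
    using assms(1) by (simp add: Lp_norm_def lebesgue_on_UNIV_eq powr_powr)
  ultimately show ?thesis by simp
qed

lemma Lp_imp_L1_ball:
  fixes h :: "'b \<Rightarrow> 'a::euclidean_space \<Rightarrow> real"
  assumes p: "p \<ge> 1" and lim: "((\<lambda>s. Lp_norm p UNIV (h s)) \<longlongrightarrow> 0) F" and h: "\<forall>\<^sub>F s in F. in_Lp p UNIV (h s)"
  shows "((\<lambda>s. \<integral>x. indicator (cball 0 R) x * \<bar>h s x\<bar> \<partial>lebesgue) \<longlongrightarrow> 0) F"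
proof (rule tendstoI)
  fix e :: real assume e: "e > 0"
  define V where "V = measure lebesgue (cball (0::'a) R)"
  define \<eta> where "\<eta> = e / (2 * (V + 1))"
  have V: "V \<ge> 0" by (simp add: V_def)
  have \<eta>: "\<eta> > 0" using e V by (simp add: \<eta>_def)
  have "((\<lambda>s. \<eta> powr (1 - p) * (\<integral>x. \<bar>h s x\<bar> powr p \<partial>lebesgue)) \<longlongrightarrow> 0) F"
    by (rule tendsto_mult_right_zero[OF Lp_norm_tendsto_imp[OF p lim]])
  from order_tendstoD(2)[OF this, of "e / 2"] e
  have "\<forall>\<^sub>F s in F. \<eta> powr (1 - p) * (\<integral>x. \<bar>h s x\<bar> powr p \<partial>lebesgue) < e / 2" by simp
  with h show "\<forall>\<^sub>F s in F. dist (\<integral>x. indicator (cball 0 R) x * \<bar>h s x\<bar> \<partial>lebesgue) 0 < e"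
  proof eventually_elim
    fix s assume a: "in_Lp p UNIV (h s)" and b: "\<eta> powr (1 - p) * (\<integral>x. \<bar>h s x\<bar> powr p \<partial>lebesgue) < e / 2"
    have "\<eta> * V \<le> e / 2" using e V by (simp add: \<eta>_def field_simps)
    then have "(\<integral>x. indicator (cball 0 R) x * \<bar>h s x\<bar> \<partial>lebesgue) < e"
      using L1_ball_le_Lp[OF a p \<eta>, of R] b by (simp add: V_def)
    then show "dist (\<integral>x. indicator (cball 0 R) x * \<bar>h s x\<bar> \<partial>lebesgue) 0 < e" by (simp add: dist_real_def)
  qed
qed

text \<open>Convexity of the power at \<open>(1 - \<theta>) * (b / (1 - \<theta>)) + \<theta> * ((a - b) / \<theta>)\<close>. It serves as a substitute for the triangle
  inequality in \<open>L\<^sup>p\<close>: the first factor tends to 1 as \<open>\<theta>\<close> tends to 0.\<close>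

lemma powr_interpolate:
  assumes p: "p \<ge> 1" and \<theta>: "0 < \<theta>" "\<theta> < 1"
  shows "\<bar>a::real\<bar> powr p \<le> (1 - \<theta>) powr (1 - p) * \<bar>b\<bar> powr p + \<theta> powr (1 - p) * \<bar>a - b\<bar> powr p"
proof -
  have ge: "x powr (1 - p) \<ge> 1" if "0 < x" "x < 1" for x :: real
  proof -
    have "x powr (p - 1) \<le> 1" "x powr (p - 1) > 0" using that p by (auto intro: powr_le1)
    then have "1 \<le> inverse (x powr (p - 1))" by (intro one_le_inverse)
    then show ?thesis by (simp add: powr_minus[symmetric])
  qed
  have ge1: "\<theta> powr (1 - p) \<ge> 1" "(1 - \<theta>) powr (1 - p) \<ge> 1"
    using ge \<theta> by auto
  consider "b = 0" | "a = b" | "b \<noteq> 0" "a \<noteq> b" by blast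
  then show ?thesis
  proof cases
    case 1
    then show ?thesis using mult_right_mono[OF ge1(1), of "\<bar>a\<bar> powr p"] p by simp
  next
    case 2
    then show ?thesis using mult_right_mono[OF ge1(2), of "\<bar>a\<bar> powr p"] p by simp
  next
    case 3
    define x y where "x = \<bar>b\<bar> / (1 - \<theta>)" and "y = \<bar>a - b\<bar> / \<theta>"
    have xy: "x > 0" "y > 0" using 3 \<theta> by (auto simp: x_def y_def)
    have "\<bar>a\<bar> \<le> (1 - \<theta>) * x + \<theta> * y" using \<theta> by (simp add: x_def y_def)
    then have "\<bar>a\<bar> powr p \<le> ((1 - \<theta>) * x + \<theta> * y) powr p" using p by (intro powr_mono2) auto
    also have "\<dots> \<le> (1 - \<theta>) * x powr p + \<theta> * y powr p"
      using convex_onD[OF powr_convex[OF p], of \<theta> x y] xy \<theta> by simp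
    also have "(1 - \<theta>) * x powr p = (1 - \<theta>) powr (1 - p) * \<bar>b\<bar> powr p"
      using \<theta> by (simp add: x_def powr_divide powr_diff)
    also have "\<theta> * y powr p = \<theta> powr (1 - p) * \<bar>a - b\<bar> powr p"
      using \<theta> by (simp add: y_def powr_divide powr_diff)
    finally show ?thesis .
  qed
qed

lemma Lp_energy_limsup:
  fixes h :: "nat \<Rightarrow> 'a::euclidean_space \<Rightarrow> real"
  assumes p: "p \<ge> 1" and i: "\<And>n. integrable lebesgue (\<lambda>x. \<bar>h n x\<bar> powr p)" "integrable lebesgue (\<lambda>x. \<bar>h0 x\<bar> powr p)"
    "\<And>n. integrable lebesgue (\<lambda>x. \<bar>h n x - h0 x\<bar> powr p)"
    and lim: "(\<lambda>n. \<integral>x. \<bar>h n x - h0 x\<bar> powr p \<partial>lebesgue) \<longlonglongrightarrow> 0" and \<delta>: "\<delta> > 0"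
  shows "\<forall>\<^sub>F n in sequentially. (\<integral>x. \<bar>h n x\<bar> powr p \<partial>lebesgue) \<le> (\<integral>x. \<bar>h0 x\<bar> powr p \<partial>lebesgue) + \<delta>"
proof -
  define P where "P = (\<integral>x. \<bar>h0 x\<bar> powr p \<partial>lebesgue)"
  have "((\<lambda>\<theta>. (1 - \<theta>) powr (1 - p) * P) \<longlongrightarrow> (1 - 0) powr (1 - p) * P) (at_right 0)"
    by (intro tendsto_intros) auto
  then have "\<forall>\<^sub>F \<theta> in at_right 0. (1 - \<theta>) powr (1 - p) * P < P + \<delta> / 2"
    using order_tendstoD(2)[of _ P "at_right (0::real)" "P + \<delta> / 2"] \<delta> by simp
  moreover have "\<forall>\<^sub>F \<theta> in at_right 0. \<theta> \<in> {0<..<(1::real)}" by (rule eventually_at_right_real) simp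
  ultimately have "\<forall>\<^sub>F \<theta> in at_right 0. (1 - \<theta>) powr (1 - p) * P < P + \<delta> / 2 \<and> \<theta> \<in> {0<..<(1::real)}"
    by (rule eventually_conj)
  from eventually_happens'[OF trivial_limit_at_right_real this]
  obtain \<theta> :: real where \<theta>: "0 < \<theta>" "\<theta> < 1" "(1 - \<theta>) powr (1 - p) * P < P + \<delta> / 2" by auto
  have "(\<lambda>n. \<theta> powr (1 - p) * (\<integral>x. \<bar>h n x - h0 x\<bar> powr p \<partial>lebesgue)) \<longlonglongrightarrow> 0"
    by (rule tendsto_mult_right_zero[OF lim])
  from order_tendstoD(2)[OF this, of "\<delta> / 2"] \<delta>
  have "\<forall>\<^sub>F n in sequentially. \<theta> powr (1 - p) * (\<integral>x. \<bar>h n x - h0 x\<bar> powr p \<partial>lebesgue) < \<delta> / 2" by simp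
  then show ?thesis
  proof eventually_elim
    fix n assume a: "\<theta> powr (1 - p) * (\<integral>x. \<bar>h n x - h0 x\<bar> powr p \<partial>lebesgue) < \<delta> / 2"
    have "(\<integral>x. \<bar>h n x\<bar> powr p \<partial>lebesgue) \<le> (\<integral>x. (1 - \<theta>) powr (1 - p) * \<bar>h0 x\<bar> powr p + \<theta> powr (1 - p) * \<bar>h n x - h0 x\<bar> powr p \<partial>lebesgue)"
      using i by (intro integral_mono powr_interpolate p \<theta>) auto
    also have "\<dots> = (1 - \<theta>) powr (1 - p) * P + \<theta> powr (1 - p) * (\<integral>x. \<bar>h n x - h0 x\<bar> powr p \<partial>lebesgue)"
      using i by (simp add: P_def)
    finally show "(\<integral>x. \<bar>h n x\<bar> powr p \<partial>lebesgue) \<le> (\<integral>x. \<bar>h0 x\<bar> powr p \<partial>lebesgue) + \<delta>"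
      using a \<theta>(3) by (simp add: P_def)
  qed
qed

section \<open>Conservation of the distribution function by renormalised solutions\<close>

text \<open>Squaring makes the positive part continuously differentiable.\<close>

definition level_sq :: "real \<Rightarrow> real \<Rightarrow> real \<Rightarrow> real" where
  "level_sq a k s = (max 0 (k * (s - a)))\<^sup>2 + (max 0 (k * (- s - a)))\<^sup>2"

text \<open>An admissible renormalisation: continuously differentiable, bounded, zero for \<open>\<bar>s\<bar> \<le> a\<close>. As \<open>k\<close> tends to
  infinity it converges to the indicator function of \<open>\<bar>s\<bar> > a\<close>.\<close>

definition level :: "real \<Rightarrow> real \<Rightarrow> real \<Rightarrow> real" where
  "level a k s = level_sq a k s / (1 + level_sq a k s)"

lemma pos_part_sq_deriv: "((\<lambda>x::real. (max 0 x)\<^sup>2) has_real_derivative 2 * max 0 x) (at x)"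
proof -
  consider "x < 0" | "x > 0" | "x = 0" by linarith
  then show ?thesis
  proof cases
    case 1
    have "((\<lambda>_. 0) has_real_derivative 2 * max 0 x) (at x)" using 1 by simp
    then show ?thesis
      by (rule has_field_derivative_transform_within[where d = "-x"]) (use 1 in \<open>auto simp: dist_real_def\<close>)
  next
    case 2
    have "((\<lambda>x. x\<^sup>2) has_real_derivative 2 * max 0 x) (at x)" using 2 by (auto intro!: derivative_eq_intros)
    then show ?thesis
      by (rule has_field_derivative_transform_within[where d = x]) (use 2 in \<open>auto simp: dist_real_def\<close>)
  next
    case 3
    have "((\<lambda>h::real. (max 0 h)\<^sup>2 / h) \<longlongrightarrow> 0) (at 0)"
    proof (rule Lim_null_comparison[OF always_eventually tendsto_rabs_zero[OF tendsto_ident_at]], rule allI)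
      fix h :: real
      have "(max 0 h)\<^sup>2 \<le> \<bar>h\<bar> * \<bar>h\<bar>" by (auto simp: power2_eq_square max_def)
      then show "norm ((max 0 h)\<^sup>2 / h) \<le> \<bar>h\<bar>" by (cases "h = 0") (auto simp: abs_divide divide_le_eq)
    qed
    then show ?thesis using 3 by (simp add: DERIV_def)
  qed
qed

lemma level_sq_nonneg: "level_sq a k s \<ge> 0" by (simp add: level_sq_def)

lemma level_sq_deriv:
  "(level_sq a k has_real_derivative 2 * k * max 0 (k * (s - a)) - 2 * k * max 0 (k * (- s - a))) (at s)"
proof -
  have 1: "((\<lambda>s. k * (s - a)) has_real_derivative k) (at s)" "((\<lambda>s. k * (- s - a)) has_real_derivative - k) (at s)"
    by (auto intro!: derivative_eq_intros)
  from DERIV_add[OF DERIV_chain2[OF pos_part_sq_deriv 1(1)] DERIV_chain2[OF pos_part_sq_deriv 1(2)]]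
  show ?thesis unfolding level_sq_def[abs_def] by (rule DERIV_cong) simp
qed

definition level_deriv :: "real \<Rightarrow> real \<Rightarrow> real \<Rightarrow> real" where
  "level_deriv a k s = (2 * k * max 0 (k * (s - a)) - 2 * k * max 0 (k * (- s - a))) / (1 + level_sq a k s)\<^sup>2"

lemma level_has_deriv: "(level a k has_real_derivative level_deriv a k s) (at s)"
proof -
  have pos: "1 + level_sq a k s \<noteq> 0" using level_sq_nonneg[of a k s] by linarith
  define D where "D = 2 * k * max 0 (k * (s - a)) - 2 * k * max 0 (k * (- s - a))"
  have "((\<lambda>s. 1 + level_sq a k s) has_real_derivative 0 + D) (at s)"
    unfolding D_def by (rule DERIV_add[OF DERIV_const level_sq_deriv])
  from DERIV_divide[OF level_sq_deriv[of a k s, folded D_def] this pos]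
  show ?thesis unfolding level_def[abs_def] level_deriv_def D_def[symmetric]
    by (rule DERIV_cong) (simp add: power2_eq_square algebra_simps)
qed

lemma level_deriv_continuous: "continuous_on UNIV (level_deriv a k)"
proof -
  have "1 + level_sq a k s \<noteq> 0" for s using level_sq_nonneg[of a k s] by linarith
  moreover have "continuous_on UNIV (level_sq a k)" unfolding level_sq_def[abs_def] by (intro continuous_intros)
  ultimately show ?thesis unfolding level_deriv_def[abs_def] by (intro continuous_intros) auto
qed

lemma level_deriv_bound: assumes "k \<ge> 0" shows "\<bar>level_deriv a k s\<bar> \<le> 2 * k"
proof -
  define x y where "x = max 0 (k * (s - a))" and "y = max 0 (k * (- s - a))"
  define q where "q = level_sq a k s"
  have q: "q = x\<^sup>2 + y\<^sup>2" "q \<ge> 0" by (simp_all add: q_def level_sq_def x_def y_def)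
  have xy: "x \<ge> 0" "y \<ge> 0" by (auto simp: x_def y_def)
  have "2 * x \<le> 1 + x\<^sup>2" "2 * y \<le> 1 + y\<^sup>2"
    using sum_squares_bound[of 1 x] sum_squares_bound[of 1 y] by auto
  then have "x + y \<le> 1 + q" using q(1) zero_le_power2[of x] zero_le_power2[of y] by linarith
  also have "\<dots> \<le> (1 + q)\<^sup>2" using q(2) by (simp add: power2_eq_square algebra_simps)
  finally have le: "x + y \<le> (1 + q)\<^sup>2" .
  have "\<bar>2 * k * x - 2 * k * y\<bar> \<le> 2 * k * (x + y)" using assms xy by (simp add: abs_le_iff algebra_simps)
  also have "\<dots> \<le> 2 * k * (1 + q)\<^sup>2" using le assms by (intro mult_left_mono) auto
  finally have "\<bar>2 * k * x - 2 * k * y\<bar> / (1 + q)\<^sup>2 \<le> 2 * k"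
    using q(2) by (subst pos_divide_le_eq) (auto simp: add_nonneg_pos)
  then show ?thesis by (simp add: level_deriv_def x_def y_def q_def abs_divide)
qed

lemma level_lipschitz: assumes "k \<ge> 0" shows "\<bar>level a k s - level a k r\<bar> \<le> 2 * k * \<bar>s - r\<bar>"
proof -
  have "norm (level a k s - level a k r) \<le> 2 * k * norm (s - r)"
    by (rule field_differentiable_bound[of UNIV "level a k" "level_deriv a k"])
       (use level_has_deriv level_deriv_bound[OF assms] in auto)
  then show ?thesis by simp
qed

lemma level_bounds: "0 \<le> level a k s" "level a k s \<le> 1"
  using level_sq_nonneg[of a k s] by (auto simp: level_def divide_le_eq)

lemma level_zero: assumes "k \<ge> 0" "\<bar>s\<bar> \<le> a" shows "level a k s = 0"
proof -
  have "k * (s - a) \<le> 0" "k * (- s - a) \<le> 0" using assms by (auto intro!: mult_nonneg_nonpos)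
  then show ?thesis by (simp add: level_def level_sq_def max_def)
qed

lemma level_le: assumes "a > 0" "k \<ge> 0" shows "level a k s \<le> \<bar>s\<bar> / a"
proof (cases "\<bar>s\<bar> \<le> a")
  case True then show ?thesis using assms by (simp add: level_zero)
next
  case False
  then have "1 \<le> \<bar>s\<bar> / a" using assms by simp
  then show ?thesis using level_bounds(2)[of a k s] by linarith
qed

lemma level_measurable [measurable]: "level a k \<in> borel_measurable borel"
  unfolding level_def[abs_def] level_sq_def[abs_def] by measurable

lemma level_tendsto:
  assumes "a > 0"
  shows "(\<lambda>n. level a (real n) s) \<longlonglongrightarrow> (if a < \<bar>s\<bar> then 1 else 0)"
proof (cases "a < \<bar>s\<bar>")
  case False
  then show ?thesis by (simp add: level_zero)
next
  case True
  define d where "d = \<bar>s\<bar> - a"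
  have d: "d > 0" using True by (simp add: d_def)
  have lower: "(real n)\<^sup>2 * d\<^sup>2 \<le> level_sq a (real n) s" for n
  proof (cases "s \<ge> 0")
    case True
    then have "max 0 (real n * (s - a)) = real n * d" using d by (simp add: d_def max_def)
    then show ?thesis by (simp add: level_sq_def power_mult_distrib)
  next
    case False
    then have "max 0 (real n * (- s - a)) = real n * d" using d by (simp add: d_def max_def)
    then show ?thesis by (simp add: level_sq_def power_mult_distrib)
  qed
  have up: "1 - level a (real n) s \<le> 1 / (1 + (real n)\<^sup>2 * d\<^sup>2)" for n
  proof -
    have p: "1 + level_sq a (real n) s > 0" using level_sq_nonneg[of a "real n" s] by linarith
    have "1 - level a (real n) s = 1 / (1 + level_sq a (real n) s)" using p by (simp add: level_def field_simps)
    also have "\<dots> \<le> 1 / (1 + (real n)\<^sup>2 * d\<^sup>2)"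
      using lower[of n] by (intro divide_left_mono) (auto simp: add_pos_nonneg level_sq_nonneg)
    finally show ?thesis .
  qed
  have z: "(\<lambda>n. 1 / (1 + (real n)\<^sup>2 * d\<^sup>2)) \<longlonglongrightarrow> 0" using d by real_asymp
  have "(\<lambda>n. 1 - level a (real n) s) \<longlonglongrightarrow> 0"
    by (rule Lim_null_comparison[OF always_eventually z]) (use up level_bounds in simp)
  then have "(\<lambda>n. 1 - (1 - level a (real n) s)) \<longlonglongrightarrow> 1 - 0" by (intro tendsto_diff tendsto_const)
  then show ?thesis using True by simp
qed

lemma in_Lp_diff:
  fixes f g :: "'a::euclidean_space \<Rightarrow> real"
  assumes "in_Lp p UNIV f" "in_Lp p UNIV g" "p \<ge> 1"
  shows "in_Lp p UNIV (\<lambda>x. f x - g x)"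
proof -
  have m: "f \<in> borel_measurable lebesgue" "g \<in> borel_measurable lebesgue"
    and i: "integrable lebesgue (\<lambda>x. \<bar>f x\<bar> powr p)" "integrable lebesgue (\<lambda>x. \<bar>g x\<bar> powr p)"
    using assms by (auto simp: in_Lp_def lebesgue_on_UNIV_eq)
  have "integrable lebesgue (\<lambda>x. \<bar>f x - g x\<bar> powr p)"
  proof (rule Bochner_Integration.integrable_bound)
    show "integrable lebesgue (\<lambda>x. 2 powr p * (\<bar>f x\<bar> powr p + \<bar>g x\<bar> powr p))" using i by simp
    show "(\<lambda>x. \<bar>f x - g x\<bar> powr p) \<in> borel_measurable lebesgue" using m by measurable
    show "AE x in lebesgue. norm (\<bar>f x - g x\<bar> powr p) \<le> norm (2 powr p * (\<bar>f x\<bar> powr p + \<bar>g x\<bar> powr p))"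
      using powr_diff_le[OF assms(3)] by (intro AE_I2) simp
  qed
  then show ?thesis using m by (simp add: in_Lp_def lebesgue_on_UNIV_eq)
qed

text \<open>Nonlinear functionals of the solution are localised, so that the curve is needed as a continuous curve in local
  \<open>L\<^sup>1\<close> only.\<close>

lemma Lp_curve_local_continuity:
  assumes w: "in_C_Lp T p w" and p: "p \<ge> 1" and t: "t \<in> {0..T}"
  shows "((\<lambda>s. \<integral>x. indicator (cball 0 R) x * \<bar>w s x - w t x\<bar> \<partial>lebesgue) \<longlongrightarrow> 0) (at t within {0..T})"
proof (rule Lp_imp_L1_ball[OF p])
  show "((\<lambda>s. Lp_norm p UNIV (\<lambda>x. w s x - w t x)) \<longlongrightarrow> 0) (at t within {0..T})"
    using w t by (simp add: in_C_Lp_def)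
  show "\<forall>\<^sub>F s in at t within {0..T}. in_Lp p UNIV (\<lambda>x. w s x - w t x)"
    unfolding eventually_at_filter
    by (intro always_eventually allI impI in_Lp_diff p) (use w t in \<open>auto simp: in_C_Lp_def\<close>)
qed

text \<open>The derivative of \<open>step\<close>, rescaled, is the averaging kernel in time with which the renormalised equation is
  evaluated at a given instant.\<close>

lemma step_derivative:
  obtains S where "S > 0" "\<And>s. (step has_real_derivative pd step 1 s) (at s)" "continuous_on UNIV (pd step 1)"
    "\<And>s. \<bar>pd step 1 s\<bar> \<le> S" "\<And>s. s < 0 \<or> s > 1 \<Longrightarrow> pd step 1 s = 0"
proof -
  have h: "(step has_derivative (\<lambda>v. pd step v s)) (at s)" for s by (rule C_1_has[OF C_k_step])
  have d: "(step has_real_derivative pd step 1 s) (at s)" for s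
    unfolding has_field_derivative_def
  proof (rule has_derivative_eq_rhs[OF h], rule ext)
    fix v
    show "pd step v s = pd step 1 s * v"
      using linear_scale[OF bounded_linear.linear[OF has_derivative_bounded_linear[OF h[of s]]], of v 1] by (simp add: mult.commute)
  qed
  have c: "continuous_on UNIV (pd step 1)" using C_k_step[of 1] by simp
  have z: "pd step 1 s = 0" if "s < 0 \<or> s > 1" for s
  proof -
    have "((\<lambda>_. if s < 0 then 0 else 1) has_real_derivative 0) (at s)" by simp
    then have "(step has_real_derivative 0) (at s)"
    proof (rule has_field_derivative_transform_within_open)
      show "open (if s < 0 then {..<0} else {1<..} :: real set)" by simp
    qed (use that in \<open>auto simp: step_0 step_1 split: if_splits\<close>)
    then show ?thesis using d DERIV_unique by blast
  qed
  have "bounded (pd step 1 ` {0..1})"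
    by (intro compact_imp_bounded compact_continuous_image continuous_on_subset[OF c]) auto
  then obtain S where S: "S > 0" "\<And>s. s \<in> {0..1} \<Longrightarrow> \<bar>pd step 1 s\<bar> \<le> S" unfolding bounded_pos by auto
  have "\<bar>pd step 1 s\<bar> \<le> S" for s using S z[of s] by (cases "s \<in> {0..1}") auto
  with S(1) d c z that show ?thesis by blast
qed

lemma cutoff_integral_tendsto:
  fixes f :: "'a::euclidean_space \<Rightarrow> real"
  assumes "integrable lebesgue f"
  shows "(\<lambda>n. \<integral>x. f x * cutoff (real (Suc n)) x \<partial>lebesgue) \<longlonglongrightarrow> (\<integral>x. f x \<partial>lebesgue)"
proof (rule integral_dominated_convergence)
  have c: "cutoff (real (Suc n)) \<in> borel_measurable (lebesgue :: 'a measure)" for n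
    using C_k_continuous[OF C_k_cutoff] by (intro measurable_completion) (auto intro: borel_measurable_continuous_onI)
  show "f \<in> borel_measurable lebesgue" using assms by simp
  show "(\<lambda>x. f x * cutoff (real (Suc n)) x) \<in> borel_measurable lebesgue" for n
    using assms c[of n] by (intro borel_measurable_times) auto
  show "integrable lebesgue (\<lambda>x. \<bar>f x\<bar>)" using assms by simp
  show "AE x in lebesgue. (\<lambda>n. f x * cutoff (real (Suc n)) x) \<longlonglongrightarrow> f x"
  proof (rule AE_I2)
    fix x :: 'a
    obtain n0 where n0: "norm x \<le> real n0" using real_arch_simple by blast
    have "\<forall>\<^sub>F n in sequentially. f x = f x * cutoff (real (Suc n)) x"
      using eventually_ge_at_top[of n0]
    proof eventually_elim
      fix n assume "n \<ge> n0"
      then have "cutoff (real (Suc n)) x = 1" using n0 by (intro cutoff_1) auto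
      then show "f x = f x * cutoff (real (Suc n)) x" by simp
    qed
    then show "(\<lambda>n. f x * cutoff (real (Suc n)) x) \<longlonglongrightarrow> f x"
      by (rule Lim_transform_eventually[OF tendsto_const])
  qed
  show "AE x in lebesgue. norm (f x * cutoff (real (Suc n)) x) \<le> \<bar>f x\<bar>" for n
    by (intro AE_I2) (simp add: abs_mult mult_left_le cutoff_bounds)
qed

text \<open>Integrability of \<open>w\<close> is a hypothesis here: for a general \<open>L\<^sup>p\<close> solution the flux at infinity could not be
  controlled. It is verified for the inviscid limit by \<open>limit_L1\<close>.\<close>

locale renormalized =
  fixes T p :: real and w0 :: "real^2 \<Rightarrow> real" and u :: "real \<Rightarrow> real^2 \<Rightarrow> real^2"
    and w :: "real \<Rightarrow> real^2 \<Rightarrow> real" and N :: real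
  assumes T_pos: "T > 0" and p_ge: "p \<ge> 1" and ren: "renormalized_solution T p w0 u w"
    and L1: "\<And>t. t \<in> {0..T} \<Longrightarrow> integrable lebesgue (w t)"
    and N: "\<And>t. t \<in> {0..T} \<Longrightarrow> (\<integral>x. \<bar>w t x\<bar> \<partial>lebesgue) \<le> N"
    and w0_L1: "integrable lebesgue w0"
begin

lemma N_nonneg: "N \<ge> 0"
  using N[of 0] T_pos by (auto intro: order_trans[rotated])

lemma biot_savart_slices: "AE t in lebesgue_on {0<..<T}. AE x in lebesgue. is_biot_savart (w t) x (u t x)"
  by (rule AE_strip) (use ren in \<open>simp add: renormalized_solution_def case_prod_unfold\<close>)

text \<open>The set where \<open>\<bar>w\<bar> > a\<close> has measure at most \<open>N / a\<close>, so that \<open>level a k (w t)\<close> is bounded and integrable, and the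
  kernel splitting applies to it. This makes the flux integrable on the whole plane, although
  neither \<open>u\<close> nor the product of \<open>u\<close> and \<open>w\<close> need be.\<close>

lemma flux_bound:
  assumes a: "a > 0" and k: "k \<ge> 0" and t: "t \<in> {0..T}" and bs: "AE x in lebesgue. is_biot_savart (w t) x (u t x)"
  shows "(\<integral>\<^sup>+x. ennreal (norm (u t x) * level a k (w t x)) \<partial>lebesgue) \<le> ennreal (N * (kernel_mass + N / a))"
proof -
  have mw: "w t \<in> borel_measurable lebesgue" using L1[OF t] by simp
  obtain w' where [measurable]: "w' \<in> borel_measurable borel" and w': "AE x in lborel. w t x = w' x"
    using borel_representative[OF mw] by blast
  define G where "G x = ennreal (level a k (w' x))" for x
  have [measurable]: "G \<in> borel_measurable borel" unfolding G_def by measurable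
  have nnw: "(\<integral>\<^sup>+x. ennreal \<bar>w t x\<bar> \<partial>lborel) \<le> ennreal N"
  proof -
    have "(\<integral>\<^sup>+x. ennreal \<bar>w t x\<bar> \<partial>lborel) = (\<integral>\<^sup>+x. ennreal \<bar>w t x\<bar> \<partial>lebesgue)" by (simp add: nn_integral_completion)
    also have "\<dots> = ennreal (\<integral>x. \<bar>w t x\<bar> \<partial>lebesgue)" by (rule nn_integral_eq_integral) (use L1[OF t] in auto)
    also have "\<dots> \<le> ennreal N" by (rule ennreal_leI[OF N[OF t]])
    finally show ?thesis .
  qed
  have G1: "AE x in lborel. G x \<le> ennreal 1" unfolding G_def by (intro AE_I2 ennreal_leI level_bounds)
  have GN: "(\<integral>\<^sup>+x. G x \<partial>lborel) \<le> ennreal (N / a)"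
  proof -
    have "(\<integral>\<^sup>+x. G x \<partial>lborel) \<le> (\<integral>\<^sup>+x. ennreal (1 / a) * ennreal \<bar>w t x\<bar> \<partial>lborel)"
    proof (rule nn_integral_mono_AE, use w' in eventually_elim)
      fix x assume "w t x = w' x"
      then show "G x \<le> ennreal (1 / a) * ennreal \<bar>w t x\<bar>"
        using level_le[OF a k, of "w t x"] a by (simp add: G_def ennreal_mult[symmetric] ennreal_leI)
    qed
    also have "\<dots> = ennreal (1 / a) * (\<integral>\<^sup>+x. ennreal \<bar>w t x\<bar> \<partial>lebesgue)"
    proof -
      have "(\<integral>\<^sup>+x. ennreal (1 / a) * ennreal \<bar>w t x\<bar> \<partial>lborel) = (\<integral>\<^sup>+x. ennreal (1 / a) * ennreal \<bar>w t x\<bar> \<partial>lebesgue)"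
        by (simp add: nn_integral_completion)
      also have "\<dots> = ennreal (1 / a) * (\<integral>\<^sup>+x. ennreal \<bar>w t x\<bar> \<partial>lebesgue)"
        by (rule nn_integral_cmult) (use mw in measurable)
      finally show ?thesis .
    qed
    also have "\<dots> \<le> ennreal (1 / a) * ennreal N" using nnw by (intro mult_left_mono) (auto simp: nn_integral_completion)
    also have "\<dots> = ennreal (N / a)" using a N_nonneg by (simp add: ennreal_mult[symmetric])
    finally show ?thesis .
  qed
  have "(\<integral>\<^sup>+x. ennreal (norm (u t x) * level a k (w t x)) \<partial>lebesgue) = (\<integral>\<^sup>+x. ennreal (norm (u t x) * level a k (w t x)) \<partial>lborel)"
    by (rule nn_integral_completion)
  also have "\<dots> = (\<integral>\<^sup>+x. ennreal (norm (u t x)) * G x \<partial>lborel)"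
    by (rule nn_integral_cong_AE, use w' in eventually_elim) (simp add: G_def ennreal_mult level_bounds)
  also have "\<dots> \<le> (\<integral>\<^sup>+y. ennreal \<bar>w t y\<bar> * (\<integral>\<^sup>+x. ennreal (norm (biot_savart_kernel (x - y))) * G x \<partial>lborel) \<partial>lborel)"
    by (rule biot_savart_norm_bound[OF mw]) (use bs in \<open>auto simp: AE_completion_iff\<close>)
  also have "\<dots> \<le> (\<integral>\<^sup>+y. ennreal \<bar>w t y\<bar> * ennreal (kernel_mass + N / a) \<partial>lborel)"
  proof (intro nn_integral_mono mult_left_mono)
    fix y
    have "(\<integral>\<^sup>+x. ennreal (norm (biot_savart_kernel (x - y))) * G x \<partial>lborel) \<le> ennreal 1 * ennreal kernel_mass + (\<integral>\<^sup>+x. G x \<partial>lborel)"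
      by (rule kernel_convolution_bound[OF _ G1]) measurable
    also have "\<dots> \<le> ennreal kernel_mass + ennreal (N / a)" using GN by (simp add: add_left_mono)
    also have "\<dots> = ennreal (kernel_mass + N / a)" using kernel_mass_nonneg N_nonneg a by simp
    finally show "(\<integral>\<^sup>+x. ennreal (norm (biot_savart_kernel (x - y))) * G x \<partial>lborel) \<le> ennreal (kernel_mass + N / a)" .
  qed simp
  also have "\<dots> = (\<integral>\<^sup>+y. ennreal \<bar>w t y\<bar> * ennreal (kernel_mass + N / a) \<partial>lebesgue)" by (simp add: nn_integral_completion)
  also have "\<dots> = (\<integral>\<^sup>+y. ennreal \<bar>w t y\<bar> \<partial>lebesgue) * ennreal (kernel_mass + N / a)"
    by (rule nn_integral_multc) (use mw in measurable)
  also have "\<dots> \<le> ennreal N * ennreal (kernel_mass + N / a)"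
    using nnw by (intro mult_right_mono) (auto simp: nn_integral_completion)
  also have "\<dots> = ennreal (N * (kernel_mass + N / a))"
    using N_nonneg kernel_mass_nonneg a by (simp add: ennreal_mult)
  finally show ?thesis .
qed

lemma local_level_integral_continuous:
  assumes k: "k \<ge> 0" and R: "R > 0"
  shows "continuous_on {0..T} (\<lambda>t. \<integral>x. level a k (w t x) * cutoff R x \<partial>lebesgue)"
  unfolding continuous_on_def
proof
  fix t assume t: "t \<in> {0..T}"
  have c: "cutoff R \<in> borel_measurable (lebesgue :: (real^2) measure)"
    using C_k_continuous[OF C_k_cutoff] by (intro measurable_completion) (auto intro: borel_measurable_continuous_onI)
  have ii: "integrable lebesgue (\<lambda>x. level a k (w s x) * cutoff R x)" if s: "s \<in> {0..T}" for s
  proof (rule Bochner_Integration.integrable_bound[OF indicator_cball_integrable[of "2 * R"]])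
    show "(\<lambda>x. level a k (w s x) * cutoff R x) \<in> borel_measurable lebesgue"
      using L1[OF s] by (intro borel_measurable_times c measurable_compose[OF _ level_measurable]) auto
    show "AE x in lebesgue. norm (level a k (w s x) * cutoff R x) \<le> norm (indicator (cball 0 (2 * R)) x :: real)"
    proof (rule AE_I2)
      fix x :: "real^2"
      have "level a k (w s x) * cutoff R x \<le> 1 * 1" by (intro mult_mono level_bounds cutoff_bounds) auto
      then show "norm (level a k (w s x) * cutoff R x) \<le> norm (indicator (cball 0 (2 * R)) x :: real)"
        using cutoff_0[OF R, of x] by (cases "x \<in> cball 0 (2 * R)") (auto simp: level_bounds cutoff_bounds abs_mult)
    qed
  qed
  have lim: "((\<lambda>s. 2 * k * (\<integral>x. indicator (cball 0 (2 * R)) x * \<bar>w s x - w t x\<bar> \<partial>lebesgue)) \<longlongrightarrow> 0) (at t within {0..T})"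
    by (rule tendsto_mult_right_zero, rule Lp_curve_local_continuity[OF _ p_ge t]) (use ren in \<open>simp add: renormalized_solution_def\<close>)
  have "((\<lambda>s. (\<integral>x. level a k (w s x) * cutoff R x \<partial>lebesgue) - (\<integral>x. level a k (w t x) * cutoff R x \<partial>lebesgue)) \<longlongrightarrow> 0) (at t within {0..T})"
  proof (rule Lim_null_comparison[OF _ lim])
    show "\<forall>\<^sub>F s in at t within {0..T}. norm ((\<integral>x. level a k (w s x) * cutoff R x \<partial>lebesgue) - (\<integral>x. level a k (w t x) * cutoff R x \<partial>lebesgue))
       \<le> 2 * k * (\<integral>x. indicator (cball 0 (2 * R)) x * \<bar>w s x - w t x\<bar> \<partial>lebesgue)"
      unfolding eventually_at_filter
    proof (intro always_eventually allI impI)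
      fix s assume s: "s \<in> {0..T}"
      have di: "integrable lebesgue (\<lambda>x. indicator (cball 0 (2 * R)) x * \<bar>w s x - w t x\<bar>)"
      proof (rule Bochner_Integration.integrable_bound)
        show "integrable lebesgue (\<lambda>x. \<bar>w s x - w t x\<bar>)" using L1[OF s] L1[OF t] by simp
        show "(\<lambda>x. indicator (cball 0 (2 * R)) x * \<bar>w s x - w t x\<bar>) \<in> borel_measurable lebesgue"
          using borel_measurable_integrable[OF indicator_cball_integrable] L1[OF s] L1[OF t] by (intro borel_measurable_times) auto
      qed (auto simp: indicator_def)
      have "norm (\<integral>x. level a k (w s x) * cutoff R x - level a k (w t x) * cutoff R x \<partial>lebesgue)
         \<le> (\<integral>x. 2 * k * (indicator (cball 0 (2 * R)) x * \<bar>w s x - w t x\<bar>) \<partial>lebesgue)"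
      proof (rule order_trans[OF integral_norm_bound integral_mono'])
        show "integrable lebesgue (\<lambda>x. 2 * k * (indicator (cball 0 (2 * R)) x * \<bar>w s x - w t x\<bar>))" using di by simp
        fix x
        have "norm (level a k (w s x) * cutoff R x - level a k (w t x) * cutoff R x) = \<bar>level a k (w s x) - level a k (w t x)\<bar> * cutoff R x"
          using cutoff_bounds(1)[of R x] by (simp add: left_diff_distrib[symmetric] abs_mult)
        also have "\<dots> \<le> 2 * k * \<bar>w s x - w t x\<bar> * cutoff R x"
          by (intro mult_right_mono level_lipschitz k cutoff_bounds)
        also have "\<dots> \<le> 2 * k * \<bar>w s x - w t x\<bar> * indicator (cball 0 (2 * R)) x"
        proof (rule mult_left_mono)
          show "cutoff R x \<le> indicator (cball 0 (2 * R)) x"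
            using cutoff_bounds(2)[of R x] cutoff_0[OF R, of x] by (cases "x \<in> cball 0 (2 * R)") auto
        qed (use k in simp)
        finally show "norm (level a k (w s x) * cutoff R x - level a k (w t x) * cutoff R x) \<le> 2 * k * (indicator (cball 0 (2 * R)) x * \<bar>w s x - w t x\<bar>)"
          by (simp add: mult_ac)
        show "0 \<le> 2 * k * (indicator (cball 0 (2 * R)) x * \<bar>w s x - w t x\<bar>)" using k by simp
      qed
      then show "norm ((\<integral>x. level a k (w s x) * cutoff R x \<partial>lebesgue) - (\<integral>x. level a k (w t x) * cutoff R x \<partial>lebesgue))
       \<le> 2 * k * (\<integral>x. indicator (cball 0 (2 * R)) x * \<bar>w s x - w t x\<bar> \<partial>lebesgue)"
        using ii[OF s] ii[OF t] by simp
    qed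
  qed
  then show "((\<lambda>t. \<integral>x. level a k (w t x) * cutoff R x \<partial>lebesgue) \<longlongrightarrow> (\<integral>x. level a k (w t x) * cutoff R x \<partial>lebesgue)) (at t within {0..T})"
    by (rule LIM_zero_cancel)
qed

text \<open>The renormalised equation is tested with a product of the cut-off of radius \<open>R\<close> in space and a smooth
  switch in time that falls from 1 to 0 on a short interval ending at \<open>t0\<close>. The time derivative of the switch averages the
  localised integral near \<open>t0\<close>, where it is nearly constant; the space derivative is of size \<open>1 / R\<close>
  and meets the flux of \<open>flux_bound\<close>.\<close>

lemma localised_conservation:
  assumes a: "a > 0" and k: "k \<ge> 0" and R: "R \<ge> 1" and t0: "t0 \<in> {0<..<T}"
    and c: "\<And>x. norm (grad (cutoff R) (x :: real^2)) \<le> c / R" and c0: "c > 0"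
  shows "\<bar>(\<integral>x. level a k (w0 x) * cutoff R x \<partial>lebesgue) - (\<integral>x. level a k (w t0 x) * cutoff R x \<partial>lebesgue)\<bar>
     \<le> T * (c / R * (N * (kernel_mass + N / a)))"
proof -
  define e where "e t = (\<integral>x. level a k (w t x) * cutoff R x \<partial>lebesgue)" for t
  define e0 where "e0 = (\<integral>x. level a k (w0 x) * cutoff R x \<partial>lebesgue)"
  define K where "K = c / R * (N * (kernel_mass + N / a))"
  have Rp: "R > 0" using R by simp
  have K0: "K \<ge> 0" using c0 Rp N_nonneg kernel_mass_nonneg a by (simp add: K_def)
  have t0': "t0 \<in> {0..T}" using t0 by auto
  have ce: "continuous_on {0..T} e" unfolding e_def by (rule local_level_integral_continuous[OF k Rp])
  obtain S where S: "S > 0" "\<And>s. (step has_real_derivative pd step 1 s) (at s)" "continuous_on UNIV (pd step 1)"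
    "\<And>s. \<bar>pd step 1 s\<bar> \<le> S" "\<And>s. s < 0 \<or> s > 1 \<Longrightarrow> pd step 1 s = 0"
    using step_derivative by metis
  have main: "\<bar>e0 - e t0\<bar> \<le> S * \<eta> + T * K" if \<eta>: "\<eta> > 0" for \<eta>
  proof -
    obtain \<delta> where \<delta>: "\<delta> > 0" "\<And>t. t \<in> {0..T} \<Longrightarrow> dist t t0 < \<delta> \<Longrightarrow> dist (e t) (e t0) < \<eta>"
      using ce \<eta> t0' unfolding continuous_on_iff by blast
    define h where "h = min (\<delta> / 2) t0"
    have h: "h > 0" "h < \<delta>" "h \<le> t0" using \<delta>(1) t0 by (auto simp: h_def)
    \<comment> \<open>The second factor is 1 on \<open>[0,T]\<close>; it makes the support compact towards negative times.\<close>
    define \<zeta> where "\<zeta> t = step (t0 / h - t / h) * step (t + 2)" for t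
    define \<sigma> where "\<sigma> t = pd step 1 (t0 / h - t / h) / h" for t
    define \<phi> where "\<phi> = (\<lambda>z :: real \<times> (real^2). \<zeta> (fst z) * cutoff R (snd z))"
    have C\<zeta>: "C_k n UNIV \<zeta>" for n
    proof -
      have "C_k n UNIV (\<lambda>t. step (t0 / h + (- inverse h) *\<^sub>R t))"
        by (rule C_k_compose_affine[OF bounded_linear_scaleR_right C_k_step])
      then have 1: "C_k n UNIV (\<lambda>t. step (t0 / h - t / h))" by (simp add: divide_inverse mult.commute)
      have "C_k n UNIV (\<lambda>t. step (2 + t))" by (rule C_k_compose_affine[OF bounded_linear_ident C_k_step])
      then have 2: "C_k n UNIV (\<lambda>t. step (t + 2))" by (simp add: add.commute)
      show ?thesis unfolding \<zeta>_def[abs_def] by (rule C_k_mult[OF open_UNIV 1 2])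
    qed
    have C\<phi>: "C_k n UNIV \<phi>" for n
    proof -
      have 1: "C_k n UNIV (\<lambda>z :: real \<times> (real^2). \<zeta> (fst z))"
        by (rule C_k_compose_real[OF open_UNIV C\<zeta> C_k_bounded_linear[OF open_UNIV bounded_linear_fst]])
      have "C_k n UNIV (\<lambda>z :: real \<times> (real^2). cutoff R (0 + snd z))"
        by (rule C_k_compose_affine[OF bounded_linear_snd C_k_cutoff])
      then have 2: "C_k n UNIV (\<lambda>z :: real \<times> (real^2). cutoff R (snd z))" by simp
      show ?thesis unfolding \<phi>_def by (rule C_k_mult[OF open_UNIV 1 2])
    qed
    have \<zeta>0: "\<zeta> t = 0" if "t \<ge> t0 \<or> t \<le> -2" for t
      using that h by (auto simp: \<zeta>_def step_0 divide_right_mono)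
    have \<zeta>_eq: "\<zeta> t = step (t0 / h - t / h)" if "t > -1" for t using that by (simp add: \<zeta>_def step_1)
    have \<zeta>b: "0 \<le> \<zeta> t" "\<zeta> t \<le> 1" for t
      unfolding \<zeta>_def using step_bounds mult_mono[of "step (t0 / h - t / h)" 1 "step (t + 2)" 1] by auto
    have \<zeta>1: "\<zeta> 0 = 1" using h by (simp add: \<zeta>_def step_1)
    have d\<zeta>: "(\<zeta> has_real_derivative - \<sigma> t) (at t)" if t: "t > -1" for t
    proof -
      have "((\<lambda>t. t0 / h - t / h) has_real_derivative - (1 / h)) (at t)" using h(1) by (auto intro!: derivative_eq_intros)
      from DERIV_chain2[OF S(2) this]
      have "((\<lambda>t. step (t0 / h - t / h)) has_real_derivative - \<sigma> t) (at t)" by (rule DERIV_cong) (simp add: \<sigma>_def)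
      then show ?thesis
        by (rule has_field_derivative_transform_within_open[where S = "{-1<..}"]) (use t \<zeta>_eq in auto)
    qed
    have supp\<phi>: "supp \<phi> \<subseteq> {-2..t0} \<times> cball 0 (2 * R)"
    proof (rule supp_subset)
      show "closed ({-2..t0} \<times> cball (0::real^2) (2 * R))" by (intro closed_Times closed_atLeastAtMost closed_cball)
      fix z :: "real \<times> (real^2)" assume "z \<notin> {-2..t0} \<times> cball 0 (2 * R)"
      then have "(fst z \<ge> t0 \<or> fst z \<le> -2) \<or> norm (snd z) \<ge> 2 * R" by (cases z) auto
      then show "\<phi> z = 0" using \<zeta>0[of "fst z"] cutoff_0[OF Rp, of "snd z"] by (auto simp: \<phi>_def)
    qed
    have "compact (supp \<phi>)"
    proof -
      have "compact ({-2..t0} \<times> cball (0::real^2) (2 * R))" by (intro compact_Times compact_Icc compact_cball)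
      then have "compact (({-2..t0} \<times> cball (0::real^2) (2 * R)) \<inter> supp \<phi>)"
        by (rule compact_Int_closed) (simp add: supp_def)
      then show ?thesis using supp\<phi> by (simp add: Int_absorb1)
    qed
    moreover have "supp \<phi> \<subseteq> {..<T} \<times> UNIV" using supp\<phi> t0 by auto
    ultimately have test: "test_function ({..<T} \<times> UNIV) \<phi>"
      using C\<phi> by (simp add: test_function_def smooth_on_def)
    have \<beta>: "level a k C1_differentiable_on UNIV"
      unfolding C1_differentiable_on_def
      by (rule exI[of _ "level_deriv a k"])
         (simp add: level_deriv_continuous level_has_deriv has_real_derivative_iff_has_vector_derivative[symmetric])
    have \<beta>b: "bounded (range (level a k))"
      by (rule boundedI[of _ 1]) (use level_bounds in auto)
    have \<beta>0: "\<exists>\<delta>>0. \<forall>s. \<bar>s\<bar> < \<delta> \<longrightarrow> level a k s = 0"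
      using a level_zero[OF k] by (intro exI[of _ a]) auto
    define F where "F t x = level a k (w t x) * (deriv (\<lambda>s. \<phi> (s, x)) t + u t x \<bullet> grad (\<lambda>y. \<phi> (t, y)) x)" for t x
    have ren_all: "\<forall>\<beta> :: real \<Rightarrow> real. \<forall>\<phi> :: real \<times> (real^2) \<Rightarrow> real.
        \<beta> C1_differentiable_on UNIV \<and> bounded (range \<beta>) \<and>
        (\<exists>\<delta>>0. \<forall>s. \<bar>s\<bar> < \<delta> \<longrightarrow> \<beta> s = 0) \<and>
        test_function ({..<T} \<times> UNIV) \<phi> \<longrightarrow>
          integrable (lebesgue_on ({0<..<T} \<times> UNIV))
            (\<lambda>(t, x). \<beta> (w t x) * (deriv (\<lambda>s. \<phi> (s, x)) t + u t x \<bullet> grad (\<lambda>y. \<phi> (t, y)) x)) \<and>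
          (\<integral>(t, x). \<beta> (w t x) * (deriv (\<lambda>s. \<phi> (s, x)) t + u t x \<bullet> grad (\<lambda>y. \<phi> (t, y)) x)
             \<partial>lebesgue_on ({0<..<T} \<times> UNIV))
          + (\<integral>x. \<beta> (w0 x) * \<phi> (0, x) \<partial>lebesgue) = 0"
      using ren unfolding renormalized_solution_def by (elim conjE)
    have ren': "integrable (lebesgue_on ({0<..<T} \<times> UNIV)) (\<lambda>(t, x). F t x) \<and>
      (\<integral>(t, x). F t x \<partial>lebesgue_on ({0<..<T} \<times> UNIV)) + (\<integral>x. level a k (w0 x) * \<phi> (0, x) \<partial>lebesgue) = 0"
      using ren_all[rule_format, of "level a k" \<phi>, OF conjI[OF \<beta> conjI[OF \<beta>b conjI[OF \<beta>0 test]]]]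
      unfolding F_def .
    then have Fi: "integrable (lebesgue_on ({0<..<T} \<times> UNIV)) (\<lambda>(t, x). F t x)"
      and Feq: "(\<integral>(t, x). F t x \<partial>lebesgue_on ({0<..<T} \<times> UNIV)) + e0 = 0"
      by (auto simp: \<phi>_def \<zeta>1 e0_def)
    define H where "H t = (\<integral>x. F t x \<partial>lebesgue)" for t
    note Fub = Fubini_strip[OF Fi]
    have Hi: "integrable (lebesgue_on {0<..<T}) H" using Fub(2) by (simp add: H_def[abs_def])
    have Heq: "e0 = - (\<integral>t. H t \<partial>lebesgue_on {0<..<T})" using Feq Fub(3) by (simp add: H_def[abs_def])
    \<comment> \<open>On almost every time slice only the flux through the cut-off remains once the averaging term is removed.\<close>
    have cm: "cutoff R \<in> borel_measurable (lebesgue :: (real^2) measure)"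
      using C_k_continuous[OF C_k_cutoff] by (intro measurable_completion) (auto intro: borel_measurable_continuous_onI)
    have ii: "integrable lebesgue (\<lambda>x. level a k (w s x) * cutoff R x)" if s: "s \<in> {0..T}" for s
    proof (rule Bochner_Integration.integrable_bound)
      show "integrable lebesgue (\<lambda>x. (1 / a) * \<bar>w s x\<bar>)" using L1[OF s] by simp
      show "(\<lambda>x. level a k (w s x) * cutoff R x) \<in> borel_measurable lebesgue"
        using L1[OF s] by (intro borel_measurable_times cm measurable_compose[OF _ level_measurable]) auto
      show "AE x in lebesgue. norm (level a k (w s x) * cutoff R x) \<le> norm ((1 / a) * \<bar>w s x\<bar>)"
      proof (rule AE_I2)
        fix x
        have "level a k (w s x) * cutoff R x \<le> \<bar>w s x\<bar> / a * 1"
          using a by (intro mult_mono level_le[OF a k] cutoff_bounds) auto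
        then show "norm (level a k (w s x) * cutoff R x) \<le> norm ((1 / a) * \<bar>w s x\<bar>)"
          using a by (simp add: abs_mult level_bounds cutoff_bounds)
      qed
    qed
    have H_bound: "AE t in lebesgue_on {0<..<T}. \<bar>H t + \<sigma> t * e t\<bar> \<le> K"
      using Fub(1) biot_savart_slices AE_space
    proof eventually_elim
      fix t assume Ft: "integrable lebesgue (F t)" and bs: "AE x in lebesgue. is_biot_savart (w t) x (u t x)"
        and "t \<in> space (lebesgue_on {0<..<T})"
      then have t: "t \<in> {0<..<T}" by simp
      then have t': "t \<in> {0..T}" "t > -1" by auto
      have dt: "deriv (\<lambda>s. \<phi> (s, x)) t = - \<sigma> t * cutoff R x" for x
        unfolding \<phi>_def fst_conv snd_conv by (rule DERIV_imp_deriv, rule DERIV_cmult_right, rule d\<zeta>[OF t'(2)])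
      have gt: "grad (\<lambda>y. \<phi> (t, y)) x = \<zeta> t *\<^sub>R grad (cutoff R) x" for x
        unfolding \<phi>_def fst_conv snd_conv grad_def pd_cmult[OF C_k_cutoff] by (simp add: scaleR_sum_right)
      have Fe: "F t x = - \<sigma> t * (level a k (w t x) * cutoff R x) + \<zeta> t * (level a k (w t x) * (u t x \<bullet> grad (cutoff R) x))" for x
        unfolding F_def dt gt by (simp add: algebra_simps)
      have i1: "integrable lebesgue (\<lambda>x. \<sigma> t * (level a k (w t x) * cutoff R x))" using ii[OF t'(1)] by simp
      have "H t + \<sigma> t * e t = (\<integral>x. F t x + \<sigma> t * (level a k (w t x) * cutoff R x) \<partial>lebesgue)"
        using Ft i1 by (simp add: H_def e_def)
      also have "\<dots> = (\<integral>x. \<zeta> t * (level a k (w t x) * (u t x \<bullet> grad (cutoff R) x)) \<partial>lebesgue)"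
        unfolding Fe by simp
      finally have He: "H t + \<sigma> t * e t = (\<integral>x. \<zeta> t * (level a k (w t x) * (u t x \<bullet> grad (cutoff R) x)) \<partial>lebesgue)" .
      have fi: "integrable lebesgue (\<lambda>x. \<zeta> t * (level a k (w t x) * (u t x \<bullet> grad (cutoff R) x)))"
        using Bochner_Integration.integrable_add[OF Ft i1] unfolding Fe by simp
      have "ennreal \<bar>H t + \<sigma> t * e t\<bar> \<le> (\<integral>\<^sup>+x. ennreal (norm (\<zeta> t * (level a k (w t x) * (u t x \<bullet> grad (cutoff R) x)))) \<partial>lebesgue)"
        unfolding He using integral_norm_bound_ennreal[OF fi] by simp
      also have "\<dots> \<le> (\<integral>\<^sup>+x. ennreal (c / R) * ennreal (norm (u t x) * level a k (w t x)) \<partial>lebesgue)"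
      proof (rule nn_integral_mono)
        fix x
        have "norm (\<zeta> t * (level a k (w t x) * (u t x \<bullet> grad (cutoff R) x))) = \<zeta> t * (level a k (w t x) * \<bar>u t x \<bullet> grad (cutoff R) x\<bar>)"
          using \<zeta>b level_bounds by (simp add: abs_mult)
        also have "\<dots> \<le> 1 * (level a k (w t x) * (norm (u t x) * (c / R)))"
        proof (intro mult_mono mult_left_mono \<zeta>b level_bounds)
          show "\<bar>u t x \<bullet> grad (cutoff R) x\<bar> \<le> norm (u t x) * (c / R)"
            using Cauchy_Schwarz_ineq2[of "u t x" "grad (cutoff R) x"] mult_left_mono[OF c[of x], of "norm (u t x)"] by simp
        qed (auto simp: level_bounds)
        finally have "norm (\<zeta> t * (level a k (w t x) * (u t x \<bullet> grad (cutoff R) x))) \<le> c / R * (norm (u t x) * level a k (w t x))"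
          by (simp add: mult_ac)
        then show "ennreal (norm (\<zeta> t * (level a k (w t x) * (u t x \<bullet> grad (cutoff R) x)))) \<le> ennreal (c / R) * ennreal (norm (u t x) * level a k (w t x))"
          using c0 Rp by (subst ennreal_mult[symmetric]) (auto simp: level_bounds intro!: ennreal_leI)
      qed
      also have "\<dots> = ennreal (c / R) * (\<integral>\<^sup>+x. ennreal (norm (u t x) * level a k (w t x)) \<partial>lebesgue)"
      proof -
        have "(\<integral>\<^sup>+x. ennreal (c / R) * ennreal (norm (u t x) * level a k (w t x)) \<partial>lebesgue)
          = (\<integral>\<^sup>+x. ennreal (norm (u t x) * level a k (w t x)) * ennreal (c / R) \<partial>lebesgue)" by (simp add: mult.commute)
        have mw: "w t \<in> borel_measurable lebesgue" using L1[OF t'(1)] by simp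
        obtain w' where [measurable]: "w' \<in> borel_measurable borel" and w': "AE x in lborel. w t x = w' x"
          using borel_representative[OF mw] by blast
        define v where "v x = (\<integral>y. w' y *\<^sub>R biot_savart_kernel (x - y) \<partial>lborel)" for x
        have [measurable]: "v \<in> borel_measurable borel" unfolding v_def[abs_def] by measurable
        have bs': "AE x in lborel. is_biot_savart (w t) x (u t x)" using bs by (simp add: AE_completion_iff)
        have uv: "AE x in lborel. u t x = v x"
          using bs'
        proof eventually_elim
          fix x assume "is_biot_savart (w t) x (u t x)"
          then have "has_bochner_integral lborel (\<lambda>y. w' y *\<^sub>R biot_savart_kernel (x - y)) (u t x)"
            by (intro is_biot_savart_cong_AE[OF w' mw]) auto
          then show "u t x = v x" by (simp add: v_def has_bochner_integral_iff)
        qed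
        have eqn: "(\<integral>\<^sup>+x. C * ennreal (norm (u t x) * level a k (w t x)) \<partial>lebesgue) = (\<integral>\<^sup>+x. C * ennreal (norm (v x) * level a k (w' x)) \<partial>lborel)" for C
          unfolding nn_integral_completion
          by (rule nn_integral_cong_AE) (use uv w' in eventually_elim, simp)
        have "(\<integral>\<^sup>+x. ennreal (c / R) * ennreal (norm (v x) * level a k (w' x)) \<partial>lborel) = ennreal (c / R) * (\<integral>\<^sup>+x. ennreal (norm (v x) * level a k (w' x)) \<partial>lborel)"
          by (rule nn_integral_cmult) measurable
        then show ?thesis using eqn[of "ennreal (c / R)"] eqn[of 1] by simp
      qed
      also have "\<dots> \<le> ennreal (c / R) * ennreal (N * (kernel_mass + N / a))"
        by (intro mult_left_mono flux_bound[OF a k t'(1) bs]) simp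
      also have "\<dots> = ennreal K"
        unfolding K_def using c0 Rp N_nonneg kernel_mass_nonneg a by (subst ennreal_mult) auto
      finally show "\<bar>H t + \<sigma> t * e t\<bar> \<le> K" using K0 by (subst (asm) ennreal_le_iff) auto
    qed
    \<comment> \<open>\<open>\<sigma>\<close> is an averaging kernel on the interval from \<open>t0 - h\<close> to \<open>t0\<close>.\<close>
    have c\<sigma>: "continuous_on UNIV \<sigma>"
      unfolding \<sigma>_def[abs_def]
      by (intro continuous_on_divide continuous_on_const continuous_on_compose2[OF S(3)] continuous_intros) (use h in auto)
    have \<sigma>0: "\<sigma> t = 0" if "t < t0 - h \<or> t > t0" for t
    proof -
      have "t0 / h - t / h < 0 \<or> t0 / h - t / h > 1"
        using that h(1) by (auto simp: diff_divide_distrib[symmetric] divide_less_0_iff less_divide_eq)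
      then show ?thesis using S(5) by (simp add: \<sigma>_def)
    qed
    have \<sigma>b: "\<bar>\<sigma> t\<bar> \<le> S / h * indicator {t0 - h..t0} t" for t
    proof (cases "t \<in> {t0 - h..t0}")
      case True then show ?thesis using S(4)[of "t0 / h - t / h"] h(1) by (simp add: \<sigma>_def abs_divide divide_right_mono)
    next
      case False then show ?thesis using \<sigma>0[of t] by auto
    qed
    have \<sigma>int: "(\<integral>t. \<sigma> t * indicator {0..T} t \<partial>lborel) = 1"
    proof -
      have "(\<integral>t. \<sigma> t * indicator {0..T} t \<partial>lborel) = - step (t0 / h - T / h) - (- step (t0 / h - 0 / h))"
      proof (rule integral_FTC_Icc_real)
        show "0 \<le> T" using T_pos by simp
        fix t assume "0 \<le> t" "t \<le> T"
        have "((\<lambda>t. t0 / h - t / h) has_real_derivative - (1 / h)) (at t)" using h(1) by (auto intro!: derivative_eq_intros)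
        from DERIV_minus[OF DERIV_chain2[OF S(2) this]]
        show "((\<lambda>t. - step (t0 / h - t / h)) has_real_derivative \<sigma> t) (at t)" by (rule DERIV_cong) (simp add: \<sigma>_def)
        show "isCont \<sigma> t" using c\<sigma> by (simp add: continuous_on_eq_continuous_at)
      qed
      also have "step (t0 / h - T / h) = 0" using t0 h by (intro step_0) (simp add: divide_right_mono)
      also have "step (t0 / h - 0 / h) = 1" using h by (intro step_1) simp
      finally show ?thesis by simp
    qed
    have sub: "{0<..<T} \<inter> space lebesgue \<in> sets lebesgue" by simp
    have m\<sigma>: "\<sigma> \<in> borel_measurable borel" by (rule borel_measurable_continuous_onI[OF c\<sigma>])
    have \<sigma>int': "(\<integral>t. \<sigma> t \<partial>lebesgue_on {0<..<T}) = 1"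
    proof -
      have "(\<integral>t. \<sigma> t \<partial>lebesgue_on {0<..<T}) = (\<integral>t. indicator {0<..<T} t *\<^sub>R \<sigma> t \<partial>lebesgue)"
        by (rule integral_restrict_space[OF sub])
      also have "\<dots> = (\<integral>t. indicator {0<..<T} t *\<^sub>R \<sigma> t \<partial>lborel)"
        by (rule integral_completion) (use m\<sigma> in measurable)
      also have "\<dots> = (\<integral>t. \<sigma> t * indicator {0..T} t \<partial>lborel)"
      proof (rule integral_cong_AE)
        have "AE t in lborel. t \<noteq> (0::real)" "AE t in lborel. t \<noteq> T" by (rule AE_lborel_singleton)+
        then show "AE t in lborel. indicator {0<..<T} t *\<^sub>R \<sigma> t = \<sigma> t * indicator {0..T} t"
          by eventually_elim (auto simp: indicator_def)
      qed (use m\<sigma> in measurable)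
      finally show ?thesis using \<sigma>int by simp
    qed
    have \<sigma>i: "integrable (lebesgue_on {0<..<T}) \<sigma>"
      using \<sigma>int' not_integrable_integral_eq by force
    have ind_i: "integrable (lebesgue_on {0<..<T}) (\<lambda>t. S / h * \<eta> * indicator {t0 - h..t0} t + K)"
    proof (rule Bochner_Integration.integrable_add)
      have fm: "finite_measure (lebesgue_on {0<..<T})"
        by (intro finite_measureI) (use T_pos in \<open>simp add: emeasure_restrict_space\<close>)
      then show "integrable (lebesgue_on {0<..<T}) (\<lambda>t. K)" by (intro finite_measure.integrable_const)
      show "integrable (lebesgue_on {0<..<T}) (\<lambda>t. S / h * \<eta> * indicator {t0 - h..t0} t)"
        by (rule finite_measure.integrable_const_bound[OF fm, of _ "\<bar>S / h * \<eta>\<bar>"])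
           (auto simp: indicator_def intro!: measurable_restrict_space1 measurable_completion)
    qed
    have "e0 - e t0 = - (\<integral>t. H t + \<sigma> t * e t0 \<partial>lebesgue_on {0<..<T})"
      using Heq Hi \<sigma>i \<sigma>int' by simp
    then have "\<bar>e0 - e t0\<bar> = norm (\<integral>t. H t + \<sigma> t * e t0 \<partial>lebesgue_on {0<..<T})" by simp
    also have "\<dots> \<le> (\<integral>t. norm (H t + \<sigma> t * e t0) \<partial>lebesgue_on {0<..<T})" by (rule integral_norm_bound)
    also have "\<dots> \<le> (\<integral>t. S / h * \<eta> * indicator {t0 - h..t0} t + K \<partial>lebesgue_on {0<..<T})"
    proof (rule integral_mono_AE[OF _ ind_i])
      show "integrable (lebesgue_on {0<..<T}) (\<lambda>t. norm (H t + \<sigma> t * e t0))" using Hi \<sigma>i by simp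
      show "AE t in lebesgue_on {0<..<T}. norm (H t + \<sigma> t * e t0) \<le> S / h * \<eta> * indicator {t0 - h..t0} t + K"
        using H_bound AE_space
      proof eventually_elim
        fix t assume Ht: "\<bar>H t + \<sigma> t * e t\<bar> \<le> K" and "t \<in> space (lebesgue_on {0<..<T})"
        then have t: "t \<in> {0..T}" by auto
        have "\<bar>\<sigma> t * (e t0 - e t)\<bar> \<le> S / h * \<eta> * indicator {t0 - h..t0} t"
        proof (cases "t \<in> {t0 - h..t0}")
          case True
          then have "dist t t0 < \<delta>" using h by (auto simp: dist_real_def)
          then have "\<bar>e t0 - e t\<bar> \<le> \<eta>" using \<delta>(2)[OF t] by (simp add: dist_real_def abs_minus_commute)
          then have "\<bar>\<sigma> t\<bar> * \<bar>e t0 - e t\<bar> \<le> S / h * \<eta>"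
            using \<sigma>b[of t] True S(1) h(1) by (intro mult_mono) auto
          then show ?thesis using True by (simp add: abs_mult)
        next
          case False
          then show ?thesis using \<sigma>0[of t] by auto
        qed
        moreover have "H t + \<sigma> t * e t0 = (H t + \<sigma> t * e t) + \<sigma> t * (e t0 - e t)" by (simp add: algebra_simps)
        ultimately show "norm (H t + \<sigma> t * e t0) \<le> S / h * \<eta> * indicator {t0 - h..t0} t + K"
          using Ht by (simp only: real_norm_def)
      qed
    qed
    also have "\<dots> \<le> S * \<eta> + T * K"
    proof -
      have "(\<integral>t. S / h * \<eta> * indicator {t0 - h..t0} t + K \<partial>lebesgue_on {0<..<T})
         = (\<integral>t. indicator {0<..<T} t *\<^sub>R (S / h * \<eta> * indicator {t0 - h..t0} t + K) \<partial>lebesgue)"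
        by (rule integral_restrict_space[OF sub])
      also have "\<dots> = (\<integral>t. indicator {0<..<T} t *\<^sub>R (S / h * \<eta> * indicator {t0 - h..t0} t + K) \<partial>lborel)"
        by (rule integral_completion) measurable
      also have "\<dots> \<le> (\<integral>t. S / h * \<eta> * indicator {t0 - h..t0} t + K * indicator {0<..<T} t \<partial>lborel)"
      proof (rule integral_mono')
        show "integrable lborel (\<lambda>t. S / h * \<eta> * indicator {t0 - h..t0} t + K * indicator {0<..<T} t)"
          using T_pos h by (intro Bochner_Integration.integrable_add integrable_mult_right integrable_real_indicator) auto
        show "indicator {0<..<T} t *\<^sub>R (S / h * \<eta> * indicator {t0 - h..t0} t + K) \<le> S / h * \<eta> * indicator {t0 - h..t0} t + K * indicator {0<..<T} t" for t
          using S(1) h(1) \<eta> by (auto simp: indicator_def)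
        show "0 \<le> S / h * \<eta> * indicator {t0 - h..t0} t + K * indicator {0<..<T} t" for t
          using S(1) h(1) \<eta> K0 by simp
      qed
      also have "\<dots> = S / h * \<eta> * h + K * T"
      proof -
        have "integrable lborel (indicator {t0 - h..t0} :: real \<Rightarrow> real)" "integrable lborel (indicator {0<..<T} :: real \<Rightarrow> real)"
          using T_pos h by (auto intro!: integrable_real_indicator)
        then show ?thesis using T_pos h by simp
      qed
      also have "\<dots> = S * \<eta> + T * K" using h(1) by simp
      finally show ?thesis .
    qed
    finally show ?thesis .
  qed
  have "\<bar>e0 - e t0\<bar> \<le> T * K"
  proof (rule field_le_epsilon)
    fix \<epsilon> :: real assume "\<epsilon> > 0"
    then have "\<bar>e0 - e t0\<bar> \<le> S * (\<epsilon> / S) + T * K" using S(1) by (intro main) simp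
    then show "\<bar>e0 - e t0\<bar> \<le> T * K + \<epsilon>" using S(1) by simp
  qed
  then show ?thesis by (simp add: e_def e0_def K_def)
qed

lemma level_integral_conserved:
  assumes a: "a > 0" and k: "k \<ge> 0" and t: "t \<in> {0..T}"
  shows "(\<integral>x. level a k (w t x) \<partial>lebesgue) = (\<integral>x. level a k (w0 x) \<partial>lebesgue)"
proof -
  obtain c where c: "c > 0" "\<And>R x. R \<ge> 1 \<Longrightarrow> norm (grad (cutoff R) (x :: real^2)) \<le> c / R"
    using cutoff_derivative_bounds[where 'a = "real^2"] by metis
  define M where "M = T * (c * (N * (kernel_mass + N / a)))"
  define e where "e R t = (\<integral>x. level a k (w t x) * cutoff R x \<partial>lebesgue)" for R t
  define e0 where "e0 R = (\<integral>x. level a k (w0 x) * cutoff R x \<partial>lebesgue)" for R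
  have bound: "\<bar>e0 R - e R t\<bar> \<le> M / R" if R: "R \<ge> 1" for R
  proof (rule continuous_le_on_closure[where f = "\<lambda>t. \<bar>e0 R - e R t\<bar>" and S = "{0<..<T}"])
    have "continuous_on {0..T} (e R)" unfolding e_def by (rule local_level_integral_continuous[OF k]) (use R in simp)
    then show "continuous_on (closure {0<..<T}) (\<lambda>t. \<bar>e0 R - e R t\<bar>)"
      using T_pos by (simp add: closure_greaterThanLessThan) (intro continuous_intros)
    show "t \<in> closure {0<..<T}" using t T_pos by (simp add: closure_greaterThanLessThan)
    fix s assume "s \<in> {0<..<T}"
    from localised_conservation[OF a k R this c(2)[OF R] c(1)]
    show "\<bar>e0 R - e R s\<bar> \<le> M / R" by (simp add: e_def e0_def M_def)
  qed
  have int: "integrable lebesgue (\<lambda>x. level a k (f x))" if f: "integrable lebesgue f" for f :: "real^2 \<Rightarrow> real"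
  proof (rule Bochner_Integration.integrable_bound)
    show "integrable lebesgue (\<lambda>x. (1 / a) * \<bar>f x\<bar>)" using f by simp
    show "(\<lambda>x. level a k (f x)) \<in> borel_measurable lebesgue"
      using f by (intro measurable_compose[OF _ level_measurable]) auto
    show "AE x in lebesgue. norm (level a k (f x)) \<le> norm ((1 / a) * \<bar>f x\<bar>)"
      using level_le[OF a k] level_bounds(1) a by (intro AE_I2) simp
  qed
  have l1: "(\<lambda>n. e (real (Suc n)) t) \<longlonglongrightarrow> (\<integral>x. level a k (w t x) \<partial>lebesgue)"
    unfolding e_def by (rule cutoff_integral_tendsto[OF int[OF L1[OF t]]])
  have l2: "(\<lambda>n. e0 (real (Suc n))) \<longlonglongrightarrow> (\<integral>x. level a k (w0 x) \<partial>lebesgue)"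
    unfolding e0_def by (rule cutoff_integral_tendsto[OF int[OF w0_L1]])
  have z: "(\<lambda>n. M / real (Suc n)) \<longlonglongrightarrow> 0" by real_asymp
  have "(\<lambda>n. e0 (real (Suc n)) - e (real (Suc n)) t) \<longlonglongrightarrow> 0"
    by (rule Lim_null_comparison[OF always_eventually z]) (use bound in simp)
  from LIMSEQ_unique[OF this tendsto_diff[OF l2 l1]] show ?thesis by simp
qed

text \<open>The functions \<open>level a k\<close> approximate the indicator function, under the integrable majorant \<open>\<bar>w\<bar> / a\<close>.\<close>

lemma distribution_conserved:
  assumes a: "a > 0" and t: "t \<in> {0..T}"
  shows "emeasure lebesgue {x. a < \<bar>w t x\<bar>} = emeasure lebesgue {x. a < \<bar>w0 x\<bar>}"
proof -
  have lim: "(\<lambda>n. \<integral>x. level a (real n) (f x) \<partial>lebesgue) \<longlonglongrightarrow> measure lebesgue {x. a < \<bar>f x\<bar>}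
    \<and> emeasure lebesgue {x. a < \<bar>f x\<bar>} = ennreal (measure lebesgue {x. a < \<bar>f x\<bar>})"
    if f: "integrable lebesgue f" for f :: "real^2 \<Rightarrow> real"
  proof -
    have "{x \<in> space lebesgue. a < \<bar>f x\<bar>} \<in> sets lebesgue" using f by measurable
    then have m: "{x. a < \<bar>f x\<bar>} \<in> sets lebesgue" by simp
    have "(\<lambda>n. \<integral>x. level a (real n) (f x) \<partial>lebesgue) \<longlonglongrightarrow> (\<integral>x. indicator {x. a < \<bar>f x\<bar>} x \<partial>lebesgue)"
    proof (rule integral_dominated_convergence)
      show "integrable lebesgue (\<lambda>x. (1 / a) * \<bar>f x\<bar>)" using f by simp
      show "(\<lambda>x. level a (real n) (f x)) \<in> borel_measurable lebesgue" for n
        using f by (intro measurable_compose[OF _ level_measurable]) auto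
      show "(\<lambda>x. indicator {x. a < \<bar>f x\<bar>} x :: real) \<in> borel_measurable lebesgue" using m by measurable
      show "AE x in lebesgue. (\<lambda>n. level a (real n) (f x)) \<longlonglongrightarrow> indicator {x. a < \<bar>f x\<bar>} x"
      proof (rule AE_I2)
        fix x
        show "(\<lambda>n. level a (real n) (f x)) \<longlonglongrightarrow> indicator {x. a < \<bar>f x\<bar>} x"
          using level_tendsto[OF a, of "f x"] by (cases "a < \<bar>f x\<bar>") simp_all
      qed
      show "AE x in lebesgue. norm (level a (real n) (f x)) \<le> (1 / a) * \<bar>f x\<bar>" for n
        using level_le[OF a] level_bounds(1) by (intro AE_I2) simp
    qed
    moreover have i: "integrable lebesgue (indicator {x. a < \<bar>f x\<bar>} :: real^2 \<Rightarrow> real)"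
    proof (rule Bochner_Integration.integrable_bound)
      show "integrable lebesgue (\<lambda>x. (1 / a) * \<bar>f x\<bar>)" using f by simp
      show "AE x in lebesgue. norm (indicator {x. a < \<bar>f x\<bar>} x :: real) \<le> norm ((1 / a) * \<bar>f x\<bar>)"
        using a by (intro AE_I2) (simp add: indicator_def)
    qed (use m in measurable)
    then have "emeasure lebesgue {x. a < \<bar>f x\<bar>} < \<infinity>" using m by (simp add: integrable_indicator_iff)
    ultimately show ?thesis using m by (simp add: emeasure_eq_ennreal_measure)
  qed
  have eq: "(\<integral>x. level a (real n) (w t x) \<partial>lebesgue) = (\<integral>x. level a (real n) (w0 x) \<partial>lebesgue)" for n
    by (rule level_integral_conserved[OF a _ t]) simp
  have "measure lebesgue {x. a < \<bar>w t x\<bar>} = measure lebesgue {x. a < \<bar>w0 x\<bar>}"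
    using lim[OF L1[OF t]] lim[OF w0_L1] unfolding eq by (blast intro: LIMSEQ_unique)
  then show ?thesis using lim[OF L1[OF t]] lim[OF w0_L1] by simp
qed

lemma functional_conserved:
  assumes "t \<in> {0..T}" "(G :: real \<Rightarrow> real) \<in> borel_measurable borel" "\<And>s. G s \<ge> 0"
    "\<And>\<tau>. \<tau> > 0 \<Longrightarrow> \<exists>a>0. \<forall>s. \<tau> < G s \<longleftrightarrow> a < \<bar>s\<bar>"
  shows "(\<integral>x. G (w t x) \<partial>lebesgue) = (\<integral>x. G (w0 x) \<partial>lebesgue)"
  by (rule equimeasurable_integral)
     (use assms distribution_conserved[OF _ assms(1)] L1[OF assms(1)] w0_L1 in auto)

end

section \<open>The inviscid limit\<close>

text \<open>The tool that turns convergence of time averages into convergence at the times \<open>t j\<close>: both \<open>a (r j) (t j)\<close> and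
  \<open>b \<tau>\<close> are close to their averages over a short interval around \<open>\<tau>\<close>, the former by equicontinuity up
  to an arbitrarily small error.\<close>

lemma interval_average_limit:
  fixes a :: "nat \<Rightarrow> real \<Rightarrow> real" and b :: "real \<Rightarrow> real"
  assumes T: "T > 0"
    and equi: "\<And>\<eta>. \<eta> > 0 \<Longrightarrow> \<exists>C. \<forall>\<^sub>F n in sequentially. \<forall>s\<in>{0..T}. \<forall>t\<in>{0..T}. \<bar>a n t - a n s\<bar> \<le> \<eta> + C * \<bar>t - s\<bar>"
    and b: "continuous_on {0..T} b"
    and int: "\<And>\<alpha> \<beta> n. 0 \<le> \<alpha> \<Longrightarrow> \<alpha> < \<beta> \<Longrightarrow> \<beta> \<le> T \<Longrightarrow> integrable lebesgue (\<lambda>t. indicator {\<alpha><..<\<beta>} t * a n t)"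
      "\<And>\<alpha> \<beta>. 0 \<le> \<alpha> \<Longrightarrow> \<alpha> < \<beta> \<Longrightarrow> \<beta> \<le> T \<Longrightarrow> integrable lebesgue (\<lambda>t. indicator {\<alpha><..<\<beta>} t * b t)"
    and conv: "\<And>\<alpha> \<beta>. 0 \<le> \<alpha> \<Longrightarrow> \<alpha> < \<beta> \<Longrightarrow> \<beta> \<le> T \<Longrightarrow>
      (\<lambda>n. \<integral>t. indicator {\<alpha><..<\<beta>} t * a n t \<partial>lebesgue) \<longlonglongrightarrow> (\<integral>t. indicator {\<alpha><..<\<beta>} t * b t \<partial>lebesgue)"
    and r: "filterlim r at_top sequentially" and t: "\<And>j. t j \<in> {0..T}" "t \<longlonglongrightarrow> \<tau>" and \<tau>: "\<tau> \<in> {0..T}"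
  shows "(\<lambda>j. a (r j) (t j)) \<longlonglongrightarrow> b \<tau>"
proof (rule tendstoI)
  fix e :: real assume e: "e > 0"
  define \<eta> where "\<eta> = e / 5"
  have \<eta>: "\<eta> > 0" using e by (simp add: \<eta>_def)
  obtain C0 where C0: "\<forall>\<^sub>F n in sequentially. \<forall>s\<in>{0..T}. \<forall>t\<in>{0..T}. \<bar>a n t - a n s\<bar> \<le> \<eta> + C0 * \<bar>t - s\<bar>"
    using equi[OF \<eta>] by blast
  define C where "C = max C0 0"
  have C: "C \<ge> 0" "C0 \<le> C" by (auto simp: C_def)
  obtain \<delta>0 where \<delta>0: "\<delta>0 > 0" "\<And>s. s \<in> {0..T} \<Longrightarrow> dist s \<tau> < \<delta>0 \<Longrightarrow> dist (b s) (b \<tau>) < \<eta>"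
    using b \<eta> \<tau> unfolding continuous_on_iff by blast
  define \<delta> where "\<delta> = min \<delta>0 (\<eta> / (2 * (C + 1)))"
  have \<delta>: "\<delta> > 0" "\<delta> \<le> \<delta>0" using \<delta>0 \<eta> C by (auto simp: \<delta>_def)
  have "2 * (C + 1) * \<delta> \<le> 2 * (C + 1) * (\<eta> / (2 * (C + 1)))" using C by (intro mult_left_mono) (auto simp: \<delta>_def)
  also have "\<dots> = \<eta>" using C by simp
  finally have C\<delta>: "C * (2 * \<delta>) \<le> \<eta>" using \<delta>(1) by (simp add: algebra_simps)
  define \<alpha> \<beta> where "\<alpha> = max 0 (\<tau> - \<delta>)" and "\<beta> = min T (\<tau> + \<delta>)"
  have \<alpha>\<beta>: "0 \<le> \<alpha>" "\<alpha> < \<beta>" "\<beta> \<le> T" using \<tau> \<delta>(1) T by (auto simp: \<alpha>_def \<beta>_def)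
  define h where "h = \<beta> - \<alpha>"
  have h: "h > 0" using \<alpha>\<beta> by (simp add: h_def)
  let ?i = "indicator {\<alpha><..<\<beta>} :: real \<Rightarrow> real"
  have near: "s \<in> {0..T}" "\<bar>s - \<tau>\<bar> < \<delta>" if "s \<in> {\<alpha><..<\<beta>}" for s using that by (auto simp: \<alpha>_def \<beta>_def)
  have ii: "integrable lebesgue ?i" using \<alpha>\<beta> by (intro integrable_real_indicator) auto
  have mi: "(\<integral>s. ?i s \<partial>lebesgue) = h" using \<alpha>\<beta> by (simp add: h_def)
  have ia: "integrable lebesgue (\<lambda>s. ?i s * a n s)" for n by (rule int(1)[OF \<alpha>\<beta>])
  have ib: "integrable lebesgue (\<lambda>s. ?i s * b s)" by (rule int(2)[OF \<alpha>\<beta>])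
  have ev1: "\<forall>\<^sub>F j in sequentially. \<forall>s\<in>{0..T}. \<forall>t\<in>{0..T}. \<bar>a (r j) t - a (r j) s\<bar> \<le> \<eta> + C0 * \<bar>t - s\<bar>"
    by (rule eventually_compose_filterlim[OF C0 r])
  have ev2: "\<forall>\<^sub>F j in sequentially. \<bar>(\<integral>s. ?i s * a (r j) s \<partial>lebesgue) - (\<integral>s. ?i s * b s \<partial>lebesgue)\<bar> < \<eta> * h"
    using tendstoD[OF filterlim_compose[OF conv[OF \<alpha>\<beta>] r], of "\<eta> * h"] \<eta> h by (simp add: dist_real_def)
  have ev3: "\<forall>\<^sub>F j in sequentially. \<bar>t j - \<tau>\<bar> < \<delta>"
    using tendstoD[OF t(2) \<delta>(1)] by (simp add: dist_real_def)
  show "\<forall>\<^sub>F j in sequentially. dist (a (r j) (t j)) (b \<tau>) < e"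
    using ev1 ev2 ev3
  proof eventually_elim
    fix j
    assume e1: "\<forall>s\<in>{0..T}. \<forall>t\<in>{0..T}. \<bar>a (r j) t - a (r j) s\<bar> \<le> \<eta> + C0 * \<bar>t - s\<bar>"
      and e2: "\<bar>(\<integral>s. ?i s * a (r j) s \<partial>lebesgue) - (\<integral>s. ?i s * b s \<partial>lebesgue)\<bar> < \<eta> * h"
      and e3: "\<bar>t j - \<tau>\<bar> < \<delta>"
    define A where "A = a (r j)"
    define d where "d = A (t j) - b \<tau>"
    have idd: "integrable lebesgue (\<lambda>s. ?i s * d - (?i s * A s - ?i s * b s))"
      using ii ia[of "r j"] ib by (simp add: A_def)
    have "norm (\<integral>s. ?i s * d - (?i s * A s - ?i s * b s) \<partial>lebesgue) \<le> (\<integral>s. ?i s * (3 * \<eta>) \<partial>lebesgue)"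
    proof (rule order_trans[OF integral_norm_bound integral_mono'])
      show "integrable lebesgue (\<lambda>s. ?i s * (3 * \<eta>))" using ii by simp
      fix s
      show "norm (?i s * d - (?i s * A s - ?i s * b s)) \<le> ?i s * (3 * \<eta>)"
      proof (cases "s \<in> {\<alpha><..<\<beta>}")
        case True
        have "\<bar>A (t j) - A s\<bar> \<le> \<eta> + C0 * \<bar>t j - s\<bar>" using e1 near(1)[OF True] t(1)[of j] by (auto simp: A_def)
        also have "C0 * \<bar>t j - s\<bar> \<le> C * (2 * \<delta>)" using C e3 near(2)[OF True] by (intro mult_mono) auto
        finally have 1: "\<bar>A (t j) - A s\<bar> \<le> \<eta> + \<eta>" using C\<delta> by linarith
        have 2: "\<bar>b s - b \<tau>\<bar> \<le> \<eta>" using \<delta>0(2)[OF near(1)[OF True]] near(2)[OF True] \<delta>(2) by (simp add: dist_real_def)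
        have "?i s * d - (?i s * A s - ?i s * b s) = (A (t j) - A s) + (b s - b \<tau>)" using True by (simp add: d_def)
        then show ?thesis using 1 2 True by simp
      qed simp
      show "0 \<le> ?i s * (3 * \<eta>)" using \<eta> by simp
    qed
    moreover have "(\<integral>s. ?i s * (3 * \<eta>) \<partial>lebesgue) = 3 * \<eta> * h" using mi by (simp add: mult_ac)
    moreover have "(\<integral>s. ?i s * d - (?i s * A s - ?i s * b s) \<partial>lebesgue) = h * d - ((\<integral>s. ?i s * A s \<partial>lebesgue) - (\<integral>s. ?i s * b s \<partial>lebesgue))"
      using ii ia[of "r j"] ib mi by (simp add: A_def)
    ultimately have "\<bar>h * d\<bar> < 4 * \<eta> * h" using e2 unfolding A_def real_norm_def by linarith
    then have "h * \<bar>d\<bar> < h * (4 * \<eta>)" using h by (simp add: abs_mult mult.commute)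
    then have "\<bar>d\<bar> < 4 * \<eta>" using h by (simp only: mult_less_cancel_left_pos)
    then show "dist (a (r j) (t j)) (b \<tau>) < e" using e by (simp add: dist_real_def d_def A_def \<eta>_def)
  qed
qed

locale inviscid_limit =
  fixes T p :: real and w0 :: "real^2 \<Rightarrow> real" and \<nu> :: "nat \<Rightarrow> real" and wi :: "nat \<Rightarrow> real^2 \<Rightarrow> real"
    and un :: "nat \<Rightarrow> real \<Rightarrow> real^2 \<Rightarrow> real^2" and wn :: "nat \<Rightarrow> real \<Rightarrow> real^2 \<Rightarrow> real"
    and u :: "real \<Rightarrow> real^2 \<Rightarrow> real^2" and w :: "real \<Rightarrow> real^2 \<Rightarrow> real"
  assumes T_pos: "T > 0" and p_ge: "p \<ge> 1" and w0: "in_Lp_c p w0"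
    and nu_pos: "\<And>n. \<nu> n > 0" and nu_lim: "\<nu> \<longlonglongrightarrow> 0"
    and init_test: "\<And>n. test_function UNIV (wi n)"
    and init_supp: "\<exists>R>0. \<forall>n. supp (wi n) \<subseteq> ball 0 R"
    and init_conv: "(\<lambda>n. Lp_norm p UNIV (\<lambda>x. wi n x - w0 x)) \<longlonglongrightarrow> 0"
    and ns_sol: "\<And>n. navier_stokes_solution T (\<nu> n) (wi n) (un n) (wn n)"
    and ren: "renormalized_solution T p w0 u w"
    and weak: "weakstar_Linf_L2loc T un u"
begin

lemma NS: "navier_stokes T (\<nu> n) (wi n) (un n) (wn n)"
  using T_pos nu_pos ns_sol by (intro navier_stokes.intro)

lemma support_radius: obtains R where "R > 0" "\<And>n. vanishes_outside R (wi n)" "AE x in lebesgue. norm x > R \<longrightarrow> w0 x = 0"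
proof -
  obtain R1 where R1: "R1 > 0" "\<And>n. supp (wi n) \<subseteq> ball 0 R1" using init_supp by blast
  obtain A where A: "compact A" "AE x in lebesgue. x \<notin> A \<longrightarrow> w0 x = 0" using w0 by (auto simp: in_Lp_c_def)
  obtain R2 where R2: "A \<subseteq> ball 0 R2" "R2 > 0"
    using bounded_subset_ballD[OF compact_imp_bounded[OF A(1)], of 0] by blast
  show ?thesis
  proof (rule that[of "max R1 R2"])
    show "max R1 R2 > 0" using R1 by simp
    show "vanishes_outside (max R1 R2) (wi n)" for n
      unfolding vanishes_outside_def
    proof (intro allI impI, rule ccontr)
      fix x assume "norm x > max R1 R2" "wi n x \<noteq> 0"
      then have "x \<in> supp (wi n)" unfolding supp_def using closure_subset by fastforce
      then show False using R1(2)[of n] \<open>norm x > max R1 R2\<close> by auto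
    qed
    show "AE x in lebesgue. norm x > max R1 R2 \<longrightarrow> w0 x = 0"
      using A(2) by eventually_elim (use R2(1) in auto)
  qed
qed

lemma wi_continuous: "continuous_on UNIV (wi n)"
  using init_test[of n] C_k_continuous[of 0 UNIV "wi n"] by (auto simp: test_function_def smooth_on_def)

lemma wi_borel [measurable]: "wi n \<in> borel_measurable borel"
  using wi_continuous by (rule borel_measurable_continuous_onI)

lemma wi_lebesgue: "wi n \<in> borel_measurable lebesgue"
  by (intro measurable_completion) measurable

lemma w0_in_Lp: "in_Lp p UNIV w0" using w0 by (simp add: in_Lp_c_def)

lemma wi_in_Lp:
  assumes q: "q \<ge> 1" shows "in_Lp q UNIV (wi n)"
proof -
  obtain R where R: "vanishes_outside R (wi n)" using support_radius by metis
  obtain B where B: "\<And>x. norm (wi n x) \<le> B" using bounded_continuous_vanishing[OF wi_continuous R] by blast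
  have "integrable lebesgue (\<lambda>x. \<bar>wi n x\<bar> powr q)"
  proof (rule Bochner_Integration.integrable_bound)
    show "integrable lebesgue (\<lambda>x. B powr q * indicator (cball (0::real^2) R) x)"
      by (intro integrable_mult_right indicator_cball_integrable)
    show "(\<lambda>x. \<bar>wi n x\<bar> powr q) \<in> borel_measurable lebesgue" using wi_lebesgue by measurable
    show "AE x in lebesgue. norm (\<bar>wi n x\<bar> powr q) \<le> norm (B powr q * indicator (cball (0::real^2) R) x)"
    proof (rule AE_I2)
      fix x
      show "norm (\<bar>wi n x\<bar> powr q) \<le> norm (B powr q * indicator (cball (0::real^2) R) x)"
        using R q powr_mono2[of q "\<bar>wi n x\<bar>" B] B[of x]
        by (cases "x \<in> cball 0 R") (auto simp: vanishes_outside_def abs_mult)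
    qed
  qed
  then show ?thesis using wi_lebesgue by (simp add: in_Lp_def lebesgue_on_UNIV_eq)
qed

lemma w0_integrable: "integrable lebesgue w0"
proof -
  obtain R where R: "AE x in lebesgue. norm x > R \<longrightarrow> w0 x = 0" using support_radius by metis
  have i: "integrable lebesgue (\<lambda>x. indicator (cball 0 R) x * w0 x)"
    by (rule Lp_locally_integrable[OF w0_in_Lp p_ge])
  have m: "w0 \<in> borel_measurable lebesgue" using w0_in_Lp by (simp add: in_Lp_def lebesgue_on_UNIV_eq)
  show ?thesis
    by (rule integrable_cong_AE_imp[OF i m]) (use R in eventually_elim, auto simp: indicator_def)
qed

lemma wi_integrable: "integrable lebesgue (wi n)"
  using L1_integral(1)[OF wi_in_Lp[of 1]] by simp

lemma initial_L1: "(\<lambda>n. \<integral>x. \<bar>wi n x - w0 x\<bar> \<partial>lebesgue) \<longlonglongrightarrow> 0"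
proof -
  obtain R where R: "\<And>n. vanishes_outside R (wi n)" "AE x in lebesgue. norm x > R \<longrightarrow> w0 x = 0" using support_radius by metis
  have "(\<lambda>n. \<integral>x. indicator (cball 0 R) x * \<bar>wi n x - w0 x\<bar> \<partial>lebesgue) \<longlonglongrightarrow> 0"
    by (rule Lp_imp_L1_ball[OF p_ge init_conv]) (intro always_eventually allI in_Lp_diff wi_in_Lp w0_in_Lp p_ge)
  moreover have "(\<integral>x. indicator (cball 0 R) x * \<bar>wi n x - w0 x\<bar> \<partial>lebesgue) = (\<integral>x. \<bar>wi n x - w0 x\<bar> \<partial>lebesgue)" for n
  proof (rule integral_cong_AE)
    show "AE x in lebesgue. indicator (cball 0 R) x * \<bar>wi n x - w0 x\<bar> = \<bar>wi n x - w0 x\<bar>"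
      using R(2) by eventually_elim (use R(1)[of n] in \<open>auto simp: indicator_def vanishes_outside_def\<close>)
    show m: "(\<lambda>x. \<bar>wi n x - w0 x\<bar>) \<in> borel_measurable lebesgue" using wi_integrable w0_integrable by auto
    show "(\<lambda>x. indicator (cball 0 R) x * \<bar>wi n x - w0 x\<bar>) \<in> borel_measurable lebesgue"
      by (rule borel_measurable_times[OF borel_measurable_integrable[OF indicator_cball_integrable] m])
  qed
  ultimately show ?thesis by simp
qed

lemma initial_mass: obtains N where "N \<ge> 0" "\<And>n. (\<integral>x. \<bar>wi n x\<bar> \<partial>lebesgue) \<le> N"
proof -
  obtain D where D: "\<And>n. norm (\<integral>x. \<bar>wi n x - w0 x\<bar> \<partial>lebesgue) \<le> D"
    using convergent_imp_Bseq[OF convergentI[OF initial_L1]] unfolding Bseq_def by blast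
  define N where "N = D + (\<integral>x. \<bar>w0 x\<bar> \<partial>lebesgue)"
  have le: "(\<integral>x. \<bar>wi n x\<bar> \<partial>lebesgue) \<le> N" for n
  proof -
    have "(\<integral>x. \<bar>wi n x\<bar> \<partial>lebesgue) \<le> (\<integral>x. \<bar>wi n x - w0 x\<bar> + \<bar>w0 x\<bar> \<partial>lebesgue)"
      using wi_integrable w0_integrable by (intro integral_mono) auto
    also have "\<dots> = (\<integral>x. \<bar>wi n x - w0 x\<bar> \<partial>lebesgue) + (\<integral>x. \<bar>w0 x\<bar> \<partial>lebesgue)"
      using wi_integrable w0_integrable by simp
    also have "\<dots> \<le> N" using D[of n] by (simp add: N_def)
    finally show ?thesis .
  qed
  moreover have "N \<ge> 0" using le[of 0] by (rule order_trans[rotated]) simp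
  ultimately show ?thesis using that by blast
qed

lemma initial_soft_abs:
  assumes k: "k > 0"
  shows "(\<lambda>n. \<integral>x. soft_abs k (wi n x) \<partial>lebesgue) \<longlonglongrightarrow> (\<integral>x. soft_abs k (w0 x) \<partial>lebesgue)"
proof -
  have "(\<lambda>n. (\<integral>x. soft_abs k (wi n x) \<partial>lebesgue) - (\<integral>x. soft_abs k (w0 x) \<partial>lebesgue)) \<longlonglongrightarrow> 0"
  proof (rule Lim_null_comparison[OF always_eventually initial_L1], rule allI)
    fix n
    have i: "integrable lebesgue (\<lambda>x. soft_abs k (wi n x))" "integrable lebesgue (\<lambda>x. soft_abs k (w0 x))"
      by (rule soft_abs_integrable_comp[OF k wi_integrable], rule soft_abs_integrable_comp[OF k w0_integrable])
    have "norm (\<integral>x. soft_abs k (wi n x) - soft_abs k (w0 x) \<partial>lebesgue) \<le> (\<integral>x. \<bar>wi n x - w0 x\<bar> \<partial>lebesgue)"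
      by (rule order_trans[OF integral_norm_bound integral_mono'])
         (use wi_integrable w0_integrable soft_abs_lipschitz[OF k] in auto)
    then show "norm ((\<integral>x. soft_abs k (wi n x) \<partial>lebesgue) - (\<integral>x. soft_abs k (w0 x) \<partial>lebesgue)) \<le> (\<integral>x. \<bar>wi n x - w0 x\<bar> \<partial>lebesgue)"
      using i by simp
  qed
  then show ?thesis by (rule LIM_zero_cancel)
qed

text \<open>For large \<open>k\<close> the integral for the limit datum is small by dominated convergence, and the integrals for the
  approximating data converge to it.\<close>

lemma initial_equiintegrable:
  assumes \<eta>: "\<eta> > 0"
  obtains k where "k > 0" "\<forall>\<^sub>F n in sequentially. (\<integral>x. soft_abs k (wi n x) \<partial>lebesgue) \<le> \<eta>"
proof -
  have "(\<lambda>n. \<integral>x. soft_abs (real (Suc n)) (w0 x) \<partial>lebesgue) \<longlonglongrightarrow> (\<integral>x. 0 \<partial>(lebesgue :: (real^2) measure))"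
  proof (rule integral_dominated_convergence)
    show "integrable lebesgue (\<lambda>x. \<bar>w0 x\<bar>)" using w0_integrable by simp
    show "(\<lambda>x. soft_abs (real (Suc n)) (w0 x)) \<in> borel_measurable lebesgue" for n
      using soft_abs_integrable_comp[OF _ w0_integrable, of "real (Suc n)"] by auto
    show "AE x in lebesgue. (\<lambda>n. soft_abs (real (Suc n)) (w0 x)) \<longlonglongrightarrow> 0"
    proof (rule AE_I2)
      fix x
      define s where "s = w0 x"
      have "(\<lambda>n. sqrt ((real (Suc n))\<^sup>2 + s\<^sup>2) - real (Suc n)) \<longlonglongrightarrow> 0" by real_asymp
      then show "(\<lambda>n. soft_abs (real (Suc n)) (w0 x)) \<longlonglongrightarrow> 0" by (simp only: soft_abs_def s_def)
    qed
    show "AE x in lebesgue. norm (soft_abs (real (Suc n)) (w0 x)) \<le> \<bar>w0 x\<bar>" for n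
      using soft_abs_le[of "real (Suc n)"] soft_abs_nonneg[of "real (Suc n)"] by (intro AE_I2) simp
  qed auto
  then have "\<forall>\<^sub>F n in sequentially. (\<integral>x. soft_abs (real (Suc n)) (w0 x) \<partial>lebesgue) < \<eta>"
    using order_tendstoD(2) \<eta> by fastforce
  then obtain m where m: "(\<integral>x. soft_abs (real (Suc m)) (w0 x) \<partial>lebesgue) < \<eta>"
    using eventually_happens by fastforce
  have "\<forall>\<^sub>F n in sequentially. (\<integral>x. soft_abs (real (Suc m)) (wi n x) \<partial>lebesgue) < \<eta>"
    by (rule order_tendstoD(2)[OF initial_soft_abs m]) simp
  then show ?thesis by (intro that[of "real (Suc m)"]) (auto elim: eventually_mono)
qed

section \<open>Convergence at given times\<close>

lemma wn_lebesgue: "t \<in> {0..T} \<Longrightarrow> wn n t \<in> borel_measurable lebesgue"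
  using navier_stokes.w_borel[OF NS] by (intro measurable_completion) simp

lemma lebesgue_eq_lborel:
  fixes f :: "real^2 \<Rightarrow> real"
  shows "f \<in> borel_measurable borel \<Longrightarrow> (\<integral>x. f x \<partial>lebesgue) = (\<integral>x. f x \<partial>lborel)"
  by (rule integral_completion) simp

lemma wn_soft_abs:
  assumes k: "k > 0" and t: "t \<in> {0..T}"
  shows "(\<integral>x. soft_abs k (wn n t x) \<partial>lebesgue) \<le> (\<integral>x. soft_abs k (wi n x) \<partial>lebesgue)"
proof -
  note [measurable] = navier_stokes.w_borel[OF NS t]
  have "(\<integral>x. soft_abs k (wn n t x) \<partial>lebesgue) = (\<integral>x. soft_abs k (wn n t x) \<partial>lborel)"
    by (rule lebesgue_eq_lborel) measurable
  also have "\<dots> \<le> (\<integral>x. soft_abs k (wi n x) \<partial>lborel)" by (rule navier_stokes.soft_abs_decay[OF NS k t])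
  also have "\<dots> = (\<integral>x. soft_abs k (wi n x) \<partial>lebesgue)"
    by (rule lebesgue_eq_lborel[symmetric]) measurable
  finally show ?thesis .
qed

lemma wn_powr:
  assumes q: "q \<ge> 1" and t: "t \<in> {0..T}"
  shows "(\<integral>x. \<bar>wn n t x\<bar> powr q \<partial>lebesgue) \<le> (\<integral>x. \<bar>wi n x\<bar> powr q \<partial>lebesgue)"
    "integrable lebesgue (\<lambda>x. \<bar>wn n t x\<bar> powr q)"
proof -
  obtain R where R: "vanishes_outside R (wi n)" using support_radius by metis
  note [measurable] = navier_stokes.w_borel[OF NS t]
  have "(\<integral>x. \<bar>wn n t x\<bar> powr q \<partial>lebesgue) = (\<integral>x. \<bar>wn n t x\<bar> powr q \<partial>lborel)"
    by (rule lebesgue_eq_lborel) measurable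
  also have "\<dots> \<le> (\<integral>x. \<bar>wi n x\<bar> powr q \<partial>lborel)" by (rule navier_stokes.Lp_decay[OF NS q t R])
  also have "\<dots> = (\<integral>x. \<bar>wi n x\<bar> powr q \<partial>lebesgue)"
    by (rule lebesgue_eq_lborel[symmetric]) measurable
  finally show "(\<integral>x. \<bar>wn n t x\<bar> powr q \<partial>lebesgue) \<le> (\<integral>x. \<bar>wi n x\<bar> powr q \<partial>lebesgue)" .
  show "integrable lebesgue (\<lambda>x. \<bar>wn n t x\<bar> powr q)"
    using navier_stokes.w_powr_integrable[OF NS q t] by (simp add: integrable_completion)
qed

lemma wn_integrable: "t \<in> {0..T} \<Longrightarrow> integrable lebesgue (wn n t)"
  by (rule navier_stokes.w_integrable[OF NS])

text \<open>First \<open>k\<close> is chosen from the tail of the initial data so that the nonlipschitz term is at most \<open>\<eta>\<close>; the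
  Lipschitz constant then depends on \<open>k\<close> but on neither \<open>n\<close> nor the viscosity.\<close>

lemma pairing_equicontinuous:
  assumes \<zeta>: "\<And>n. C_k n UNIV \<zeta>" "vanishes_outside R \<zeta>" and \<eta>: "\<eta> > 0"
  shows "\<exists>C. \<forall>\<^sub>F n in sequentially. \<forall>s\<in>{0..T}. \<forall>t\<in>{0..T}.
    \<bar>(\<integral>x. wn n t x * \<zeta> x \<partial>lebesgue) - (\<integral>x. wn n s x * \<zeta> x \<partial>lebesgue)\<bar> \<le> \<eta> + C * \<bar>t - s\<bar>"
proof -
  have c: "continuous_on UNIV \<zeta>" "continuous_on UNIV (grad \<zeta>)" "continuous_on UNIV (laplacian \<zeta>)"
  proof -
    show "continuous_on UNIV \<zeta>" using \<zeta>(1)[of 0] by simp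
    show "continuous_on UNIV (grad \<zeta>)" by (rule grad_measurable(3)[OF \<zeta>(1)])
    show "continuous_on UNIV (laplacian \<zeta>)"
      unfolding laplacian_def[abs_def]
      by (intro continuous_on_sum C_k_continuous[OF C_k_Suc_pd[OF C_k_Suc_pd[OF \<zeta>(1)]]])
  qed
  have v: "vanishes_outside R (laplacian \<zeta>)"
    using vanishes_pd[OF vanishes_pd[OF \<zeta>(2)]] by (auto simp: vanishes_outside_def laplacian_def)
  obtain m where m: "m > 0" "\<And>x. norm (\<zeta> x) \<le> m" using bounded_continuous_vanishing[OF c(1) \<zeta>(2)] by blast
  obtain G where G: "G > 0" "\<And>x. norm (grad \<zeta> x) \<le> G" using bounded_continuous_vanishing[OF c(2) vanishes_grad(1)[OF \<zeta>(2)]] by blast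
  obtain \<Lambda> where \<Lambda>: "\<Lambda> > 0" "\<And>x. norm (laplacian \<zeta> x) \<le> \<Lambda>" using bounded_continuous_vanishing[OF c(3) v] by blast
  obtain \<nu>b where \<nu>b: "\<And>n. norm (\<nu> n) \<le> \<nu>b"
    using convergent_imp_Bseq[OF convergentI[OF nu_lim]] unfolding Bseq_def by blast
  obtain N where N: "N \<ge> 0" "\<And>n. (\<integral>x. \<bar>wi n x\<bar> \<partial>lebesgue) \<le> N" using initial_mass by blast
  obtain R0 where R0: "\<And>n. vanishes_outside R0 (wi n)" using support_radius by metis
  obtain k where k: "k > 0" "\<forall>\<^sub>F n in sequentially. (\<integral>x. soft_abs k (wi n x) \<partial>lebesgue) \<le> \<eta> / (5 * m)"
    using initial_equiintegrable[of "\<eta> / (5 * m)"] \<eta> m by auto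
  define V where "V = measure lborel (cball (0::real^2) R)"
  define C where "C = k * (G * (N * (kernel_mass + V)) + \<nu>b * \<Lambda> * V)"
  have V0: "V \<ge> 0" by (simp add: V_def)
  have pair_eq: "(\<integral>x. wn n t x * \<zeta> x \<partial>lebesgue) = (\<integral>x. wn n t x * \<zeta> x \<partial>lborel)" if "t \<in> {0..T}" for n t
    by (rule lebesgue_eq_lborel)
       (use navier_stokes.w_borel[OF NS that] borel_measurable_continuous_onI[OF c(1)] in measurable)
  have ordered: "\<bar>(\<integral>x. wn n t x * \<zeta> x \<partial>lebesgue) - (\<integral>x. wn n s x * \<zeta> x \<partial>lebesgue)\<bar> \<le> \<eta> + C * (t - s)"
    if n: "(\<integral>x. soft_abs k (wi n x) \<partial>lebesgue) \<le> \<eta> / (5 * m)" and st: "0 \<le> s" "s \<le> t" "t \<le> T" for n s t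
  proof -
    have "\<bar>(\<integral>x. wn n t x * \<zeta> x \<partial>lborel) - (\<integral>x. wn n s x * \<zeta> x \<partial>lborel)\<bar>
      \<le> 5 * m * (\<integral>x. soft_abs k (wi n x) \<partial>lborel)
        + k * (G * ((\<integral>x. \<bar>wi n x\<bar> \<partial>lborel) * (kernel_mass + V)) + \<nu> n * \<Lambda> * V) * (t - s)"
      unfolding V_def
      by (rule navier_stokes.time_equicontinuity[OF NS k(1) R0 \<zeta>(1) \<zeta>(2) _ G(2) _ st]) (use m(2) \<Lambda>(2) in auto)
    also have "(\<integral>x. soft_abs k (wi n x) \<partial>lborel) = (\<integral>x. soft_abs k (wi n x) \<partial>lebesgue)"
      by (rule lebesgue_eq_lborel[symmetric]) measurable
    also have "(\<integral>x. \<bar>wi n x\<bar> \<partial>lborel) = (\<integral>x. \<bar>wi n x\<bar> \<partial>lebesgue)"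
      by (rule lebesgue_eq_lborel[symmetric]) measurable
    also have "5 * m * (\<integral>x. soft_abs k (wi n x) \<partial>lebesgue)
        + k * (G * ((\<integral>x. \<bar>wi n x\<bar> \<partial>lebesgue) * (kernel_mass + V)) + \<nu> n * \<Lambda> * V) * (t - s) \<le> \<eta> + C * (t - s)"
    proof (rule add_mono)
      show "5 * m * (\<integral>x. soft_abs k (wi n x) \<partial>lebesgue) \<le> \<eta>" using n m(1) by (simp add: field_simps)
      have "\<nu> n \<le> \<nu>b" using \<nu>b[of n] by simp
      then have "k * (G * ((\<integral>x. \<bar>wi n x\<bar> \<partial>lebesgue) * (kernel_mass + V)) + \<nu> n * \<Lambda> * V) \<le> C"
        unfolding C_def using k(1) G(1) \<Lambda>(1) V0 N(2)[of n] kernel_mass_nonneg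
        by (intro mult_left_mono mult_right_mono add_mono) auto
      then show "k * (G * ((\<integral>x. \<bar>wi n x\<bar> \<partial>lebesgue) * (kernel_mass + V)) + \<nu> n * \<Lambda> * V) * (t - s) \<le> C * (t - s)"
        using st by (intro mult_right_mono) auto
    qed
    finally show ?thesis using st by (simp add: pair_eq)
  qed
  show ?thesis
  proof (rule exI[of _ C], rule eventually_mono[OF k(2)], intro ballI)
    fix n s t assume n: "(\<integral>x. soft_abs k (wi n x) \<partial>lebesgue) \<le> \<eta> / (5 * m)" and s: "s \<in> {0..T}" and t: "t \<in> {0..T}"
    show "\<bar>(\<integral>x. wn n t x * \<zeta> x \<partial>lebesgue) - (\<integral>x. wn n s x * \<zeta> x \<partial>lebesgue)\<bar> \<le> \<eta> + C * \<bar>t - s\<bar>"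
      using ordered[OF n, of s t] ordered[OF n, of t s] s t by (cases "s \<le> t") (auto simp: abs_minus_commute)
  qed
qed

lemma limit_in_Lp: "t \<in> {0..T} \<Longrightarrow> in_Lp p UNIV (w t)"
  using ren by (simp add: renormalized_solution_def in_C_Lp_def)

lemma limit_curve: "in_C_Lp T p w"
  using ren by (simp add: renormalized_solution_def)

lemma limit_locally_integrable: "t \<in> {0..T} \<Longrightarrow> locally_integrable (w t)"
  unfolding locally_integrable_def using Lp_locally_integrable[OF limit_in_Lp p_ge] by blast

lemma limit_pairing_continuous:
  assumes \<zeta>: "continuous_on UNIV \<zeta>" "vanishes_outside R \<zeta>"
  shows "continuous_on {0..T} (\<lambda>t. \<integral>x. w t x * \<zeta> x \<partial>lebesgue)"
  unfolding continuous_on_def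
proof
  fix t assume t: "t \<in> {0..T}"
  obtain m where m: "m > 0" "\<And>x. norm (\<zeta> x) \<le> m" using bounded_continuous_vanishing[OF \<zeta>] by blast
  have mz: "\<zeta> \<in> borel_measurable lebesgue"
    by (intro measurable_completion) (simp add: borel_measurable_continuous_onI[OF \<zeta>(1)])
  have i: "integrable lebesgue (\<lambda>x. w s x * \<zeta> x)" if "s \<in> {0..T}" for s
    by (rule locally_integrable_mult[OF limit_locally_integrable[OF that] mz _ \<zeta>(2), of m]) (use m in auto)
  have lim: "((\<lambda>s. m * (\<integral>x. indicator (cball 0 R) x * \<bar>w s x - w t x\<bar> \<partial>lebesgue)) \<longlongrightarrow> 0) (at t within {0..T})"
    by (rule tendsto_mult_right_zero, rule Lp_curve_local_continuity[OF limit_curve p_ge t])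
  have "((\<lambda>s. (\<integral>x. w s x * \<zeta> x \<partial>lebesgue) - (\<integral>x. w t x * \<zeta> x \<partial>lebesgue)) \<longlongrightarrow> 0) (at t within {0..T})"
  proof (rule Lim_null_comparison[OF _ lim])
    show "\<forall>\<^sub>F s in at t within {0..T}. norm ((\<integral>x. w s x * \<zeta> x \<partial>lebesgue) - (\<integral>x. w t x * \<zeta> x \<partial>lebesgue))
      \<le> m * (\<integral>x. indicator (cball 0 R) x * \<bar>w s x - w t x\<bar> \<partial>lebesgue)"
      unfolding eventually_at_filter
    proof (intro always_eventually allI impI)
      fix s assume s: "s \<in> {0..T}"
      have di: "integrable lebesgue (\<lambda>x. indicator (cball 0 R) x * \<bar>w s x - w t x\<bar>)"
      proof -
        have "integrable lebesgue (\<lambda>x. \<bar>indicator (cball 0 R) x * w s x - indicator (cball 0 R) x * w t x\<bar>)"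
          using limit_locally_integrable[OF s] limit_locally_integrable[OF t] unfolding locally_integrable_def by simp
        then show ?thesis by (simp add: right_diff_distrib[symmetric] abs_mult)
      qed
      have "norm (\<integral>x. w s x * \<zeta> x - w t x * \<zeta> x \<partial>lebesgue) \<le> (\<integral>x. m * (indicator (cball 0 R) x * \<bar>w s x - w t x\<bar>) \<partial>lebesgue)"
      proof (rule order_trans[OF integral_norm_bound integral_mono'])
        show "integrable lebesgue (\<lambda>x. m * (indicator (cball 0 R) x * \<bar>w s x - w t x\<bar>))" using di by simp
        fix x
        have "norm (w s x * \<zeta> x - w t x * \<zeta> x) = \<bar>\<zeta> x\<bar> * \<bar>w s x - w t x\<bar>"
          by (simp add: left_diff_distrib[symmetric] abs_mult)
        also have "\<dots> \<le> (m * indicator (cball 0 R) x) * \<bar>w s x - w t x\<bar>"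
          using m(2)[of x] \<zeta>(2) by (intro mult_right_mono) (auto simp: indicator_def vanishes_outside_def)
        finally show "norm (w s x * \<zeta> x - w t x * \<zeta> x) \<le> m * (indicator (cball 0 R) x * \<bar>w s x - w t x\<bar>)"
          by (simp add: mult.assoc)
        show "0 \<le> m * (indicator (cball 0 R) x * \<bar>w s x - w t x\<bar>)" using m(1) by simp
      qed
      then show "norm ((\<integral>x. w s x * \<zeta> x \<partial>lebesgue) - (\<integral>x. w t x * \<zeta> x \<partial>lebesgue))
        \<le> m * (\<integral>x. indicator (cball 0 R) x * \<bar>w s x - w t x\<bar> \<partial>lebesgue)"
        using i[OF s] i[OF t] by simp
    qed
  qed
  then show "((\<lambda>t. \<integral>x. w t x * \<zeta> x \<partial>lebesgue) \<longlongrightarrow> (\<integral>x. w t x * \<zeta> x \<partial>lebesgue)) (at t within {0..T})"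
    by (rule LIM_zero_cancel)
qed

text \<open>Stated for a general pair of velocity and vorticity, since it is used both along the sequence and for
  the limit.\<close>

lemma velocity_pairing:
  fixes v :: "real \<Rightarrow> real^2 \<Rightarrow> real^2" and z :: "real \<Rightarrow> real^2 \<Rightarrow> real"
  assumes v: "in_Linf_L2loc T v" and \<zeta>: "C_k 1 UNIV \<zeta>" "vanishes_outside R \<zeta>"
    and curl: "AE t in lebesgue_on {0<..<T}. (\<integral>x. v t x \<bullet> perp_grad \<zeta> x \<partial>lebesgue) = - kernel_const * (\<integral>x. z t x * \<zeta> x \<partial>lebesgue)"
    and J: "0 \<le> \<alpha>" "\<alpha> < \<beta>" "\<beta> \<le> T"
  shows "integrable lebesgue (\<lambda>t. indicator {\<alpha><..<\<beta>} t * (\<integral>x. z t x * \<zeta> x \<partial>lebesgue))"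
    "(\<integral>(t, x). v t x \<bullet> (indicator {\<alpha><..<\<beta>} t *\<^sub>R perp_grad \<zeta> x) \<partial>lebesgue_on ({0<..<T} \<times> UNIV))
      = - kernel_const * (\<integral>t. indicator {\<alpha><..<\<beta>} t * (\<integral>x. z t x * \<zeta> x \<partial>lebesgue) \<partial>lebesgue)"
proof -
  let ?J = "indicator {\<alpha><..<\<beta>} :: real \<Rightarrow> real"
  note g = grad_measurable[OF \<zeta>(1)]
  note Fub = Fubini_strip[OF Linf_L2loc_pairing_integrable[OF v g(4) vanishes_grad(2)[OF \<zeta>(2)], of "{\<alpha><..<\<beta>}"]]
  define P where "P t = (\<integral>x. v t x \<bullet> (?J t *\<^sub>R perp_grad \<zeta> x) \<partial>lebesgue)" for t
  define Z where "Z t = (\<integral>x. z t x * \<zeta> x \<partial>lebesgue)" for t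
  have P_eq: "P t = ?J t * (\<integral>x. v t x \<bullet> perp_grad \<zeta> x \<partial>lebesgue)" for t by (simp add: P_def)
  have Pi: "integrable (lebesgue_on {0<..<T}) P" using Fub(2) by (simp add: P_def[abs_def])
  have JT: "indicator {0<..<T} t * ?J t = ?J t" for t using J by (auto simp: indicator_def)
  have iP: "integrable lebesgue (\<lambda>t. indicator {0<..<T} t *\<^sub>R P t)"
    using Pi by (subst (asm) integrable_restrict_space) auto
  have "AE t in lebesgue. t \<in> {0<..<T} \<longrightarrow> (\<integral>x. v t x \<bullet> perp_grad \<zeta> x \<partial>lebesgue) = - kernel_const * Z t"
    using curl by (subst (asm) AE_restrict_space_iff) (auto simp: Z_def)
  then have ae: "AE t in lebesgue. indicator {0<..<T} t *\<^sub>R P t = - kernel_const * (?J t * Z t)"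
  proof eventually_elim
    fix t assume a: "t \<in> {0<..<T} \<longrightarrow> (\<integral>x. v t x \<bullet> perp_grad \<zeta> x \<partial>lebesgue) = - kernel_const * Z t"
    show "indicator {0<..<T} t *\<^sub>R P t = - kernel_const * (?J t * Z t)"
    proof (cases "t \<in> {0<..<T}")
      case True then show ?thesis using a by (simp add: P_eq)
    next
      case False then show ?thesis using JT[of t] by simp
    qed
  qed
  have m: "(\<lambda>t. - kernel_const * (?J t * Z t)) \<in> borel_measurable lebesgue"
    by (rule borel_measurable_AE[OF borel_measurable_integrable[OF iP] ae])
  have i: "integrable lebesgue (\<lambda>t. - kernel_const * (?J t * Z t))"
    by (rule integrable_cong_AE_imp[OF iP m]) (use ae in eventually_elim, simp)
  then show "integrable lebesgue (\<lambda>t. ?J t * (\<integral>x. z t x * \<zeta> x \<partial>lebesgue))"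
    using kernel_const(1) by (simp add: Z_def)
  have "(\<integral>(t, x). v t x \<bullet> (?J t *\<^sub>R perp_grad \<zeta> x) \<partial>lebesgue_on ({0<..<T} \<times> UNIV)) = (\<integral>t. P t \<partial>lebesgue_on {0<..<T})"
    using Fub(3) by (simp add: P_def)
  also have "\<dots> = (\<integral>t. indicator {0<..<T} t *\<^sub>R P t \<partial>lebesgue)" by (rule integral_restrict_space) simp
  also have "\<dots> = (\<integral>t. - kernel_const * (?J t * Z t) \<partial>lebesgue)"
    by (rule integral_cong_AE[OF borel_measurable_integrable[OF iP] m ae])
  also have "\<dots> = - kernel_const * (\<integral>t. ?J t * Z t \<partial>lebesgue)" by simp
  finally show "(\<integral>(t, x). v t x \<bullet> (?J t *\<^sub>R perp_grad \<zeta> x) \<partial>lebesgue_on ({0<..<T} \<times> UNIV))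
      = - kernel_const * (\<integral>t. ?J t * (\<integral>x. z t x * \<zeta> x \<partial>lebesgue) \<partial>lebesgue)" by (simp add: Z_def)
qed

lemma perp_grad_in_L1_L2c:
  assumes \<zeta>: "C_k 1 UNIV \<zeta>" "vanishes_outside R \<zeta>"
  shows "in_L1_L2c T (\<lambda>t x. indicator {\<alpha><..<\<beta>} t *\<^sub>R perp_grad \<zeta> x)"
proof -
  note g = grad_measurable[OF \<zeta>(1)] and v = vanishes_grad(2)[OF \<zeta>(2)]
  note [measurable] = g(2)
  obtain B where B: "B > 0" "\<And>x. norm (perp_grad \<zeta> x) \<le> B" using bounded_continuous_vanishing[OF g(4) v] by blast
  have ml: "perp_grad \<zeta> \<in> borel_measurable lebesgue" by (intro measurable_completion) measurable
  have i2: "integrable lebesgue (\<lambda>x. norm (perp_grad \<zeta> x) powr 2)"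
  proof (rule Bochner_Integration.integrable_bound)
    show "integrable lebesgue (\<lambda>x. B powr 2 * indicator (cball (0::real^2) R) x)"
      by (intro integrable_mult_right indicator_cball_integrable)
    show "(\<lambda>x. norm (perp_grad \<zeta> x) powr 2) \<in> borel_measurable lebesgue" using ml by measurable
    show "AE x in lebesgue. norm (norm (perp_grad \<zeta> x) powr 2) \<le> norm (B powr 2 * indicator (cball (0::real^2) R) x)"
    proof (rule AE_I2)
      fix x
      have "norm (perp_grad \<zeta> x) powr 2 \<le> B powr 2" using B by (intro powr_mono2) auto
      then show "norm (norm (perp_grad \<zeta> x) powr 2) \<le> norm (B powr 2 * indicator (cball (0::real^2) R) x)"
        using v by (cases "x \<in> cball 0 R") (auto simp: vanishes_outside_def)
    qed
  qed
  define L where "L = Lp_norm 2 UNIV (perp_grad \<zeta>)"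
  have Lp: "in_Lp 2 UNIV (\<lambda>x. indicator {\<alpha><..<\<beta>} t *\<^sub>R perp_grad \<zeta> x)"
    "Lp_norm 2 UNIV (\<lambda>x. indicator {\<alpha><..<\<beta>} t *\<^sub>R perp_grad \<zeta> x) = indicator {\<alpha><..<\<beta>} t * L" for t
  proof -
    show "in_Lp 2 UNIV (\<lambda>x. indicator {\<alpha><..<\<beta>} t *\<^sub>R perp_grad \<zeta> x)"
      using ml i2 by (cases "t \<in> {\<alpha><..<\<beta>}") (auto simp: in_Lp_def lebesgue_on_UNIV_eq)
    show "Lp_norm 2 UNIV (\<lambda>x. indicator {\<alpha><..<\<beta>} t *\<^sub>R perp_grad \<zeta> x) = indicator {\<alpha><..<\<beta>} t * L"
      by (cases "t \<in> {\<alpha><..<\<beta>}") (auto simp: Lp_norm_def L_def lebesgue_on_UNIV_eq)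
  qed
  show ?thesis
    unfolding in_L1_L2c_def
  proof (intro conjI)
    have mg: "(\<lambda>(t, x). indicator {\<alpha><..<\<beta>} t *\<^sub>R perp_grad \<zeta> x) \<in> borel_measurable (borel :: (real \<times> (real^2)) measure)"
      unfolding borel_prod[symmetric] by measurable
    show "(\<lambda>(t, x). indicator {\<alpha><..<\<beta>} t *\<^sub>R perp_grad \<zeta> x) \<in> borel_measurable (lebesgue_on ({0<..<T} \<times> UNIV))"
      by (rule measurable_restrict_space1) (use mg in \<open>auto intro: measurable_completion\<close>)
    show "\<exists>R. \<forall>t x. x \<notin> ball 0 R \<longrightarrow> indicator {\<alpha><..<\<beta>} t *\<^sub>R perp_grad \<zeta> x = 0"
      using v by (intro exI[of _ "R + 1"]) (auto simp: vanishes_outside_def)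
    show "AE t in lebesgue_on {0<..<T}. in_Lp 2 UNIV (\<lambda>x. indicator {\<alpha><..<\<beta>} t *\<^sub>R perp_grad \<zeta> x)"
      using Lp(1) by simp
    have fm: "finite_measure (lebesgue_on {0<..<T})"
      by (intro finite_measureI) (use T_pos in \<open>simp add: emeasure_restrict_space\<close>)
    show "integrable (lebesgue_on {0<..<T}) (\<lambda>t. Lp_norm 2 UNIV (\<lambda>x. indicator {\<alpha><..<\<beta>} t *\<^sub>R perp_grad \<zeta> x))"
      unfolding Lp(2)
      by (rule finite_measure.integrable_const_bound[OF fm, of _ "\<bar>L\<bar>"])
         (auto simp: indicator_def intro!: measurable_restrict_space1 measurable_completion)
  qed
qed

text \<open>The test fields \<open>indicator J t *\<^sub>R perp_grad \<zeta> x\<close> for intervals \<open>J\<close> are admissible in the weak* convergence of the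
  velocities; after division by \<open>- kernel_const\<close> they give convergence of the time averages of the pairings of the vorticities.\<close>

lemma pairing_converges:
  assumes \<zeta>: "\<And>n. C_k n UNIV \<zeta>" "vanishes_outside R \<zeta>"
    and r: "filterlim r at_top sequentially" and t: "\<And>j. t j \<in> {0..T}" "t \<longlonglongrightarrow> \<tau>" and \<tau>: "\<tau> \<in> {0..T}"
  shows "(\<lambda>j. \<integral>x. wn (r j) (t j) x * \<zeta> x \<partial>lebesgue) \<longlonglongrightarrow> (\<integral>x. w \<tau> x * \<zeta> x \<partial>lebesgue)"
proof (rule interval_average_limit[OF T_pos _ _ _ _ _ r t \<tau>,
    where a = "\<lambda>n t. \<integral>x. wn n t x * \<zeta> x \<partial>lebesgue" and b = "\<lambda>t. \<integral>x. w t x * \<zeta> x \<partial>lebesgue"])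
  have \<zeta>1: "C_k 1 UNIV \<zeta>" by (rule \<zeta>(1))
  have Linf: "in_Linf_L2loc T (un n)" "in_Linf_L2loc T u" for n using weak by (auto simp: weakstar_Linf_L2loc_def)
  have curl_n: "AE t in lebesgue_on {0<..<T}. (\<integral>x. un n t x \<bullet> perp_grad \<zeta> x \<partial>lebesgue) = - kernel_const * (\<integral>x. wn n t x * \<zeta> x \<partial>lebesgue)" for n
    by (rule AE_I2) (simp add: navier_stokes.velocity_curl[OF NS _ \<zeta>1 \<zeta>(2)])
  have bs: "AE t in lebesgue_on {0<..<T}. AE x in lebesgue. is_biot_savart (w t) x (u t x)"
    by (rule AE_strip) (use ren in \<open>simp add: renormalized_solution_def case_prod_unfold\<close>)
  have curl: "AE t in lebesgue_on {0<..<T}. (\<integral>x. u t x \<bullet> perp_grad \<zeta> x \<partial>lebesgue) = - kernel_const * (\<integral>x. w t x * \<zeta> x \<partial>lebesgue)"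
    using bs AE_space
  proof eventually_elim
    fix t assume b: "AE x in lebesgue. is_biot_savart (w t) x (u t x)" and "t \<in> space (lebesgue_on {0<..<T})"
    then have "t \<in> {0..T}" by auto
    then show "(\<integral>x. u t x \<bullet> perp_grad \<zeta> x \<partial>lebesgue) = - kernel_const * (\<integral>x. w t x * \<zeta> x \<partial>lebesgue)"
      by (rule euler_velocity_curl[OF limit_in_Lp p_ge b \<zeta>1 \<zeta>(2)])
  qed
  show "\<exists>C. \<forall>\<^sub>F n in sequentially. \<forall>s\<in>{0..T}. \<forall>t\<in>{0..T}. \<bar>(\<integral>x. wn n t x * \<zeta> x \<partial>lebesgue) - (\<integral>x. wn n s x * \<zeta> x \<partial>lebesgue)\<bar> \<le> \<eta> + C * \<bar>t - s\<bar>"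
    if "\<eta> > 0" for \<eta> by (rule pairing_equicontinuous[OF \<zeta> that])
  show "continuous_on {0..T} (\<lambda>t. \<integral>x. w t x * \<zeta> x \<partial>lebesgue)"
    by (rule limit_pairing_continuous[OF _ \<zeta>(2)]) (use \<zeta>(1)[of 0] in simp)
  fix \<alpha> \<beta> assume J: "0 \<le> \<alpha>" "\<alpha> < \<beta>" "\<beta> \<le> T"
  show "integrable lebesgue (\<lambda>t. indicator {\<alpha><..<\<beta>} t * (\<integral>x. wn n t x * \<zeta> x \<partial>lebesgue))" for n
    by (rule velocity_pairing(1)[OF Linf(1) \<zeta>1 \<zeta>(2) curl_n J])
  show "integrable lebesgue (\<lambda>t. indicator {\<alpha><..<\<beta>} t * (\<integral>x. w t x * \<zeta> x \<partial>lebesgue))"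
    by (rule velocity_pairing(1)[OF Linf(2) \<zeta>1 \<zeta>(2) curl J])
  have "(\<lambda>n. \<integral>(t, x). un n t x \<bullet> (indicator {\<alpha><..<\<beta>} t *\<^sub>R perp_grad \<zeta> x) \<partial>lebesgue_on ({0<..<T} \<times> UNIV))
     \<longlonglongrightarrow> (\<integral>(t, x). u t x \<bullet> (indicator {\<alpha><..<\<beta>} t *\<^sub>R perp_grad \<zeta> x) \<partial>lebesgue_on ({0<..<T} \<times> UNIV))"
    using weak perp_grad_in_L1_L2c[OF \<zeta>1 \<zeta>(2)] unfolding weakstar_Linf_L2loc_def by blast
  then have "(\<lambda>n. - kernel_const * (\<integral>t. indicator {\<alpha><..<\<beta>} t * (\<integral>x. wn n t x * \<zeta> x \<partial>lebesgue) \<partial>lebesgue))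
     \<longlonglongrightarrow> - kernel_const * (\<integral>t. indicator {\<alpha><..<\<beta>} t * (\<integral>x. w t x * \<zeta> x \<partial>lebesgue) \<partial>lebesgue)"
    unfolding velocity_pairing(2)[OF Linf(1) \<zeta>1 \<zeta>(2) curl_n J] velocity_pairing(2)[OF Linf(2) \<zeta>1 \<zeta>(2) curl J] .
  then have "(\<lambda>n. (- 1 / kernel_const) * (- kernel_const * (\<integral>t. indicator {\<alpha><..<\<beta>} t * (\<integral>x. wn n t x * \<zeta> x \<partial>lebesgue) \<partial>lebesgue)))
     \<longlonglongrightarrow> (- 1 / kernel_const) * (- kernel_const * (\<integral>t. indicator {\<alpha><..<\<beta>} t * (\<integral>x. w t x * \<zeta> x \<partial>lebesgue) \<partial>lebesgue))"
    by (rule tendsto_mult_left)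
  then show "(\<lambda>n. \<integral>t. indicator {\<alpha><..<\<beta>} t * (\<integral>x. wn n t x * \<zeta> x \<partial>lebesgue) \<partial>lebesgue)
     \<longlonglongrightarrow> (\<integral>t. indicator {\<alpha><..<\<beta>} t * (\<integral>x. w t x * \<zeta> x \<partial>lebesgue) \<partial>lebesgue)"
    using kernel_const(1) by simp
qed

lemma slices_equiintegrable:
  assumes r: "filterlim r at_top sequentially" and t: "\<And>j. t j \<in> {0..T}"
  shows "equiintegrable (\<lambda>j. wn (r j) (t j))"
  unfolding equiintegrable_def
proof (intro conjI allI impI)
  show "integrable lebesgue (wn (r j) (t j))" for j by (rule wn_integrable[OF t])
  fix \<eta> :: real assume "\<eta> > 0"
  then obtain k where k: "k > 0" "\<forall>\<^sub>F n in sequentially. (\<integral>x. soft_abs k (wi n x) \<partial>lebesgue) \<le> \<eta>"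
    by (rule initial_equiintegrable)
  have "\<forall>\<^sub>F j in sequentially. (\<integral>x. soft_abs k (wn (r j) (t j) x) \<partial>lebesgue) \<le> \<eta>"
    by (rule eventually_mono[OF eventually_compose_filterlim[OF k(2) r]]) (rule order_trans[OF wn_soft_abs[OF k(1) t]])
  with k(1) show "\<exists>k>0. \<forall>\<^sub>F j in sequentially. (\<integral>x. soft_abs k (wn (r j) (t j) x) \<partial>lebesgue) \<le> \<eta>" by blast
qed

lemma slices_weakly_convergent:
  assumes "filterlim r at_top sequentially" "\<And>j. t j \<in> {0..T}" "t \<longlonglongrightarrow> \<tau>" "\<tau> \<in> {0..T}"
  shows "weakly_convergent (\<lambda>j. wn (r j) (t j)) (w \<tau>)"
  unfolding weakly_convergent_def using pairing_converges assms by blast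

text \<open>An \<open>L\<^sup>p\<close> solution of the Euler equations need not be integrable a priori; integrability, which the conservation
  laws rest on, is inherited from the approximating vorticities.\<close>

lemma limit_L1:
  assumes \<tau>: "\<tau> \<in> {0..T}" and N: "\<And>n. (\<integral>x. \<bar>wi n x\<bar> \<partial>lebesgue) \<le> N"
  shows "integrable lebesgue (w \<tau>)" "(\<integral>x. \<bar>w \<tau> x\<bar> \<partial>lebesgue) \<le> N"
proof -
  have id: "filterlim (\<lambda>j::nat. j) at_top sequentially" by (rule filterlim_ident)
  have m: "w \<tau> \<in> borel_measurable lebesgue" using limit_in_Lp[OF \<tau>] by (simp add: in_Lp_def lebesgue_on_UNIV_eq)
  have le: "(\<integral>x. \<bar>wn j \<tau> x\<bar> \<partial>lebesgue) \<le> N" for j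
    using wn_powr(1)[of 1 \<tau> j] \<tau> N[of j] by simp
  note * = weak_limit_integrable[OF slices_equiintegrable[OF id] limit_locally_integrable[OF \<tau>] m
      slices_weakly_convergent[OF id _ tendsto_const \<tau>] le]
  show "integrable lebesgue (w \<tau>)" "(\<integral>x. \<bar>w \<tau> x\<bar> \<partial>lebesgue) \<le> N" using * \<tau> by auto
qed

lemma limit_conserved:
  assumes t: "t \<in> {0..T}"
  shows "(\<integral>x. soft_abs 1 (w t x) \<partial>lebesgue) = (\<integral>x. soft_abs 1 (w0 x) \<partial>lebesgue)"
    "(\<integral>x. \<bar>w t x\<bar> powr p \<partial>lebesgue) = (\<integral>x. \<bar>w0 x\<bar> powr p \<partial>lebesgue)"
proof -
  obtain N where N: "\<And>n. (\<integral>x. \<bar>wi n x\<bar> \<partial>lebesgue) \<le> N" using initial_mass by blast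
  interpret renormalized T p w0 u w N
    using T_pos p_ge ren limit_L1[OF _ N] w0_integrable by (intro renormalized.intro)
  show "(\<integral>x. soft_abs 1 (w t x) \<partial>lebesgue) = (\<integral>x. soft_abs 1 (w0 x) \<partial>lebesgue)"
    by (rule functional_conserved[OF t]) (auto simp: soft_abs_nonneg intro: soft_abs_level)
  show "(\<integral>x. \<bar>w t x\<bar> powr p \<partial>lebesgue) = (\<integral>x. \<bar>w0 x\<bar> powr p \<partial>lebesgue)"
    by (rule functional_conserved[OF t]) (auto intro: powr_level[OF p_ge])
qed

text \<open>The energies of the Navier-Stokes vorticities at time \<open>t j\<close> are at most the initial ones, which converge to those of
  \<open>w0\<close>, and these coincide with the energies of \<open>w \<tau>\<close> by conservation. Hence no energy is lost in the weak limit.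
  The bound \<open>B\<close> is a maximum with the limit value because for the powers only the upper limit is controlled.\<close>

lemma slices_converge_strongly:
  assumes r: "filterlim r at_top sequentially" and t: "\<And>j. t j \<in> {0..T}" "t \<longlonglongrightarrow> \<tau>" and \<tau>: "\<tau> \<in> {0..T}"
  obtains q where "strict_mono (q :: nat \<Rightarrow> nat)" "(\<lambda>j. \<integral>x. \<bar>wn (r (q j)) (t (q j)) x - w \<tau> x\<bar> powr p \<partial>lebesgue) \<longlonglongrightarrow> 0"
proof -
  obtain N where N: "\<And>n. (\<integral>x. \<bar>wi n x\<bar> \<partial>lebesgue) \<le> N" using initial_mass by blast
  define P where "P = (\<integral>x. \<bar>w0 x\<bar> powr p \<partial>lebesgue)"
  define B where "B j = max (\<integral>x. \<bar>wi (r j) x\<bar> powr p \<partial>lebesgue) P" for j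
  have iw0: "integrable lebesgue (\<lambda>x. \<bar>w0 x\<bar> powr p)" using w0_in_Lp by (simp add: in_Lp_def lebesgue_on_UNIV_eq)
  have iwi: "integrable lebesgue (\<lambda>x. \<bar>wi n x\<bar> powr p)" for n using wi_in_Lp[OF p_ge] by (simp add: in_Lp_def lebesgue_on_UNIV_eq)
  have idiff: "integrable lebesgue (\<lambda>x. \<bar>wi n x - w0 x\<bar> powr p)" for n
    using in_Lp_diff[OF wi_in_Lp[OF p_ge] w0_in_Lp p_ge] by (simp add: in_Lp_def lebesgue_on_UNIV_eq)
  have iw: "integrable lebesgue (\<lambda>x. \<bar>w \<tau> x\<bar> powr p)" using limit_in_Lp[OF \<tau>] by (simp add: in_Lp_def lebesgue_on_UNIV_eq)
  have B: "B \<longlonglongrightarrow> P"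
  proof (rule LIMSEQ_I)
    fix e :: real assume e: "e > 0"
    have "\<forall>\<^sub>F n in sequentially. (\<integral>x. \<bar>wi n x\<bar> powr p \<partial>lebesgue) \<le> P + e / 2"
      unfolding P_def
      by (rule Lp_energy_limsup[OF p_ge iwi iw0 idiff Lp_norm_tendsto_imp[OF p_ge init_conv]]) (use e in simp)
    from eventually_compose_filterlim[OF this r]
    have "\<forall>\<^sub>F j in sequentially. norm (B j - P) < e"
      by eventually_elim (use e in \<open>auto simp: B_def\<close>)
    then show "\<exists>no. \<forall>n\<ge>no. norm (B n - P) < e" by (simp add: eventually_sequentially)
  qed
  have A: "(\<lambda>j. \<integral>x. soft_abs 1 (wi (r j) x) \<partial>lebesgue) \<longlonglongrightarrow> (\<integral>x. soft_abs 1 (w \<tau> x) \<partial>lebesgue)"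
    unfolding limit_conserved(1)[OF \<tau>] by (rule filterlim_compose[OF initial_soft_abs r]) simp
  have B': "B \<longlonglongrightarrow> (\<integral>x. \<bar>w \<tau> x\<bar> powr p \<partial>lebesgue)"
    unfolding limit_conserved(2)[OF \<tau>] using B by (simp add: P_def)
  have le: "(\<integral>x. \<bar>wn (r j) (t j) x\<bar> powr p \<partial>lebesgue) \<le> B j" for j
    using wn_powr(1)[OF p_ge t(1), of "r j" j] by (simp add: B_def)
  show ?thesis
    by (rule weak_to_strong[OF slices_equiintegrable[OF r t(1)] limit_L1(1)[OF \<tau> N] slices_weakly_convergent[OF r t \<tau>] p_ge
          wn_soft_abs[OF zero_less_one t(1)] A wn_powr(2)[OF p_ge t(1)] iw le B'])
       (rule that)
qed

section \<open>Uniformity in time\<close>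

text \<open>If uniformity failed, it would fail at times \<open>t0 m\<close>; these accumulate at some \<open>\<tau>\<close> by compactness,
  contradicting strong convergence along moving times and the continuity of the limit curve.\<close>

lemma uniform_Lp_convergence:
  assumes e: "\<epsilon> > 0"
  shows "\<forall>\<^sub>F n in sequentially. \<forall>t\<in>{0..T}. (\<integral>x. \<bar>wn n t x - w t x\<bar> powr p \<partial>lebesgue) \<le> \<epsilon>"
proof (rule ccontr)
  assume "\<not> ?thesis"
  then have "\<forall>m. \<exists>n\<ge>m. \<exists>t\<in>{0..T}. (\<integral>x. \<bar>wn n t x - w t x\<bar> powr p \<partial>lebesgue) > \<epsilon>"
    by (auto simp: eventually_sequentially not_le)
  then obtain n0 t0 where n0: "\<And>m. n0 m \<ge> m" "\<And>m. t0 m \<in> {0..T}"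
    and bad: "\<And>m. (\<integral>x. \<bar>wn (n0 m) (t0 m) x - w (t0 m) x\<bar> powr p \<partial>lebesgue) > \<epsilon>" by metis
  have "seq_compact {0..T}" by (rule compact_imp_seq_compact) simp
  then have "\<exists>\<tau>\<in>{0..T}. \<exists>s. strict_mono (s :: nat \<Rightarrow> nat) \<and> (t0 \<circ> s) \<longlonglongrightarrow> \<tau>"
    unfolding seq_compact_def by (rule allE[of _ t0]) (simp only: n0(2) simp_thms)
  then obtain \<tau> s where \<tau>: "\<tau> \<in> {0..T}" and s: "strict_mono (s :: nat \<Rightarrow> nat)" "(t0 \<circ> s) \<longlonglongrightarrow> \<tau>" by blast
  have r: "filterlim (\<lambda>j. n0 (s j)) at_top sequentially"
  proof (rule filterlim_at_top_mono[OF filterlim_ident])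
    show "\<forall>\<^sub>F j in sequentially. j \<le> n0 (s j)"
      by (intro always_eventually allI order_trans[OF seq_suble[OF s(1)] n0(1)])
  qed
  have st: "(\<lambda>j. t0 (s j)) \<longlonglongrightarrow> \<tau>" using s(2) by (simp add: o_def)
  obtain q where q: "strict_mono q"
    and lim1: "(\<lambda>j. \<integral>x. \<bar>wn (n0 (s (q j))) (t0 (s (q j))) x - w \<tau> x\<bar> powr p \<partial>lebesgue) \<longlonglongrightarrow> 0"
    using slices_converge_strongly[OF r n0(2) st \<tau>] by blast
  define D where "D t = (\<integral>x. \<bar>w t x - w \<tau> x\<bar> powr p \<partial>lebesgue)" for t
  have "(D \<longlongrightarrow> 0) (at \<tau> within {0..T})"
    unfolding D_def by (rule Lp_norm_tendsto_imp[OF p_ge]) (use limit_curve \<tau> in \<open>simp add: in_C_Lp_def\<close>)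
  moreover have D0: "D \<tau> = 0" using p_ge by (simp add: D_def)
  ultimately have "continuous (at \<tau> within {0..T}) D" by (simp add: continuous_within)
  then have lim2: "(\<lambda>j. D (t0 (s (q j)))) \<longlonglongrightarrow> 0"
    using continuous_within_tendsto_compose'[of \<tau> "{0..T}" D "\<lambda>j. t0 (s (q j))" sequentially] n0(2)
      LIMSEQ_subseq_LIMSEQ[OF st q] D0 by (simp add: o_def)
  define F where "F j = (\<integral>x. \<bar>wn (n0 (s (q j))) (t0 (s (q j))) x - w \<tau> x\<bar> powr p \<partial>lebesgue)" for j
  have "(\<lambda>j. 2 powr p * (F j + D (t0 (s (q j))))) \<longlonglongrightarrow> 2 powr p * (0 + 0)"
    using lim1 lim2 unfolding F_def by (intro tendsto_intros)
  then have "\<forall>\<^sub>F j in sequentially. 2 powr p * (F j + D (t0 (s (q j)))) < \<epsilon>"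
    using order_tendstoD(2)[of _ "2 powr p * (0 + 0)" sequentially \<epsilon>] e by simp
  then obtain j where j: "2 powr p * (F j + D (t0 (s (q j)))) < \<epsilon>" using eventually_happens by fastforce
  define n t where "n = n0 (s (q j))" and "t = t0 (s (q j))"
  have t: "t \<in> {0..T}" using n0(2) by (simp add: t_def)
  have L: "in_Lp p UNIV (wn n t)" using wn_powr(2)[OF p_ge t] wn_lebesgue[OF t] by (simp add: in_Lp_def lebesgue_on_UNIV_eq)
  have i: "integrable lebesgue (\<lambda>x. \<bar>wn n t x - w \<tau> x\<bar> powr p)" "integrable lebesgue (\<lambda>x. \<bar>w t x - w \<tau> x\<bar> powr p)"
    "integrable lebesgue (\<lambda>x. \<bar>wn n t x - w t x\<bar> powr p)"
    using in_Lp_diff[OF L limit_in_Lp[OF \<tau>] p_ge] in_Lp_diff[OF limit_in_Lp[OF t] limit_in_Lp[OF \<tau>] p_ge] in_Lp_diff[OF L limit_in_Lp[OF t] p_ge]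
    by (auto simp: in_Lp_def lebesgue_on_UNIV_eq)
  have "(\<integral>x. \<bar>wn n t x - w t x\<bar> powr p \<partial>lebesgue) \<le> (\<integral>x. 2 powr p * (\<bar>wn n t x - w \<tau> x\<bar> powr p + \<bar>w t x - w \<tau> x\<bar> powr p) \<partial>lebesgue)"
  proof (rule integral_mono)
    show "integrable lebesgue (\<lambda>x. 2 powr p * (\<bar>wn n t x - w \<tau> x\<bar> powr p + \<bar>w t x - w \<tau> x\<bar> powr p))" using i by simp
    show "\<bar>wn n t x - w t x\<bar> powr p \<le> 2 powr p * (\<bar>wn n t x - w \<tau> x\<bar> powr p + \<bar>w t x - w \<tau> x\<bar> powr p)" for x
      using powr_diff_le[OF p_ge, of "wn n t x - w \<tau> x" "w t x - w \<tau> x"] by simp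
  qed (rule i)
  also have "\<dots> = 2 powr p * (F j + D t)" using i by (simp add: F_def D_def n_def t_def)
  also have "\<dots> < \<epsilon>" using j by (simp add: t_def)
  finally show False using bad[of "s (q j)"] by (simp add: n_def t_def)
qed

lemma strong_convergence: "converges_in_C_Lp T p wn w"
  unfolding converges_in_C_Lp_def
proof (intro conjI allI limit_curve)
  show "in_C_Lp T p (wn n)" for n by (rule navier_stokes.solution_in_C_Lp[OF NS p_ge])
  show "(\<lambda>n. C_Lp_norm T p (\<lambda>t x. wn n t x - w t x)) \<longlonglongrightarrow> 0"
  proof (rule LIMSEQ_I)
    fix e :: real assume e: "e > 0"
    have "(e / 2) powr p > 0" using e by simp
    from uniform_Lp_convergence[OF this]
    have "\<forall>\<^sub>F n in sequentially. norm (C_Lp_norm T p (\<lambda>t x. wn n t x - w t x) - 0) < e"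
    proof eventually_elim
      fix n assume n: "\<forall>t\<in>{0..T}. (\<integral>x. \<bar>wn n t x - w t x\<bar> powr p \<partial>lebesgue) \<le> (e / 2) powr p"
      have le: "Lp_norm p UNIV (\<lambda>x. wn n t x - w t x) \<le> e / 2" if "t \<in> {0..T}" for t
      proof -
        have "(\<integral>x. \<bar>wn n t x - w t x\<bar> powr p \<partial>lebesgue) powr (1 / p) \<le> ((e / 2) powr p) powr (1 / p)"
          using n that p_ge by (intro powr_mono2) auto
        also have "\<dots> = e / 2" using e p_ge by (simp add: powr_powr)
        finally show ?thesis by (simp add: Lp_norm_def lebesgue_on_UNIV_eq)
      qed
      have ne: "{0..T} \<noteq> {}" using T_pos by simp
      have 1: "C_Lp_norm T p (\<lambda>t x. wn n t x - w t x) \<le> e / 2"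
        unfolding C_Lp_norm_def by (rule cSUP_least[OF ne le])
      have "0 \<le> Lp_norm p UNIV (\<lambda>x. wn n 0 x - w 0 x)" by (simp add: Lp_norm_def)
      also have "\<dots> \<le> C_Lp_norm T p (\<lambda>t x. wn n t x - w t x)"
        unfolding C_Lp_norm_def
        by (rule cSUP_upper) (use T_pos le in \<open>auto intro!: bdd_aboveI2[where M = "e / 2"]\<close>)
      finally show "norm (C_Lp_norm T p (\<lambda>t x. wn n t x - w t x) - 0) < e" using 1 e by simp
    qed
    then show "\<exists>no. \<forall>n\<ge>no. norm (C_Lp_norm T p (\<lambda>t x. wn n t x - w t x) - 0) < e" by (simp add: eventually_sequentially)
  qed
qed

end

theorem theorem3p2:
  fixes T p :: real
    and \<omega>0 :: "real^2 \<Rightarrow> real"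
    and \<nu> :: "nat \<Rightarrow> real"
    and \<omega>0\<nu> :: "nat \<Rightarrow> real^2 \<Rightarrow> real"
    and u\<nu> :: "nat \<Rightarrow> real \<Rightarrow> real^2 \<Rightarrow> real^2"
    and \<omega>\<nu> :: "nat \<Rightarrow> real \<Rightarrow> real^2 \<Rightarrow> real"
    and u :: "real \<Rightarrow> real^2 \<Rightarrow> real^2"
    and \<omega> :: "real \<Rightarrow> real^2 \<Rightarrow> real"
  assumes "T > 0" and "p \<ge> 1"
    and "in_Lp_c p \<omega>0"
    and "\<And>n. \<nu> n > 0" and "\<nu> \<longlonglongrightarrow> 0"
    and "\<And>n. test_function UNIV (\<omega>0\<nu> n)"
    and "\<exists>R>0. \<forall>n. supp (\<omega>0\<nu> n) \<subseteq> ball 0 R"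
    and "\<exists>C. \<forall>n. Lp_norm p UNIV (\<omega>0\<nu> n) \<le> C"
    and "bounded_in_Hm1_loc \<omega>0\<nu>"
    and "(\<lambda>n. Lp_norm p UNIV (\<lambda>x. \<omega>0\<nu> n x - \<omega>0 x)) \<longlonglongrightarrow> 0"
    and "\<And>n. navier_stokes_solution T (\<nu> n) (\<omega>0\<nu> n) (u\<nu> n) (\<omega>\<nu> n)"
    and "renormalized_solution T p \<omega>0 u \<omega>"
    and "weakstar_Linf_L2loc T u\<nu> u"
  shows "converges_in_C_Lp T p \<omega>\<nu> \<omega>"
proof -
  interpret inviscid_limit T p \<omega>0 \<nu> \<omega>0\<nu> u\<nu> \<omega>\<nu> u \<omega>
    using assms by (intro inviscid_limit.intro) blast+
  show ?thesis by (rule strong_convergence)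
qed

end
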